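(* Let $\Omega\subset\mathbb R^d$ be nonempty, open and bounded, and let $\Xi\subset\overline\Omega$ be nonempty and closed. Let $\ell\colon\mathbb R_+\times\overline\Omega\times\mathbb R^d\to\mathbb R_+$ be such that: $t\mapsto\ell(t,x,p)$ is measurable for every $(x,p)$; $(x,p)\mapsto\ell(t,x,p)$ is continuous for a.e. $t$; $p\mapsto\ell(t,x,p)$ is convex for a.e. $t$ and every $x$; and there exist $\alpha>0$, $\theta>1$ with $\ell(t,x,p)\ge\alpha|p|^\theta$ for all $(t,x,p)$. Let $h\colon\mathbb R_+\times\overline\Omega\times\overline\Omega\times\mathbb R^d\times\mathbb R^d\to\mathbb R_+$ be such that: $t\mapsto h(t,x,\tilde x,p,\tilde p)$ is measurable for every $(x,\tilde x,p,\tilde p)$; $(x,\tilde x,p,\tilde p)\mapsto h(t,x,\tilde x,p,\tilde p)$ is continuous for a.e. $t$; $(p,\tilde p)\mapsto h(t,x,\tilde x,p,\tilde p)$ is convex for a.e. $t$ and every $(x,\tilde x)$; $h(t,x,\tilde x,p,\tilde p)=h(t,\tilde x,x,\tilde p,p)$ for all arguments; and there exist $C>0$ and $\beta\in(0,\theta]$ with $h(t,x,\tilde x,p,\tilde p)\le C(|p|^\beta+|\tilde p|^\beta)$ for all arguments. Let $\Psi\colon\mathbb R_+\to\mathbb R_+$ be lower semicontinuous and nondecreasing, with constants $a,b>0$ such that $\Psi(t)\ge at-b$ for all $t\ge0$. Assume there exists $\kappa>0$ such that for every $x_0\in\overline\Omega$ there exists an absolutely continuous $\gamma\in\Gamma$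 with $\gamma(0)=x_0$ and $\int_0^{+\infty}\ell(t,\gamma(t),\dot\gamma(t))\,\mathrm dt+\Psi(\tau(\gamma))\le\kappa$. Let $m_0\in\mathcal P(\overline\Omega)$. Then there exists an equilibrium $Q\in\mathcal P(\Gamma)$ of the mean field game with initial condition $m_0$.
   Context: $\mathbb R_+=[0,+\infty)$. $\Gamma=\mathcal C(\mathbb R_+;\overline\Omega)$ is the Polish space of continuous curves with uniform convergence on compact time intervals; $\mathcal P(\cdot)$ denotes Borel probability measures; $e_0\colon\Gamma\to\overline\Omega$, $e_0(\gamma)=\gamma(0)$; ${e_0}_\#Q$ is the pushforward. "Absolutely continuous" for $\gamma\in\Gamma$ means absolutely continuous on every compact interval. Exit time: $\tau(\gamma)=\inf\{t\ge0:\gamma(t)\in\Xi\}\in[0,+\infty]$, with $\inf\emptyset=+\infty$; convention $\Psi(+\infty)=+\infty$; $s\wedge t=\min\{s,t\}$. Cost of $\gamma\in\Gamma$ given $Q\in\mathcal P(\Gamma)$: $$F(\gamma,Q)=\int_0^{+\infty}\ell(t,\gamma(t),\dot\gamma(t))\,\mathrm dt+\Psi(\tau(\gamma))+\int_\Gamma\int_0^{\tau(\gamma)\wedge\tau(\tilde\gamma)}h(t,\gamma(t),\tilde\gamma(t),\dot\gamma(t),\dot{\tilde\gamma}(t))\,\mathrm dt\,\mathrm dQ(\tilde\gamma),$$ with $F(\gamma,Q)=+\infty$ by convention if $\gamma$ is not absolutely continuous, if $Q$ gives positive measure to a set of functions which are not absolutely continuous, or if $\tilde\gamma\mapsto\int_0^{\tau(\gamma)\wedge\tau(\tilde\gamma)}h(t,\gamma(t),\tilde\gamma(t),\dot\gamma(t),\dot{\tilde\gamma}(t))\,\mathrm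 dt$ is not $Q$-integrable. Equilibrium: $Q\in\mathcal P(\Gamma)$ is an equilibrium with initial condition $m_0$ if ${e_0}_\#Q=m_0$, $\int_\Gamma F(\gamma,Q)\,\mathrm dQ(\gamma)<+\infty$, and $Q$-almost every $\gamma$ satisfies $F(\gamma,Q)=\inf\{F(\omega,Q):\omega\in\Gamma,\ \omega(0)=\gamma(0)\}$. *)

theory Defs
  imports "HOL-Probability.Probability"
begin

text \<open>For real sets, \<open>D division_of S\<close> says that \<open>D\<close> is a finite family of
  nonempty compact intervals with pairwise disjoint interiors and union \<open>S\<close>.\<close>

definition abs_continuous_on :: "real set \<Rightarrow> (real \<Rightarrow> 'a::real_normed_vector) \<Rightarrow> bool" where
  "abs_continuous_on I f \<longleftrightarrow>
     (\<forall>e>0. \<exists>\<delta>>0. \<forall>D S. D division_of S \<and> S \<subseteq> I \<and> (\<Sum>k\<in>D. Sup k - Inf k) < \<delta>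
        \<longrightarrow> (\<Sum>k\<in>D. norm (f (Sup k) - f (Inf k))) < e)"

definition loc_abs_continuous :: "(real \<Rightarrow> 'a::real_normed_vector) \<Rightarrow> bool" where
  "loc_abs_continuous f \<longleftrightarrow> (\<forall>T\<ge>0. abs_continuous_on {0..T} f)"

definition lsc_on :: "'a::topological_space set \<Rightarrow> ('a \<Rightarrow> 'b::linorder) \<Rightarrow> bool" where
  "lsc_on S f \<longleftrightarrow> (\<forall>x\<in>S. \<forall>y<f x. eventually (\<lambda>z. y < f z) (at x within S))"

text \<open>Curves are extensional (equal to \<open>undefined\<close> outside \<open>{0..}\<close>), so
  that an element of \<open>curves X\<close> is determined by its values at nonnegative times.\<close>

definition curves :: "'a::metric_space set \<Rightarrow> (real \<Rightarrow> 'a) set" where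
  "curves X = {\<gamma> \<in> {0..} \<rightarrow>\<^sub>E X. continuous_on {0..} \<gamma>}"

definition compact_nbhd :: "'a::metric_space set \<Rightarrow> real \<Rightarrow> real \<Rightarrow> (real \<Rightarrow> 'a) \<Rightarrow> (real \<Rightarrow> 'a) set" where
  "compact_nbhd X T e \<gamma> = {\<omega> \<in> curves X. \<forall>t\<in>{0..T}. dist (\<gamma> t) (\<omega> t) < e}"

text \<open>The topology of uniform convergence on compact time intervals.\<close>

definition curve_topology :: "'a::metric_space set \<Rightarrow> (real \<Rightarrow> 'a) topology" where
  "curve_topology X = topology (\<lambda>U. U \<subseteq> curves X \<and>
     (\<forall>\<gamma>\<in>U. \<exists>T\<ge>0. \<exists>e>0. compact_nbhd X T e \<gamma> \<subseteq> U))"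

lemma openin_curve_topology:
  "openin (curve_topology X) U \<longleftrightarrow>
     U \<subseteq> curves X \<and> (\<forall>\<gamma>\<in>U. \<exists>T\<ge>0. \<exists>e>0. compact_nbhd X T e \<gamma> \<subseteq> U)"
proof -
  let ?P = "\<lambda>U. U \<subseteq> curves X \<and> (\<forall>\<gamma>\<in>U. \<exists>T\<ge>0. \<exists>e>0. compact_nbhd X T e \<gamma> \<subseteq> U)"
  have "istopology ?P"
    unfolding istopology_def
  proof (rule conjI; intro allI impI)
    fix S V assume S: "?P S" and V: "?P V"
    show "?P (S \<inter> V)"
    proof (intro conjI ballI)
      show "S \<inter> V \<subseteq> curves X" using S by blast
      fix \<gamma> assume g: "\<gamma> \<in> S \<inter> V"
      obtain T1 e1 where 1: "T1 \<ge> 0" "e1 > 0" "compact_nbhd X T1 e1 \<gamma> \<subseteq> S"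
        using S g by blast
      obtain T2 e2 where 2: "T2 \<ge> 0" "e2 > 0" "compact_nbhd X T2 e2 \<gamma> \<subseteq> V"
        using V g by blast
      have "compact_nbhd X (max T1 T2) (min e1 e2) \<gamma>
              \<subseteq> compact_nbhd X T1 e1 \<gamma> \<inter> compact_nbhd X T2 e2 \<gamma>"
        by (auto simp: compact_nbhd_def)
      then have "compact_nbhd X (max T1 T2) (min e1 e2) \<gamma> \<subseteq> S \<inter> V"
        using 1(3) 2(3) by blast
      then show "\<exists>T\<ge>0. \<exists>e>0. compact_nbhd X T e \<gamma> \<subseteq> S \<inter> V"
        using 1 2 by (intro exI[of _ "max T1 T2"] conjI exI[of _ "min e1 e2"]) auto
    qed
  next
    fix K assume K: "\<forall>S\<in>K. ?P S"
    show "?P (\<Union>K)"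
    proof (intro conjI ballI)
      show "\<Union>K \<subseteq> curves X" using K by blast
      fix \<gamma> assume "\<gamma> \<in> \<Union>K"
      then obtain S where S: "S \<in> K" "\<gamma> \<in> S" by blast
      then obtain T e where "T \<ge> 0" "e > 0" "compact_nbhd X T e \<gamma> \<subseteq> S"
        using K by blast
      then show "\<exists>T\<ge>0. \<exists>e>0. compact_nbhd X T e \<gamma> \<subseteq> \<Union>K"
        using S(1) by blast
    qed
  qed
  then show ?thesis
    unfolding curve_topology_def by (simp add: topology_inverse')
qed

lemma topspace_curve_topology [simp]: "topspace (curve_topology X) = curves X"
proof
  show "topspace (curve_topology X) \<subseteq> curves X"
    using openin_topspace[of "curve_topology X"] unfolding openin_curve_topology by blast
  have "openin (curve_topology X) (curves X)"
    unfolding openin_curve_topology compact_nbhd_def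
    by (auto intro!: exI[of _ "0::real"] exI[of _ "1::real"])
  then show "curves X \<subseteq> topspace (curve_topology X)"
    by (rule openin_subset)
qed

definition borel_of_topology :: "'a topology \<Rightarrow> 'a measure" where
  "borel_of_topology X = sigma (topspace X) {U. openin X U}"

definition borel_prob_measures :: "'a topology \<Rightarrow> 'a measure set" where
  "borel_prob_measures X = {\<mu>. prob_space \<mu> \<and> sets \<mu> = sets (borel_of_topology X)}"

text \<open>At points of non-differentiability this is an unspecified constant; for locally absolutely
  continuous curves these points form a Lebesgue null set and do not affect the integrals
  below. Likewise for the value at time 0.\<close>

abbreviation velocity :: "(real \<Rightarrow> 'a::real_normed_vector) \<Rightarrow> real \<Rightarrow> 'a" where
  "velocity \<gamma> t \<equiv> vector_derivative \<gamma> (at t)"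

definition exit_time :: "'a set \<Rightarrow> (real \<Rightarrow> 'a) \<Rightarrow> ereal" where
  "exit_time \<Xi> \<gamma> = Inf {ereal t | t. 0 \<le> t \<and> \<gamma> t \<in> \<Xi>}"

text \<open>Extension of \<open>\<Psi>\<close> to \<open>[0, \<infinity>]\<close> by \<open>\<Psi> \<infinity> = \<infinity>\<close>.\<close>

definition exit_cost :: "(real \<Rightarrow> real) \<Rightarrow> ereal \<Rightarrow> ennreal" where
  "exit_cost \<Psi> s = (if s = \<infinity> then \<infinity> else ennreal (\<Psi> (real_of_ereal s)))"

definition running_cost ::
  "(real \<Rightarrow> 'a::real_normed_vector \<Rightarrow> 'a \<Rightarrow> real) \<Rightarrow> (real \<Rightarrow> 'a) \<Rightarrow> ennreal" where
  "running_cost l \<gamma> = (\<integral>\<^sup>+ t\<in>{0..}. ennreal (l t (\<gamma> t) (velocity \<gamma> t)) \<partial>lebesgue)"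

definition interaction_cost ::
  "'a::real_normed_vector set \<Rightarrow> (real \<Rightarrow> 'a \<Rightarrow> 'a \<Rightarrow> 'a \<Rightarrow> 'a \<Rightarrow> real) \<Rightarrow>
   (real \<Rightarrow> 'a) \<Rightarrow> (real \<Rightarrow> 'a) \<Rightarrow> ennreal" where
  "interaction_cost \<Xi> h \<gamma> \<gamma>' =
     (\<integral>\<^sup>+ t\<in>{t. 0 \<le> t \<and> ereal t \<le> min (exit_time \<Xi> \<gamma>) (exit_time \<Xi> \<gamma>')}.
        ennreal (h t (\<gamma> t) (\<gamma>' t) (velocity \<gamma> t) (velocity \<gamma>' t)) \<partial>lebesgue)"

definition nn_integrable :: "'a measure \<Rightarrow> ('a \<Rightarrow> ennreal) \<Rightarrow> bool" where
  "nn_integrable M f \<longleftrightarrow> f \<in> borel_measurable M \<and> (\<integral>\<^sup>+ x. f x \<partial>M) < \<infinity>"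

definition total_cost ::
  "'a::real_normed_vector set \<Rightarrow> (real \<Rightarrow> 'a \<Rightarrow> 'a \<Rightarrow> real) \<Rightarrow>
   (real \<Rightarrow> 'a \<Rightarrow> 'a \<Rightarrow> 'a \<Rightarrow> 'a \<Rightarrow> real) \<Rightarrow> (real \<Rightarrow> real) \<Rightarrow>
   (real \<Rightarrow> 'a) \<Rightarrow> (real \<Rightarrow> 'a) measure \<Rightarrow> ennreal" where
  "total_cost \<Xi> l h \<Psi> \<gamma> Q =
     (if loc_abs_continuous \<gamma> \<and> (AE \<gamma>' in Q. loc_abs_continuous \<gamma>') \<and>
         nn_integrable Q (interaction_cost \<Xi> h \<gamma>)
      then running_cost l \<gamma> + exit_cost \<Psi> (exit_time \<Xi> \<gamma>)
             + (\<integral>\<^sup>+ \<gamma>'. interaction_cost \<Xi> h \<gamma> \<gamma>' \<partial>Q)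
      else \<infinity>)"

definition equilibrium ::
  "'a::real_normed_vector set \<Rightarrow> 'a set \<Rightarrow> (real \<Rightarrow> 'a \<Rightarrow> 'a \<Rightarrow> real) \<Rightarrow>
   (real \<Rightarrow> 'a \<Rightarrow> 'a \<Rightarrow> 'a \<Rightarrow> 'a \<Rightarrow> real) \<Rightarrow> (real \<Rightarrow> real) \<Rightarrow>
   'a measure \<Rightarrow> (real \<Rightarrow> 'a) measure \<Rightarrow> bool" where
  "equilibrium \<Omega> \<Xi> l h \<Psi> m0 Q \<longleftrightarrow>
     Q \<in> borel_prob_measures (curve_topology (closure \<Omega>)) \<and>
     distr Q (borel_of_topology (top_of_set (closure \<Omega>))) (\<lambda>\<gamma>. \<gamma> 0) = m0 \<and>
     (\<integral>\<^sup>+ \<gamma>. total_cost \<Xi> l h \<Psi> \<gamma> Q \<partial>Q) < \<infinity> \<and>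
     (AE \<gamma> in Q. total_cost \<Xi> l h \<Psi> \<gamma> Q =
        Inf {total_cost \<Xi> l h \<Psi> \<omega> Q | \<omega>. \<omega> \<in> curves (closure \<Omega>) \<and> \<omega> 0 = \<gamma> 0})"

end

(*
The game has a potential. By symmetry of h, a Q that minimizes
  J(Q) = 2 int (running + exit cost) dQ + int int (interaction) dQ dQ
among the measures with initial marginal m_0 is an equilibrium: its first variation in the direction of
a competitor Q' reads int F(., Q) dQ <= int F(., Q) dQ', and choosing Q' concentrated on the curves that
are optimal against Q gives optimality Q-almost everywhere.
The minimizer comes from the direct method. Coercivity of l makes the curves of bounded cost
equicontinuous, an absolutely continuous function is the integral of its velocity, velocities converge
weakly, and Ioffe's theorem (convexity in the velocity) gives lower semicontinuity of all costs under
pointwise convergence of curves of bounded cost.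
No compactness theory on the space of curves is used: a curve of finite cost is encoded by a real number
whose integer part bounds its cost and whose fractional part lists, in base 4, the answers to the
questions "is the curve at time q_i in the k-th basic open set?". Decoding is continuous on the closure
Z of the set of codes, so that Helly's selection theorem and Skorohod's representation on the real line
yield the minimizer, which is then pushed forward to the space of curves.
*)
theory Submission
  imports Defs
begin

section \<open>Vitali coverings, differentiability almost everywhere, fundamental theorem of
  calculus\<close>

section \<open>Absolutely continuous functions\<close>

text \<open>Two obstacles shape the argument. A limit of codes is a point of \<open>Z\<close> that
  need not itself be a code: its decoded curve may cost far less than its integer part suggests, and
  one curve may be decoded from several points. The cost of a point is therefore the maximum of the
  cost of its curve and its level minus one. This is coercive and lower semicontinuous on
  \<open>Z\<close> and exact on genuine codes, and optimality only has to be tested against genuine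
  codes. Secondly, the competitor concentrated on best replies must be a measure, which requires a
  measurable choice of minimizers; on the real line the smallest minimizer in each fibre is such a
  choice. Base 4 with digits 0 and 1 leaves gaps between codes, so along a convergent sequence of
  codes each answer is constant from some index on. The quantitative tool throughout is v \<le> c +
  c^(1 - \<theta>) v^\<theta>, which, with c large, turns a bound on the \<theta>-energy into
  equi-absolute continuity and uniform integrability.\<close>

lemma finite_subfamily_emeasure_gt:
  assumes "countable C" and A: "\<And>i. i \<in> C \<Longrightarrow> A i \<in> sets M"
    and gt: "emeasure M (\<Union>i\<in>C. A i) > c"
  obtains F where "finite F" "F \<subseteq> C" "emeasure M (\<Union>i\<in>F. A i) > c"
proof (cases "finite C")
  case True
  then show ?thesis using that gt by blast
next
  case False
  define B where "B n = (\<Union>i\<in>from_nat_into C ` {..n}. A i)" for n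
  have sub: "from_nat_into C ` {..n} \<subseteq> C" for n
    using False by (auto simp: from_nat_into infinite_imp_nonempty)
  have "range B \<subseteq> sets M"
    unfolding B_def using A sub by (intro image_subsetI sets.finite_UN) blast+
  moreover have "incseq B"
    unfolding B_def by (rule incseq_SucI) (force simp: atMost_Suc)
  ultimately have "(SUP n. emeasure M (B n)) = emeasure M (\<Union>n. B n)"
    by (rule SUP_emeasure_incseq)
  moreover have "(\<Union>n. B n) = (\<Union>i\<in>C. A i)"
  proof -
    have "C = range (from_nat_into C)"
      using False \<open>countable C\<close> by (simp add: range_from_nat_into infinite_imp_nonempty)
    then have "(\<Union>i\<in>C. A i) = (\<Union>n. A (from_nat_into C n))"
      by (metis image_image)
    then show ?thesis unfolding B_def by auto
  qed
  ultimately have "c < (SUP n. emeasure M (B n))" using gt by simp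
  then obtain n where "c < emeasure M (B n)" by (auto simp: less_SUP_iff)
  then show ?thesis
    using that[of "from_nat_into C ` {..n}"] sub[of n] unfolding B_def by blast
qed

text \<open>Vitali's theorem for balls, read through midpoints and half-lengths. Intervals are kept
  as pairs of endpoints because slopes will be attached to them.\<close>

lemma Vitali_intervals:
  fixes K :: "(real \<times> real) set"
  assumes K: "\<And>u v. (u, v) \<in> K \<Longrightarrow> u < v"
    and S: "\<And>x d. x \<in> S \<Longrightarrow> 0 < d \<Longrightarrow> \<exists>u v. (u, v) \<in> K \<and> x \<in> {u..v} \<and> v - u < d"
  obtains C where "countable C" "C \<subseteq> K"
    "disjoint_family_on (\<lambda>(u, v). {u..v}) C"
    "negligible (S - (\<Union>(u, v)\<in>C. {u..v}))"
proof -
  define m where "m = (\<lambda>(u, v). (u + v) / 2 :: real)"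
  define r where "r = (\<lambda>(u, v). (v - u) / 2 :: real)"
  have cb: "cball (m i) (r i) = (case i of (u, v) \<Rightarrow> {u..v})" for i
    by (cases i) (simp add: m_def r_def cball_eq_atLeastAtMost field_simps)
  obtain C where C: "countable C" "C \<subseteq> K"
     "pairwise (\<lambda>i j. disjnt (cball (m i) (r i)) (cball (m j) (r j))) C"
     "negligible (S - (\<Union>i \<in> C. cball (m i) (r i)))"
  proof (rule Vitali_covering_theorem_cballs[of K r S m])
    show "0 < r i" if "i \<in> K" for i
      using K that by (cases i) (auto simp: r_def)
    show "\<exists>i. i \<in> K \<and> x \<in> cball (m i) (r i) \<and> r i < d" if "x \<in> S" "0 < d" for x d
    proof -
      from S[OF that] obtain u v where "(u, v) \<in> K \<and> x \<in> {u..v} \<and> v - u < d" by blast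
      then show ?thesis
        using K[of u v] by (intro exI[of _ "(u, v)"]) (simp add: cb, simp add: r_def)
    qed
  qed blast
  show ?thesis
    using C by (intro that[of C]) (auto simp: cb disjoint_family_on_def pairwise_def disjnt_def)
qed

text \<open>Tagging each piece by its left endpoint turns the division into a tagged one, to which
  additivity over tagged divisions applies.\<close>

lemma division_telescope:
  fixes f :: "real \<Rightarrow> 'a::real_normed_vector"
  assumes D: "D division_of {a..b}" and "a \<le> b"
  shows "(\<Sum>k\<in>D. f (Sup k) - f (Inf k)) = f b - f a"
proof -
  let ?p = "(\<lambda>k. (Inf k, k)) ` D"
  have fin: "finite D" using D by blast
  have *: "Inf k \<in> k \<and> k \<subseteq> {a..b} \<and> (\<exists>c d. k = cbox c d)" if k: "k \<in> D" for k
  proof -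
    obtain c d where cd: "k = cbox c d" "k \<noteq> {}" "k \<subseteq> {a..b}"
      using D k by (metis division_ofD(2,3,4))
    then show ?thesis by (auto simp: cInf_atLeastAtMost)
  qed
  have "?p tagged_division_of {a..b}"
    unfolding tagged_division_of_def tagged_partial_division_of_def
  proof (intro conjI allI impI)
    show "finite ?p" using fin by simp
    show "\<Union> {K. \<exists>x. (x, K) \<in> ?p} = {a..b}"
      using D * unfolding division_of_def by (auto simp: image_iff)
    show "x \<in> K" "K \<subseteq> {a..b}" "\<exists>a b. K = cbox a b" if "(x, K) \<in> ?p" for x K
      using * that by auto
    show "interior K \<inter> interior K' = {}"
      if "(x, K) \<in> ?p \<and> (y, K') \<in> ?p \<and> (x, K) \<noteq> (y, K')" for x K y K'
    proof -
      have "K \<in> D" "K' \<in> D" "K \<noteq> K'" using that by auto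
      then show ?thesis using D unfolding division_of_def by blast
    qed
  qed
  from additive_tagged_division_1[OF \<open>a \<le> b\<close> this, of f]
  have "(\<Sum>(x, k)\<in>?p. f (Sup k) - f (Inf k)) = f b - f a" .
  then show ?thesis by (subst (asm) sum.reindex) (auto simp: inj_on_def)
qed

lemma abs_continuous_onD:
  assumes "abs_continuous_on I f" "e > 0"
  obtains \<delta> where "\<delta> > 0"
    "\<And>D S. D division_of S \<Longrightarrow> S \<subseteq> I \<Longrightarrow> (\<Sum>k\<in>D. Sup k - Inf k) < \<delta>
        \<Longrightarrow> (\<Sum>k\<in>D. norm (f (Sup k) - f (Inf k))) < e"
proof -
  obtain \<delta> where \<delta>: "\<delta> > 0" "\<forall>D S. D division_of S \<and> S \<subseteq> I \<and> (\<Sum>k\<in>D. Sup k - Inf k) < \<delta>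
        \<longrightarrow> (\<Sum>k\<in>D. norm (f (Sup k) - f (Inf k))) < e"
    using assms unfolding abs_continuous_on_def by meson
  show ?thesis
  proof (rule that[OF \<delta>(1)])
    show "(\<Sum>k\<in>D. norm (f (Sup k) - f (Inf k))) < e"
      if "D division_of S" "S \<subseteq> I" "(\<Sum>k\<in>D. Sup k - Inf k) < \<delta>" for D S
      using \<delta>(2)[rule_format, of D S] that by simp
  qed
qed

lemma abs_continuous_on_subset:
  "abs_continuous_on I f \<Longrightarrow> J \<subseteq> I \<Longrightarrow> abs_continuous_on J f"
  unfolding abs_continuous_on_def by (elim all_forward imp_forward ex_forward conj_forward) auto

lemma abs_continuous_on_imp_continuous_on:
  fixes f :: "real \<Rightarrow> 'a::real_normed_vector"
  assumes "abs_continuous_on {a..b} f"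
  shows "continuous_on {a..b} f"
  unfolding continuous_on_iff
proof (intro ballI allI impI)
  fix x and e :: real assume x: "x \<in> {a..b}" and e: "0 < e"
  obtain \<delta> where \<delta>: "\<delta> > 0" "\<And>D S. D division_of S \<Longrightarrow> S \<subseteq> {a..b} \<Longrightarrow> (\<Sum>k\<in>D. Sup k - Inf k) < \<delta>
        \<Longrightarrow> (\<Sum>k\<in>D. norm (f (Sup k) - f (Inf k))) < e"
    using abs_continuous_onD[OF assms e] by blast
  have *: "norm (f v - f u) < e" if "u \<le> v" "u \<in> {a..b}" "v \<in> {a..b}" "v - u < \<delta>" for u v
  proof -
    have "{{u..v}} division_of {u..v}"
      using division_of_self[of u v] that by (simp add: cbox_interval)
    from \<delta>(2)[OF this] that show ?thesis by auto
  qed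
  show "\<exists>d>0. \<forall>x'\<in>{a..b}. dist x' x < d \<longrightarrow> dist (f x') (f x) < e"
  proof (intro exI conjI ballI impI)
    show "\<delta> > 0" by fact
    fix x' assume x': "x' \<in> {a..b}" "dist x' x < \<delta>"
    show "dist (f x') (f x) < e"
      using *[of x x'] *[of x' x] x x' by (cases "x \<le> x'") (auto simp: dist_norm norm_minus_commute)
  qed
qed

section \<open>Difference quotients and differentiability almost everywhere\<close>

definition slope :: "(real \<Rightarrow> real) \<Rightarrow> real \<Rightarrow> real \<Rightarrow> real" where
  "slope f x y = (f y - f x) / (y - x)"

lemma slope_commute: "slope f x y = slope f y x"
proof -
  have "slope f x y = (- (f x - f y)) / (- (x - y))"
    unfolding slope_def by (simp only: minus_diff_eq)
  also have "\<dots> = slope f y x"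
    unfolding slope_def by (rule minus_divide_divide)
  finally show ?thesis .
qed

text \<open>For a fixed partner \<open>y\<close> the condition on \<open>x\<close> is open, and the
  set is the union over all \<open>y\<close>. The oscillation set studied below is thus a countable
  intersection of open sets, hence measurable.\<close>

lemma open_slope_witness:
  assumes "continuous_on {a<..<b} f" "open P"
  shows "open {x\<in>{a<..<b}. \<exists>y\<in>{a<..<b}. x \<noteq> y \<and> \<bar>y - x\<bar> < d \<and> slope f x y \<in> P}"
proof -
  have "open {x \<in> {a<..<b} - {y}. \<bar>y - x\<bar> < d \<and> slope f x y \<in> P}" for y
  proof -
    have f: "continuous_on ({a<..<b} - {y}) f"
      by (rule continuous_on_subset[OF assms(1)]) auto
    have "continuous_on ({a<..<b} - {y}) (slope f y)"
      unfolding slope_def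
        by (intro continuous_on_divide continuous_on_diff f continuous_on_const continuous_on_id) auto
    then have "continuous_on ({a<..<b} - {y}) (\<lambda>x. slope f x y)"
      by (simp add: slope_commute[of f _ y])
    then have "continuous_on ({a<..<b} - {y}) (\<lambda>x. (\<bar>y - x\<bar>, slope f x y))"
      by (intro continuous_intros)
    then have "open (({a<..<b} - {y}) \<inter> (\<lambda>x. (\<bar>y - x\<bar>, slope f x y)) -` ({..<d} \<times> P))"
      by (rule continuous_open_preimage) (auto intro!: open_Times assms)
    also have "(({a<..<b} - {y}) \<inter> (\<lambda>x. (\<bar>y - x\<bar>, slope f x y)) -` ({..<d} \<times> P))
       = {x \<in> {a<..<b} - {y}. \<bar>y - x\<bar> < d \<and> slope f x y \<in> P}" by auto
    finally show ?thesis .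
  qed
  then have "open (\<Union>y\<in>{a<..<b}. {x \<in> {a<..<b} - {y}. \<bar>y - x\<bar> < d \<and> slope f x y \<in> P})"
    by blast
  also have "\<dots> = {x\<in>{a<..<b}. \<exists>y\<in>{a<..<b}. x \<noteq> y \<and> \<bar>y - x\<bar> < d \<and> slope f x y \<in> P}"
    by blast
  finally show ?thesis .
qed

lemma slope_interval:
  assumes "y \<noteq> x" "\<bar>y - x\<bar> < d" "ball x d \<subseteq> U"
  obtains u v where "u < v" "{u..v} \<subseteq> U" "x \<in> {u..v}" "v - u < d" "slope f x y = slope f u v"
    "{u, v} = {x, y}"
proof -
  have U: "z \<in> U" if "\<bar>z - x\<bar> < d" for z
    using assms(3) that by (auto simp: dist_real_def)
  show ?thesis
  proof (cases "x < y")
    case True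
    moreover have "{x..y} \<subseteq> U" using U assms(2) by auto
    ultimately show ?thesis using assms(2) by (intro that[of x y]) auto
  next
    case False
    with assms(1) have "y < x" by simp
    moreover have "{y..x} \<subseteq> U" using U assms(2) by auto
    ultimately show ?thesis using assms(2) by (intro that[of y x]) (auto simp: slope_commute)
  qed
qed

lemma measure_Union_intervals:
  assumes "finite F" "disjoint_family_on (\<lambda>(u, v). {u..v}) F" "\<And>u v. (u, v) \<in> F \<Longrightarrow> u < (v::real)"
  shows "(\<Union>(u, v)\<in>F. {u..v}) \<in> lmeasurable"
    and "measure lebesgue (\<Union>(u, v)\<in>F. {u..v}) = (\<Sum>(u, v)\<in>F. v - u)"
proof -
  show "(\<Union>(u, v)\<in>F. {u..v}) \<in> lmeasurable"
    using assms(1) by (intro fmeasurable.finite_UN) auto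
  have "measure lebesgue (\<Union>i\<in>F. case i of (u, v) \<Rightarrow> {u..v}) = (\<Sum>i\<in>F.
    measure lebesgue (case i of (u, v) \<Rightarrow> {u..v}))"
    using assms(1,2) by (intro measure_finite_Union) (auto simp: emeasure_lborel_Icc_eq)
  also have "\<dots> = (\<Sum>(u, v)\<in>F. v - u)"
    using assms(3) by (intro sum.cong) (auto simp: less_imp_le)
  finally show "measure lebesgue (\<Union>(u, v)\<in>F. {u..v}) = (\<Sum>(u, v)\<in>F. v - u)" .
qed

lemma emeasure_gt_if_negligible_diff:
  assumes "E \<in> lmeasurable" "B \<in> sets lebesgue" "negligible (E - B)" "0 \<le> c" "c < measure lebesgue E"
  shows "ennreal c < emeasure lebesgue B"
proof -
  have "ennreal c < ennreal (measure lebesgue E)"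
    using assms(4,5) by (intro ennreal_lessI) auto
  also have "ennreal (measure lebesgue E) = emeasure lebesgue E"
    using assms(1) by (simp add: emeasure_eq_measure2)
  also have "emeasure lebesgue E \<le> emeasure lebesgue (B \<union> (E - B))"
    using assms by (intro emeasure_mono) (auto simp: negligible_imp_sets)
  also have "\<dots> = emeasure lebesgue B"
    using assms(2,3) by (intro emeasure_Un_null_set) (auto simp: negligible_iff_null_sets)
  finally show ?thesis .
qed

lemma division_of_intervals:
  fixes F :: "(real \<times> real) set"
  assumes "finite F" "disjoint_family_on (\<lambda>(u, v). {u..v}) F" "\<And>u v. (u, v) \<in> F \<Longrightarrow> u < v"
  shows "(\<lambda>(u, v). {u..v}) ` F division_of (\<Union>(u, v)\<in>F. {u..v})"
    and "inj_on (\<lambda>(u, v). {u..v}) F"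
proof -
  let ?iv = "\<lambda>(u, v). {u..v::real}"
  show "?iv ` F division_of \<Union> (?iv ` F)"
  proof (rule division_ofI)
    show "K \<noteq> {}" "\<exists>a b. K = cbox a b" if K: "K \<in> ?iv ` F" for K
    proof -
      obtain u v where "(u, v) \<in> F" "K = {u..v}" using K by auto
      then show "K \<noteq> {}" "\<exists>a b. K = cbox a b" using assms(3)[of u v] by (auto intro!: exI[of _ u] exI[of _ v])
    qed
    show "interior K1 \<inter> interior K2 = {}" if "K1 \<in> ?iv ` F" "K2 \<in> ?iv ` F" "K1 \<noteq> K2" for K1 K2
    proof -
      obtain i j where ij: "i \<in> F" "K1 = ?iv i" "j \<in> F" "K2 = ?iv j" using \<open>K1 \<in> _\<close> \<open>K2 \<in> _\<close> by blast
      then have "i \<noteq> j" using \<open>K1 \<noteq> K2\<close> by blast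
      then have "K1 \<inter> K2 = {}"
        using assms(2) ij unfolding disjoint_family_on_def by blast
      then show ?thesis by (metis interior_Int interior_empty)
    qed
  qed (use assms in auto)
  show "inj_on ?iv F"
  proof (rule inj_onI)
    fix i j assume ij: "i \<in> F" "j \<in> F" "?iv i = ?iv j"
    then show "i = j"
      using assms(3)[of "fst i" "snd i"] assms(3)[of "fst j" "snd j"]
      by (cases i; cases j) (simp add: Icc_eq_Icc)
  qed
qed

text \<open>Two-stage Vitali argument. The points in question see slopes below \<open>p\<close> and
  slopes above \<open>q\<close> at every scale. Up to a null set they are covered by disjoint
  intervals of slope below \<open>p\<close>, inside an open set of nearly the same measure, and
  again by disjoint intervals of slope above \<open>q\<close> inside the former. On the first family
  \<open>f\<close> grows by at most \<open>p\<close> times the length, on the second by at least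
  \<open>q\<close> times the length. The lengths differ by little, and absolute continuity controls
  \<open>f\<close> on the difference; with \<open>p < q\<close> this leaves only measure
  zero.\<close>

lemma negligible_slope_oscillation:
  fixes f :: "real \<Rightarrow> real"
  assumes ac: "abs_continuous_on {a..b} f" and "p < q"
  defines "W \<equiv> \<lambda>P n. {x\<in>{a<..<b}. \<exists>y\<in>{a<..<b}. x \<noteq> y \<and> \<bar>y - x\<bar> < 1 / real (Suc n) \<and> slope f x y \<in> P}"
  shows "negligible ((\<Inter>n. W {..<p} n) \<inter> (\<Inter>n. W {q<..} n))"
proof -
  define E where "E = (\<Inter>n. W {..<p} n) \<inter> (\<Inter>n. W {q<..} n)"
  let ?iv = "\<lambda>(u, v). {u..v::real}"
  have cont: "continuous_on {a<..<b} f"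
    by (rule continuous_on_subset[OF abs_continuous_on_imp_continuous_on[OF ac]]) auto
  have "open (W P n)" if "open P" for P n
    unfolding W_def by (rule open_slope_witness[OF cont that])
  then have Em: "E \<in> sets lebesgue"
    unfolding E_def by (intro sets.Int sets.countable_INT) (auto intro!: borel_open)
  have Eab: "E \<subseteq> {a<..<b}" unfolding E_def W_def by auto
  have bdd: "bounded S" if "S \<subseteq> {a<..<b}" for S :: "real set"
    using that by (intro bounded_subset[of "{a..b}" S]) (auto simp: subset_iff less_imp_le)
  have "bounded E" by (rule bdd[OF Eab])
  then have E: "E \<in> lmeasurable" using Em by (rule bounded_set_imp_lmeasurable)
  define s where "s = measure lebesgue E"
  have cover: "\<exists>u v. u < v \<and> {u..v} \<subseteq> U \<and> slope f u v \<in> P \<and> x \<in> {u..v} \<and> v - u < d"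
    if "x \<in> (\<Inter>n. W P n)" "0 < d" "open U" "x \<in> U" for x d U P
  proof -
    obtain r where r: "r > 0" "ball x r \<subseteq> U" using \<open>open U\<close> \<open>x \<in> U\<close> open_contains_ball by blast
    obtain n where n: "1 / real (Suc n) < min d r"
      using nat_approx_posE[of "min d r"] r \<open>0 < d\<close> by auto
    obtain y where y: "x \<noteq> y" "\<bar>y - x\<bar> < 1 / real (Suc n)" "slope f x y \<in> P"
      using \<open>x \<in> (\<Inter>n. W P n)\<close> unfolding W_def by blast
    have "ball x (1 / real (Suc n)) \<subseteq> U" using r n by (auto simp: subset_iff)
    with y obtain u v where "u < v" "{u..v} \<subseteq> U" "x \<in> {u..v}" "v - u < 1 / real (Suc n)"
      "slope f x y = slope f u v"
      by (metis slope_interval)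
    then show ?thesis using n y(3) by (intro exI[of _ u] exI[of _ v]) auto
  qed
  \<comment> \<open>The constant collects three errors: 1 from absolute continuity on the leftover
    pieces, \<open>2 * \<bar>p\<bar>\<close> from their length, and \<open>q - p\<close> from
    replacing the length of the second family by \<open>s\<close>.\<close>
  have key: "(q - p) * s \<le> (1 + 2 * \<bar>p\<bar> + (q - p)) * \<epsilon>" if "\<epsilon> > 0" for \<epsilon>
  proof -
    obtain \<delta> where \<delta>: "\<delta> > 0" "\<And>D S. D division_of S \<Longrightarrow> S \<subseteq> {a..b} \<Longrightarrow> (\<Sum>k\<in>D. Sup k - Inf k) < \<delta>
        \<Longrightarrow> (\<Sum>k\<in>D. norm (f (Sup k) - f (Inf k))) < \<epsilon>"
      using abs_continuous_onD[OF ac \<open>\<epsilon> > 0\<close>] by blast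
    \<comment> \<open>The leftover length will be at most \<open>2 * \<epsilon>'\<close>; a third of
      \<open>\<delta>\<close> keeps this below \<open>\<delta>\<close>.\<close>
    define \<epsilon>' where "\<epsilon>' = min \<epsilon> (\<delta> / 3)"
    have \<epsilon>': "\<epsilon>' > 0" "\<epsilon>' \<le> \<epsilon>" "2 * \<epsilon>' < \<delta>" using \<delta>(1) \<open>\<epsilon> > 0\<close> by (auto simp: \<epsilon>'_def min_def)
    obtain T where T: "open T" "E \<subseteq> T" "T - E \<in> lmeasurable" "emeasure lebesgue (T - E) < ennreal \<epsilon>'"
      using sets_lebesgue_outer_open[OF Em \<epsilon>'(1)] by blast
    define U where "U = T \<inter> {a<..<b}"
    have U: "open U" "E \<subseteq> U" "U \<subseteq> {a<..<b}" using T Eab by (auto simp: U_def)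
    have U': "U \<in> lmeasurable" using U(1) bdd[OF U(3)] by (intro bounded_set_imp_lmeasurable) auto
    have "measure lebesgue U = measure lebesgue E + measure lebesgue (U - E)"
      using measurable_measure_Diff[OF U' Em U(2)] by simp
    moreover have "measure lebesgue (U - E) \<le> measure lebesgue (T - E)"
      using T U' Em by (intro measure_mono_fmeasurable) (auto simp: U_def)
    moreover have "measure lebesgue (T - E) < \<epsilon>'"
      using T(3,4) \<epsilon>' by (simp add: emeasure_eq_measure2 ennreal_less_iff)
    ultimately have Us: "measure lebesgue U < s + \<epsilon>'" by (simp add: s_def)
    show ?thesis
    proof (cases "s \<le> \<epsilon>'")
      case True
      then have "(q - p) * s \<le> (q - p) * \<epsilon>"
        using \<epsilon>'(2) \<open>p < q\<close> by (intro mult_left_mono) auto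
      moreover have "(1 + 2 * \<bar>p\<bar> + (q - p)) * \<epsilon> = \<epsilon> + 2 * (\<bar>p\<bar> * \<epsilon>) + (q - p) * \<epsilon>"
        by (simp add: algebra_simps)
      moreover have "0 \<le> \<bar>p\<bar> * \<epsilon>" using \<open>\<epsilon> > 0\<close> by simp
      ultimately show ?thesis using \<open>\<epsilon> > 0\<close> by linarith
    next
      case False
      define K1 where "K1 = {(u, v). u < v \<and> {u..v} \<subseteq> U \<and> slope f u v < p}"
      obtain C1 where C1: "countable C1" "C1 \<subseteq> K1" "disjoint_family_on ?iv C1" "negligible (E - (\<Union>i\<in>C1. ?iv i))"
      proof (rule Vitali_intervals[of K1 E])
        show "u < v" if "(u, v) \<in> K1" for u v using that by (simp add: K1_def)
        show "\<exists>u v. (u, v) \<in> K1 \<and> x \<in> {u..v} \<and> v - u < d" if "x \<in> E" "0 < d" for x d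
        proof -
          have "x \<in> (\<Inter>n. W {..<p} n)" "x \<in> U" using that(1) U(2) by (auto simp: E_def)
          from cover[OF this(1) that(2) U(1) this(2)] obtain u v where
            "u < v" "{u..v} \<subseteq> U" "slope f u v \<in> {..<p}" "x \<in> {u..v}" "v - u < d" by blast
          then show ?thesis by (intro exI[of _ u] exI[of _ v]) (simp add: K1_def)
        qed
      qed blast
      \<comment> \<open>Only points in the open intervals of the first family are covered again, so
        that second-stage intervals fit inside a single first-stage interval. The endpoints that are
        lost are countable.\<close>
      define E1 where "E1 = E \<inter> (\<Union>i\<in>C1. {fst i<..<snd i})"
      define K2 where "K2 = {(u, v). u < v \<and> (\<exists>P\<in>C1. {u..v} \<subseteq> {fst P<..<snd P}) \<and> q < slope f u v}"
      obtain C2 where C2: "countable C2" "C2 \<subseteq> K2" "disjoint_family_on ?iv C2"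
        "negligible (E1 - (\<Union>i\<in>C2. ?iv i))"
      proof (rule Vitali_intervals[of K2 E1])
        show "u < v" if "(u, v) \<in> K2" for u v using that by (simp add: K2_def)
        show "\<exists>u v. (u, v) \<in> K2 \<and> x \<in> {u..v} \<and> v - u < d" if "x \<in> E1" "0 < d" for x d
        proof -
          obtain P where P: "P \<in> C1" "x \<in> {fst P<..<snd P}" using \<open>x \<in> E1\<close> by (auto simp: E1_def)
          have "x \<in> (\<Inter>n. W {q<..} n)" using that(1) by (auto simp: E1_def E_def)
          from cover[OF this that(2) open_greaterThanLessThan P(2)] obtain u v where
            "u < v" "{u..v} \<subseteq> {fst P<..<snd P}" "slope f u v \<in> {q<..}" "x \<in> {u..v}" "v - u < d" by blast
          then show ?thesis using P(1) by (intro exI[of _ u] exI[of _ v]) (auto simp: K2_def)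
        qed
      qed blast
      have "negligible (E - (\<Union>i\<in>C2. ?iv i))"
      proof (rule negligible_subset)
        show "negligible ((E - (\<Union>i\<in>C1. ?iv i)) \<union> (fst ` C1 \<union> snd ` C1) \<union> (E1 - (\<Union>i\<in>C2. ?iv i)))"
        proof (intro negligible_Un)
          show "negligible (fst ` C1)" "negligible (snd ` C1)"
            using C1(1)
              by (simp_all add: negligible_iff_null_sets countable_imp_null_set_lborel null_sets_completionI)
        qed (use C1 C2 in auto)
        show "E - (\<Union>i\<in>C2. ?iv i) \<subseteq> (E - (\<Union>i\<in>C1. ?iv i)) \<union> (fst ` C1 \<union> snd ` C1) \<union> (E1 - (\<Union>i\<in>C2. ?iv i))"
        proof
          fix x assume x: "x \<in> E - (\<Union>i\<in>C2. ?iv i)"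
          show "x \<in> (E - (\<Union>i\<in>C1. ?iv i)) \<union> (fst ` C1 \<union> snd ` C1) \<union> (E1 - (\<Union>i\<in>C2. ?iv i))"
          proof (cases "\<exists>u v. (u, v) \<in> C1 \<and> x \<in> {u..v}")
            case True
            then obtain u v where uv: "(u, v) \<in> C1" "u \<le> x" "x \<le> v" by auto
            then consider "x = u" | "x = v" | "x \<in> {u<..<v}" by fastforce
            then show ?thesis
            proof cases
              case 3
              then have "x \<in> E1" using x uv(1) unfolding E1_def by force
              then show ?thesis using x by blast
            qed (use uv in force)+
          next
            case False
            then show ?thesis using x by auto
          qed
        qed
      qed
      then have "ennreal (s - \<epsilon>') < emeasure lebesgue (\<Union>i\<in>C2. ?iv i)"
        using C2(1) \<epsilon>'(1) False by (intro emeasure_gt_if_negligible_diff[OF E]) (auto simp: s_def)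
      then obtain F2 where F2: "finite F2" "F2 \<subseteq> C2" "ennreal (s - \<epsilon>') < emeasure lebesgue (\<Union>i\<in>F2. ?iv i)"
        by (rule finite_subfamily_emeasure_gt[rotated 2]) (use C2(1) in auto)
      have F2': "fst i < snd i" "q < slope f (fst i) (snd i)" if "i \<in> F2" for i
      proof -
        have "i \<in> K2" using that F2(2) C2(2) by blast
        then show "fst i < snd i" "q < slope f (fst i) (snd i)"
          unfolding K2_def case_prod_beta mem_Collect_eq by blast+
      qed
      have "\<forall>i\<in>F2. \<exists>P. P \<in> C1 \<and> {fst i..snd i} \<subseteq> {fst P<..<snd P}"
      proof
        fix i assume "i \<in> F2"
        then have "i \<in> K2" using F2(2) C2(2) by blast
        then show "\<exists>P. P \<in> C1 \<and> {fst i..snd i} \<subseteq> {fst P<..<snd P}"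
          unfolding K2_def case_prod_beta mem_Collect_eq by blast
      qed
      then obtain g where g: "\<And>i. i \<in> F2 \<Longrightarrow> g i \<in> C1" "\<And>i. i \<in> F2 \<Longrightarrow> {fst i..snd i} \<subseteq> {fst (g i)<..<snd (g i)}"
        by metis
      \<comment> \<open>Keeping only the first-stage intervals that contain a chosen second-stage
        interval makes the first family finite as well.\<close>
      define F1 where "F1 = g ` F2"
      have F1: "finite F1" "F1 \<subseteq> C1" using F2(1) g by (auto simp: F1_def)
      have F1': "fst P < snd P" "slope f (fst P) (snd P) < p" "{fst P..snd P} \<subseteq> U" if "P \<in> F1" for P
      proof -
        have "P \<in> K1" using that F1(2) C1(2) by blast
        then show "fst P < snd P" "slope f (fst P) (snd P) < p" "{fst P..snd P} \<subseteq> U"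
          unfolding K1_def case_prod_beta mem_Collect_eq by blast+
      qed
      have dj1: "disjoint_family_on ?iv F1" and dj2: "disjoint_family_on ?iv F2"
        using C1(3) C2(3) F1(2) F2(2) disjoint_family_on_mono by blast+
      have ivs: "?iv i = {fst i..snd i}" for i by (cases i) auto
      have div2: "?iv ` G division_of \<Union> (?iv ` G)" "inj_on ?iv G" if "G \<subseteq> F2" for G
      proof -
        have "finite G" using that F2(1) by (rule finite_subset)
        moreover have "u < v" if "(u, v) \<in> G" for u v
          using F2'(1)[of "(u, v)"] that \<open>G \<subseteq> F2\<close> by auto
        ultimately show "?iv ` G division_of \<Union> (?iv ` G)" "inj_on ?iv G"
          using division_of_intervals[OF _ disjoint_family_on_mono[OF that dj2]] by blast+
      qed
      have lt2: "u < v" if "(u, v) \<in> F2" for u v using F2'(1)[OF that] by simp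
      have lt1: "u < v" if "(u, v) \<in> F1" for u v using F1'(1)[OF that] by simp
      have ms2: "measure lebesgue (\<Union>i\<in>F2. ?iv i) = (\<Sum>i\<in>F2. snd i - fst i)"
        using measure_Union_intervals(2)[OF F2(1) dj2 lt2] by (simp add: case_prod_beta)
      have ms1: "measure lebesgue (\<Union>i\<in>F1. ?iv i) = (\<Sum>i\<in>F1. snd i - fst i)"
        using measure_Union_intervals(2)[OF F1(1) dj1 lt1] by (simp add: case_prod_beta)
      have m1: "(\<Union>i\<in>F1. ?iv i) \<in> lmeasurable" and m2: "(\<Union>i\<in>F2. ?iv i) \<in> lmeasurable"
        using measure_Union_intervals(1)[OF F1(1) dj1 lt1] measure_Union_intervals(1)[OF F2(1) dj2 lt2]
          by simp_all
      define \<sigma> where "\<sigma> = (\<Sum>i\<in>F2. snd i - fst i)"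
      have \<sigma>: "s - \<epsilon>' < \<sigma>"
        using F2(3) m2 False by (simp add: emeasure_eq_measure2 ms2 \<sigma>_def ennreal_less_iff)
      have U1: "(\<Sum>i\<in>F1. snd i - fst i) \<le> measure lebesgue U"
        unfolding ms1[symmetric] using F1'(3) m1 U'
        by (intro measure_mono_fmeasurable) (auto simp: ivs)
      \<comment> \<open>Each interval of \<open>F1\<close> is divided in such a way that the
        second-stage intervals inside it are among the pieces; what remains is the region where
        absolute continuity is used.\<close>
      have "\<forall>P\<in>F1. \<exists>Q. ?iv ` {i\<in>F2. g i = P} \<subseteq> Q \<and> Q division_of {fst P..snd P}"
      proof
        fix P assume P: "P \<in> F1"
        have sub: "\<Union> (?iv ` {i\<in>F2. g i = P}) \<subseteq> {fst P..snd P}"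
        proof -
          have "?iv i \<subseteq> {fst P..snd P}" if "i \<in> F2" "g i = P" for i
            using g(2)[OF that(1)] greaterThanLessThan_subseteq_atLeastAtMost_iff that(2)
            unfolding ivs by (metis greaterThanLessThan_subseteq_atLeastAtMost_iff order_refl subset_trans)
          then show ?thesis by blast
        qed
        have d1: "{{fst P..snd P}} division_of {fst P..snd P}"
          using F1'(1)[OF P] division_of_self[of "fst P" "snd P"] by (simp add: cbox_interval)
        have d2: "?iv ` {i\<in>F2. g i = P} division_of \<Union> (?iv ` {i\<in>F2. g i = P})"
          by (rule div2(1)) simp
        obtain r where "?iv ` {i\<in>F2. g i = P} \<subseteq> r" "r division_of {fst P..snd P}"
          by (rule partial_division_extend[OF d2 d1 sub])
        then show "\<exists>Q. ?iv ` {i\<in>F2. g i = P} \<subseteq> Q \<and> Q division_of {fst P..snd P}" by blast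
      qed
      from bchoice[OF this] obtain Q where
        Q0: "\<forall>P\<in>F1. ?iv ` {i\<in>F2. g i = P} \<subseteq> Q P \<and> Q P division_of {fst P..snd P}" ..
      have Q: "?iv ` {i\<in>F2. g i = P} \<subseteq> Q P" "Q P division_of {fst P..snd P}" if "P \<in> F1" for P
        using Q0[rule_format, OF that] by simp_all
      define QQ where "QQ = (\<Union>P\<in>F1. Q P)"
      have Qsub: "k \<subseteq> {fst P..snd P}" "k \<noteq> {}" "\<exists>c d. k = cbox c d" if "k \<in> Q P" "P \<in> F1" for k P
        using division_ofD(2,3,4)[OF Q(2)[OF that(2)] that(1)] .
      have disj: "{fst P..snd P} \<inter> {fst P'..snd P'} = {}" if "P \<in> F1" "P' \<in> F1" "P \<noteq> P'" for P P'
        using dj1 that unfolding disjoint_family_on_def by (auto simp: ivs)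
      have QQ: "QQ division_of (\<Union>i\<in>F1. ?iv i)"
      proof (rule division_ofI)
        show "finite QQ" unfolding QQ_def using F1(1) Q(2) by blast
        show "K \<subseteq> (\<Union>i\<in>F1. ?iv i)" "K \<noteq> {}" "\<exists>a b. K = cbox a b" if "K \<in> QQ" for K
          using that Qsub unfolding QQ_def ivs by blast+
        show "\<Union>QQ = (\<Union>i\<in>F1. ?iv i)"
          unfolding QQ_def ivs using division_ofD(6)[OF Q(2)] by blast
        show "interior K1 \<inter> interior K2 = {}" if K: "K1 \<in> QQ" "K2 \<in> QQ" "K1 \<noteq> K2" for K1 K2
        proof -
          obtain P1 P2 where P: "P1 \<in> F1" "K1 \<in> Q P1" "P2 \<in> F1" "K2 \<in> Q P2" using K unfolding QQ_def by blast
          show ?thesis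
          proof (cases "P1 = P2")
            case True
            then show ?thesis using division_ofD(5)[OF Q(2)[OF P(1)]] P K(3) by blast
          next
            case False
            then have "K1 \<inter> K2 = {}" using disj[of P1 P2] P Qsub(1)[of K1 P1] Qsub(1)[of K2 P2] by blast
            then show ?thesis by (metis interior_Int interior_empty)
          qed
        qed
      qed
      have sumQ: "(\<Sum>k\<in>QQ. \<phi> (Sup k) - \<phi> (Inf k)) = (\<Sum>P\<in>F1. \<phi> (snd P) - \<phi> (fst P))" for \<phi> :: "real \<Rightarrow> real"
      proof -
        have "(\<Sum>k\<in>QQ. \<phi> (Sup k) - \<phi> (Inf k)) = (\<Sum>P\<in>F1. \<Sum>k\<in>Q P. \<phi> (Sup k) - \<phi> (Inf k))"
          unfolding QQ_def
        proof (rule sum.UNION_disjoint[OF F1(1)])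
          show "\<forall>i\<in>F1. finite (Q i)" using Q(2) by blast
          show "\<forall>i\<in>F1. \<forall>j\<in>F1. i \<noteq> j \<longrightarrow> Q i \<inter> Q j = {}"
          proof (intro ballI impI equals0I)
            fix i j k assume ij: "i \<in> F1" "j \<in> F1" "i \<noteq> j" and k: "k \<in> Q i \<inter> Q j"
            then show False using disj[OF ij] Qsub(1,2)[of k i] Qsub(1)[of k j] by blast
          qed
        qed
        also have "\<dots> = (\<Sum>P\<in>F1. \<phi> (snd P) - \<phi> (fst P))"
          using F1'(1) by (intro sum.cong division_telescope Q(2)) (auto simp: less_imp_le)
        finally show ?thesis .
      qed
      define D2 where "D2 = ?iv ` F2"
      have D2: "D2 \<subseteq> QQ" unfolding D2_def QQ_def
      proof
        fix k assume "k \<in> ?iv ` F2"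
        then obtain i where i: "i \<in> F2" "k = ?iv i" by blast
        then have "k \<in> ?iv ` {j\<in>F2. g j = g i}" by blast
        moreover have "g i \<in> F1" using i by (simp add: F1_def)
        ultimately show "k \<in> (\<Union>P\<in>F1. Q P)" using Q(1)[of "g i"] by blast
      qed
      have fQ: "finite QQ" using QQ by blast
      have split: "sum \<phi> QQ = sum \<phi> D2 + sum \<phi> (QQ - D2)" for \<phi> :: "real set \<Rightarrow> real"
        using sum.subset_diff[OF D2 fQ, of \<phi>] by simp
      have sumD: "(\<Sum>k\<in>D2. \<phi> (Sup k) - \<phi> (Inf k)) = (\<Sum>i\<in>F2. \<phi> (snd i) - \<phi> (fst i))" for \<phi> :: "real \<Rightarrow> real"
        unfolding D2_def sum.reindex[OF div2(2)[OF subset_refl]]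
        by (intro sum.cong refl) (simp add: ivs less_imp_le[OF F2'(1)])
      \<comment> \<open>Length of the leftover pieces. It is small because the first family is
        shorter than \<open>s + \<epsilon>'\<close> and the second longer than
        \<open>s - \<epsilon>'\<close>.\<close>
      define \<rho> where "\<rho> = (\<Sum>k\<in>QQ - D2. Sup k - Inf k)"
      have R: "QQ - D2 division_of \<Union>(QQ - D2)"
      proof (rule division_of_subset)
        show "QQ division_of \<Union>QQ" using QQ division_ofD(6)[OF QQ] by simp
      qed blast
      have "\<rho> = (\<Sum>i\<in>F1. snd i - fst i) - \<sigma>"
        using split[of "\<lambda>k. Sup k - Inf k"] sumQ[of "\<lambda>x. x"] sumD[of "\<lambda>x. x"] by (simp add: \<rho>_def \<sigma>_def)
      then have \<rho>: "\<rho> \<le> 2 * \<epsilon>'" using U1 Us \<sigma> by linarith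
      have \<rho>0: "\<rho> \<ge> 0"
        unfolding \<rho>_def
      proof (rule sum_nonneg)
        fix k assume "k \<in> QQ - D2"
        then obtain P where "P \<in> F1" "k \<in> Q P" by (auto simp: QQ_def)
        then obtain c d where "k = cbox c d" "k \<noteq> {}" using Qsub(2,3) by blast
        then show "0 \<le> Sup k - Inf k" by (simp add: cbox_interval)
      qed
      have "\<Union>(QQ - D2) \<subseteq> {a..b}"
      proof -
        have "\<Union>QQ \<subseteq> U" unfolding division_ofD(6)[OF QQ] ivs using F1'(3) by blast
        moreover have "U \<subseteq> {a..b}" using U(3) by (rule order_trans) auto
        ultimately show ?thesis by blast
      qed
      then have "(\<Sum>k\<in>QQ - D2. norm (f (Sup k) - f (Inf k))) < \<epsilon>"
        using \<rho> \<epsilon>'(3) by (intro \<delta>(2)[OF R]) (auto simp: \<rho>_def)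
      then have "norm (\<Sum>k\<in>QQ - D2. f (Sup k) - f (Inf k)) < \<epsilon>"
        by (rule le_less_trans[OF norm_sum])
      then have "- \<epsilon> < (\<Sum>k\<in>QQ - D2. f (Sup k) - f (Inf k))" by simp
      moreover have "q * \<sigma> \<le> (\<Sum>k\<in>D2. f (Sup k) - f (Inf k))"
        unfolding sumD \<sigma>_def sum_distrib_left
      proof (rule sum_mono)
        fix i assume "i \<in> F2"
        from F2'[OF this] show "q * (snd i - fst i) \<le> f (snd i) - f (fst i)"
          by (simp add: slope_def less_divide_eq)
      qed
      moreover have "(\<Sum>k\<in>QQ. f (Sup k) - f (Inf k)) \<le> p * (\<sigma> + \<rho>)"
      proof -
        have "\<sigma> + \<rho> = (\<Sum>i\<in>F1. snd i - fst i)"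
          using split[of "\<lambda>k. Sup k - Inf k"] sumQ[of "\<lambda>x. x"] sumD[of "\<lambda>x. x"] by (simp add: \<rho>_def \<sigma>_def)
        show ?thesis
          unfolding sumQ \<open>\<sigma> + \<rho> = _\<close> sum_distrib_left
        proof (intro sum_mono)
          fix i assume "i \<in> F1"
          from F1'[OF this] show "f (snd i) - f (fst i) \<le> p * (snd i - fst i)"
            by (simp add: slope_def divide_less_eq)
        qed
      qed
      ultimately have "q * \<sigma> - \<epsilon> \<le> p * (\<sigma> + \<rho>)"
        using split[of "\<lambda>k. f (Sup k) - f (Inf k)"] by linarith
      moreover have "p * \<rho> \<le> \<bar>p\<bar> * (2 * \<epsilon>)"
        using \<rho> \<rho>0 \<epsilon>'(2) by (intro mult_mono) auto
      moreover have "(q - p) * (s - \<epsilon>) \<le> (q - p) * \<sigma>"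
        using \<sigma> \<epsilon>'(2) \<open>p < q\<close> by (intro mult_left_mono) auto
      ultimately show ?thesis by (simp add: algebra_simps)
    qed
  qed
  have "s \<le> 0"
  proof (rule ccontr)
    assume "\<not> s \<le> 0"
    define c where "c = 1 + 2 * \<bar>p\<bar> + (q - p)"
    have c: "c > 0" using \<open>p < q\<close> by (simp add: c_def)
    have pos: "(q - p) * s > 0" using \<open>\<not> s \<le> 0\<close> \<open>p < q\<close> by simp
    have "(q - p) * s \<le> c * ((q - p) * s / (2 * c))"
      using key[of "(q - p) * s / (2 * c)"] c pos by (simp add: c_def)
    moreover have "c * ((q - p) * s / (2 * c)) = (q - p) * s / 2" using c by simp
    ultimately show False using pos by linarith
  qed
  then have "measure lebesgue E = 0" unfolding s_def by (simp add: measure_le_0_iff)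
  then show ?thesis using E unfolding E_def[symmetric] negligible_iff_measure by blast
qed

text \<open>On an interval shorter than the \<open>\<delta>\<close> that guarantees variation below
  one, disjoint intervals of slope larger than M in modulus have total length below 1/M. A Vitali
  cover by such intervals bounds the outer measure by any given number; countably many short
  intervals cover the general case.\<close>

lemma negligible_unbounded_slope:
  fixes f :: "real \<Rightarrow> real"
  assumes ac: "abs_continuous_on {a..b} f"
  shows "negligible {x\<in>{a<..<b}. \<forall>n. \<exists>y\<in>{a<..<b}. x \<noteq> y \<and> \<bar>y - x\<bar> < 1 / real (Suc n) \<and> real n < \<bar>slope f x y\<bar>}"
    (is "negligible ?E")
proof -
  let ?iv = "\<lambda>(u, v). {u..v::real}"
  obtain \<delta> where \<delta>: "\<delta> > 0" "\<And>D S. D division_of S \<Longrightarrow> S \<subseteq> {a..b} \<Longrightarrow> (\<Sum>k\<in>D. Sup k - Inf k) < \<delta>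
        \<Longrightarrow> (\<Sum>k\<in>D. norm (f (Sup k) - f (Inf k))) < 1"
    using abs_continuous_onD[OF ac zero_less_one] by blast
  have loc: "negligible (?E \<inter> {c<..<d})" if cd: "{c<..<d} \<subseteq> {a<..<b}" "d - c < \<delta>" for c d
    unfolding negligible_outer_le
  proof (intro allI impI)
    fix e :: real assume "e > 0"
    obtain M :: nat where M: "1 / real (Suc M) < e" using nat_approx_posE[OF \<open>e > 0\<close>] by blast
    define K where "K = {(u, v). u < v \<and> {u..v} \<subseteq> {c<..<d} \<and> real (Suc M) < \<bar>slope f u v\<bar>}"
    obtain C where C: "countable C" "C \<subseteq> K" "disjoint_family_on ?iv C"
      "negligible (?E \<inter> {c<..<d} - (\<Union>i\<in>C. ?iv i))"
    proof (rule Vitali_intervals[of K "?E \<inter> {c<..<d}"])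
      show "u < v" if "(u, v) \<in> K" for u v using that by (simp add: K_def)
      show "\<exists>u v. (u, v) \<in> K \<and> x \<in> {u..v} \<and> v - u < t" if x: "x \<in> ?E \<inter> {c<..<d}" and "0 < t" for x t
      proof -
        obtain r where r: "r > 0" "ball x r \<subseteq> {c<..<d}"
          using x open_contains_ball[of "{c<..<d}"] open_greaterThanLessThan by blast
        obtain n where n: "1 / real (Suc n) < min t r"
          using nat_approx_posE[of "min t r"] r \<open>0 < t\<close> by auto
        \<comment> \<open>Large enough for two purposes: the interval fits into the window and is
          short, and the slope exceeds \<open>Suc M\<close>.\<close>
        define N where "N = max n (Suc M)"
        have N: "1 / real (Suc N) < min t r"
        proof -
          have "1 / real (Suc N) \<le> 1 / real (Suc n)" by (simp add: N_def frac_le)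
          then show ?thesis using n by linarith
        qed
        obtain y where y: "x \<noteq> y" "\<bar>y - x\<bar> < 1 / real (Suc N)" "real N < \<bar>slope f x y\<bar>"
          using x by blast
        have "ball x (1 / real (Suc N)) \<subseteq> {c<..<d}"
          using r(2) N subset_ball[of "1 / real (Suc N)" r x] by auto
        from slope_interval[OF y(1)[symmetric] y(2) this, of f] obtain u v where
          uv: "u < v" "{u..v} \<subseteq> {c<..<d}" "x \<in> {u..v}" "v - u < 1 / real (Suc N)" "slope f x y = slope f u v"
          by metis
        moreover have "real (Suc M) < \<bar>slope f u v\<bar>" using y(3) uv(5) by (simp add: N_def)
        ultimately show ?thesis using N by (intro exI[of _ u] exI[of _ v]) (auto simp: K_def)
      qed
    qed blast
    have KC: "fst i < snd i" "{fst i..snd i} \<subseteq> {c<..<d}" "real (Suc M) < \<bar>slope f (fst i) (snd i)\<bar>" if "i \<in> C"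
      for i
    proof -
      have "i \<in> K" using that C(2) by blast
      then show "fst i < snd i" "{fst i..snd i} \<subseteq> {c<..<d}" "real (Suc M) < \<bar>slope f (fst i) (snd i)\<bar>"
        unfolding K_def case_prod_beta mem_Collect_eq by blast+
    qed
    have ivs: "?iv i = {fst i..snd i}" for i by (cases i) auto
    define B where "B = (\<Union>i\<in>C. ?iv i)"
    have Bs: "B \<in> sets lebesgue" unfolding B_def using C(1) by (intro sets.countable_UN') auto
    have "emeasure lebesgue B \<le> ennreal e"
    proof (rule ccontr)
      assume "\<not> ?thesis"
      then have "ennreal e < emeasure lebesgue (\<Union>i\<in>C. ?iv i)" by (simp add: B_def)
      then obtain F where F: "finite F" "F \<subseteq> C" "ennreal e < emeasure lebesgue (\<Union>i\<in>F. ?iv i)"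
        by (rule finite_subfamily_emeasure_gt[rotated 2]) (use C(1) in auto)
      have dj: "disjoint_family_on ?iv F" using C(3) F(2) disjoint_family_on_mono by blast
      have lt: "u < v" if "(u, v) \<in> F" for u v using KC(1)[of "(u, v)"] that F(2) by auto
      note div = division_of_intervals[OF F(1) dj lt] and ms = measure_Union_intervals[OF F(1) dj lt]
      have "e < measure lebesgue (\<Union>i\<in>F. ?iv i)"
        using F(3) ms(1) \<open>e > 0\<close> by (simp add: emeasure_eq_measure2 ennreal_less_iff)
      then have len: "e < (\<Sum>i\<in>F. snd i - fst i)" using ms(2) by (simp add: case_prod_beta)
      have sub: "(\<Union>i\<in>F. ?iv i) \<subseteq> {c<..<d}" unfolding ivs using KC(2) F(2) by blast
      have cd': "c \<le> d"
      proof (rule ccontr)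
        assume "\<not> c \<le> d"
        then have "(\<Union>i\<in>F. ?iv i) = {}" using sub by auto
        then show False using F(3) by simp
      qed
      have "measure lebesgue (\<Union>i\<in>F. ?iv i) \<le> measure lebesgue {c<..<d}"
        using sub ms(1) by (intro measure_mono_fmeasurable) auto
      then have "(\<Sum>i\<in>F. snd i - fst i) \<le> d - c" using cd' ms(2) by (simp add: case_prod_beta)
      moreover have "sum \<phi> (?iv ` F) = (\<Sum>i\<in>F. \<phi> {fst i..snd i})" for \<phi> :: "real set \<Rightarrow> real"
      proof -
        have "sum \<phi> (?iv ` F) = sum (\<phi> \<circ> ?iv) F" by (rule sum.reindex[OF div(2)])
        also have "\<dots> = (\<Sum>i\<in>F. \<phi> {fst i..snd i})"
          by (intro sum.cong refl) (simp only: comp_apply ivs)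
        finally show ?thesis .
      qed
      moreover have "(\<Union>i\<in>F. ?iv i) \<subseteq> {a..b}"
        using sub cd(1) greaterThanLessThan_subseteq_atLeastAtMost_iff[of a b a b] by auto
      moreover have le: "fst i \<le> snd i" if "i \<in> F" for i using KC(1)[of i] that F(2) by auto
      ultimately have "(\<Sum>i\<in>F. norm (f (snd i) - f (fst i))) < 1"
        using \<delta>(2)[OF div(1)] cd(2) by simp
      moreover have "(\<Sum>i\<in>F. real (Suc M) * (snd i - fst i)) \<le> (\<Sum>i\<in>F. norm (f (snd i) - f (fst i)))"
      proof (rule sum_mono)
        fix i assume "i \<in> F"
        then have "fst i < snd i" "real (Suc M) < \<bar>slope f (fst i) (snd i)\<bar>" using KC F(2) by blast+
        then show "real (Suc M) * (snd i - fst i) \<le> norm (f (snd i) - f (fst i))"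
          by (simp add: slope_def less_divide_eq abs_divide)
      qed
      ultimately have "real (Suc M) * (\<Sum>i\<in>F. snd i - fst i) < 1"
        by (simp add: sum_distrib_left)
      moreover have "real (Suc M) * e < real (Suc M) * (\<Sum>i\<in>F. snd i - fst i)"
        using len by (intro mult_strict_left_mono) auto
      moreover have "1 < real (Suc M) * e" using M by (simp add: divide_less_eq mult.commute)
      ultimately show False by linarith
    qed
    note B = this
    have Bm: "B \<in> lmeasurable" using Bs le_less_trans[OF B ennreal_less_top] by (intro fmeasurableI) auto
    have Bm2: "measure lebesgue B \<le> e" using B Bm \<open>e > 0\<close> by (simp add: emeasure_eq_measure2)
    have neg: "negligible (?E \<inter> {c<..<d} - B)" using C(4) by (simp add: B_def)
    show "\<exists>T. ?E \<inter> {c<..<d} \<subseteq> T \<and> T \<in> lmeasurable \<and> measure lebesgue T \<le> e"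
    proof (intro exI conjI)
      show "?E \<inter> {c<..<d} \<subseteq> B \<union> (?E \<inter> {c<..<d} - B)" by blast
      show "B \<union> (?E \<inter> {c<..<d} - B) \<in> lmeasurable"
        by (rule fmeasurable.Un[OF Bm negligible_imp_measurable[OF neg]])
      have "measure lebesgue (B \<union> (?E \<inter> {c<..<d} - B)) \<le> measure lebesgue B +
        measure lebesgue (?E \<inter> {c<..<d} - B)"
        using Bm neg by (intro measure_Un_le) (auto simp: negligible_imp_sets)
      then show "measure lebesgue (B \<union> (?E \<inter> {c<..<d} - B)) \<le> e"
        using Bm2 negligible_imp_measure0[OF neg] by simp
    qed
  qed
  define \<eta> where "\<eta> = \<delta> / 2"
  have \<eta>: "\<eta> > 0" "\<eta> < \<delta>" using \<delta>(1) by (auto simp: \<eta>_def)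
  \<comment> \<open>Windows of length \<open>\<eta>\<close> advance by half their length: being
    open, they have to overlap in order to cover every point.\<close>
  define I where "I k = {max a (of_int k * (\<eta> / 2)) <..< min b (of_int k * (\<eta> / 2) + \<eta>)}" for k :: int
  have "negligible (?E \<inter> I k)" for k unfolding I_def using \<eta> by (intro loc) auto
  then have "negligible (\<Union>k\<in>UNIV. ?E \<inter> I k)" by (intro negligible_countable_Union) auto
  moreover have "?E \<subseteq> (\<Union>k\<in>UNIV. ?E \<inter> I k)"
  proof
    fix x assume x: "x \<in> ?E"
    define k where "k = \<lceil>x / (\<eta> / 2)\<rceil> - 1"
    have "of_int k < x / (\<eta> / 2)" "x / (\<eta> / 2) \<le> of_int k + 1" unfolding k_def by linarith+
    then have "of_int k * (\<eta> / 2) < x" "x \<le> of_int k * (\<eta> / 2) + \<eta> / 2"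
      using \<eta> by (simp_all add: field_simps)
    then have "x \<in> I k" using x \<eta> by (auto simp: I_def)
    then show "x \<in> (\<Union>k\<in>UNIV. ?E \<inter> I k)" using x by blast
  qed
  ultimately show ?thesis by (rule negligible_subset)
qed

text \<open>Off the exceptional sets the difference quotients are bounded near the point, and a gap
  between their lower and upper limit would contain rationals \<open>p < q\<close> placing the point
  in an oscillation set. Hence they converge to a finite limit.\<close>

theorem abs_continuous_on_differentiable_AE:
  fixes f :: "real \<Rightarrow> real"
  assumes ac: "abs_continuous_on {a..b} f"
  shows "negligible {x\<in>{a<..<b}. \<not> f differentiable (at x)}"
proof -
  define W where "W \<equiv> \<lambda>P n. {x\<in>{a<..<b}. \<exists>y\<in>{a<..<b}. x \<noteq> y \<and> \<bar>y - x\<bar> < 1 / real (Suc n) \<and> slope f x y \<in> P}"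
  define G where "G = {x\<in>{a<..<b}. \<forall>n. \<exists>y\<in>{a<..<b}. x \<noteq> y \<and> \<bar>y - x\<bar> < 1 / real (Suc n) \<and>
    real n < \<bar>slope f x y\<bar>}"
  let ?R = "{(p, q). p < (q::rat)}"
  let ?O = "\<lambda>(p, q). (\<Inter>n. W {..<real_of_rat p} n) \<inter> (\<Inter>n. W {real_of_rat q<..} n)"
  have "negligible (\<Union>(?O ` ?R) \<union> G)"
  proof (intro negligible_Un negligible_countable_Union)
    show "countable (?O ` ?R)" by (intro countable_image) auto
    show "negligible S" if "S \<in> ?O ` ?R" for S
    proof -
      obtain p q where "p < q" "S = ?O (p, q)" using \<open>S \<in> _\<close> by auto
      then show ?thesis
        using negligible_slope_oscillation[OF ac, of "real_of_rat p" "real_of_rat q"]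
        by (simp add: W_def of_rat_less)
    qed
    show "negligible G" unfolding G_def by (rule negligible_unbounded_slope[OF ac])
  qed
  moreover have "{x\<in>{a<..<b}. \<not> f differentiable (at x)} \<subseteq> \<Union>(?O ` ?R) \<union> G"
  proof (rule subsetI, rule ccontr)
    fix x assume x: "x \<in> {x\<in>{a<..<b}. \<not> f differentiable (at x)}" and nx: "x \<notin> \<Union>(?O ` ?R) \<union> G"
    have xab: "x \<in> {a<..<b}" using x by blast
    have freq: "x \<in> (\<Inter>n. W P n)" if fr: "frequently (\<lambda>y. slope f x y \<in> P) (at x)" for P
    proof
      fix n
      have "eventually (\<lambda>y. y \<in> {a<..<b} \<and> y \<noteq> x \<and> \<bar>y - x\<bar> < 1 / real (Suc n)) (at x)"
      proof (intro eventually_conj)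
        show "eventually (\<lambda>y. y \<in> {a<..<b}) (at x)"
          using xab by (intro eventually_at_in_open') auto
        show "eventually (\<lambda>y. y \<noteq> x) (at x)" by (simp add: eventually_at_filter)
        show "eventually (\<lambda>y. \<bar>y - x\<bar> < 1 / real (Suc n)) (at x)"
          unfolding eventually_at by (intro exI[of _ "1 / real (Suc n)"]) (auto simp: dist_real_def)
      qed
      note ev = this
      have "\<exists>y. (y \<in> {a<..<b} \<and> y \<noteq> x \<and> \<bar>y - x\<bar> < 1 / real (Suc n)) \<and> slope f x y \<in> P"
      proof (rule ccontr)
        assume "\<not> ?thesis"
        with ev have "eventually (\<lambda>y. slope f x y \<notin> P) (at x)" by (auto elim: eventually_mono)
        then show False using fr by (simp add: frequently_def)
      qed
      then obtain y where "y \<in> {a<..<b}" "y \<noteq> x" "\<bar>y - x\<bar> < 1 / real (Suc n)" "slope f x y \<in> P" by blast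
      then show "x \<in> W P n" using xab unfolding W_def by (intro CollectI conjI bexI[of _ y]) auto
    qed
    let ?s = "\<lambda>y. ereal (slope f x y)"
    obtain n where n: "\<And>y. y \<in> {a<..<b} \<Longrightarrow> x \<noteq> y \<Longrightarrow> \<bar>y - x\<bar> < 1 / real (Suc n) \<Longrightarrow> \<bar>slope f x y\<bar> \<le> real n"
    proof -
      have "\<not> (\<forall>n. \<exists>y\<in>{a<..<b}. x \<noteq> y \<and> \<bar>y - x\<bar> < 1 / real (Suc n) \<and> real n < \<bar>slope f x y\<bar>)"
        using nx xab unfolding G_def by blast
      then obtain n where "\<not> (\<exists>y\<in>{a<..<b}. x \<noteq> y \<and> \<bar>y - x\<bar> < 1 / real (Suc n) \<and> real n < \<bar>slope f x y\<bar>)"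
        by blast
      then show thesis by (intro that[of n]) (meson not_less)
    qed
    have bnd: "eventually (\<lambda>y. \<bar>slope f x y\<bar> \<le> real n) (at x)"
    proof -
      have "eventually (\<lambda>y. y \<in> {a<..<b} \<and> y \<noteq> x \<and> \<bar>y - x\<bar> < 1 / real (Suc n)) (at x)"
      proof (intro eventually_conj)
        show "eventually (\<lambda>y. y \<in> {a<..<b}) (at x)"
          using xab by (intro eventually_at_in_open') auto
        show "eventually (\<lambda>y. y \<noteq> x) (at x)" by (simp add: eventually_at_filter)
        show "eventually (\<lambda>y. \<bar>y - x\<bar> < 1 / real (Suc n)) (at x)"
          unfolding eventually_at by (intro exI[of _ "1 / real (Suc n)"]) (auto simp: dist_real_def)
      qed
      then show ?thesis by (rule eventually_mono) (use n in auto)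
    qed
    have "Limsup (at x) ?s \<le> Liminf (at x) ?s"
    proof (rule ccontr)
      assume "\<not> ?thesis"
      then have "Liminf (at x) ?s < Limsup (at x) ?s" by simp
      then obtain p where p: "Liminf (at x) ?s < ereal (real_of_rat p)"
        "ereal (real_of_rat p) < Limsup (at x) ?s"
        using ereal_dense3 by blast
      obtain q where q: "ereal (real_of_rat p) < ereal (real_of_rat q)"
        "ereal (real_of_rat q) < Limsup (at x) ?s"
        using ereal_dense3[OF p(2)] by blast
      have "frequently (\<lambda>y. slope f x y \<in> {..<real_of_rat p}) (at x)"
        unfolding frequently_def
      proof
        assume "eventually (\<lambda>y. \<not> slope f x y \<in> {..<real_of_rat p}) (at x)"
        then have "eventually (\<lambda>y. ereal (real_of_rat p) \<le> ?s y) (at x)" by (rule eventually_mono) auto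
        then have "ereal (real_of_rat p) \<le> Liminf (at x) ?s" by (rule Liminf_bounded)
        then show False using p(1) by simp
      qed
      moreover have "frequently (\<lambda>y. slope f x y \<in> {real_of_rat q<..}) (at x)"
        unfolding frequently_def
      proof
        assume "eventually (\<lambda>y. \<not> slope f x y \<in> {real_of_rat q<..}) (at x)"
        then have "eventually (\<lambda>y. ?s y \<le> ereal (real_of_rat q)) (at x)" by (rule eventually_mono) auto
        then have "Limsup (at x) ?s \<le> ereal (real_of_rat q)" by (rule Limsup_bounded)
        then show False using q(2) by simp
      qed
      ultimately have "x \<in> ?O (p, q)" using freq by auto
      moreover have "(p, q) \<in> ?R" using q(1) by (simp add: of_rat_less)
      ultimately show False using nx by blast
    qed
    moreover have nt: "\<not> trivial_limit (at x)" by simp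
    ultimately have eq: "Liminf (at x) ?s = Limsup (at x) ?s" using Liminf_le_Limsup[OF nt] by (intro antisym)
    have "ereal (- real n) \<le> Liminf (at x) ?s"
      using bnd by (intro Liminf_bounded) (auto elim: eventually_mono)
    moreover have "Limsup (at x) ?s \<le> ereal (real n)"
      using bnd by (intro Limsup_bounded) (auto elim: eventually_mono)
    ultimately obtain c where "Limsup (at x) ?s = ereal c"
      unfolding eq by (cases "Limsup (at x) ?s") auto
    then have "(?s \<longlongrightarrow> ereal c) (at x)" using eq by (intro Liminf_eq_Limsup[OF nt]) auto
    then have "((\<lambda>y. (f y - f x) / (y - x)) \<longlongrightarrow> c) (at x)" by (simp add: slope_def)
    then have "(f has_field_derivative c) (at x)" by (simp add: has_field_derivative_iff)
    then show False using x real_differentiable_def by auto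
  qed
  ultimately show ?thesis by (rule negligible_subset)
qed

section \<open>Fundamental theorem of calculus for vector-valued absolutely continuous
  functions\<close>

lemma abs_continuous_on_inner:
  fixes f :: "real \<Rightarrow> 'a::euclidean_space"
  assumes "abs_continuous_on I f" "i \<in> Basis"
  shows "abs_continuous_on I (\<lambda>x. f x \<bullet> i)"
  unfolding abs_continuous_on_def
proof (intro allI impI)
  fix e :: real assume "e > 0"
  obtain \<delta> where \<delta>: "\<delta> > 0" "\<And>D S. D division_of S \<Longrightarrow> S \<subseteq> I \<Longrightarrow> (\<Sum>k\<in>D. Sup k - Inf k) < \<delta>
        \<Longrightarrow> (\<Sum>k\<in>D. norm (f (Sup k) - f (Inf k))) < e"
    using abs_continuous_onD[OF assms(1) \<open>e > 0\<close>] by blast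
  show "\<exists>\<delta>>0. \<forall>D S. D division_of S \<and> S \<subseteq> I \<and> (\<Sum>k\<in>D. Sup k - Inf k) < \<delta>
        \<longrightarrow> (\<Sum>k\<in>D. norm (f (Sup k) \<bullet> i - f (Inf k) \<bullet> i)) < e"
  proof (intro exI conjI allI impI; (elim conjE)?)
    fix D S assume D: "D division_of S" "S \<subseteq> I" "(\<Sum>k\<in>D. Sup k - Inf k) < \<delta>"
    have "(\<Sum>k\<in>D. norm (f (Sup k) \<bullet> i - f (Inf k) \<bullet> i)) \<le> (\<Sum>k\<in>D. norm (f (Sup k) - f (Inf k)))"
    proof (rule sum_mono)
      fix k
      show "norm (f (Sup k) \<bullet> i - f (Inf k) \<bullet> i) \<le> norm (f (Sup k) - f (Inf k))"
        using Basis_le_norm[OF assms(2), of "f (Sup k) - f (Inf k)"] by (simp add: inner_diff_left)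
    qed
    also have "\<dots> < e" by (rule \<delta>(2)[OF D])
    finally show "(\<Sum>k\<in>D. norm (f (Sup k) \<bullet> i - f (Inf k) \<bullet> i)) < e" .
  qed (rule \<delta>(1))
qed

lemma negligible_not_differentiable:
  fixes f :: "real \<Rightarrow> 'a::euclidean_space"
  assumes "abs_continuous_on {a..b} f"
  shows "negligible {x\<in>{a<..<b}. \<not> f differentiable (at x)}"
proof (rule negligible_subset)
  show "negligible (\<Union>i\<in>Basis. {x\<in>{a<..<b}. \<not> (\<lambda>x. f x \<bullet> (i::'a)) differentiable (at x)})"
  proof (intro negligible_Union finite_imageI finite_Basis)
    fix S assume "S \<in> (\<lambda>i. {x\<in>{a<..<b}. \<not> (\<lambda>x. f x \<bullet> (i::'a)) differentiable (at x)}) ` Basis"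
    then obtain i :: 'a where "i \<in> Basis" "S = {x\<in>{a<..<b}. \<not> (\<lambda>x. f x \<bullet> i) differentiable (at x)}" by blast
    then show "negligible S"
      using abs_continuous_on_differentiable_AE[OF abs_continuous_on_inner[OF assms]] by simp
  qed
  show "{x\<in>{a<..<b}. \<not> f differentiable (at x)} \<subseteq> (\<Union>i\<in>Basis. {x\<in>{a<..<b}. \<not> (\<lambda>x.
    f x \<bullet> (i::'a)) differentiable (at x)})"
    using differentiable_componentwise_within[of f _ UNIV] by auto
qed

text \<open>Both sides are the integral of the constant 1 over \<open>S\<close>, which is additive
  over the pieces of a division.\<close>

lemma sum_lengths_division:
  fixes D :: "real set set"
  assumes "D division_of S"
  shows "S \<in> lmeasurable" "(\<Sum>k\<in>D. Sup k - Inf k) = measure lebesgue S"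
proof -
  have fin: "finite D" using assms by blast
  have k: "k \<in> lmeasurable \<and> Sup k - Inf k = measure lebesgue k" if k: "k \<in> D" for k
  proof -
    obtain c d where "k = cbox c d" "k \<noteq> {}"
      using assms k by (metis division_ofD(3,4))
    then show ?thesis by (simp add: cbox_interval)
  qed
  have S: "S = \<Union>D" using division_ofD(6)[OF assms] by simp
  show lm: "S \<in> lmeasurable" unfolding S using k fin by (intro fmeasurable.finite_Union) auto
  have int: "((\<lambda>x. 1::real) has_integral measure lebesgue A) A" if "A \<in> lmeasurable" for A :: "real set"
  proof -
    have "(\<lambda>x. 1::real) integrable_on A" by (rule lmeasurable_iff_integrable_on[THEN iffD1, OF that])
    then show ?thesis unfolding lmeasure_integral[OF that] by (rule integrable_integral)
  qed
  have "((\<lambda>x. 1::real) has_integral (\<Sum>k\<in>D. measure lebesgue k)) S"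
    by (rule has_integral_combine_division[OF assms]) (use k int in simp)
  with int[OF lm] have "(\<Sum>k\<in>D. measure lebesgue k) = measure lebesgue S"
    by (rule has_integral_unique[symmetric])
  then show "(\<Sum>k\<in>D. Sup k - Inf k) = measure lebesgue S" using k by simp
qed

text \<open>Proved with a gauge for the Henstock-Kurzweil integral, so that integrability of the
  velocity is part of the conclusion. At tags where \<open>f\<close> is differentiable, first-order
  approximation costs \<open>e'\<close> times the length of the piece. Pieces tagged in the null set
  \<open>N\<close> lie in an open set of small measure, and absolute continuity makes the increments
  over them small.\<close>

theorem abs_continuous_on_has_integral_velocity:
  fixes f :: "real \<Rightarrow> 'a::euclidean_space"
  assumes ac: "abs_continuous_on {a..b} f" and "a \<le> b"
  shows "(velocity f has_integral (f b - f a)) {a..b}"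
proof -
  \<comment> \<open>The endpoints are included because \<open>velocity\<close> is a two-sided
    derivative, about which nothing is known there.\<close>
  define N where "N = {x\<in>{a<..<b}. \<not> f differentiable (at x)} \<union> {a, b}"
  have N: "negligible N" unfolding N_def
    by (intro negligible_Un negligible_not_differentiable[OF ac]) auto
  define g where "g x = (if x \<in> N then 0 else velocity f x)" for x
  have "(g has_integral (f b - f a)) {a..b}"
    unfolding has_integral_real
  proof (intro allI impI)
    fix e :: real assume "e > 0"
    define e' where "e' = e / (2 * (b - a + 1))"
    have e': "e' > 0" "e' * (b - a) < e / 2"
    proof -
      show "e' > 0" using \<open>e > 0\<close> \<open>a \<le> b\<close> by (simp add: e'_def)
      have "e' * (b - a) = e / 2 * ((b - a) / (b - a + 1))" by (simp add: e'_def)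
      also have "\<dots> < e / 2 * 1" using \<open>e > 0\<close> \<open>a \<le> b\<close> by (intro mult_strict_left_mono) auto
      finally show "e' * (b - a) < e / 2" by simp
    qed
    obtain \<delta> where \<delta>: "\<delta> > 0" "\<And>D S. D division_of S \<Longrightarrow> S \<subseteq> {a..b} \<Longrightarrow> (\<Sum>k\<in>D. Sup k - Inf k) < \<delta>
        \<Longrightarrow> (\<Sum>k\<in>D. norm (f (Sup k) - f (Inf k))) < e / 2"
      using abs_continuous_onD[OF ac, of "e / 2"] \<open>e > 0\<close> by auto
    obtain T where T: "open T" "N \<subseteq> T" "T - N \<in> lmeasurable" "emeasure lebesgue (T - N) < ennreal \<delta>"
      using sets_lebesgue_outer_open[OF negligible_imp_sets[OF N] \<delta>(1)] by blast
    have "T = (T - N) \<union> N" using T(2) by blast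
    then have "emeasure lebesgue T = emeasure lebesgue ((T - N) \<union> N)" by simp
    also have "\<dots> = emeasure lebesgue (T - N)"
      using T(3) N by (intro emeasure_Un_null_set) (auto simp: negligible_iff_null_sets)
    finally have Tm: "emeasure lebesgue T < ennreal \<delta>" using T(4) by simp
    then have Tl: "T \<in> lmeasurable" using T(1)
      by (intro fmeasurableI) (auto intro: less_trans[OF _ ennreal_less_top])
    have Tm: "measure lebesgue T < \<delta>" using Tm Tl \<delta>(1) by (simp add: emeasure_eq_measure2 ennreal_less_iff)
    have "\<exists>d>0. (x \<in> N \<longrightarrow> ball x d \<subseteq> T) \<and>
       (x \<in> {a..b} - N \<longrightarrow> (\<forall>y. \<bar>y - x\<bar> < d \<longrightarrow> norm (f y - f x - (y - x) *\<^sub>R velocity f x) \<le> e' * \<bar>y - x\<bar>))" for x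
    proof (cases "x \<in> N")
      case True
      then show ?thesis using T(1,2) open_contains_ball by blast
    next
      case False
      show ?thesis
      proof (cases "x \<in> {a..b}")
        case True
        with False have "f differentiable (at x)" unfolding N_def by fastforce
        then have "(f has_derivative (\<lambda>h. h *\<^sub>R velocity f x)) (at x)"
          using vector_derivative_works has_vector_derivative_def by blast
        then obtain d where "d > 0" "\<forall>y. norm (y - x) < d \<longrightarrow>
          norm (f y - f x - (y - x) *\<^sub>R velocity f x) \<le> e' * norm (y - x)"
          using e'(1) unfolding has_derivative_at_alt by blast
        then show ?thesis using False by auto
      qed (use False in \<open>auto intro: exI[of _ 1]\<close>)
    qed
    then obtain d where d: "\<And>x. d x > 0" "\<And>x. x \<in> N \<Longrightarrow> ball x (d x) \<subseteq> T"
      "\<And>x y. x \<in> {a..b} - N \<Longrightarrow> \<bar>y - x\<bar> < d x \<Longrightarrow> norm (f y - f x - (y - x) *\<^sub>R velocity f x) \<le> e' * \<bar>y - x\<bar>"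
      by metis
    show "\<exists>\<gamma>. gauge \<gamma> \<and> (\<forall>p. p tagged_division_of {a..b} \<and> \<gamma> fine p \<longrightarrow>
        norm ((\<Sum>(x, k)\<in>p. measure lborel k *\<^sub>R g x) - (f b - f a)) < e)"
    proof (intro exI[of _ "\<lambda>x. ball x (d x)"] conjI allI impI; (elim conjE)?)
      show "gauge (\<lambda>x. ball x (d x))" using d(1) by (simp add: gauge_def)
      fix p assume p: "p tagged_division_of {a..b}" and fine: "(\<lambda>x. ball x (d x)) fine p"
      have fin: "finite p" using p by blast
      have int: "\<exists>u v. k = {u..v} \<and> u \<le> x \<and> x \<le> v \<and> x \<in> {a..b} \<and> {u..v} \<subseteq> ball x (d x)" if xk: "(x, k) \<in> p"
        for x k
      proof -
        have "x \<in> k" "k \<subseteq> {a..b}" using tagged_division_ofD(2,3)[OF p xk] by auto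
        moreover obtain u v where "k = cbox u v" using tagged_division_ofD(4)[OF p xk] by blast
        moreover have "k \<subseteq> ball x (d x)" using fine xk by (auto simp: fine_def)
        ultimately show ?thesis by (auto simp: cbox_interval)
      qed
      define F where "F k = f (Sup k) - f (Inf k)" for k
      have "(\<Sum>(x, k)\<in>p. measure lborel k *\<^sub>R g x) - (f b - f a) = (\<Sum>(x, k)\<in>p.
        measure lborel k *\<^sub>R g x) - (\<Sum>(x, k)\<in>p. F k)"
        using additive_tagged_division_1[OF \<open>a \<le> b\<close> p, of f] by (simp add: F_def)
      also have "\<dots> = (\<Sum>(x, k)\<in>p. measure lborel k *\<^sub>R g x - F k)"
        by (simp add: sum_subtractf case_prod_beta)
      finally have "norm ((\<Sum>(x, k)\<in>p. measure lborel k *\<^sub>R g x) - (f b - f a)) \<le> (\<Sum>(x, k)\<in>p.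
        norm (measure lborel k *\<^sub>R g x - F k))"
        by (simp add: case_prod_beta sum_norm_le)
      also have "(\<Sum>(x, k)\<in>p. norm (measure lborel k *\<^sub>R g x - F k)) = (\<Sum>(x, k)\<in>p.
        if x \<in> N then norm (F k) else 0) + (\<Sum>(x, k)\<in>p.
        if x \<in> N then 0 else norm (measure lborel k *\<^sub>R g x - F k))"
        unfolding sum.distrib[symmetric] by (intro sum.cong) (auto simp: g_def)
      finally have A: "norm ((\<Sum>(x, k)\<in>p. measure lborel k *\<^sub>R g x) - (f b - f a)) \<le> \<dots>" .
      have B: "(\<Sum>(x, k)\<in>p. if x \<in> N then 0 else norm (measure lborel k *\<^sub>R g x - F k)) \<le> (\<Sum>(x, k)\<in>p.
        e' * measure lborel k)"
      proof (rule sum_mono)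
        fix i assume ip: "i \<in> p"
        obtain x k where i: "i = (x, k)" by (cases i)
        show "(case i of (x, k) \<Rightarrow> if x \<in> N then 0 else norm (measure lborel k *\<^sub>R g x - F k)) \<le>
          (case i of (x, k) \<Rightarrow> e' * measure lborel k)"
        proof (cases "x \<in> N")
          case True
          then show ?thesis using e'(1) by (simp add: i)
        next
          case False
        obtain u v where k: "k = {u..v}" "u \<le> x" "x \<le> v" "x \<in> {a..b}" "{u..v} \<subseteq> ball x (d x)"
          using int[of x k] ip i by blast
        with False have x: "x \<in> {a..b} - N" by blast
        have "u \<in> {u..v}" "v \<in> {u..v}" using k(2,3) by auto
        then have "u \<in> ball x (d x)" "v \<in> ball x (d x)" using k(5) by blast+
        then have "\<bar>u - x\<bar> < d x" "\<bar>v - x\<bar> < d x" by (simp_all add: dist_real_def abs_minus_commute)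
        from d(3)[OF x this(1)] d(3)[OF x this(2)] have
          uv: "norm (f u - f x - (u - x) *\<^sub>R velocity f x) + norm (f v - f x - (v - x) *\<^sub>R velocity f x) \<le>
            e' * \<bar>u - x\<bar> + e' * \<bar>v - x\<bar>"
          by (rule add_mono)
        have eq: "measure lborel k *\<^sub>R g x - F k =
          (f u - f x - (u - x) *\<^sub>R velocity f x) - (f v - f x - (v - x) *\<^sub>R velocity f x)"
          using k(1-3) False by (simp add: g_def F_def algebra_simps)
        have "norm (measure lborel k *\<^sub>R g x - F k) \<le> e' * \<bar>u - x\<bar> + e' * \<bar>v - x\<bar>"
          unfolding eq using norm_triangle_ineq4[of "f u - f x - (u - x) *\<^sub>R velocity f x"
            "f v - f x - (v - x) *\<^sub>R velocity f x"] uv by linarith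
        also have "\<dots> = e' * (\<bar>u - x\<bar> + \<bar>v - x\<bar>)" by (rule distrib_left[symmetric])
        also have "\<dots> = e' * measure lborel k" using k(1-3) by simp
        finally show ?thesis using False by (simp add: i)
        qed
      qed
      have Ce:  "(\<Sum>(x, k)\<in>p. e' * measure lborel k) = e' * (b - a)"
      proof -
        have "(\<Sum>(x, k)\<in>p. measure lborel k) = b - a"
          using additive_content_tagged_division[of p a b] p \<open>a \<le> b\<close> by (simp add: cbox_interval)
        moreover have "(\<Sum>(x, k)\<in>p. e' * measure lborel k) = e' * (\<Sum>(x, k)\<in>p. measure lborel k)"
          by (simp add: sum_distrib_left case_prod_beta)
        ultimately show ?thesis by simp
      qed
      have D: "(\<Sum>(x, k)\<in>p. if x \<in> N then norm (F k) else 0) < e / 2"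
      proof -
        define q where "q = {(x, k)\<in>p. x \<in> N}"
        have qp: "q \<subseteq> p" by (auto simp: q_def)
        have "q tagged_partial_division_of {a..b}"
          using p qp tagged_partial_division_subset tagged_division_of_def by blast
        note q = tagged_partial_division_of_Union_self[OF this] partial_division_of_tagged_division[OF this]
        have "(\<Sum>(x, k)\<in>p. if x \<in> N then norm (F k) else 0) = (\<Sum>(x, k)\<in>q. norm (F k))"
          unfolding q_def using fin by (intro sum.mono_neutral_cong_right) (auto split: if_splits)
        \<comment> \<open>Passing from tagged pieces to pieces merges repeated ones, which is
          harmless for a summand vanishing on intervals with empty interior. The value 0 at the
          empty set makes the summand such a function; on single points the increment vanishes
          anyway.\<close>
        also have "\<dots> = (\<Sum>(x, k)\<in>q. if k = {} then 0 else norm (F k))"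
          using qp int by (intro sum.cong) fastforce+
        also have "\<dots> = (\<Sum>k\<in>snd ` q. if k = {} then 0 else norm (F k))"
        proof (rule sum.over_tagged_division_lemma[OF q(1)])
          fix u v :: real assume "box u v = {}"
          then have "u \<ge> v" by (simp add: box_real)
          then show "(if cbox u v = {} then 0 else norm (F (cbox u v))) = 0"
            by (cases "u = v") (auto simp: F_def cbox_interval)
        qed
        also have "\<dots> = (\<Sum>k\<in>snd ` q. norm (F k))"
          using qp int by (intro sum.cong) fastforce+
        also have "\<dots> < e / 2"
          unfolding F_def
        proof (rule \<delta>(2)[OF q(2)])
          show "\<Union> (snd ` q) \<subseteq> {a..b}" using qp tagged_division_ofD(3)[OF p] by fastforce
          have "\<Union> (snd ` q) \<subseteq> T"
          proof
            fix z assume "z \<in> \<Union> (snd ` q)"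
            then obtain x k where "(x, k) \<in> p" "x \<in> N" "z \<in> k" by (auto simp: q_def)
            then show "z \<in> T" using int[of x k] d(2)[of x] by blast
          qed
          then have "measure lebesgue (\<Union> (snd ` q)) \<le> measure lebesgue T"
            using sum_lengths_division(1)[OF q(2)] Tl by (intro measure_mono_fmeasurable) auto
          then show "(\<Sum>k\<in>snd ` q. Sup k - Inf k) < \<delta>"
            using sum_lengths_division(2)[OF q(2)] Tm by simp
        qed
        finally show ?thesis .
      qed
      show "norm ((\<Sum>(x, k)\<in>p. measure lborel k *\<^sub>R g x) - (f b - f a)) < e" using A B Ce D e'(2) by linarith
    qed
  qed
  then show ?thesis
    by (rule has_integral_spike[OF N, rotated]) (simp add: g_def)
qed

section \<open>Lower semicontinuous costs, measurable best replies, minimization of the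
  potential\<close>

section \<open>Equilibria of potential games on the line\<close>

definition lsc :: "('a::topological_space \<Rightarrow> ennreal) \<Rightarrow> bool" where
  "lsc g \<longleftrightarrow> (\<forall>c. closed {x. g x \<le> c})"

lemma lsc_borel_measurable: "lsc g \<Longrightarrow> g \<in> borel_measurable borel"
  unfolding lsc_def by (intro borel_measurableI_le) simp

lemma lsc_liminf:
  assumes "lsc g" "u \<longlonglongrightarrow> x"
  shows "g x \<le> liminf (\<lambda>n. g (u n))"
  unfolding le_Liminf_iff
proof (intro allI impI)
  fix y assume "y < g x"
  have "open (- {x. g x \<le> y})" using assms(1) unfolding lsc_def by blast
  moreover have "x \<in> - {x. g x \<le> y}" using \<open>y < g x\<close> by simp
  ultimately have "eventually (\<lambda>n. u n \<in> - {x. g x \<le> y}) sequentially"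
    using assms(2) topological_tendstoD by blast
  then show "eventually (\<lambda>n. y < g (u n)) sequentially" by (rule eventually_mono) auto
qed

lemma liminf_le_const:
  fixes f :: "nat \<Rightarrow> 'a::complete_linorder"
  assumes "\<And>n. f n \<le> c"
  shows "liminf f \<le> c"
  by (rule order_trans[OF Liminf_le_Limsup Limsup_bounded]) (use assms in auto)

lemma lscI:
  fixes g :: "'a::first_countable_topology \<Rightarrow> ennreal"
  assumes "\<And>u x. u \<longlonglongrightarrow> x \<Longrightarrow> g x \<le> liminf (\<lambda>n. g (u n))"
  shows "lsc g"
  unfolding lsc_def closed_sequential_limits
proof (intro allI impI; (elim conjE)?)
  fix c u x assume "\<forall>n. u n \<in> {x. g x \<le> c}" "u \<longlonglongrightarrow> x"
  then show "x \<in> {x. g x \<le> c}"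
    using assms[of u x] liminf_le_const[of "\<lambda>n. g (u n)" c] by auto
qed

lemma liminf_add_ennreal:
  fixes f g :: "nat \<Rightarrow> ennreal"
  shows "liminf f + liminf g \<le> liminf (\<lambda>n. f n + g n)"
proof -
  have "liminf f + liminf g = (SUP n. (INF m\<in>{n..}. f m) + (INF m\<in>{n..}. g m))"
    unfolding liminf_SUP_INF
    by (rule ennreal_SUP_add[symmetric]) (auto intro!: monoI INF_superset_mono)
  also have "\<dots> \<le> (SUP n. INF m\<in>{n..}. f m + g m)"
    by (intro SUP_mono bexI[where x = n for n] INF_greatest add_mono INF_lower) auto
  finally show ?thesis by (simp add: liminf_SUP_INF)
qed

lemma lsc_add:
  fixes f g :: "'a::first_countable_topology \<Rightarrow> ennreal"
  assumes "lsc f" "lsc g"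
  shows "lsc (\<lambda>x. f x + g x)"
proof (rule lscI)
  fix u x assume u: "u \<longlonglongrightarrow> (x::'a)"
  have "f x + g x \<le> liminf (\<lambda>n. f (u n)) + liminf (\<lambda>n. g (u n))"
    by (intro add_mono lsc_liminf assms u)
  also have "\<dots> \<le> liminf (\<lambda>n. f (u n) + g (u n))" by (rule liminf_add_ennreal)
  finally show "f x + g x \<le> liminf (\<lambda>n. f (u n) + g (u n))" .
qed

text \<open>Fatou's lemma along a convergent sequence of parameters.\<close>

lemma lsc_nn_integral:
  fixes I :: "'a::second_countable_topology \<times> 'b::second_countable_topology \<Rightarrow> ennreal"
  assumes I: "lsc I" and M: "sets M = sets borel"
  shows "lsc (\<lambda>z. \<integral>\<^sup>+ v. I (z, v) \<partial>M)"
proof (rule lscI)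
  fix u x assume u: "u \<longlonglongrightarrow> (x::'a)"
  have m: "(\<lambda>v. I (z, v)) \<in> borel_measurable M" for z
  proof -
    have "(\<lambda>v. I (z, v)) \<in> borel_measurable borel"
      using lsc_borel_measurable[OF I] by (rule measurable_compose_rev) (auto simp: borel_prod[symmetric])
    then show ?thesis by (simp add: measurable_cong_sets[OF M])
  qed
  have "(\<integral>\<^sup>+ v. I (x, v) \<partial>M) \<le> (\<integral>\<^sup>+ v. liminf (\<lambda>n. I (u n, v)) \<partial>M)"
    by (intro nn_integral_mono lsc_liminf[OF I] tendsto_Pair u tendsto_const)
  also have "\<dots> \<le> liminf (\<lambda>n. \<integral>\<^sup>+ v. I (u n, v) \<partial>M)"
    by (intro nn_integral_liminf m)
  finally show "(\<integral>\<^sup>+ v. I (x, v) \<partial>M) \<le> liminf (\<lambda>n. \<integral>\<^sup>+ v. I (u n, v) \<partial>M)" .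
qed

section \<open>Measurable selection of minimizers in the fibres of a continuous map\<close>

lemma ennreal_less_add: "c < c + ennreal r" if "c < \<infinity>" "0 < r"
  using that by (cases c) (auto simp: ennreal_plus[symmetric] ennreal_less_iff simp del: ennreal_plus)

text \<open>\<open>V W x\<close> is the infimum of \<open>g\<close> over the part of the fibre of
  \<open>x\<close> lying in \<open>W\<close>. Coercivity makes the sublevel sets of \<open>g\<close>
  in \<open>Z\<close> compact, so infima are attained and the sublevel sets of \<open>V W\<close>
  are continuous images of compact sets; thus \<open>V W\<close> is lower semicontinuous. The chosen
  point is the smallest minimizer: it is at most r exactly when restricting the fibre to
  \<open>{..r}\<close> does not raise the infimum, and this compares two Borel functions.\<close>

lemma measurable_minimizer:
  fixes g :: "real \<Rightarrow> ennreal" and e :: "real \<Rightarrow> 'x::{second_countable_topology, t2_space}"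
  assumes g: "lsc g" and Z: "closed Z" "continuous_on Z e"
    and coer: "\<And>z. z \<in> Z \<Longrightarrow> ennreal \<bar>z\<bar> \<le> ennreal A + ennreal B * g z"
  obtains s where "s \<in> borel_measurable borel"
    "\<And>x. \<exists>z\<in>Z. e z = x \<and> g z < \<infinity> \<Longrightarrow> s x \<in> Z \<and> e (s x) = x \<and> (\<forall>w\<in>Z. e w = x \<longrightarrow> g (s x) \<le> g w)"
proof -
  define K where "K W c = {z \<in> Z \<inter> W. g z \<le> c}" for W c
  define V where "V W x = Inf (g ` {z \<in> Z \<inter> W. e z = x})" for W x
  have K: "compact (K W c)" if "closed W" "c < \<infinity>" for W c
    unfolding compact_eq_bounded_closed
  proof
    have "K W c = Z \<inter> W \<inter> {z. g z \<le> c}" by (auto simp: K_def)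
    then show "closed (K W c)" using g Z(1) \<open>closed W\<close> by (auto simp: lsc_def)
    obtain r where r: "ennreal A + ennreal B * c = ennreal r" "r \<ge> 0"
    proof -
      have "ennreal A + ennreal B * c < \<infinity>" using \<open>c < \<infinity>\<close> by (simp add: ennreal_mult_less_top)
      then show ?thesis using that by (cases "ennreal A + ennreal B * c") auto
    qed
    have "\<bar>z\<bar> \<le> r" if "z \<in> K W c" for z
    proof -
      have "ennreal \<bar>z\<bar> \<le> ennreal A + ennreal B * g z" using that coer by (simp add: K_def)
      also have "\<dots> \<le> ennreal A + ennreal B * c" using that
        by (intro add_left_mono mult_left_mono) (auto simp: K_def)
      finally show ?thesis using r by (simp add: ennreal_le_iff)
    qed
    then show "bounded (K W c)" unfolding bounded_iff by (auto simp: real_norm_def)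
  qed
  have Kx: "compact {z \<in> K W c. e z = x}" if "closed W" "c < \<infinity>" for W c x
  proof -
    have "{z \<in> K W c. e z = x} = K W c \<inter> {z \<in> Z. e z = x}" by (auto simp: K_def)
    then show ?thesis using K[OF that] continuous_closed_preimage_constant[OF Z(2,1), of x] by auto
  qed
  have att: "\<exists>z\<in>K W c. e z = x" if le: "V W x \<le> c" and W: "closed W" and c: "c < \<infinity>" for W x c
  proof -
    \<comment> \<open>Near-minimizers in one fibre form a decreasing sequence of nonempty compact
      sets; a common point attains the infimum.\<close>
    define S where "S n = {z \<in> K W (c + ennreal (1 / Suc n)). e z = x}" for n
    have "\<Inter> (range S) \<noteq> {}"
    proof (rule compact_nest)
      show "compact (S n)" for n unfolding S_def using c by (intro Kx W) auto
      show "S n \<noteq> {}" for n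
      proof -
        have "V W x < c + ennreal (1 / Suc n)"
        proof -
          have "c < c + ennreal (1 / Suc n)" using c by (intro ennreal_less_add) auto
          with le show ?thesis by (rule le_less_trans)
        qed
        then obtain z where "z \<in> Z \<inter> W" "e z = x" "g z < c + ennreal (1 / Suc n)"
          unfolding V_def by (auto simp: INF_less_iff)
        then have "z \<in> S n" by (auto simp: S_def K_def)
        then show ?thesis by blast
      qed
      show "S n \<subseteq> S m" if "m \<le> n" for m n
      proof -
        have "c + ennreal (1 / Suc n) \<le> c + ennreal (1 / Suc m)"
          using that by (intro add_left_mono ennreal_leI frac_le) auto
        then show ?thesis by (auto simp: S_def K_def intro: order_trans)
      qed
    qed
    then obtain z where z: "\<And>n. z \<in> S n" by blast
    have "g z \<le> c"
    proof (rule ennreal_le_epsilon)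
      fix r :: real assume "r > 0"
      then obtain n where "1 / real (Suc n) < r" using nat_approx_posE by blast
      have "g z \<le> c + ennreal (1 / Suc n)" using z[of n] by (simp add: S_def K_def)
      also have "\<dots> \<le> c + ennreal r" using \<open>1 / real (Suc n) < r\<close> by (intro add_left_mono ennreal_leI) auto
      finally show "g z \<le> c + ennreal r" .
    qed
    then show ?thesis using z[of 0] by (auto simp: S_def K_def)
  qed
  have Vle: "V W x \<le> g z" if "z \<in> Z \<inter> W" "e z = x" for z W x
    unfolding V_def using that by (intro INF_lower) auto
  have Vlsc: "lsc (V W)" if W: "closed W" for W
    unfolding lsc_def
  proof
    fix c show "closed {x. V W x \<le> c}"
    proof (cases "c < \<infinity>")
      case True
      have "{x. V W x \<le> c} = e ` K W c"
      proof (intro set_eqI iffI)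
        fix x assume "x \<in> {x. V W x \<le> c}"
        then show "x \<in> e ` K W c" using att[of W x c] W True by auto
      next
        fix x assume "x \<in> e ` K W c"
        then show "x \<in> {x. V W x \<le> c}" using Vle[of _ W x] by (auto simp: K_def intro: order_trans)
      qed
      moreover have "compact (e ` K W c)"
        using K[OF W True] Z(2)
          by (intro compact_continuous_image) (auto simp: K_def intro: continuous_on_subset)
      ultimately show ?thesis by (simp add: compact_imp_closed)
    next
      case False
      then have "c = \<top>" by (simp add: not_less top_unique)
      then have "{x. V W x \<le> c} = UNIV" by simp
      then show ?thesis by simp
    qed
  qed
  define T where "T x = {z \<in> K UNIV (V UNIV x). e z = x}" for x
  \<comment> \<open>Where the fibre has no point of finite value, 0 is a placeholder; it accounts
    for the second alternative in the description of \<open>s x \<le> r\<close> below.\<close>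
  define s where "s x = (if V UNIV x < \<infinity> then Inf (T x) else 0)" for x
  have T: "compact (T x)" "T x \<noteq> {}" if "V UNIV x < \<infinity>" for x
    unfolding T_def using Kx[OF closed_UNIV that] att[OF order_refl closed_UNIV that] by auto
  have sT: "s x \<in> T x" if "V UNIV x < \<infinity>" for x
    using T[OF that] that unfolding s_def
      by (auto intro!: closed_contains_Inf compact_imp_closed bounded_imp_bdd_below compact_imp_bounded)
  have sle: "s x \<le> z" if "V UNIV x < \<infinity>" "z \<in> T x" for x z
    using T[OF that(1)] that unfolding s_def
      by (auto intro!: cInf_lower bounded_imp_bdd_below compact_imp_bounded)
  show ?thesis
  proof (rule that)
    have [measurable]: "V W \<in> borel_measurable borel" if "closed W" for W
      by (rule lsc_borel_measurable[OF Vlsc[OF that]])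
    show "s \<in> borel_measurable borel"
    proof (rule borel_measurableI_le)
      fix r :: real
      have "{x \<in> space borel. s x \<le> r} = {x \<in> space borel. V UNIV x < \<infinity> \<and>
        V {..r} x \<le> V UNIV x \<or> \<not> V UNIV x < \<infinity> \<and> 0 \<le> r}"
      proof (intro Collect_cong conj_cong refl iffI)
        fix x assume sx: "s x \<le> r"
        show "V UNIV x < \<infinity> \<and> V {..r} x \<le> V UNIV x \<or> \<not> V UNIV x < \<infinity> \<and> 0 \<le> r"
        proof (cases "V UNIV x < \<infinity>")
          case True
          have "s x \<in> Z \<inter> {..r}" "e (s x) = x" "g (s x) \<le> V UNIV x"
            using sT[OF True] sx by (auto simp: T_def K_def)
          then show ?thesis using Vle[of "s x" "{..r}" x] True by (auto intro: order_trans)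
        qed (use sx in \<open>auto simp: s_def\<close>)
      next
        fix x assume *: "V UNIV x < \<infinity> \<and> V {..r} x \<le> V UNIV x \<or> \<not> V UNIV x < \<infinity> \<and> 0 \<le> r"
        show "s x \<le> r"
        proof (cases "V UNIV x < \<infinity>")
          case True
          then obtain z where "z \<in> K {..r} (V UNIV x)" "e z = x" using * att[of "{..r}" x "V UNIV x"] by auto
          then have "z \<in> T x" "z \<le> r" by (auto simp: T_def K_def)
          then show ?thesis using sle[OF True] by force
        qed (use * in \<open>auto simp: s_def\<close>)
      qed
      also have "\<dots> \<in> sets borel" by measurable
      finally show "{x \<in> space borel. s x \<le> r} \<in> sets borel" .
    qed
    fix x assume "\<exists>z\<in>Z. e z = x \<and> g z < \<infinity>"
    then have fin: "V UNIV x < \<infinity>" using Vle[of _ UNIV x] by (auto intro: le_less_trans)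
    have "s x \<in> Z" "e (s x) = x" "g (s x) \<le> V UNIV x" using sT[OF fin] by (auto simp: T_def K_def)
    then show "s x \<in> Z \<and> e (s x) = x \<and> (\<forall>w\<in>Z. e w = x \<longrightarrow> g (s x) \<le> g w)"
      using Vle[of _ UNIV x] by (auto intro: order_trans)
  qed
qed

section \<open>Comparison of functions and of measures, tightness\<close>

lemma nn_integral_le_imp_AE_eq:
  assumes [measurable]: "f \<in> borel_measurable M" "g \<in> borel_measurable M"
    and "AE x in M. f x \<le> g x" and le: "(\<integral>\<^sup>+ x. g x \<partial>M) \<le> (\<integral>\<^sup>+ x. f x \<partial>M)" and fin: "(\<integral>\<^sup>+ x. f x \<partial>M) < \<infinity>"
  shows "AE x in M. f x = g x"
proof -
  have "(\<integral>\<^sup>+ x. g x - f x \<partial>M) = (\<integral>\<^sup>+ x. g x \<partial>M) - (\<integral>\<^sup>+ x. f x \<partial>M)"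
    using assms by (intro nn_integral_diff) auto
  also have "\<dots> = 0" using le fin by (intro diff_eq_0_ennreal) auto
  finally have "AE x in M. g x - f x = 0" by (subst (asm) nn_integral_0_iff_AE) auto
  moreover have "AE x in M. f x \<noteq> \<infinity>" using fin by (intro nn_integral_noteq_infinite) auto
  ultimately show ?thesis using assms(3)
  proof eventually_elim
    case (elim x)
    then have "g x \<le> f x" by (metis diff_gt_0_iff_gt_ennreal not_le less_irrefl infinity_ennreal_def)
    then show ?case using elim by simp
  qed
qed

text \<open>Outer regularity carries the inequality from open sets to Borel sets; applied to a set
  and its complement it becomes an equality, both total masses being one. The initial marginal of a
  weak limit will be identified in this way, since Fatou's lemma yields an inequality on open
  sets.\<close>

lemma prob_measure_eqI_open:
  fixes M N :: "'x::{second_countable_topology, complete_space} measure"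
  assumes M: "prob_space M" "sets M = sets borel" and N: "prob_space N" "sets N = sets borel"
    and le: "\<And>U. open U \<Longrightarrow> emeasure N U \<le> emeasure M U"
  shows "N = M"
proof (rule measure_eqI)
  interpret M: prob_space M by fact
  interpret N: prob_space N by fact
  have sp: "space M = UNIV" "space N = UNIV" using M(2) N(2) sets_eq_imp_space_eq[of _ borel] by auto
  have le': "emeasure N B \<le> emeasure M B" if B: "B \<in> sets borel" for B
    unfolding outer_regular[OF M(2) M.emeasure_finite[of "space M", folded infinity_ennreal_def] B]
  proof (rule INF_greatest)
    fix U assume U: "U \<in> {U. B \<subseteq> U \<and> open U}"
    then have "emeasure N B \<le> emeasure N U" using N(2) by (intro emeasure_mono) auto
    also have "\<dots> \<le> emeasure M U" using U le by simp
    finally show "emeasure N B \<le> emeasure M U" .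
  qed
  show "sets N = sets M" using M N by simp
  fix B assume "B \<in> sets N"
  then have B: "B \<in> sets borel" using N by simp
  then have "measure N B \<le> measure M B" "measure N (UNIV - B) \<le> measure M (UNIV - B)"
    using le'[of B] le'[of "UNIV - B"] by (auto simp: N.emeasure_eq_measure M.emeasure_eq_measure)
  moreover have "measure N (UNIV - B) = 1 - measure N B" "measure M (UNIV - B) = 1 - measure M B"
    using N.prob_compl[of B] M.prob_compl[of B] B M(2) N(2) sp by auto
  ultimately show "emeasure N B = emeasure M B"
    by (simp add: N.emeasure_eq_measure M.emeasure_eq_measure)
qed

text \<open>Markov's inequality; the factor 2 in the radius leaves room for a strict
  inequality.\<close>

lemma tight_if_nn_integral_bounded:
  assumes "\<And>n. real_distribution (\<mu> n)"
    and "\<And>n. (\<integral>\<^sup>+ z. ennreal \<bar>z\<bar> \<partial>\<mu> n) \<le> ennreal C"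
  shows "tight \<mu>"
  unfolding tight_def
proof (intro conjI allI impI)
  show "real_distribution (\<mu> n)" for n by fact
  fix \<epsilon> :: real assume "\<epsilon> > 0"
  define r where "r = max 1 (2 * \<bar>C\<bar> / \<epsilon>)"
  have r: "r > 0" by (simp add: r_def)
  have "measure (\<mu> n) {- r<..r} > 1 - \<epsilon>" for n
  proof -
    interpret real_distribution "\<mu> n" by fact
    have ge: "1 \<le> ennreal (1 / r) * ennreal \<bar>x\<bar> \<longleftrightarrow> r \<le> \<bar>x\<bar>" for x
    proof -
      have "ennreal (1 / r) * ennreal \<bar>x\<bar> = ennreal (\<bar>x\<bar> / r)" using r by (simp add: ennreal_mult[symmetric])
      then show ?thesis using r by (simp add: le_divide_eq)
    qed
    have "- {- r<..<r} = {x\<in>UNIV. 1 \<le> ennreal (1 / r) * ennreal \<bar>x\<bar>}" unfolding ge by auto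
    then have "emeasure (\<mu> n) (- {- r<..<r}) \<le> ennreal (1 / r) * (\<integral>\<^sup>+ x. ennreal \<bar>x\<bar> * indicator UNIV x \<partial>\<mu> n)"
      using nn_integral_Markov_inequality[where u = "\<lambda>x. ennreal \<bar>x\<bar>" and M = "\<mu> n" and A = UNIV
        and c = "ennreal (1 / r)"] by simp
    also have "\<dots> \<le> ennreal (1 / r) * ennreal \<bar>C\<bar>"
      using assms(2)[of n] by (intro mult_left_mono) (auto intro: order_trans ennreal_leI)
    also have "\<dots> = ennreal (\<bar>C\<bar> / r)" using r by (simp add: ennreal_mult[symmetric])
    finally have "measure (\<mu> n) (- {- r<..<r}) \<le> \<bar>C\<bar> / r" using r by (simp add: emeasure_eq_measure)
    moreover have "measure (\<mu> n) (- {- r<..<r}) = 1 - measure (\<mu> n) {- r<..<r}"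
      using prob_compl[of "{- r<..<r}"] by (simp add: Compl_eq_Diff_UNIV)
    moreover have "measure (\<mu> n) {- r<..<r} \<le> measure (\<mu> n) {- r<..r}"
      by (intro finite_measure_mono) auto
    moreover have "\<bar>C\<bar> / r < \<epsilon>"
    proof -
      have "2 * \<bar>C\<bar> / \<epsilon> \<le> r" by (simp add: r_def)
      then have "2 * \<bar>C\<bar> \<le> r * \<epsilon>" using \<open>\<epsilon> > 0\<close> by (simp add: divide_le_eq)
      then have "\<bar>C\<bar> < r * \<epsilon>" using mult_pos_pos[OF r \<open>\<epsilon> > 0\<close>] by linarith
      then show ?thesis using r by (simp add: divide_less_eq mult.commute)
    qed
    ultimately show ?thesis by linarith
  qed
  then show "\<exists>a b. a < b \<and> (\<forall>n. 1 - \<epsilon> < measure (\<mu> n) {a<..b})"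
    using r by (intro exI[of _ "- r"] exI[of _ r]) auto
qed

text \<open>A game whose strategies are real numbers: \<open>e\<close> gives the initial state of a
  strategy, \<open>L\<close> its own cost and \<open>I\<close> the interaction. The infinite value
  of \<open>L\<close> outside \<open>Z\<close> confines measures of finite cost to \<open>Z\<close>,
  where \<open>e\<close> is continuous; \<open>coer\<close> provides tightness, and
  \<open>I_le\<close> makes the interaction finite as soon as own costs are.\<close>

locale potential_game =
  fixes Z :: "real set" and e :: "real \<Rightarrow> 'x::{second_countable_topology, complete_space}"
    and L :: "real \<Rightarrow> ennreal" and I :: "real \<times> real \<Rightarrow> ennreal"
    and m0 :: "'x measure" and A0 B0 A B \<kappa> :: real
  assumes closed_Z: "closed Z" and e_cont: "continuous_on Z e"
    and e_meas [measurable]: "e \<in> borel_measurable borel"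
    and lsc_L: "lsc L" and L_off: "\<And>z. z \<notin> Z \<Longrightarrow> L z = \<infinity>"
    and coer: "\<And>z. z \<in> Z \<Longrightarrow> ennreal \<bar>z\<bar> \<le> ennreal A0 + ennreal B0 * L z"
    and lsc_I: "lsc I" and I_sym: "\<And>z w. I (z, w) = I (w, z)"
    and I_le: "\<And>z w. I (z, w) \<le> ennreal A + ennreal B * (L z + L w)"
    and m0: "prob_space m0" "sets m0 = sets borel"
    and adm: "AE x in m0. \<exists>z\<in>Z. e z = x \<and> L z \<le> ennreal \<kappa>"
begin

definition feasible :: "real measure \<Rightarrow> bool" where
  "feasible \<mu> \<longleftrightarrow> prob_space \<mu> \<and> sets \<mu> = sets borel \<and> distr \<mu> borel e = m0"

definition potential :: "real measure \<Rightarrow> ennreal" where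
  "potential \<mu> = (\<integral>\<^sup>+ z. L z \<partial>\<mu>) + (\<integral>\<^sup>+ z. L z \<partial>\<mu>) + (\<integral>\<^sup>+ z. \<integral>\<^sup>+ w. I (z, w) \<partial>\<mu> \<partial>\<mu>)"

lemma L_meas [measurable]: "L \<in> borel_measurable borel"
  by (rule lsc_borel_measurable[OF lsc_L])

lemma I_meas [measurable]: "I \<in> borel_measurable (borel \<Otimes>\<^sub>M borel)"
  using lsc_borel_measurable[OF lsc_I] by (simp add: borel_prod)

lemma feasibleD:
  assumes "feasible \<mu>"
  shows "prob_space \<mu>" "sets \<mu> = sets borel" "distr \<mu> borel e = m0" "real_distribution \<mu>"
  using assms by (auto simp: feasible_def real_distribution_def real_distribution_axioms_def)

lemma interaction_le:
  assumes "feasible \<nu>"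
  shows "(\<integral>\<^sup>+ w. I (z, w) \<partial>\<nu>) \<le> ennreal A + ennreal B * (L z + (\<integral>\<^sup>+ w. L w \<partial>\<nu>))"
proof -
  interpret prob_space \<nu> using assms by (rule feasibleD)
  note [measurable_cong] = feasibleD(2)[OF assms]
  have "(\<integral>\<^sup>+ w. I (z, w) \<partial>\<nu>) \<le> (\<integral>\<^sup>+ w. ennreal A + ennreal B * (L z + L w) \<partial>\<nu>)"
    by (intro nn_integral_mono I_le)
  also have "\<dots> = ennreal A + ennreal B * (L z + (\<integral>\<^sup>+ w. L w \<partial>\<nu>))"
    by (simp add: nn_integral_add nn_integral_cmult emeasure_space_1)
  finally show ?thesis .
qed

lemma double_interaction_le:
  assumes "feasible \<mu>" "feasible \<nu>"
  shows "(\<integral>\<^sup>+ z. \<integral>\<^sup>+ w. I (z, w) \<partial>\<nu> \<partial>\<mu>) \<le> ennreal A + ennreal B * ((\<integral>\<^sup>+ z. L z \<partial>\<mu>) + (\<integral>\<^sup>+ w. L w \<partial>\<nu>))"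
proof -
  interpret prob_space \<mu> using assms(1) by (rule feasibleD)
  note [measurable_cong] = feasibleD(2)[OF assms(1)]
  have "(\<integral>\<^sup>+ z. \<integral>\<^sup>+ w. I (z, w) \<partial>\<nu> \<partial>\<mu>) \<le> (\<integral>\<^sup>+ z. ennreal A + ennreal B * (L z + (\<integral>\<^sup>+ w. L w \<partial>\<nu>)) \<partial>\<mu>)"
    by (intro nn_integral_mono interaction_le assms)
  also have "\<dots> = ennreal A + ennreal B * ((\<integral>\<^sup>+ z. L z \<partial>\<mu>) + (\<integral>\<^sup>+ w. L w \<partial>\<nu>))"
    by (simp add: nn_integral_add nn_integral_cmult emeasure_space_1)
  finally show ?thesis .
qed

text \<open>\<open>s\<close> picks a cheapest strategy for \<open>F\<close> over each initial state,
  and its image measure has the right marginal because \<open>e (s x) = x\<close> almost everywhere.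
  With \<open>F = L\<close> this yields a feasible measure of finite cost, with the linearized cost
  it yields the best reply.\<close>

lemma selection:
  assumes F: "lsc F" "\<And>z. L z \<le> F z" and c: "c < \<infinity>"
    and adm': "AE x in m0. \<exists>z\<in>Z. e z = x \<and> F z \<le> c"
  obtains s where "s \<in> borel_measurable borel" "feasible (distr m0 borel s)"
    "(\<integral>\<^sup>+ z. F z \<partial>distr m0 borel s) \<le> c"
    "AE x in m0. \<forall>w\<in>Z. e w = x \<longrightarrow> F (s x) \<le> F w"
proof -
  interpret m0: prob_space m0 by (rule m0)
  note [measurable_cong] = m0(2)
  have [measurable]: "F \<in> borel_measurable borel" by (rule lsc_borel_measurable[OF F(1)])
  have "ennreal \<bar>z\<bar> \<le> ennreal A0 + ennreal B0 * F z" if "z \<in> Z" for z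
    by (rule order_trans[OF coer[OF that]]) (intro add_left_mono mult_left_mono F(2), simp)
  from measurable_minimizer[OF F(1) closed_Z e_cont this] obtain s where
    [measurable]: "s \<in> borel_measurable borel" and s:
    "\<And>x. \<exists>z\<in>Z. e z = x \<and> F z < \<infinity> \<Longrightarrow> s x \<in> Z \<and> e (s x) = x \<and> (\<forall>w\<in>Z. e w = x \<longrightarrow> F (s x) \<le> F w)"
    by blast
  have ae: "AE x in m0. e (s x) = x \<and> F (s x) \<le> c \<and> (\<forall>w\<in>Z. e w = x \<longrightarrow> F (s x) \<le> F w)"
    using adm'
  proof eventually_elim
    case (elim x)
    then obtain z where z: "z \<in> Z" "e z = x" "F z \<le> c" by blast
    then have "\<exists>z\<in>Z. e z = x \<and> F z < \<infinity>" using c by (auto intro: le_less_trans)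
    from s[OF this] show ?case using z by (auto intro: order_trans)
  qed
  show ?thesis
  proof (rule that)
    show "s \<in> borel_measurable borel" by fact
    have "distr (distr m0 borel s) borel e = distr m0 borel (e \<circ> s)"
      by (rule distr_distr) auto
    also have "\<dots> = distr m0 borel (\<lambda>x. x)"
      using ae by (intro distr_cong_AE) (auto simp: m0(2))
    also have "\<dots> = m0" by (rule distr_id2) (simp add: m0(2))
    finally show "feasible (distr m0 borel s)"
      unfolding feasible_def by (auto intro!: m0.prob_space_distr)
    have "(\<integral>\<^sup>+ z. F z \<partial>distr m0 borel s) = (\<integral>\<^sup>+ x. F (s x) \<partial>m0)"
      by (rule nn_integral_distr) auto
    also have "\<dots> \<le> (\<integral>\<^sup>+ x. c \<partial>m0)"
      by (rule nn_integral_mono_AE) (use ae in auto)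
    also have "\<dots> = c" by (simp add: m0.emeasure_space_1)
    finally show "(\<integral>\<^sup>+ z. F z \<partial>distr m0 borel s) \<le> c" .
    show "AE x in m0. \<forall>w\<in>Z. e w = x \<longrightarrow> F (s x) \<le> F w" using ae by auto
  qed
qed

text \<open>Coercivity bounds the first absolute moment along a minimizing sequence, hence
  tightness. Skorohod's representation turns weak into pointwise convergence, after which lower
  semicontinuity and Fatou's lemma handle the single and the double integral alike.\<close>

lemma exists_minimizer:
  obtains M where "feasible M" "potential M < \<infinity>" "\<And>\<nu>. feasible \<nu> \<Longrightarrow> potential M \<le> potential \<nu>"
proof -
  define j where "j = Inf (potential ` Collect feasible)"
  obtain \<mu>0 where \<mu>0: "feasible \<mu>0" "(\<integral>\<^sup>+ z. L z \<partial>\<mu>0) \<le> ennreal \<kappa>"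
    using selection[OF lsc_L order_refl ennreal_less_top[folded infinity_ennreal_def] adm] by blast
  have "(\<integral>\<^sup>+ z. L z \<partial>\<mu>0) < \<infinity>" using \<mu>0(2) by (auto intro: le_less_trans)
  then have "potential \<mu>0 < \<infinity>"
    using double_interaction_le[OF \<mu>0(1) \<mu>0(1)]
    by (auto simp: potential_def ennreal_mult_less_top intro: le_less_trans)
  then have j: "j < \<infinity>" unfolding j_def using \<mu>0(1) by (auto intro: le_less_trans[OF INF_lower])
  have "\<exists>\<mu>. feasible \<mu> \<and> potential \<mu> < j + ennreal (1 / Suc n)" for n
  proof -
    have "j < j + ennreal (1 / Suc n)" using j by (intro ennreal_less_add) auto
    then show ?thesis unfolding j_def by (subst (asm) INF_less_iff) auto
  qed
  then obtain \<mu> where \<mu>: "\<And>n. feasible (\<mu> n)" "\<And>n. potential (\<mu> n) < j + ennreal (1 / Suc n)" by metis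
  have Lle: "(\<integral>\<^sup>+ z. L z \<partial>\<mu> n) \<le> j + 1" for n
  proof -
    have "(\<integral>\<^sup>+ z. L z \<partial>\<mu> n) \<le> potential (\<mu> n)" unfolding potential_def by (simp add: add.assoc)
    also have "\<dots> \<le> j + ennreal (1 / Suc n)" using \<mu>(2)[of n] by simp
    also have "\<dots> \<le> j + ennreal 1" by (intro add_left_mono ennreal_leI) auto
    finally show ?thesis by simp
  qed
  have inZ: "AE z in \<mu> n. z \<in> Z" for n
  proof -
    note [measurable_cong] = feasibleD(2)[OF \<mu>(1)[of n]]
    have "(\<integral>\<^sup>+ z. L z \<partial>\<mu> n) \<noteq> \<infinity>" using Lle[of n] j by (auto simp: top_unique)
    then have "AE z in \<mu> n. L z \<noteq> \<infinity>" by (intro nn_integral_noteq_infinite) auto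
    then show ?thesis using L_off by (auto elim: eventually_mono)
  qed
  obtain C where C: "ennreal A0 + ennreal B0 * (j + 1) = ennreal C"
  proof -
    have "ennreal A0 + ennreal B0 * (j + 1) < \<infinity>" using j by (simp add: ennreal_mult_less_top)
    then show ?thesis using that by (cases "ennreal A0 + ennreal B0 * (j + 1)") auto
  qed
  have "(\<integral>\<^sup>+ z. ennreal \<bar>z\<bar> \<partial>\<mu> n) \<le> ennreal C" for n
  proof -
    interpret prob_space "\<mu> n" using \<mu>(1) by (rule feasibleD)
    note [measurable_cong] = feasibleD(2)[OF \<mu>(1)[of n]]
    have "(\<integral>\<^sup>+ z. ennreal \<bar>z\<bar> \<partial>\<mu> n) \<le> (\<integral>\<^sup>+ z. ennreal A0 + ennreal B0 * L z \<partial>\<mu> n)"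
      using inZ[of n] coer by (intro nn_integral_mono_AE) (auto elim: eventually_mono)
    also have "\<dots> = ennreal A0 + ennreal B0 * (\<integral>\<^sup>+ z. L z \<partial>\<mu> n)"
      by (simp add: nn_integral_add nn_integral_cmult emeasure_space_1)
    also have "\<dots> \<le> ennreal A0 + ennreal B0 * (j + 1)" by (intro add_left_mono mult_left_mono Lle) simp
    finally show ?thesis by (simp add: C)
  qed
  then have "tight \<mu>" using feasibleD(4)[OF \<mu>(1)] by (intro tight_if_nn_integral_bounded) auto
  from tight_imp_convergent_subsubsequence[OF this strict_mono_id] obtain r M where
    r: "strict_mono r" and M: "real_distribution M" and w: "weak_conv_m (\<mu> \<circ> r) M" by auto
  define \<nu> where "\<nu> = \<mu> \<circ> r"
  have \<nu>: "feasible (\<nu> n)" for n using \<mu> by (simp add: \<nu>_def)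
  obtain \<Omega> :: "real measure" and Y X where \<Omega>: "prob_space \<Omega>" and Y [measurable]: "\<And>n. Y n \<in> measurable \<Omega> borel"
    and dY: "\<And>n. distr \<Omega> borel (Y n) = \<nu> n" and X: "X \<in> measurable \<Omega> lborel"
    and dX: "distr \<Omega> borel X = M" and lim: "\<And>x. x \<in> space \<Omega> \<Longrightarrow> (\<lambda>n. Y n x) \<longlonglongrightarrow> X x"
  proof -
    obtain \<Omega> :: "real measure" and Y X where "prob_space \<Omega> \<and> (\<forall>n. Y n \<in> measurable \<Omega> borel) \<and>
      (\<forall>n. distr \<Omega> borel (Y n) = \<nu> n) \<and> X \<in> measurable \<Omega> lborel \<and> distr \<Omega> borel X = M \<and>
      (\<forall>x\<in>space \<Omega>. (\<lambda>n. Y n x) \<longlonglongrightarrow> X x)"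
      using Skorohod[of \<nu> M] feasibleD(4)[OF \<nu>] M w unfolding \<nu>_def by metis
    then show thesis by (intro that[of \<Omega> Y X]) simp_all
  qed
  have [measurable]: "X \<in> measurable \<Omega> borel" using X by simp
  interpret \<Omega>: prob_space \<Omega> by fact
  interpret M: real_distribution M by fact
  \<comment> \<open>Finite cost keeps the sequence in \<open>Z\<close> almost surely, and closedness
    keeps its limit there; continuity of \<open>e\<close> is available on \<open>Z\<close>
    alone.\<close>
  have "AE x in \<Omega>. \<forall>n. Y n x \<in> Z"
    unfolding AE_all_countable
  proof
    fix n
    have "AE z in distr \<Omega> borel (Y n). z \<in> Z" unfolding dY \<nu>_def comp_def by (rule inZ)
    then show "AE x in \<Omega>. Y n x \<in> Z" using Y by (rule AE_distrD[rotated])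
  qed
  have "distr M borel e = m0"
  proof (rule prob_measure_eqI_open[OF m0])
    show "prob_space (distr M borel e)" by (rule M.prob_space_distr) simp
    fix U :: "'x set" assume U: "open U"
    then have [measurable]: "U \<in> sets borel" by simp
    have "emeasure (distr M borel e) U = (\<integral>\<^sup>+ x. indicator U (e (X x)) \<partial>\<Omega>)"
    proof -
      have "emeasure (distr M borel e) U = (\<integral>\<^sup>+ z. indicator U z \<partial>distr M borel e)" using U by simp
      also have "\<dots> = (\<integral>\<^sup>+ z. indicator U (e z) \<partial>distr \<Omega> borel X)" unfolding dX
        by (rule nn_integral_distr) measurable
      also have "\<dots> = (\<integral>\<^sup>+ x. indicator U (e (X x)) \<partial>\<Omega>)" by (rule nn_integral_distr) measurable
      finally show ?thesis .
    qed
    also have "\<dots> \<le> (\<integral>\<^sup>+ x. liminf (\<lambda>n. indicator U (e (Y n x))) \<partial>\<Omega>)"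
    proof (rule nn_integral_mono_AE)
      show "AE x in \<Omega>. indicator U (e (X x)) \<le> liminf (\<lambda>n. indicator U (e (Y n x)) :: ennreal)"
        using \<open>AE x in \<Omega>. \<forall>n. Y n x \<in> Z\<close> AE_space
      proof eventually_elim
        case (elim x)
        have XZ: "X x \<in> Z" by (rule closed_sequentially[OF closed_Z _ lim[OF elim(2)]]) (simp add: elim(1))
        have "(\<lambda>n. e (Y n x)) \<longlonglongrightarrow> e (X x)"
          using e_cont by (rule continuous_on_tendsto_compose) (auto simp: elim XZ lim)
        show ?case
        proof (cases "e (X x) \<in> U")
          case True
          then have "eventually (\<lambda>n. e (Y n x) \<in> U) sequentially"
            using \<open>(\<lambda>n. e (Y n x)) \<longlonglongrightarrow> e (X x)\<close> U topological_tendstoD by blast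
          then have "1 \<le> liminf (\<lambda>n. indicator U (e (Y n x)) :: ennreal)"
            by (intro Liminf_bounded) (auto elim: eventually_mono)
          then show ?thesis using True by simp
        qed simp
      qed
    qed
    also have "\<dots> \<le> liminf (\<lambda>n. \<integral>\<^sup>+ x. indicator U (e (Y n x)) \<partial>\<Omega>)"
      using U by (intro nn_integral_liminf) measurable
    also have "(\<lambda>n. \<integral>\<^sup>+ x. indicator U (e (Y n x)) \<partial>\<Omega>) = (\<lambda>n. emeasure m0 U)"
    proof
      fix n
      have "emeasure m0 U = (\<integral>\<^sup>+ z. indicator U z \<partial>distr (\<nu> n) borel e)"
        using U m0(2) by (simp add: feasibleD(3)[OF \<nu>])
      also have "\<dots> = (\<integral>\<^sup>+ z. indicator U (e z) \<partial>distr \<Omega> borel (Y n))"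
        using U feasibleD(2)[OF \<nu>[of n]] unfolding dY
          by (subst nn_integral_distr) (auto cong: measurable_cong_sets)
      also have "\<dots> = (\<integral>\<^sup>+ x. indicator U (e (Y n x)) \<partial>\<Omega>)" by (rule nn_integral_distr) measurable
      finally show "(\<integral>\<^sup>+ x. indicator U (e (Y n x)) \<partial>\<Omega>) = emeasure m0 U" ..
    qed
    also have "liminf (\<lambda>n. emeasure m0 U) = emeasure m0 U" by (simp add: Liminf_const)
    finally show "emeasure (distr M borel e) U \<le> emeasure m0 U" .
  qed simp
  then have fM: "feasible M" using M.prob_space_axioms by (simp add: feasible_def)
  \<comment> \<open>In terms of random variables the quadratic part becomes an iterated integral
    over two copies of the same probability space.\<close>
  have pot: "potential (distr \<Omega> borel f) = (\<integral>\<^sup>+ x. L (f x) \<partial>\<Omega>) + (\<integral>\<^sup>+ x. L (f x) \<partial>\<Omega>) + (\<integral>\<^sup>+ x. \<integral>\<^sup>+ y.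
    I (f x, f y) \<partial>\<Omega> \<partial>\<Omega>)"
    if [measurable]: "f \<in> measurable \<Omega> borel" for f
  proof -
    interpret D: prob_space "distr \<Omega> borel f" by (rule \<Omega>.prob_space_distr) simp
    show ?thesis unfolding potential_def by (simp add: nn_integral_distr)
  qed
  have "potential M = (\<integral>\<^sup>+ x. L (X x) \<partial>\<Omega>) + (\<integral>\<^sup>+ x. L (X x) \<partial>\<Omega>) + (\<integral>\<^sup>+ x. \<integral>\<^sup>+ y. I (X x, X y) \<partial>\<Omega> \<partial>\<Omega>)"
    using pot[of X] by (simp add: dX)
  also have "\<dots> \<le> liminf (\<lambda>n. \<integral>\<^sup>+ x. L (Y n x) \<partial>\<Omega>) + liminf (\<lambda>n. \<integral>\<^sup>+ x. L (Y n x) \<partial>\<Omega>) +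
      liminf (\<lambda>n. \<integral>\<^sup>+ x. \<integral>\<^sup>+ y. I (Y n x, Y n y) \<partial>\<Omega> \<partial>\<Omega>)"
  proof (intro add_mono)
    have "(\<integral>\<^sup>+ x. L (X x) \<partial>\<Omega>) \<le> (\<integral>\<^sup>+ x. liminf (\<lambda>n. L (Y n x)) \<partial>\<Omega>)"
      by (intro nn_integral_mono lsc_liminf lsc_L lim)
    also have "\<dots> \<le> liminf (\<lambda>n. \<integral>\<^sup>+ x. L (Y n x) \<partial>\<Omega>)" by (intro nn_integral_liminf) measurable
    finally show "(\<integral>\<^sup>+ x. L (X x) \<partial>\<Omega>) \<le> liminf (\<lambda>n. \<integral>\<^sup>+ x. L (Y n x) \<partial>\<Omega>)" .
    then show "(\<integral>\<^sup>+ x. L (X x) \<partial>\<Omega>) \<le> liminf (\<lambda>n. \<integral>\<^sup>+ x. L (Y n x) \<partial>\<Omega>)" .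
    have "(\<integral>\<^sup>+ x. \<integral>\<^sup>+ y. I (X x, X y) \<partial>\<Omega> \<partial>\<Omega>) \<le> (\<integral>\<^sup>+ x. liminf (\<lambda>n. \<integral>\<^sup>+ y. I (Y n x, Y n y) \<partial>\<Omega>) \<partial>\<Omega>)"
    proof (rule nn_integral_mono)
      fix x assume x: "x \<in> space \<Omega>"
      have "(\<integral>\<^sup>+ y. I (X x, X y) \<partial>\<Omega>) \<le> (\<integral>\<^sup>+ y. liminf (\<lambda>n. I (Y n x, Y n y)) \<partial>\<Omega>)"
        by (intro nn_integral_mono lsc_liminf lsc_I tendsto_Pair lim x)
      also have "\<dots> \<le> liminf (\<lambda>n. \<integral>\<^sup>+ y. I (Y n x, Y n y) \<partial>\<Omega>)" using x by (intro nn_integral_liminf) measurable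
      finally show "(\<integral>\<^sup>+ y. I (X x, X y) \<partial>\<Omega>) \<le> liminf (\<lambda>n. \<integral>\<^sup>+ y. I (Y n x, Y n y) \<partial>\<Omega>)" .
    qed
    also have "\<dots> \<le> liminf (\<lambda>n. \<integral>\<^sup>+ x. \<integral>\<^sup>+ y. I (Y n x, Y n y) \<partial>\<Omega> \<partial>\<Omega>)"
      by (intro nn_integral_liminf) measurable
    finally show "(\<integral>\<^sup>+ x. \<integral>\<^sup>+ y. I (X x, X y) \<partial>\<Omega> \<partial>\<Omega>) \<le> liminf (\<lambda>n. \<integral>\<^sup>+ x. \<integral>\<^sup>+ y. I (Y n x, Y n y) \<partial>\<Omega> \<partial>\<Omega>)" .
  qed
  also have "\<dots> \<le> liminf (\<lambda>n. potential (\<nu> n))"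
    unfolding dY[symmetric] pot[OF Y]
    by (rule order_trans[OF add_right_mono[OF liminf_add_ennreal] liminf_add_ennreal])
  also have "\<dots> \<le> j"
  proof (rule ennreal_le_epsilon)
    fix \<epsilon> :: real assume "\<epsilon> > 0"
    then obtain N where N: "1 / real (Suc N) < \<epsilon>" using nat_approx_posE by blast
    have "liminf (\<lambda>n. potential (\<nu> n)) \<le> limsup (\<lambda>n. potential (\<nu> n))" by (rule Liminf_le_Limsup) simp
    also have "\<dots> \<le> j + ennreal \<epsilon>"
    proof (rule Limsup_bounded)
      show "eventually (\<lambda>n. potential (\<nu> n) \<le> j + ennreal \<epsilon>) sequentially"
      proof (rule eventually_sequentiallyI)
        fix n assume "N \<le> n"
        then have "N \<le> r n" using seq_suble[OF r, of n] by simp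
        then have "1 / real (Suc (r n)) \<le> 1 / real (Suc N)" by (intro frac_le) auto
        then have "ennreal (1 / Suc (r n)) \<le> ennreal \<epsilon>" using N by (intro ennreal_leI) linarith
        then have "j + ennreal (1 / Suc (r n)) \<le> j + ennreal \<epsilon>" by (rule add_left_mono)
        from order_trans[OF less_imp_le[OF \<mu>(2)[of "r n"]] this]
        show "potential (\<nu> n) \<le> j + ennreal \<epsilon>" by (simp add: \<nu>_def)
      qed
    qed
    finally show "liminf (\<lambda>n. potential (\<nu> n)) \<le> j + ennreal \<epsilon>" .
  qed
  finally have "potential M \<le> j" .
  then show ?thesis using fM j
    by (intro that[of M]) (auto simp: j_def intro: order_trans[OF _ INF_lower] le_less_trans)
qed

text \<open>Convex combination of two measures as a two-stage experiment: a Bernoulli trial of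
  parameter \<open>t\<close> decides which measure is used, and integrals are computed by the rule
  for \<open>bind\<close>.\<close>

definition mix :: "real \<Rightarrow> real measure \<Rightarrow> real measure \<Rightarrow> real measure" where
  "mix t \<mu> \<nu> = measure_pmf (bernoulli_pmf t) \<bind> (\<lambda>b. if b then \<nu> else \<mu>)"

lemma mix:
  assumes "feasible \<mu>" "feasible \<nu>" "0 \<le> t" "t \<le> 1"
  shows "feasible (mix t \<mu> \<nu>)"
    and "\<And>f. f \<in> borel_measurable borel \<Longrightarrow>
      (\<integral>\<^sup>+ x. f x \<partial>mix t \<mu> \<nu>) = ennreal (1 - t) * (\<integral>\<^sup>+ x. f x \<partial>\<mu>) + ennreal t * (\<integral>\<^sup>+ x. f x \<partial>\<nu>)"
proof -
  let ?N = "\<lambda>b. if b then \<nu> else \<mu>"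
  have N: "?N b \<in> space (prob_algebra borel)" for b
    using assms(1,2) by (auto simp: space_prob_algebra feasible_def)
  have N': "?N \<in> measurable (measure_pmf (bernoulli_pmf t)) (subprob_algebra borel)"
    using N by (simp add: measurable_def space_prob_algebra space_subprob_algebra prob_space_imp_subprob_space)
  have sets: "sets (mix t \<mu> \<nu>) = sets borel"
    unfolding mix_def by (rule sets_bind) (use N in \<open>auto simp: space_prob_algebra\<close>)
  show int: "(\<integral>\<^sup>+ x. f x \<partial>mix t \<mu> \<nu>) = ennreal (1 - t) * (\<integral>\<^sup>+ x. f x \<partial>\<mu>) + ennreal t * (\<integral>\<^sup>+ x. f x \<partial>\<nu>)"
    if f: "f \<in> borel_measurable borel" for f
    unfolding mix_def nn_integral_bind[OF f N'] using assms(3,4)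
    by (simp add: add.commute mult.commute)
  have "prob_space (mix t \<mu> \<nu>)"
  proof
    have "emeasure (mix t \<mu> \<nu>) (space (mix t \<mu> \<nu>)) = (\<integral>\<^sup>+ x. 1 \<partial>mix t \<mu> \<nu>)" by simp
    also have "\<dots> = ennreal (1 - t) * (\<integral>\<^sup>+ x. 1 \<partial>\<mu>) + ennreal t * (\<integral>\<^sup>+ x. 1 \<partial>\<nu>)" by (rule int) simp
    also have "\<dots> = ennreal (1 - t) + ennreal t"
      using assms(1,2) by (simp add: feasible_def prob_space.emeasure_space_1)
    also have "\<dots> = 1" using assms(3,4) by (simp add: ennreal_plus[symmetric] del: ennreal_plus)
    finally show "emeasure (mix t \<mu> \<nu>) (space (mix t \<mu> \<nu>)) = 1" .
  qed
  moreover have "distr (mix t \<mu> \<nu>) borel e = m0"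
  proof (rule measure_eqI)
    show "sets (distr (mix t \<mu> \<nu>) borel e) = sets m0" by (simp add: m0(2))
    fix B assume "B \<in> sets (distr (mix t \<mu> \<nu>) borel e)"
    then have [measurable]: "B \<in> sets borel" by simp
    have eq: "(\<integral>\<^sup>+ x. indicator B (e x) \<partial>\<rho>) = emeasure (distr \<rho> borel e) B" if "sets \<rho> = sets borel"
      for \<rho> :: "real measure"
    proof -
      note [measurable_cong] = that
      have "emeasure (distr \<rho> borel e) B = (\<integral>\<^sup>+ x. indicator B x \<partial>distr \<rho> borel e)" by simp
      also have "\<dots> = (\<integral>\<^sup>+ x. indicator B (e x) \<partial>\<rho>)" by (rule nn_integral_distr) auto
      finally show ?thesis ..
    qed
    have "emeasure (distr (mix t \<mu> \<nu>) borel e) B = ennreal (1 - t) * emeasure m0 B + ennreal t * emeasure m0 B"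
      unfolding eq[OF sets, symmetric]
      using int[of "\<lambda>x. indicator B (e x)"] assms(1,2) by (simp add: eq feasible_def)
    also have "\<dots> = emeasure m0 B"
      using assms(3,4) by (simp add: distrib_right[symmetric] ennreal_plus[symmetric] del: ennreal_plus)
    finally show "emeasure (distr (mix t \<mu> \<nu>) borel e) B = emeasure m0 B" .
  qed
  ultimately show "feasible (mix t \<mu> \<nu>)" using sets by (simp add: feasible_def)
qed

text \<open>The first variation of the quadratic potential along the segment from a minimizer to another
  feasible measure gives the linearized inequality.\<close>

lemma minimizer_linear:
  assumes M: "feasible M" "potential M < \<infinity>" "\<And>\<nu>. feasible \<nu> \<Longrightarrow> potential M \<le> potential \<nu>"
    and N: "feasible N" "(\<integral>\<^sup>+ z. L z \<partial>N) < \<infinity>"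
  shows "(\<integral>\<^sup>+ z. L z + (\<integral>\<^sup>+ v. I (z, v) \<partial>M) \<partial>M) \<le> (\<integral>\<^sup>+ z. L z + (\<integral>\<^sup>+ v. I (z, v) \<partial>M) \<partial>N)"
proof -
  interpret M: prob_space M using M(1) by (rule feasibleD)
  interpret N: prob_space N using N(1) by (rule feasibleD)
  interpret pair_sigma_finite M N ..
  note [measurable_cong] = feasibleD(2)[OF M(1)] feasibleD(2)[OF N(1)]
  have LM: "(\<integral>\<^sup>+ z. L z \<partial>M) < \<infinity>" using M(2) by (auto simp: potential_def)
  define dbl where "dbl \<mu> \<nu> = (\<integral>\<^sup>+ z. \<integral>\<^sup>+ w. I (z, w) \<partial>\<nu> \<partial>\<mu>)" for \<mu> \<nu>
  have fin: "dbl \<mu> \<nu> < \<infinity>" if "feasible \<mu>" "feasible \<nu>" "(\<integral>\<^sup>+ z. L z \<partial>\<mu>) < \<infinity>" "(\<integral>\<^sup>+ z. L z \<partial>\<nu>) < \<infinity>" for \<mu> \<nu>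
    using double_interaction_le[OF that(1,2)] that(3,4)
    by (auto simp: dbl_def ennreal_mult_less_top intro: le_less_trans)
  obtain l0 where l0: "(\<integral>\<^sup>+ z. L z \<partial>M) = ennreal l0" "l0 \<ge> 0" using LM by (cases "\<integral>\<^sup>+ z. L z \<partial>M") auto
  obtain l1 where l1: "(\<integral>\<^sup>+ z. L z \<partial>N) = ennreal l1" "l1 \<ge> 0" using N(2) by (cases "\<integral>\<^sup>+ z. L z \<partial>N") auto
  obtain i00 where i00: "dbl M M = ennreal i00" "i00 \<ge> 0" using fin[OF M(1) M(1) LM LM]
    by (cases "dbl M M") auto
  obtain i10 where i10: "dbl N M = ennreal i10" "i10 \<ge> 0" using fin[OF N(1) M(1) N(2) LM]
    by (cases "dbl N M") auto
  obtain i11 where i11: "dbl N N = ennreal i11" "i11 \<ge> 0" using fin[OF N(1) N(1) N(2) N(2)]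
    by (cases "dbl N N") auto
  \<comment> \<open>Tonelli's theorem and the symmetry of \<open>I\<close> identify the two mixed
    terms. This is where the game becomes potential: the derivative of the quadratic part is twice
    one mixed term.\<close>
  have "dbl M N = (\<integral>\<^sup>+ w. \<integral>\<^sup>+ z. I (z, w) \<partial>M \<partial>N)"
    unfolding dbl_def by (rule Fubini'[symmetric]) simp
  also have "\<dots> = dbl N M" unfolding dbl_def by (subst I_sym) (rule refl)
  finally have i01: "dbl M N = ennreal i10" using i10 by simp
  \<comment> \<open>Expansion of the potential along the segment; the coefficient of
    \<open>t\<close> is the first variation at the minimizer.\<close>
  have ineq: "0 \<le> t * (2 * (l1 + i10 - l0 - i00)) + t * t * (i00 - 2 * i10 + i11)" if t: "0 \<le> t" "t \<le> 1" for t
  proof -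
    let ?m = "mix t M N"
    have fm: "feasible ?m" by (rule mix(1)[OF M(1) N(1) t])
    interpret m: prob_space ?m using fm by (rule feasibleD)
    note [measurable_cong] = feasibleD(2)[OF fm]
    have Lm: "(\<integral>\<^sup>+ z. L z \<partial>?m) = ennreal ((1 - t) * l0 + t * l1)"
      using t l0 l1 by (simp add: mix(2)[OF M(1) N(1) t] ennreal_mult)
    have "dbl ?m ?m = (\<integral>\<^sup>+ z. ennreal (1 - t) * (\<integral>\<^sup>+ w. I (z, w) \<partial>M) + ennreal t * (\<integral>\<^sup>+ w. I (z, w) \<partial>N) \<partial>?m)"
      unfolding dbl_def by (intro nn_integral_cong mix(2)[OF M(1) N(1) t]) measurable
    also have "\<dots> = ennreal (1 - t) * (\<integral>\<^sup>+ z. \<integral>\<^sup>+ w. I (z, w) \<partial>M \<partial>?m) + ennreal t * (\<integral>\<^sup>+ z. \<integral>\<^sup>+ w.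
      I (z, w) \<partial>N \<partial>?m)"
      by (simp add: nn_integral_add nn_integral_cmult)
    also have "\<dots> = ennreal (1 - t) * (ennreal (1 - t) * dbl M M + ennreal t * dbl N M)
        + ennreal t * (ennreal (1 - t) * dbl M N + ennreal t * dbl N N)"
      unfolding dbl_def by (subst (1 2) mix(2)[OF M(1) N(1) t]) auto
    also have "\<dots> = ennreal ((1 - t) * ((1 - t) * i00 + t * i10) + t * ((1 - t) * i10 + t * i11))"
      unfolding i00 i10 i01 i11 using t i00 i10 i11 by (simp add: ennreal_mult)
    finally have Im: "dbl ?m ?m = \<dots>" .
    have "ennreal (l0 + l0 + i00) = potential M"
      unfolding potential_def dbl_def[symmetric] l0(1) i00(1)
      by (simp only: ennreal_plus[OF add_nonneg_nonneg[OF l0(2) l0(2)] i00(2)] ennreal_plus[OF l0(2) l0(2)])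
    also have "\<dots> \<le> potential ?m" by (rule M(3)[OF fm])
    also have "\<dots> = ennreal (((1 - t) * l0 + t * l1) + ((1 - t) * l0 + t * l1) +
       ((1 - t) * ((1 - t) * i00 + t * i10) + t * ((1 - t) * i10 + t * i11)))"
      unfolding potential_def dbl_def[symmetric] Lm Im
    proof -
      have P: "0 \<le> (1 - t) * l0 + t * l1" using t l0 l1 by simp
      have Q: "0 \<le> (1 - t) * ((1 - t) * i00 + t * i10) + t * ((1 - t) * i10 + t * i11)" using t i00 i10 i11
        by simp
      show "ennreal ((1 - t) * l0 + t * l1) + ennreal ((1 - t) * l0 + t * l1) +
        ennreal ((1 - t) * ((1 - t) * i00 + t * i10) + t * ((1 - t) * i10 + t * i11)) =
        ennreal (((1 - t) * l0 + t * l1) + ((1 - t) * l0 + t * l1) +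
        ((1 - t) * ((1 - t) * i00 + t * i10) + t * ((1 - t) * i10 + t * i11)))"
        by (simp only: ennreal_plus[OF add_nonneg_nonneg[OF P P] Q] ennreal_plus[OF P P])
    qed
    finally have "l0 + l0 + i00 \<le> ((1 - t) * l0 + t * l1) + ((1 - t) * l0 + t * l1) +
       ((1 - t) * ((1 - t) * i00 + t * i10) + t * ((1 - t) * i10 + t * i11))"
      using t l0 l1 i00 i10 i11 by (subst (asm) ennreal_le_iff) auto
    then show ?thesis by (simp add: algebra_simps)
  qed
  have "0 \<le> 2 * (l1 + i10 - l0 - i00)"
  proof (rule ccontr)
    define d where "d = 2 * (l1 + i10 - l0 - i00)"
    define k where "k = \<bar>i00 - 2 * i10 + i11\<bar>"
    assume "\<not> ?thesis"
    then have d: "d < 0" by (simp add: d_def)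
    \<comment> \<open>If the linear coefficient \<open>d\<close> were negative, then for
      \<open>t \<le> - d / c\<close> the quadratic term would stay below \<open>- d * t\<close> and
      the potential would decrease.\<close>
    define c where "c = 2 * (k + 1)"
    define t where "t = min 1 (- d / c)"
    have k: "k \<ge> 0" by (simp add: k_def)
    then have c: "c > 0" by (simp add: c_def)
    have "0 < - d / c" using d c by (intro divide_pos_pos) auto
    then have t: "0 < t" "t \<le> 1" by (auto simp: t_def)
    have "t * c \<le> (- d / c) * c" using c by (intro mult_right_mono) (auto simp: t_def)
    then have "t * c \<le> - d" using c by simp
    then have "2 * (t * k) + 2 * t \<le> - d" by (simp add: c_def algebra_simps)
    then have "t * k < - d" using t mult_nonneg_nonneg[of t k] k by linarith
    then have "d + t * k < 0" by linarith
    moreover have "t * (i00 - 2 * i10 + i11) \<le> t * k" using t by (intro mult_left_mono) (auto simp: k_def)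
    ultimately have "d + t * (i00 - 2 * i10 + i11) < 0" by linarith
    then have "t * (d + t * (i00 - 2 * i10 + i11)) < 0" using t by (intro mult_pos_neg) auto
    then show False using ineq[of t] t unfolding d_def[symmetric] by (simp add: algebra_simps)
  qed
  then have "ennreal (l0 + i00) \<le> ennreal (l1 + i10)" by (intro ennreal_leI) simp
  then show ?thesis
    using l0 l1 i00 i10 by (simp add: nn_integral_add dbl_def)
qed

text \<open>Let \<open>F\<close> be the cost against the minimizer \<open>M\<close>, and
  \<open>s\<close> a best reply. Since both measures have marginal \<open>m0\<close>, the integral
  of \<open>F\<close> over the best-reply measure is that of \<open>F (s (e z))\<close> over
  \<open>M\<close>. The first variation bounds the integral of \<open>F\<close> by it, while
  pointwise \<open>F (s (e z)) \<le> F z\<close> almost everywhere; so the two functions agree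
  almost everywhere.\<close>

theorem exists_equilibrium:
  obtains M where "feasible M" "(\<integral>\<^sup>+ z. L z \<partial>M) < \<infinity>"
    "AE z in M. \<forall>w\<in>Z. e w = e z \<longrightarrow> L z + (\<integral>\<^sup>+ v. I (z, v) \<partial>M) \<le> L w + (\<integral>\<^sup>+ v. I (w, v) \<partial>M)"
proof -
  obtain M where M: "feasible M" "potential M < \<infinity>" "\<And>\<nu>. feasible \<nu> \<Longrightarrow> potential M \<le> potential \<nu>"
    by (rule exists_minimizer) blast
  interpret M: prob_space M using M(1) by (rule feasibleD)
  note [measurable_cong] = feasibleD(2)[OF M(1)]
  have LM: "(\<integral>\<^sup>+ z. L z \<partial>M) < \<infinity>" using M(2) by (auto simp: potential_def)
  define F where "F z = L z + (\<integral>\<^sup>+ v. I (z, v) \<partial>M)" for z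
  have F: "lsc F" "\<And>z. L z \<le> F z"
    unfolding F_def by (auto intro!: lsc_add lsc_L lsc_nn_integral lsc_I feasibleD(2)[OF M(1)])
  have [measurable]: "F \<in> borel_measurable borel" by (rule lsc_borel_measurable[OF F(1)])
  \<comment> \<open>Upper bound for what a strategy of own cost at most \<open>\<kappa>\<close> pays
    against \<open>M\<close>; it guarantees that the best replies have finite cost.\<close>
  define c where "c = ennreal \<kappa> + (ennreal A + ennreal B * (ennreal \<kappa> + (\<integral>\<^sup>+ z. L z \<partial>M)))"
  have c: "c < \<infinity>" using LM by (simp add: c_def ennreal_mult_less_top)
  have Fc: "F z \<le> c" if "L z \<le> ennreal \<kappa>" for z
    unfolding F_def c_def using interaction_le[OF M(1), of z] that
    by (intro add_mono) (auto intro!: order_trans[OF interaction_le[OF M(1), of z]] add_left_mono mult_left_mono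
      add_right_mono)
  have "AE x in m0. \<exists>z\<in>Z. e z = x \<and> F z \<le> c"
    using adm by eventually_elim (use Fc in blast)
  from selection[OF F c this] obtain s where s [measurable]: "s \<in> borel_measurable borel" and
    N: "feasible (distr m0 borel s)" "(\<integral>\<^sup>+ z. F z \<partial>distr m0 borel s) \<le> c"
    and opt: "AE x in m0. \<forall>w\<in>Z. e w = x \<longrightarrow> F (s x) \<le> F w" by blast
  have "(\<integral>\<^sup>+ z. L z \<partial>distr m0 borel s) \<le> c"
    by (rule order_trans[OF nn_integral_mono N(2)]) (rule F(2))
  then have "(\<integral>\<^sup>+ z. L z \<partial>distr m0 borel s) < \<infinity>" using c by (rule le_less_trans)
  from minimizer_linear[OF M N(1) this]
  have le: "(\<integral>\<^sup>+ z. F z \<partial>M) \<le> (\<integral>\<^sup>+ z. F z \<partial>distr m0 borel s)" by (simp add: F_def)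
  have eq: "(\<integral>\<^sup>+ z. F z \<partial>distr m0 borel s) = (\<integral>\<^sup>+ z. F (s (e z)) \<partial>M)"
  proof -
    have "(\<integral>\<^sup>+ z. F z \<partial>distr m0 borel s) = (\<integral>\<^sup>+ x. F (s x) \<partial>m0)"
      using m0(2) by (intro nn_integral_distr) (auto cong: measurable_cong_sets)
    also have "\<dots> = (\<integral>\<^sup>+ x. F (s x) \<partial>distr M borel e)" by (simp add: feasibleD(3)[OF M(1)])
    also have "\<dots> = (\<integral>\<^sup>+ z. F (s (e z)) \<partial>M)" by (intro nn_integral_distr) auto
    finally show ?thesis .
  qed
  have opt': "AE z in M. \<forall>w\<in>Z. e w = e z \<longrightarrow> F (s (e z)) \<le> F w"
    using opt unfolding feasibleD(3)[OF M(1), symmetric] by (rule AE_distrD[rotated]) simp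
  have Z: "AE z in M. z \<in> Z"
  proof -
    have "AE z in M. L z \<noteq> \<infinity>" using LM by (intro nn_integral_noteq_infinite) auto
    then show ?thesis using L_off by (auto elim: eventually_mono)
  qed
  have "AE z in M. F (s (e z)) = F z"
  proof (rule nn_integral_le_imp_AE_eq)
    show "AE z in M. F (s (e z)) \<le> F z" using opt' Z by eventually_elim blast
    show "(\<integral>\<^sup>+ z. F z \<partial>M) \<le> (\<integral>\<^sup>+ z. F (s (e z)) \<partial>M)" using le eq by simp
    show "(\<integral>\<^sup>+ z. F (s (e z)) \<partial>M) < \<infinity>" using N(2) c eq by (auto intro: le_less_trans)
  qed auto
  with opt' have "AE z in M. \<forall>w\<in>Z. e w = e z \<longrightarrow> F z \<le> F w" by eventually_elim simp
  then show ?thesis using that[OF M(1) LM] by (simp add: F_def)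
qed

end

section \<open>Affine minorants, uniform integrability and Ioffe's lower semicontinuity
  theorem\<close>

section \<open>Weak convergence and convex integrands\<close>

text \<open>Up to \<open>c\<close> the first term suffices; beyond it, v = v^(1 - \<theta>)
  v^\<theta> with v^(1 - \<theta>) decreasing. This takes the place of Hoelder's inequality in all
  later estimates: the factor in front of the power tends to 0 as \<open>c\<close> grows.\<close>

lemma le_powr_superlinear:
  assumes "(v::real) \<ge> 0" "c > 0" "\<theta> > 1"
  shows "v \<le> c + c powr (1 - \<theta>) * v powr \<theta>"
proof (cases "v \<le> c")
  case True
  then show ?thesis using assms by (simp add: add_increasing2)
next
  case False
  then have "v = v powr (1 - \<theta>) * v powr \<theta>" using assms by (simp add: powr_add[symmetric])
  also have "\<dots> \<le> c powr (1 - \<theta>) * v powr \<theta>"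
    using False assms by (intro mult_right_mono powr_mono2') auto
  finally show ?thesis using assms by simp
qed

lemma small_powr_coefficient:
  assumes "\<theta> > (1::real)" "e > 0" "K \<ge> 0"
  obtains c where "c > 0" "c powr (1 - \<theta>) * K < e"
proof
  define c where "c = (e / (K + 1)) powr (1 / (1 - \<theta>))"
  show "c > 0" using assms by (simp add: c_def)
  have "c powr (1 - \<theta>) = e / (K + 1)" using assms by (simp add: c_def powr_powr)
  moreover have "e / (K + 1) * K < e" using assms by (simp add: field_simps)
  ultimately show "c powr (1 - \<theta>) * K < e" by simp
qed

text \<open>A hyperplane between the epigraph of \<open>g y0\<close> and a point just below its
  graph gives an affine minorant nearly touching at \<open>p\<close>, whose coefficients are then
  moved into the dense set \<open>D\<close>. On a large ball uniform continuity keeps it below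
  \<open>g (y n)\<close> for late \<open>n\<close>; outside the ball the term
  \<open>\<epsilon> * norm q powr \<theta>\<close> absorbs its linear growth, \<open>g\<close> being
  nonnegative. With \<open>D\<close> countable, countably many affine functions serve all integrands
  simultaneously.\<close>

lemma affine_minorant:
  fixes g :: "'a::euclidean_space \<Rightarrow> 'b::euclidean_space \<Rightarrow> real"
  assumes y: "\<And>n. y n \<in> X" "y \<longlonglongrightarrow> y0" "y0 \<in> X"
    and cont: "continuous_on (X \<times> UNIV) (\<lambda>(x, q). g x q)"
    and conv: "convex_on UNIV (g y0)" and nonneg: "\<And>x q. x \<in> X \<Longrightarrow> 0 \<le> g x q"
    and \<theta>: "\<theta> > 1" and \<epsilon>: "\<epsilon> > 0" and \<eta>: "\<eta> > 0"
    and dense: "\<And>U. open U \<Longrightarrow> U \<noteq> {} \<Longrightarrow> \<exists>d\<in>D. d \<in> U"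
  shows "\<exists>(c, b)\<in>D. c + b \<bullet> p \<ge> g y0 p - \<eta> \<and> (\<exists>N. \<forall>n\<ge>N. \<forall>q. c + b \<bullet> q - \<epsilon> * norm q powr \<theta> \<le> g (y n) q)"
proof -
  have cont0: "continuous_on UNIV (g y0)"
  proof -
    have "continuous_on UNIV (\<lambda>q::'b. (y0, q))" by (intro continuous_intros)
    from continuous_on_compose2[OF cont this] show ?thesis using y(3) by auto
  qed
  define E where "E = {(q, v). g y0 q \<le> v}"
  have "convex E"
  proof -
    have "E = epigraph UNIV (g y0)" by (auto simp: E_def epigraph_def)
    then show ?thesis using conv convex_epigraph[of UNIV "g y0"] by simp
  qed
  moreover have "closed E"
  proof -
    have "closed {z::'b \<times> real. g y0 (fst z) \<le> snd z}"
    proof (intro closed_Collect_le continuous_on_snd continuous_on_id)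
      show "continuous_on UNIV (\<lambda>z::'b \<times> real. g y0 (fst z))"
        by (rule continuous_on_compose2[OF cont0]) (auto intro: continuous_intros)
    qed
    moreover have "E = {z. g y0 (fst z) \<le> snd z}" by (auto simp: E_def)
    ultimately show ?thesis by simp
  qed
  moreover have "(p, g y0 p - \<eta> / 4) \<notin> E" using \<eta> by (simp add: E_def)
  ultimately obtain a s where a: "inner a (p, g y0 p - \<eta> / 4) < s" "\<And>z. z \<in> E \<Longrightarrow> s < inner a z"
    using separating_hyperplane_closed_point[of E] by blast
  obtain a1 a2 where a12: "a = (a1, a2)" by (cases a)
  have sep: "s < a1 \<bullet> q + a2 * g y0 q" for q
    using a(2)[of "(q, g y0 q)"] by (simp add: E_def a12 inner_prod_def)
  have below: "a1 \<bullet> p + a2 * (g y0 p - \<eta> / 4) < s" using a(1) by (simp add: a12 inner_prod_def)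
  \<comment> \<open>The hyperplane is not vertical, since it separates a point of the graph from the
    point directly below it.\<close>
  have "a2 * (\<eta> / 4) > 0" using below sep[of p] by (simp add: algebra_simps)
  then have a2: "a2 > 0" using \<eta> by (simp add: zero_less_mult_iff)
  define b1 where "b1 = (- 1 / a2) *\<^sub>R a1"
  define c1 where "c1 = s / a2 - \<eta> / 4"
  have b1q: "c1 + b1 \<bullet> q + \<eta> / 4 = (s - a1 \<bullet> q) / a2" for q
    by (simp add: b1_def c1_def diff_divide_distrib)
  have min1: "c1 + b1 \<bullet> q + \<eta> / 4 \<le> g y0 q" for q
    using sep[of q] a2 unfolding b1q by (simp add: pos_divide_le_eq mult.commute)
  have "(g y0 p - \<eta> / 4) * a2 < s - a1 \<bullet> p" using below by (simp add: algebra_simps)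
  then have "g y0 p - \<eta> / 4 < (s - a1 \<bullet> p) / a2" by (simp only: pos_less_divide_eq[OF a2])
  then have min2: "g y0 p - \<eta> / 2 \<le> c1 + b1 \<bullet> p"
    unfolding b1q[symmetric] by simp
  \<comment> \<open>For \<open>norm q \<ge> 1\<close> the affine function is at most
    \<open>k * norm q\<close>; the summand 2 allows both coefficients to be perturbed by up to 1.
    From \<open>R\<close> on, \<open>\<epsilon> * norm q powr \<theta>\<close> overtakes this linear
    bound.\<close>
  define k where "k = \<bar>c1\<bar> + norm b1 + 2"
  have k: "k > 0" by (simp add: k_def add_nonneg_pos)
  define R where "R = max 1 ((k / \<epsilon>) powr (1 / (\<theta> - 1)))"
  have R: "R \<ge> 1" by (simp add: R_def)
  have big: "k * norm q \<le> \<epsilon> * norm q powr \<theta>" if "norm q \<ge> R" for q :: 'b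
  proof -
    have pos: "norm q > 0" using that R by linarith
    have "k / \<epsilon> = ((k / \<epsilon>) powr (1 / (\<theta> - 1))) powr (\<theta> - 1)" using \<theta> k \<epsilon> by (simp add: powr_powr)
    also have "\<dots> \<le> norm q powr (\<theta> - 1)"
      using that \<theta> by (intro powr_mono2) (auto simp: R_def)
    finally have "k \<le> \<epsilon> * norm q powr (\<theta> - 1)" using \<epsilon> by (simp add: field_simps)
    then have "k * norm q \<le> \<epsilon> * norm q powr (\<theta> - 1) * norm q" by (rule mult_right_mono) simp
    moreover have "norm q powr (\<theta> - 1) * norm q = norm q powr \<theta>"
      using pos powr_add[of "norm q" "\<theta> - 1" 1] by simp
    ultimately show ?thesis by (simp only: mult.assoc)
  qed
  \<comment> \<open>A convergent sequence together with its limit is compact, which makes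
    \<open>g\<close> uniformly continuous on \<open>K \<times> cball 0 R\<close>.\<close>
  define K where "K = insert y0 (range y)"
  have K: "compact K" unfolding K_def by (rule compact_sequence_with_limit[OF y(2)])
  have KX: "K \<subseteq> X" using y by (auto simp: K_def)
  have "uniformly_continuous_on (K \<times> cball 0 R) (\<lambda>(x, q). g x q)"
    using K KX by (intro compact_uniformly_continuous continuous_on_subset[OF cont] compact_Times) auto
  note unif = this
  have e8: "0 < \<eta> / 8" using \<eta> by simp
  from unif[unfolded uniformly_continuous_on_def, rule_format, OF e8]
  obtain \<delta> where \<delta>0: "\<delta> > 0" "\<forall>z\<in>K \<times> cball 0 R. \<forall>z'\<in>K \<times> cball 0 R. dist z' z < \<delta> \<longrightarrow>
      dist ((\<lambda>(x, q). g x q) z') ((\<lambda>(x, q). g x q) z) < \<eta> / 8"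
    by (elim exE conjE)
  note \<delta> = \<delta>0(1) \<delta>0(2)[rule_format]
  obtain N where N: "\<And>n. n \<ge> N \<Longrightarrow> dist (y n) y0 < \<delta>"
    using metric_LIMSEQ_D[OF y(2) \<delta>(1)] by blast
  have near: "g y0 q - \<eta> / 8 \<le> g (y n) q" if "n \<ge> N" "norm q \<le> R" for n q
  proof -
    have "dist ((\<lambda>(x, q). g x q) (y n, q)) ((\<lambda>(x, q). g x q) (y0, q)) < \<eta> / 8"
      using N[OF that(1)] that(2) by (intro \<delta>(2)) (auto simp: K_def dist_Pair_Pair)
    then have "\<bar>g (y n) q - g y0 q\<bar> < \<eta> / 8" by (simp add: dist_real_def)
    then show ?thesis by linarith
  qed
  \<comment> \<open>Moving the coefficients costs at most \<open>\<eta> / 8\<close> on the ball of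
    radius \<open>R\<close> and at \<open>p\<close>. With \<open>\<eta> / 8\<close> from uniform
    continuity this uses up the margin \<open>\<eta> / 4\<close> built into
    \<open>c1\<close>.\<close>
  define r where "r = min 1 (\<eta> / (8 * (R + norm p + 1)))"
  have "0 \<le> R + norm p" using R by (intro add_nonneg_nonneg) auto
  then have den: "8 * (R + norm p + 1) > 0" by simp
  have r: "r > 0" "r \<le> 1" using \<eta> den by (auto simp: r_def)
  have rR: "r * (R + norm p + 1) \<le> \<eta> / 8"
  proof -
    define w where "w = R + norm p + 1"
    have w: "w > 0" using den by (simp add: w_def)
    have "r * w \<le> \<eta> / (8 * w) * w"
      using w by (intro mult_right_mono) (auto simp: r_def w_def)
    also have "\<dots> = \<eta> / 8" using w by simp
    finally show ?thesis by (simp add: w_def)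
  qed
  obtain d where d: "d \<in> D" "d \<in> ball c1 r \<times> ball b1 r"
    using dense[of "ball c1 r \<times> ball b1 r"] r by (auto intro: open_Times)
  obtain c b where cb: "d = (c, b)" by (cases d)
  have c: "\<bar>c - c1\<bar> < r" and b: "norm (b - b1) < r"
    using d(2) by (auto simp: cb dist_real_def dist_norm norm_minus_commute abs_minus_commute)
  have diff: "\<bar>b \<bullet> q - b1 \<bullet> q\<bar> \<le> r * norm q" for q
  proof -
    have "\<bar>(b - b1) \<bullet> q\<bar> \<le> norm (b - b1) * norm q" by (rule Cauchy_Schwarz_ineq2)
    also have "\<dots> \<le> r * norm q" using b by (intro mult_right_mono) auto
    finally show ?thesis by (simp add: inner_diff_left)
  qed
  have rsplit: "r * (R + norm p + 1) = r * R + r * norm p + r" by (simp add: algebra_simps)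
  have nn: "0 \<le> r * R" "0 \<le> r * norm p" using r R by auto
  show ?thesis
  proof (rule bexI[of _ d])
    show "case d of (c, b) \<Rightarrow> c + b \<bullet> p \<ge> g y0 p - \<eta> \<and> (\<exists>N. \<forall>n\<ge>N. \<forall>q. c + b \<bullet> q - \<epsilon> * norm q powr \<theta> \<le> g (y n) q)"
      unfolding cb prod.case
    proof (intro conjI exI[of _ N] allI impI)
      show "g y0 p - \<eta> \<le> c + b \<bullet> p"
        using min2 c diff[of p] rR rsplit nn \<eta> by linarith
      fix n q assume n: "N \<le> n"
      show "c + b \<bullet> q - \<epsilon> * norm q powr \<theta> \<le> g (y n) q"
      proof (cases "norm q \<le> R")
        case True
        have "r * norm q \<le> r * R" using True r by (intro mult_left_mono) auto
        then have "c + b \<bullet> q \<le> g (y n) q"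
          using near[OF n True] min1[of q] c diff[of q] rR rsplit nn by linarith
        moreover have "0 \<le> \<epsilon> * norm q powr \<theta>" using \<epsilon> by simp
        ultimately show ?thesis by linarith
      next
        case False
        then have q1: "norm q \<ge> 1" using R by linarith
        have "c + b \<bullet> q \<le> (\<bar>c1\<bar> + 1) + (norm b1 * norm q + 1 * norm q)"
        proof -
          have "b1 \<bullet> q \<le> norm b1 * norm q" by (rule norm_cauchy_schwarz)
          moreover have "r * norm q \<le> 1 * norm q" using r by (intro mult_right_mono) auto
          ultimately show ?thesis using c r diff[of q] by linarith
        qed
        also have "\<dots> \<le> (\<bar>c1\<bar> + 1) * norm q + (norm b1 * norm q + 1 * norm q)"
          using q1 mult_left_mono[OF q1, of "\<bar>c1\<bar> + 1"] by simp
        also have "\<dots> = k * norm q" by (simp add: k_def algebra_simps)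
        also have "\<dots> \<le> \<epsilon> * norm q powr \<theta>" using False by (intro big) auto
        finally show ?thesis using nonneg[OF y(1)[of n], of q] by linarith
      qed
    qed
  qed (rule d)
qed

text \<open>By the superlinear inequality the integral over \<open>D\<close> is at most
  \<open>c * measure M D\<close> plus a small multiple of \<open>K\<close>: \<open>c\<close> is
  chosen for the second term, then the measure of \<open>D\<close> for the first.\<close>

lemma (in finite_measure) uniformly_integrable_powr:
  fixes p :: "nat \<Rightarrow> 'a \<Rightarrow> 'b::euclidean_space"
  assumes p: "\<And>n. integrable M (p n)" and \<theta>: "\<theta> > 1"
    and K: "\<And>n. (\<integral>\<^sup>+ t. ennreal (norm (p n t) powr \<theta>) \<partial>M) \<le> ennreal K" "K \<ge> 0"
    and "e > 0"
  obtains \<delta> where "\<delta> > 0"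
    "\<And>n D. D \<in> sets M \<Longrightarrow> measure M D < \<delta> \<Longrightarrow> norm (LINT t:D|M. p n t) < e"
proof -
  obtain c where c: "c > 0" "c powr (1 - \<theta>) * K < e / 2"
    using small_powr_coefficient[OF \<theta>, of "e / 2" K] \<open>e > 0\<close> K(2) by auto
  show ?thesis
  proof (rule that[of "e / (2 * c)"])
    show "e / (2 * c) > 0" using \<open>e > 0\<close> c by simp
    fix n D assume D: "D \<in> sets M" "measure M D < e / (2 * c)"
    have [measurable]: "p n \<in> borel_measurable M" "D \<in> sets M" using p D by auto
    have "ennreal (norm (LINT t:D|M. p n t)) \<le> (\<integral>\<^sup>+ t. ennreal (norm (indicator D t *\<^sub>R p n t)) \<partial>M)"
      unfolding set_lebesgue_integral_def
      by (intro integral_norm_bound_ennreal integrable_mult_indicator D p)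
    also have "\<dots> \<le> (\<integral>\<^sup>+ t. ennreal c * indicator D t +
      ennreal (c powr (1 - \<theta>)) * ennreal (norm (p n t) powr \<theta>) \<partial>M)"
    proof (rule nn_integral_mono)
      fix t
      show "ennreal (norm (indicator D t *\<^sub>R p n t)) \<le> ennreal c * indicator D t +
        ennreal (c powr (1 - \<theta>)) * ennreal (norm (p n t) powr \<theta>)"
        using le_powr_superlinear[of "norm (p n t)" c \<theta>] c \<theta>
        by (cases "t \<in> D") (auto simp: ennreal_mult[symmetric] ennreal_plus[symmetric] simp del: ennreal_plus
          intro!: ennreal_leI)
    qed
    also have "\<dots> = ennreal c * emeasure M D + ennreal (c powr (1 - \<theta>)) * (\<integral>\<^sup>+ t.
      ennreal (norm (p n t) powr \<theta>) \<partial>M)"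
      by (simp add: nn_integral_add nn_integral_cmult)
    also have "\<dots> \<le> ennreal c * ennreal (measure M D) + ennreal (c powr (1 - \<theta>)) * ennreal K"
      using K(1)[of n] by (intro add_mono mult_left_mono) (auto simp: emeasure_eq_measure)
    also have "\<dots> = ennreal (c * measure M D + c powr (1 - \<theta>) * K)"
      using c K(2) by (simp add: ennreal_mult[symmetric] ennreal_plus[symmetric] del: ennreal_plus)
    finally have "norm (LINT t:D|M. p n t) \<le> c * measure M D + c powr (1 - \<theta>) * K"
      using c K(2) by (subst (asm) ennreal_le_iff) auto
    moreover have "c * measure M D < e / 2"
      using mult_strict_left_mono[OF D(2) c(1)] c(1) by simp
    ultimately show "norm (LINT t:D|M. p n t) < e" using c(2) by linarith
  qed
qed

lemma set_integral_Diff_space: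
  fixes f :: "'a \<Rightarrow> 'b::euclidean_space"
  assumes "integrable M f" "A \<in> sets M"
  shows "(LINT t:space M - A|M. f t) = (LINT t:space M|M. f t) - (LINT t:A|M. f t)"
proof -
  have "(LINT t:space M - A|M. f t) = (\<integral>t. indicator (space M) t *\<^sub>R f t - indicator A t *\<^sub>R f t \<partial>M)"
    unfolding set_lebesgue_integral_def
    using sets.sets_into_space[OF assms(2)]
      by (intro Bochner_Integration.integral_cong) (auto simp: indicator_def)
  also have "\<dots> = (LINT t:space M|M. f t) - (LINT t:A|M. f t)"
    unfolding set_lebesgue_integral_def using assms
    by (intro Bochner_Integration.integral_diff integrable_mult_indicator) auto
  finally show ?thesis .
qed

text \<open>Dynkin's induction. Complements and finite disjoint unions only need sums and
  differences of limits. For a countable union, uniform integrability makes the integral over the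
  tail small uniformly in \<open>n\<close>.\<close>

lemma (in finite_measure) set_integral_tendsto_sigma_sets:
  fixes p :: "nat \<Rightarrow> 'a \<Rightarrow> 'b::euclidean_space"
  assumes p: "\<And>n. integrable M (p n)" and q: "integrable M q"
    and \<theta>: "\<theta> > 1" and K: "\<And>n. (\<integral>\<^sup>+ t. ennreal (norm (p n t) powr \<theta>) \<partial>M) \<le> ennreal K" "K \<ge> 0"
    and G: "Int_stable G" "G \<subseteq> Pow (space M)" "G \<subseteq> sets M"
    and sp: "(\<lambda>n. LINT t:space M|M. p n t) \<longlonglongrightarrow> (LINT t:space M|M. q t)"
    and conv: "\<And>D. D \<in> G \<Longrightarrow> (\<lambda>n. LINT t:D|M. p n t) \<longlonglongrightarrow> (LINT t:D|M. q t)"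
    and D: "D \<in> sigma_sets (space M) G"
  shows "(\<lambda>n. LINT t:D|M. p n t) \<longlonglongrightarrow> (LINT t:D|M. q t)"
proof -
  have sub: "sigma_sets (space M) G \<subseteq> sets M" using G(3) by (rule sets.sigma_sets_subset)
  show ?thesis
    using G(1,2) D
  proof (induction rule: sigma_sets_induct_disjoint)
    case (basic A)
    then show ?case by (rule conv)
  next
    case empty
    then show ?case by (simp add: set_lebesgue_integral_def)
  next
    case (compl A)
    then have "A \<in> sets M" using sub by blast
    then show ?case
      using tendsto_diff[OF sp compl.IH] p q by (simp add: set_integral_Diff_space)
  next
    case (union A)
    have Am: "A i \<in> sets M" for i using union(2) sub by blast
    define E where "E k = (\<Union>i<k. A i)" for k
    have Em: "E k \<in> sets M" for k unfolding E_def using Am by auto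
    have UE: "(\<Union>i. A i) = (\<Union>k. E k)" unfolding E_def by blast
    have inc: "incseq E" unfolding E_def by (intro incseq_SucI) (auto simp: lessThan_Suc)
    have si: "set_integrable M B f" if "B \<in> sets M" "integrable M f" for B and f :: "'a \<Rightarrow> 'b"
      unfolding set_integrable_def using that by (rule integrable_mult_indicator)
    have Ec: "(\<lambda>n. LINT t:E k|M. p n t) \<longlonglongrightarrow> (LINT t:E k|M. q t)" for k
    proof (induction k)
      case 0
      then show ?case by (simp add: E_def set_lebesgue_integral_def)
    next
      case (Suc k)
      have "E (Suc k) = E k \<union> A k" by (auto simp: E_def lessThan_Suc)
      moreover have "E k \<inter> A k = {}" unfolding E_def
        using union(1) unfolding disjoint_family_on_def by (auto simp: set_eq_iff) (metis less_irrefl)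
      ultimately have "(LINT t:E (Suc k)|M. f t) = (LINT t:E k|M. f t) + (LINT t:A k|M. f t)"
        if "integrable M f" for f :: "'a \<Rightarrow> 'b"
        using si that Em Am by (simp add: set_integral_Un)
      then show ?case using tendsto_add[OF Suc union(3)[of k]] p q by simp
    qed
    have UM: "(\<Union>i. A i) \<in> sets M" using Am by auto
    have Eq: "(\<lambda>k. LINT t:E k|M. q t) \<longlonglongrightarrow> (LINT t:(\<Union>i. A i)|M. q t)"
      unfolding UE using inc Em si[OF UM[unfolded UE] q] by (intro set_integral_cont_up) auto
    have mE: "(\<lambda>k. measure M (E k)) \<longlonglongrightarrow> measure M (\<Union>i. A i)"
      unfolding UE using inc Em by (intro finite_Lim_measure_incseq) auto
    show ?case
    proof (rule LIMSEQ_I)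
      fix e :: real assume "e > 0"
      obtain \<delta> where \<delta>: "\<delta> > 0" "\<And>n D. D \<in> sets M \<Longrightarrow> measure M D < \<delta> \<Longrightarrow> norm (LINT t:D|M. p n t) < e / 3"
      proof -
        have "e / 3 > 0" using \<open>e > 0\<close> by simp
        from uniformly_integrable_powr[where p = p, OF p \<theta> K this] show ?thesis using that by blast
      qed
      obtain k1 where k1: "\<And>k. k \<ge> k1 \<Longrightarrow> norm (measure M (E k) - measure M (\<Union>i. A i)) < \<delta>"
        using LIMSEQ_D[OF mE \<delta>(1)] by blast
      obtain k2 where k2: "\<And>k. k \<ge> k2 \<Longrightarrow> norm ((LINT t:E k|M. q t) - (LINT t:(\<Union>i. A i)|M. q t)) < e / 3"
        using LIMSEQ_D[OF Eq, of "e / 3"] \<open>e > 0\<close> by auto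
      define k where "k = max k1 k2"
      obtain N where N: "\<And>n. n \<ge> N \<Longrightarrow> norm ((LINT t:E k|M. p n t) - (LINT t:E k|M. q t)) < e / 3"
        using LIMSEQ_D[OF Ec[of k], of "e / 3"] \<open>e > 0\<close> by auto
      have Esub: "E k \<subseteq> (\<Union>i. A i)" by (auto simp: E_def)
      have "measure M ((\<Union>i. A i) - E k) = measure M (\<Union>i. A i) - measure M (E k)"
        using UM Em Esub by (intro finite_measure_Diff) auto
      then have small: "measure M ((\<Union>i. A i) - E k) < \<delta>" using k1[of k] by (simp add: k_def)
      show "\<exists>no. \<forall>n\<ge>no. norm ((LINT t:(\<Union>i. A i)|M. p n t) - (LINT t:(\<Union>i. A i)|M. q t)) < e"
      proof (intro exI[of _ N] allI impI)
        fix n assume n: "N \<le> n"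
        have "(LINT t:(\<Union>i. A i)|M. p n t) = (LINT t:E k \<union> ((\<Union>i. A i) - E k)|M. p n t)"
          using Esub by (simp add: Un_absorb1)
        also have "\<dots> = (LINT t:E k|M. p n t) + (LINT t:(\<Union>i. A i) - E k|M. p n t)"
          using UM Em by (intro set_integral_Un si p) auto
        finally have eq: "(LINT t:(\<Union>i. A i)|M. p n t) - (LINT t:(\<Union>i. A i)|M. q t) =
          ((LINT t:E k|M. p n t) - (LINT t:E k|M. q t)) + (LINT t:(\<Union>i. A i) - E k|M. p n t)
          + ((LINT t:E k|M. q t) - (LINT t:(\<Union>i. A i)|M. q t))" by simp
        have "norm (LINT t:(\<Union>i. A i) - E k|M. p n t) < e / 3" using UM Em small by (intro \<delta>(2)) auto
        moreover have "norm ((LINT t:E k|M. q t) - (LINT t:(\<Union>i. A i)|M. q t)) < e / 3"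
          by (rule k2) (simp add: k_def)
        moreover note N[OF n]
        ultimately have "norm ((LINT t:E k|M. p n t) - (LINT t:E k|M. q t)) + norm (LINT t:(\<Union>i. A i) - E k|M.
          p n t)
          + norm ((LINT t:E k|M. q t) - (LINT t:(\<Union>i. A i)|M. q t)) < e" by linarith
        then show "norm ((LINT t:(\<Union>i. A i)|M. p n t) - (LINT t:(\<Union>i. A i)|M. q t)) < e"
          unfolding eq
            by (rule le_less_trans[OF order_trans[OF norm_triangle_ineq add_right_mono[OF norm_triangle_ineq]]])
      qed
    qed
  qed
qed

text \<open>Initial intervals form an intersection-stable generator of the Borel sets, and a
  Lebesgue set differs from a Borel set by a null set. For velocities the integrals over initial
  intervals are increments of curves, so \<open>conv\<close> will be nothing but pointwise
  convergence of the curves.\<close>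

lemma set_integral_tendsto_lebesgue_on:
  fixes p :: "nat \<Rightarrow> real \<Rightarrow> 'b::euclidean_space" and a b :: real
  defines "M \<equiv> lebesgue_on {a..b}"
  assumes p: "\<And>n. integrable M (p n)" and q: "integrable M q"
    and \<theta>: "\<theta> > 1" and K: "\<And>n. (\<integral>\<^sup>+ t. ennreal (norm (p n t) powr \<theta>) \<partial>M) \<le> ennreal K" "K \<ge> 0"
    and conv: "\<And>s. s \<in> {a..b} \<Longrightarrow> (\<lambda>n. LINT t:{a..s}|M. p n t) \<longlonglongrightarrow> (LINT t:{a..s}|M. q t)"
    and "a \<le> b" and D: "D \<in> sets M"
  shows "(\<lambda>n. LINT t:D|M. p n t) \<longlonglongrightarrow> (LINT t:D|M. q t)"
proof -
  have sM: "space M = {a..b}" by (simp add: M_def)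
  interpret finite_measure M unfolding M_def by (rule finite_measure_lebesgue_on) auto
  define G where "G = (\<lambda>s. {a..s}) ` {a..b} \<union> {{}}"
  have setsM: "B \<in> sets M \<longleftrightarrow> B \<in> sets lebesgue \<and> B \<subseteq> {a..b}" for B
    unfolding M_def by (subst sets_restrict_space_iff) auto
  have gen: "{a..b} \<inter> B \<in> sigma_sets {a..b} G" if "B \<in> sets borel" for B
  proof -
    have "B \<in> sigma_sets UNIV (range (\<lambda>s::real. {..s}))"
      using that unfolding borel_eq_atMost by (simp add: sets_measure_of)
    then show ?thesis
    proof induction
      case (Basic B)
      then obtain s where "B = {..s}" by auto
      then have "{a..b} \<inter> B = (if s < a then {} else {a..min s b})" by auto
      moreover have "(if s < a then {} else {a..min s b}) \<in> G" using \<open>a \<le> b\<close> by (auto simp: G_def)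
      ultimately show ?case by auto
    next
      case Empty
      then show ?case by (simp add: sigma_sets.Empty)
    next
      case (Compl B)
      have "{a..b} \<inter> (UNIV - B) = {a..b} - {a..b} \<inter> B" by auto
      then show ?case using sigma_sets.Compl[OF Compl.IH] by simp
    next
      case (Union B)
      have "{a..b} \<inter> (\<Union>i. B i) = (\<Union>i. {a..b} \<inter> B i)" by auto
      then show ?case using sigma_sets.Union[of "\<lambda>i. {a..b} \<inter> B i", OF Union.IH] by simp
    qed
  qed
  have borel: "(\<lambda>n. LINT t:D|M. p n t) \<longlonglongrightarrow> (LINT t:D|M. q t)" if "D \<in> sigma_sets {a..b} G" for D
  proof (rule set_integral_tendsto_sigma_sets[OF p q \<theta> K, of G])
    show "Int_stable G"
    proof (rule Int_stableI)
      fix A B assume "A \<in> G" "B \<in> G"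
      then consider "A = {}" | "B = {}" | s t where "A = {a..s}" "B = {a..t}" "s \<in> {a..b}" "t \<in> {a..b}"
        by (auto simp: G_def)
      then show "A \<inter> B \<in> G"
      proof cases
        case 3
        then have "A \<inter> B = {a..min s t}" "min s t \<in> {a..b}" by auto
        then show ?thesis by (simp add: G_def)
      qed (auto simp: G_def)
    qed
    show "G \<subseteq> Pow (space M)" "G \<subseteq> sets M" by (auto simp: G_def sM setsM)
    show "(\<lambda>n. LINT t:space M|M. p n t) \<longlonglongrightarrow> (LINT t:space M|M. q t)"
      unfolding sM using \<open>a \<le> b\<close> by (intro conv) auto
    show "(\<lambda>n. LINT t:D|M. p n t) \<longlonglongrightarrow> (LINT t:D|M. q t)" if "D \<in> G" for D
      using that conv by (auto simp: G_def set_lebesgue_integral_def)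
    show "D \<in> sigma_sets (space M) G" using that by (simp add: sM)
  qed
  have "D \<in> sets (completion lborel)" using D setsM by simp
  then obtain S N N' where SN: "D = S \<union> N" "N \<subseteq> N'" "N' \<in> null_sets lborel" "S \<in> sets lborel"
    by (rule sets_completionE) auto
  have N': "AE t in M. t \<notin> N'"
  proof -
    have "AE t in lebesgue. t \<notin> N'" using SN(3) by (intro AE_not_in null_sets_completionI)
    then show ?thesis unfolding M_def by (subst AE_restrict_space_iff) (auto elim: eventually_mono)
  qed
  have S: "{a..b} \<inter> S \<in> sets M" using SN(4) setsM by auto
  have eq: "(LINT t:D|M. f t) = (LINT t:{a..b} \<inter> S|M. f t)" if "integrable M f" for f :: "real \<Rightarrow> 'b"
    unfolding set_lebesgue_integral_def
  proof (rule integral_cong_AE)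
    show "(\<lambda>t. indicator D t *\<^sub>R f t) \<in> borel_measurable M"
      "(\<lambda>t. indicator ({a..b} \<inter> S) t *\<^sub>R f t) \<in> borel_measurable M"
      using that D S by (intro borel_measurable_scaleR borel_measurable_indicator; simp)+
    show "AE t in M. indicator D t *\<^sub>R f t = indicator ({a..b} \<inter> S) t *\<^sub>R f t"
      using N' AE_space
    proof eventually_elim
      case (elim t)
      then have "t \<in> D \<longleftrightarrow> t \<in> {a..b} \<inter> S" using SN(1,2) by (auto simp: sM)
      then show ?case by (simp add: indicator_def)
    qed
  qed
  have "S \<in> sets borel" using SN(4) by simp
  from borel[OF gen[OF this]] show ?thesis unfolding eq[OF p] eq[OF q] .
qed

text \<open>The space is split into countably many measurable pieces. On each, one affine function
  lies below \<open>f t (x n t)\<close> up to \<open>\<epsilon>\<close> times the power, for all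
  \<open>n\<close> past a fixed index, and nearly touches \<open>f t (x0 t)\<close> at
  \<open>p0 t\<close>. On finitely many pieces the resulting piecewise affine functional is
  continuous for the weak convergence; then the pieces exhaust the space and
  \<open>\<epsilon>\<close>, \<open>\<eta>\<close> tend to 0.\<close>

theorem (in finite_measure) nn_integral_convex_lsc:
  fixes f :: "'a \<Rightarrow> 'y::euclidean_space \<Rightarrow> 'b::euclidean_space \<Rightarrow> real"
  assumes cont: "AE t in M. continuous_on (X \<times> UNIV) (\<lambda>(y, q). f t y q)"
    and conv: "AE t in M. convex_on UNIV (f t (x0 t))"
    and nonneg: "\<And>t y q. t \<in> space M \<Longrightarrow> y \<in> X \<Longrightarrow> 0 \<le> f t y q"
    and x: "\<And>n t. t \<in> space M \<Longrightarrow> x n t \<in> X" "\<And>t. t \<in> space M \<Longrightarrow> x0 t \<in> X"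
      "\<And>t. t \<in> space M \<Longrightarrow> (\<lambda>n. x n t) \<longlonglongrightarrow> x0 t"
    and meas: "\<And>n q. (\<lambda>t. f t (x n t) q) \<in> borel_measurable M"
      "\<And>n. (\<lambda>t. f t (x n t) (p n t)) \<in> borel_measurable M"
      "(\<lambda>t. f t (x0 t) (p0 t)) \<in> borel_measurable M"
    and p: "\<And>n. integrable M (p n)" "integrable M p0"
    and \<theta>: "\<theta> > 1" and K: "\<And>n. (\<integral>\<^sup>+ t. ennreal (norm (p n t) powr \<theta>) \<partial>M) \<le> ennreal K" "K \<ge> 0"
    and weak: "\<And>D. D \<in> sets M \<Longrightarrow> (\<lambda>n. LINT t:D|M. p n t) \<longlonglongrightarrow> (LINT t:D|M. p0 t)"
    and le: "\<And>n. (\<integral>\<^sup>+ t. ennreal (f t (x n t) (p n t)) \<partial>M) \<le> ennreal A" "A \<ge> 0"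
  shows "(\<integral>\<^sup>+ t. ennreal (f t (x0 t) (p0 t)) \<partial>M) \<le> ennreal A"
proof -
  note [measurable] = meas borel_measurable_integrable[OF p(1)] borel_measurable_integrable[OF p(2)]
  define B where "B = measure M (space M)"
  have key: "(\<integral>\<^sup>+ t. ennreal (f t (x0 t) (p0 t)) \<partial>M) \<le> ennreal (A + \<epsilon> * K + \<eta> * B)"
    if \<epsilon>: "\<epsilon> > 0" and \<eta>: "\<eta> > 0" for \<epsilon> \<eta>
  proof -
    obtain D0 :: "(real \<times> 'b) set" where D0: "countable D0" "\<And>U. open U \<Longrightarrow> U \<noteq> {} \<Longrightarrow> \<exists>d\<in>D0. d \<in> U"
      using countable_dense_exists by metis
    obtain Q :: "'b set" where Q: "countable Q" "\<And>U. open U \<Longrightarrow> U \<noteq> {} \<Longrightarrow> \<exists>d\<in>Q. d \<in> U"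
      using countable_dense_exists by metis
    have D0ne: "D0 \<noteq> {}" using D0(2)[of UNIV] by auto
    define qs where "qs = from_nat_into Q"
    define d where "d j = from_nat_into D0 (fst (prod_decode j))" for j
    define N where "N j = snd (prod_decode j)" for j
    define cc where "cc j = fst (d j)" for j
    define bb where "bb j = snd (d j)" for j
    \<comment> \<open>The number \<open>j\<close> encodes an affine function and the index from
      which it is a minorant. The inequality is demanded only at the countable dense set of points
      \<open>qs i\<close>, which keeps \<open>G j\<close> measurable; continuity in the velocity
      extends it to all points when it is used.\<close>
    define G where "G j = {t \<in> space M. (\<forall>n i. N j \<le> n \<longrightarrow>
      cc j + bb j \<bullet> qs i - \<epsilon> * norm (qs i) powr \<theta> \<le> f t (x n t) (qs i)) \<and>
       f t (x0 t) (p0 t) - \<eta> \<le> cc j + bb j \<bullet> p0 t}" for j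
    have G [measurable]: "G j \<in> sets M" for j
      unfolding G_def by measurable
    have cover: "AE t in M. \<exists>j. t \<in> G j"
      using cont conv AE_space
    proof eventually_elim
      case (elim t)
      have "\<exists>(c, b)\<in>D0. c + b \<bullet> p0 t \<ge> f t (x0 t) (p0 t) - \<eta> \<and>
        (\<exists>N. \<forall>n\<ge>N. \<forall>q. c + b \<bullet> q - \<epsilon> * norm q powr \<theta> \<le> f t (x n t) q)"
        by (rule affine_minorant[where X = X, OF x(1)[OF elim(3)] x(3)[OF elim(3)] x(2)[OF elim(3)] elim(1,2)
          nonneg[OF elim(3)] \<theta> \<epsilon> \<eta> D0(2)])
      then obtain d0 N0 where d0: "d0 \<in> D0" "fst d0 + snd d0 \<bullet> p0 t \<ge> f t (x0 t) (p0 t) - \<eta>"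
        "\<forall>n\<ge>N0. \<forall>q. fst d0 + snd d0 \<bullet> q - \<epsilon> * norm q powr \<theta> \<le> f t (x n t) q" by auto
      obtain i where i: "from_nat_into D0 i = d0" using from_nat_into_surj[OF D0(1) d0(1)] by blast
      have "t \<in> G (prod_encode (i, N0))"
        using d0 i elim(3) by (simp add: G_def cc_def bb_def N_def d_def)
      then show ?case by blast
    qed
    define DJ where "DJ = disjointed G"
    have DJ [measurable]: "DJ j \<in> sets M" for j
      unfolding DJ_def using G sets.range_disjointed_sets[of G M] by blast
    have dj: "disjoint_family DJ" unfolding DJ_def by (rule disjoint_family_disjointed)
    have DJG: "DJ j \<subseteq> G j" for j unfolding DJ_def by (rule disjointed_subset)
    have UDJ: "(\<Union>j<k. DJ j) = (\<Union>j<k. G j)" for k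
      unfolding DJ_def using finite_UN_disjointed_eq[of G k] by (simp add: atLeast0LessThan)
    define E where "E k = (\<Union>j<k. DJ j)" for k
    have E [measurable]: "E k \<in> sets M" for k unfolding E_def by auto
    have step: "(\<integral>\<^sup>+ t. ennreal (f t (x0 t) (p0 t)) * indicator (E k) t \<partial>M) \<le> ennreal (A + \<epsilon> * K + \<eta> * B)" for k
    proof -
      \<comment> \<open>Its integral is a finite combination of set integrals of \<open>r\<close>,
        which is why it passes to the weak limit.\<close>
      define \<phi> where "\<phi> r t = (\<Sum>j<k. indicator (DJ j) t * (cc j + bb j \<bullet> r t))" for r :: "'a \<Rightarrow> 'b" and t
      have \<phi>_in: "\<phi> r t = cc j + bb j \<bullet> r t" if "t \<in> DJ j" "j < k" for r t j
      proof -
        have "\<phi> r t = (\<Sum>i\<in>{j}. indicator (DJ i) t * (cc i + bb i \<bullet> r t))"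
          unfolding \<phi>_def
        proof (rule sum.mono_neutral_right)
          show "\<forall>i\<in>{..<k} - {j}. indicator (DJ i) t * (cc i + bb i \<bullet> r t) = 0"
            using dj that unfolding disjoint_family_on_def by (auto simp: indicator_def)
        qed (use that in auto)
        then show ?thesis using that by simp
      qed
      have \<phi>_out: "\<phi> r t = 0" if "t \<notin> E k" for r t
        using that by (auto simp: \<phi>_def E_def intro!: sum.neutral)
      have si: "integrable M (\<lambda>t. indicator (DJ j) t * (cc j + bb j \<bullet> r t))" if "integrable M r" for r j
      proof -
        have "integrable M (\<lambda>t. cc j + bb j \<bullet> r t)" using that by auto
        from integrable_mult_indicator[OF DJ this] show ?thesis by simp
      qed
      have \<phi>i: "integrable M (\<phi> r)" if "integrable M r" for r
        unfolding \<phi>_def[abs_def] by (intro Bochner_Integration.integrable_sum si that)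
      have \<phi>int: "(\<integral>t. \<phi> r t \<partial>M) = (\<Sum>j<k. cc j * measure M (DJ j) + bb j \<bullet> (LINT t:DJ j|M. r t))"
        if r: "integrable M r" for r
      proof -
        have "(\<integral>t. \<phi> r t \<partial>M) = (\<Sum>j<k. \<integral>t. indicator (DJ j) t * (cc j + bb j \<bullet> r t) \<partial>M)"
          unfolding \<phi>_def by (intro Bochner_Integration.integral_sum si r)
        also have "\<dots> = (\<Sum>j<k. cc j * measure M (DJ j) + bb j \<bullet> (LINT t:DJ j|M. r t))"
        proof (rule sum.cong[OF refl])
          fix j
          have ir: "integrable M (\<lambda>t. indicator (DJ j) t *\<^sub>R r t)" by (rule integrable_mult_indicator[OF DJ r])
          have "(\<integral>t. indicator (DJ j) t * (cc j + bb j \<bullet> r t) \<partial>M) = (\<integral>t. cc j * indicator (DJ j) t +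
            bb j \<bullet> (indicator (DJ j) t *\<^sub>R r t) \<partial>M)"
            by (intro Bochner_Integration.integral_cong) (auto simp: algebra_simps)
          also have "\<dots> = (\<integral>t. cc j * indicator (DJ j) t \<partial>M) + (\<integral>t. bb j \<bullet> (indicator (DJ j) t *\<^sub>R r t) \<partial>M)"
            by (intro Bochner_Integration.integral_add integrable_inner_right ir)
              (use integrable_real_indicator[OF DJ] emeasure_finite in \<open>auto simp: less_top[symmetric]\<close>)
          also have "\<dots> = cc j * measure M (DJ j) + bb j \<bullet> (LINT t:DJ j|M. r t)"
            unfolding set_lebesgue_integral_def integral_inner_right[OF ir] by simp
          finally show "(\<integral>t. indicator (DJ j) t * (cc j + bb j \<bullet> r t) \<partial>M) = \<dots>" .
        qed
        finally show ?thesis .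
      qed
      have lim: "(\<lambda>n. \<integral>t. \<phi> (p n) t \<partial>M) \<longlonglongrightarrow> (\<integral>t. \<phi> p0 t \<partial>M)"
        unfolding \<phi>int[OF p(1)] \<phi>int[OF p(2)] by (intro tendsto_intros weak DJ)
      define n0 where "n0 = Max (N ` {..k})"
      have n0: "N j \<le> n0" if "j < k" for j unfolding n0_def using that by (intro Max_ge) auto
      have upper: "(\<integral>t. \<phi> (p n) t \<partial>M) \<le> A + \<epsilon> * K" if n: "n \<ge> n0" for n
      proof -
        \<comment> \<open>Adding the power turns the approximate minorant into a genuine one, at the
          price \<open>\<epsilon> * K\<close> in the integral.\<close>
        define F where "F t = f t (x n t) (p n t) + \<epsilon> * norm (p n t) powr \<theta>" for t
        have [measurable]: "F \<in> borel_measurable M" unfolding F_def by measurable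
        have F0: "AE t in M. 0 \<le> F t" using AE_space nonneg x(1) \<epsilon> by (auto simp: F_def elim!: eventually_mono)
        have "(\<integral>\<^sup>+ t. ennreal (F t) \<partial>M) = (\<integral>\<^sup>+ t. ennreal (f t (x n t) (p n t)) +
          ennreal \<epsilon> * ennreal (norm (p n t) powr \<theta>) \<partial>M)"
          using nonneg x(1) \<epsilon> by (intro nn_integral_cong) (simp add: F_def ennreal_mult)
        also have "\<dots> = (\<integral>\<^sup>+ t. ennreal (f t (x n t) (p n t)) \<partial>M) + ennreal \<epsilon> * (\<integral>\<^sup>+ t.
          ennreal (norm (p n t) powr \<theta>) \<partial>M)"
          by (simp add: nn_integral_add nn_integral_cmult)
        also have "\<dots> \<le> ennreal A + ennreal \<epsilon> * ennreal K"
          by (intro add_mono mult_left_mono le K) auto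
        also have "\<dots> = ennreal (A + \<epsilon> * K)" using le(2) K(2) \<epsilon> by (simp add: ennreal_mult)
        finally have Fle: "(\<integral>\<^sup>+ t. ennreal (F t) \<partial>M) \<le> ennreal (A + \<epsilon> * K)" .
        then have "(\<integral>\<^sup>+ t. ennreal (F t) \<partial>M) < \<infinity>" by (auto intro: le_less_trans)
        then have Fi: "integrable M F" using F0 by (intro integrableI_nonneg) auto
        have "(\<integral>t. \<phi> (p n) t \<partial>M) \<le> (\<integral>t. F t \<partial>M)"
        proof (rule integral_mono_AE[OF \<phi>i[OF p(1)] Fi])
          show "AE t in M. \<phi> (p n) t \<le> F t"
            using cont F0 AE_space
          proof eventually_elim
            case (elim t)
            show ?case
            proof (cases "t \<in> E k")
              case True
              then obtain j where j: "j < k" "t \<in> DJ j" by (auto simp: E_def)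
              then have tG: "t \<in> G j" using DJG by blast
              have "continuous_on UNIV (\<lambda>q::'b. (x n t, q))" by (intro continuous_intros)
              from continuous_on_compose2[OF elim(1) this] have cq: "continuous_on UNIV (f t (x n t))"
                using x(1)[OF elim(3)] by auto
              have "cc j + bb j \<bullet> q - \<epsilon> * norm q powr \<theta> \<le> f t (x n t) q" for q
              proof (rule ccontr)
                assume neg: "\<not> ?thesis"
                define U where "U = {q. f t (x n t) q < cc j + bb j \<bullet> q - \<epsilon> * norm q powr \<theta>}"
                have "open U" unfolding U_def
                proof (rule open_Collect_less[OF cq])
                  show "continuous_on UNIV (\<lambda>q. cc j + bb j \<bullet> q - \<epsilon> * norm q powr \<theta>)"
                    using \<theta> by (intro continuous_intros continuous_on_powr') auto
                qed
                moreover have "q \<in> U" using neg by (simp add: U_def)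
                ultimately obtain q' where "q' \<in> Q" "q' \<in> U" using Q(2)[of U] by blast
                moreover obtain i where "qs i = q'"
                  using from_nat_into_surj[OF Q(1) \<open>q' \<in> Q\<close>] by (auto simp: qs_def)
                moreover have "N j \<le> n" using n n0[OF j(1)] by simp
                ultimately show False using tG by (auto simp: G_def U_def not_le[symmetric])
              qed
              from this[of "p n t"] show ?thesis using \<phi>_in[OF j(2,1)] by (simp add: F_def)
            qed (use \<phi>_out elim in simp)
          qed
        qed
        also have "(\<integral>t. F t \<partial>M) \<le> A + \<epsilon> * K"
        proof -
          have "ennreal (\<integral>t. F t \<partial>M) \<le> ennreal (A + \<epsilon> * K)"
            using Fle nn_integral_eq_integral[OF Fi F0] by simp
          then show ?thesis using le(2) K(2) \<epsilon> by (subst (asm) ennreal_le_iff) auto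
        qed
        finally show ?thesis .
      qed
      have upper0: "(\<integral>t. \<phi> p0 t \<partial>M) \<le> A + \<epsilon> * K"
        using lim by (rule LIMSEQ_le_const2) (use upper in blast)
      have ge: "f t (x0 t) (p0 t) * indicator (E k) t \<le> \<phi> p0 t + \<eta> \<and> 0 \<le> \<phi> p0 t + \<eta>" if t: "t \<in> space M" for t
      proof (cases "t \<in> E k")
        case True
        then obtain j where j: "j < k" "t \<in> DJ j" by (auto simp: E_def)
        then have "t \<in> G j" using DJG by blast
        then have "f t (x0 t) (p0 t) - \<eta> \<le> cc j + bb j \<bullet> p0 t" by (simp add: G_def)
        then show ?thesis using \<phi>_in[OF j(2,1)] True nonneg[OF t x(2)[OF t], of "p0 t"] by auto
      next
        case False
        then show ?thesis using \<phi>_out \<eta> by simp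
      qed
      have "(\<integral>\<^sup>+ t. ennreal (f t (x0 t) (p0 t)) * indicator (E k) t \<partial>M) \<le> (\<integral>\<^sup>+ t. ennreal (\<phi> p0 t + \<eta>) \<partial>M)"
      proof (rule nn_integral_mono)
        fix t assume "t \<in> space M"
        from ge[OF this] show "ennreal (f t (x0 t) (p0 t)) * indicator (E k) t \<le> ennreal (\<phi> p0 t + \<eta>)"
          by (cases "t \<in> E k") (auto intro: ennreal_leI)
      qed
      also have "\<dots> = ennreal (\<integral>t. \<phi> p0 t + \<eta> \<partial>M)"
        using ge \<phi>i[OF p(2)] by (intro nn_integral_eq_integral) auto
      also have "(\<integral>t. \<phi> p0 t + \<eta> \<partial>M) = (\<integral>t. \<phi> p0 t \<partial>M) + \<eta> * B"
        using \<phi>i[OF p(2)] by (subst Bochner_Integration.integral_add) (auto simp: B_def)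
      also have "ennreal \<dots> \<le> ennreal (A + \<epsilon> * K + \<eta> * B)" using upper0 by (intro ennreal_leI) auto
      finally show ?thesis .
    qed
    have "(\<integral>\<^sup>+ t. ennreal (f t (x0 t) (p0 t)) \<partial>M) = (\<integral>\<^sup>+ t. (SUP k.
      ennreal (f t (x0 t) (p0 t)) * indicator (E k) t) \<partial>M)"
    proof (rule nn_integral_cong_AE)
      show "AE t in M. ennreal (f t (x0 t) (p0 t)) = (SUP k. ennreal (f t (x0 t) (p0 t)) * indicator (E k) t)"
        using cover
      proof eventually_elim
        case (elim t)
        then obtain j where "t \<in> G j" by blast
        then have "t \<in> E (Suc j)" unfolding E_def UDJ by auto
        then have "ennreal (f t (x0 t) (p0 t)) \<le> (SUP k. ennreal (f t (x0 t) (p0 t)) * indicator (E k) t)"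
          by (intro SUP_upper2[of "Suc j"]) auto
        moreover have "(SUP k. ennreal (f t (x0 t) (p0 t)) * indicator (E k) t) \<le> ennreal (f t (x0 t) (p0 t))"
          by (intro SUP_least) (auto simp: indicator_def)
        ultimately show ?case by (rule antisym)
      qed
    qed
    also have "\<dots> = (SUP k. \<integral>\<^sup>+ t. ennreal (f t (x0 t) (p0 t)) * indicator (E k) t \<partial>M)"
    proof (rule nn_integral_monotone_convergence_SUP)
      show "incseq (\<lambda>k t. ennreal (f t (x0 t) (p0 t)) * indicator (E k) t)"
        by (auto simp: incseq_def le_fun_def E_def indicator_def intro!: mult_left_mono)
    qed measurable
    also have "\<dots> \<le> ennreal (A + \<epsilon> * K + \<eta> * B)" by (rule SUP_least) (rule step)
    finally show ?thesis .
  qed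
  have B: "B \<ge> 0" by (simp add: B_def)
  show ?thesis
  proof (rule ennreal_le_epsilon)
    fix e :: real assume e: "e > 0"
    define z where "z = e / (K + B + 1)"
    have z: "z > 0" using e K(2) B by (simp add: z_def)
    have "z * (K + B) \<le> e"
      using e K(2) B by (simp add: z_def field_simps)
    then have "ennreal (A + z * K + z * B) \<le> ennreal (A + e)" by (intro ennreal_leI) (simp add: algebra_simps)
    with key[OF z z] show "(\<integral>\<^sup>+ t. ennreal (f t (x0 t) (p0 t)) \<partial>M) \<le> ennreal A + ennreal e"
      using le(2) e by simp
  qed
qed

section \<open>Energy estimates and pointwise limits of curves\<close>

section \<open>Curves of finite energy\<close>

definition energy :: "real \<Rightarrow> (real \<Rightarrow> 'a::euclidean_space) \<Rightarrow> ennreal" where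
  "energy \<theta> \<gamma> = (\<integral>\<^sup>+ t\<in>{0..}. ennreal (norm (velocity \<gamma> t) powr \<theta>) \<partial>lebesgue)"

lemma loc_abs_continuousD: "loc_abs_continuous \<gamma> \<Longrightarrow> 0 \<le> s \<Longrightarrow> abs_continuous_on {s..t} \<gamma>"
proof (cases "s \<le> t")
  case True
  moreover assume "loc_abs_continuous \<gamma>" "0 \<le> s"
  ultimately show ?thesis
    using abs_continuous_on_subset[of "{0..t}" \<gamma> "{s..t}"] by (auto simp: loc_abs_continuous_def)
next
  case False
  moreover assume "loc_abs_continuous \<gamma>"
  then have "abs_continuous_on {0..0} \<gamma>" by (auto simp: loc_abs_continuous_def)
  ultimately show ?thesis using abs_continuous_on_subset[of "{0..0}" \<gamma> "{s..t}"] by auto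
qed

lemma velocity_measurable:
  fixes \<gamma> :: "real \<Rightarrow> 'a::euclidean_space"
  assumes "loc_abs_continuous \<gamma>" "0 \<le> T"
  shows "velocity \<gamma> \<in> borel_measurable (lebesgue_on {0..T})"
proof -
  have "(velocity \<gamma> has_integral (\<gamma> T - \<gamma> 0)) {0..T}"
    by (rule abs_continuous_on_has_integral_velocity[OF loc_abs_continuousD[OF assms(1) order_refl] assms(2)])
  from has_integral_implies_lebesgue_measurable[OF this] show ?thesis
    by (subst borel_measurable_restrict_space_iff) auto
qed

lemma measurable_lebesgue_on_atLeast:
  fixes f :: "real \<Rightarrow> 'a::real_normed_vector"
  assumes "\<And>T. 0 \<le> T \<Longrightarrow> f \<in> borel_measurable (lebesgue_on {0..T})"
  shows "f \<in> borel_measurable (lebesgue_on {0..})"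
proof -
  have "(\<lambda>t. indicator {0..} t *\<^sub>R f t) \<in> borel_measurable lebesgue"
  proof (rule borel_measurable_LIMSEQ_metric)
    show "(\<lambda>t. indicator {0..real n} t *\<^sub>R f t) \<in> borel_measurable lebesgue" for n
      by (rule borel_measurable_restrict_space_iff[THEN iffD1, OF _ assms]) auto
    fix t :: real
    obtain N :: nat where N: "t \<le> real N" using real_arch_simple by blast
    have "eventually (\<lambda>n. indicator {0..real n} t *\<^sub>R f t = indicator {0..} t *\<^sub>R f t) sequentially"
      using eventually_ge_at_top[of N]
    proof eventually_elim
      case (elim n)
      then have "t \<in> {0..real n} \<longleftrightarrow> t \<in> {0..}" using N by auto
      then show ?case by (simp add: indicator_def)
    qed
    then show "(\<lambda>n. indicator {0..real n} t *\<^sub>R f t) \<longlonglongrightarrow> indicator {0..} t *\<^sub>R f t"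
      by (rule tendsto_eventually)
  qed
  then show ?thesis by (subst borel_measurable_restrict_space_iff) auto
qed

lemma velocity_measurable_atLeast:
  fixes \<gamma> :: "real \<Rightarrow> 'a::euclidean_space"
  assumes "loc_abs_continuous \<gamma>"
  shows "velocity \<gamma> \<in> borel_measurable (lebesgue_on {0..})"
  by (rule measurable_lebesgue_on_atLeast) (rule velocity_measurable[OF assms])

locale finite_energy_curve =
  fixes \<theta> K :: real and \<gamma> :: "real \<Rightarrow> 'a::euclidean_space"
  assumes \<theta>: "\<theta> > 1" and K: "K \<ge> 0" and ac: "loc_abs_continuous \<gamma>" and en: "energy \<theta> \<gamma> \<le> ennreal K"
begin

lemma nn_integral_powr_le:
  assumes "0 \<le> T"
  shows "(\<integral>\<^sup>+ t. ennreal (norm (velocity \<gamma> t) powr \<theta>) \<partial>lebesgue_on {0..T}) \<le> ennreal K"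
proof -
  have "(\<integral>\<^sup>+ t. ennreal (norm (velocity \<gamma> t) powr \<theta>) \<partial>lebesgue_on {0..T})
    = (\<integral>\<^sup>+ t\<in>{0..T}. ennreal (norm (velocity \<gamma> t) powr \<theta>) \<partial>lebesgue)"
    by (subst nn_integral_restrict_space) auto
  also have "\<dots> \<le> energy \<theta> \<gamma>"
    unfolding energy_def by (intro nn_integral_mono) (auto simp: indicator_def)
  finally show ?thesis using en by (rule order_trans)
qed

lemma powr_integrable:
  assumes "0 \<le> T"
  shows "integrable (lebesgue_on {0..T}) (\<lambda>t. norm (velocity \<gamma> t) powr \<theta>)"
    and "(\<lambda>t. norm (velocity \<gamma> t) powr \<theta>) integrable_on {0..T}"
    and "integral {0..T} (\<lambda>t. norm (velocity \<gamma> t) powr \<theta>) \<le> K"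
proof -
  have [measurable]: "velocity \<gamma> \<in> borel_measurable (lebesgue_on {0..T})"
    by (rule velocity_measurable[OF ac assms])
  show int: "integrable (lebesgue_on {0..T}) (\<lambda>t. norm (velocity \<gamma> t) powr \<theta>)"
    using nn_integral_powr_le[OF assms] by (intro integrableI_nonneg) (auto intro: le_less_trans)
  then have si: "set_integrable lebesgue {0..T} (\<lambda>t. norm (velocity \<gamma> t) powr \<theta>)"
    unfolding set_integrable_def by (subst (asm) integrable_restrict_space) auto
  show "(\<lambda>t. norm (velocity \<gamma> t) powr \<theta>) integrable_on {0..T}"
    by (rule set_lebesgue_integral_eq_integral(1)[OF si])
  have "ennreal (\<integral>t. norm (velocity \<gamma> t) powr \<theta> \<partial>lebesgue_on {0..T}) \<le> ennreal K"
    using nn_integral_powr_le[OF assms] by (subst nn_integral_eq_integral[OF int, symmetric]) auto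
  then have "(\<integral>t. norm (velocity \<gamma> t) powr \<theta> \<partial>lebesgue_on {0..T}) \<le> K" using K by simp
  also have "(\<integral>t. norm (velocity \<gamma> t) powr \<theta> \<partial>lebesgue_on {0..T}) = integral {0..T} (\<lambda>t.
    norm (velocity \<gamma> t) powr \<theta>)"
    unfolding set_lebesgue_integral_eq_integral(2)[OF si, symmetric] set_lebesgue_integral_def
    by (subst integral_restrict_space) auto
  finally show "integral {0..T} (\<lambda>t. norm (velocity \<gamma> t) powr \<theta>) \<le> K" .
qed

text \<open>The superlinear inequality is integrated over each piece, and the energies of the pieces
  add up to at most \<open>K\<close>. As \<open>c\<close> is free, this is equi-absolute continuity,
  in a form that is preserved by pointwise limits of curves.\<close>

lemma sum_increments_le:
  assumes "0 \<le> T" "D division_of S" "S \<subseteq> {0..T}" "c > 0"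
  shows "(\<Sum>k\<in>D. norm (\<gamma> (Sup k) - \<gamma> (Inf k))) \<le> c * (\<Sum>k\<in>D. Sup k - Inf k) + c powr (1 - \<theta>) * K"
proof -
  let ?w = "\<lambda>t. norm (velocity \<gamma> t) powr \<theta>"
  have each: "norm (\<gamma> (Sup k) - \<gamma> (Inf k)) \<le> c * (Sup k - Inf k) + c powr (1 - \<theta>) * integral k ?w" if k: "k \<in> D"
    for k
  proof -
    obtain u v where "k = cbox u v" "k \<noteq> {}" "k \<subseteq> {0..T}"
      using division_ofD(2,3,4)[OF assms(2) k] assms(3) by blast
    then have uv: "k = {u..v}" "u \<le> v" "0 \<le> u" "v \<le> T" by (auto simp: cbox_interval)
    have hi: "(velocity \<gamma> has_integral (\<gamma> v - \<gamma> u)) {u..v}"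
      by (rule abs_continuous_on_has_integral_velocity[OF loc_abs_continuousD[OF ac uv(3)] uv(2)])
    have wi: "?w integrable_on {u..v}"
      using powr_integrable(2)[OF assms(1)] uv by (rule_tac integrable_on_subinterval) auto
    have "norm (integral {u..v} (velocity \<gamma>)) \<le> integral {u..v} (\<lambda>t. c + c powr (1 - \<theta>) * ?w t)"
    proof (rule integral_norm_bound_integral)
      show "velocity \<gamma> integrable_on {u..v}" using hi by blast
      show "(\<lambda>t. c + c powr (1 - \<theta>) * ?w t) integrable_on {u..v}"
        by (intro integrable_add integrable_on_mult_right wi) auto
      show "norm (velocity \<gamma> t) \<le> c + c powr (1 - \<theta>) * ?w t" for t
        using \<theta> assms(4) by (intro le_powr_superlinear) auto
    qed
    also have "\<dots> = c * (v - u) + c powr (1 - \<theta>) * integral {u..v} ?w"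
      using uv wi by (subst Henstock_Kurzweil_Integration.integral_add) (auto intro: integrable_on_mult_right)
    finally show ?thesis using hi uv by (simp add: integral_unique)
  qed
  have wS: "?w integrable_on S"
    using has_integral_combine_division_topdown[OF powr_integrable(2)[OF assms(1)] assms(2,3)] by blast
  have "(\<Sum>k\<in>D. norm (\<gamma> (Sup k) - \<gamma> (Inf k))) \<le> (\<Sum>k\<in>D. c * (Sup k - Inf k) + c powr (1 - \<theta>) * integral k ?w)"
    by (rule sum_mono) (rule each)
  also have "\<dots> = c * (\<Sum>k\<in>D. Sup k - Inf k) + c powr (1 - \<theta>) * integral S ?w"
    by (simp add: sum.distrib sum_distrib_left integral_combine_division_topdown[OF wS assms(2)])
  also have "\<dots> \<le> c * (\<Sum>k\<in>D. Sup k - Inf k) + c powr (1 - \<theta>) * K"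
  proof (intro add_left_mono mult_left_mono)
    have "integral S ?w \<le> integral {0..T} ?w"
      by (rule integral_subset_le[OF assms(3) wS powr_integrable(2)[OF assms(1)]]) simp
    then show "integral S ?w \<le> K" using powr_integrable(3)[OF assms(1)] by linarith
  qed simp
  finally show ?thesis .
qed

lemma increment_le:
  assumes "0 \<le> s" "s \<le> t" "c > 0"
  shows "norm (\<gamma> t - \<gamma> s) \<le> c * (t - s) + c powr (1 - \<theta>) * K"
proof -
  have "{{s..t}} division_of {s..t}"
    using division_of_self[of s t] assms by (simp add: cbox_interval)
  from sum_increments_le[OF _ this _ assms(3), of t] assms show ?thesis by simp
qed

end

text \<open>The velocity already has a Henstock-Kurzweil integral, equal to the increments; bounded
  variation of the latter upgrades it to Lebesgue integrability.\<close>

lemma ac_integrable_velocity_if_bounded_variation: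
  fixes \<gamma> :: "real \<Rightarrow> 'a::euclidean_space"
  assumes ac: "loc_abs_continuous \<gamma>" and "0 \<le> T"
    and bv: "\<And>D. D division_of {0..T} \<Longrightarrow> (\<Sum>k\<in>D. norm (\<gamma> (Sup k) - \<gamma> (Inf k))) \<le> B"
  shows "integrable (lebesgue_on {0..T}) (velocity \<gamma>)"
    and "\<And>s t. 0 \<le> s \<Longrightarrow> s \<le> t \<Longrightarrow> t \<le> T \<Longrightarrow> (LINT u:{s..t}|lebesgue_on {0..T}. velocity \<gamma> u) = \<gamma> t - \<gamma> s"
proof -
  have hi: "(velocity \<gamma> has_integral (\<gamma> v - \<gamma> u)) {u..v}" if "0 \<le> u" "u \<le> v" for u v
    by (rule abs_continuous_on_has_integral_velocity[OF loc_abs_continuousD[OF ac that(1)] that(2)])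
  have ai: "velocity \<gamma> absolutely_integrable_on cbox 0 T"
  proof (rule bounded_variation_absolutely_integrable_interval)
    show "velocity \<gamma> integrable_on cbox 0 T" using hi[of 0 T] \<open>0 \<le> T\<close> by (auto simp: cbox_interval)
    fix D assume "D division_of cbox 0 T"
    then have D: "D division_of {0..T}" by (simp add: cbox_interval)
    have "(\<Sum>k\<in>D. norm (integral k (velocity \<gamma>))) = (\<Sum>k\<in>D. norm (\<gamma> (Sup k) - \<gamma> (Inf k)))"
    proof (rule sum.cong[OF refl])
      fix k assume "k \<in> D"
      from division_ofD(2,3,4)[OF D this] obtain u v where "k = cbox u v" "k \<noteq> {}" "k \<subseteq> {0..T}" by blast
      then have "k = {u..v}" "u \<le> v" "0 \<le> u" by (auto simp: cbox_interval)
      then show "norm (integral k (velocity \<gamma>)) = norm (\<gamma> (Sup k) - \<gamma> (Inf k))"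
        using hi[of u v] by (simp add: integral_unique)
    qed
    then show "(\<Sum>k\<in>D. norm (integral k (velocity \<gamma>))) \<le> B" using bv[OF D] by simp
  qed
  then have ai': "set_integrable lebesgue {0..T} (velocity \<gamma>)" by (simp add: cbox_interval)
  then show "integrable (lebesgue_on {0..T}) (velocity \<gamma>)"
    unfolding set_integrable_def by (subst integrable_restrict_space) auto
  fix s t assume st: "0 \<le> s" "s \<le> t" "t \<le> T"
  have "set_integrable lebesgue {s..t} (velocity \<gamma>)"
    using absolutely_integrable_on_subinterval[OF ai', of s t] st by auto
  from set_lebesgue_integral_eq_integral(2)[OF this]
  have "(LINT u:{s..t}|lebesgue. velocity \<gamma> u) = \<gamma> t - \<gamma> s"
    using hi[OF st(1,2)] by (simp add: integral_unique)
  also have "(LINT u:{s..t}|lebesgue. velocity \<gamma> u) = (LINT u:{s..t}|lebesgue_on {0..T}. velocity \<gamma> u)"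
    unfolding set_lebesgue_integral_def using st
    by (subst integral_restrict_space) (auto intro!: Bochner_Integration.integral_cong simp: indicator_def)
  finally show "(LINT u:{s..t}|lebesgue_on {0..T}. velocity \<gamma> u) = \<gamma> t - \<gamma> s" .
qed

lemma (in finite_energy_curve) velocity_integrable:
  assumes "0 \<le> T"
  shows "integrable (lebesgue_on {0..T}) (velocity \<gamma>)"
    and "\<And>s t. 0 \<le> s \<Longrightarrow> s \<le> t \<Longrightarrow> t \<le> T \<Longrightarrow> (LINT u:{s..t}|lebesgue_on {0..T}. velocity \<gamma> u) = \<gamma> t - \<gamma> s"
proof -
  have bv: "(\<Sum>k\<in>D. norm (\<gamma> (Sup k) - \<gamma> (Inf k))) \<le> T + K" if "D division_of {0..T}" for D
    using sum_increments_le[OF assms that order_refl zero_less_one] sum_lengths_division(2)[OF that] assms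
      by simp
  show "integrable (lebesgue_on {0..T}) (velocity \<gamma>)"
    by (rule ac_integrable_velocity_if_bounded_variation(1)[OF ac assms bv])
  show "(LINT u:{s..t}|lebesgue_on {0..T}. velocity \<gamma> u) = \<gamma> t - \<gamma> s" if "0 \<le> s" "s \<le> t" "t \<le> T" for s t
    by (rule ac_integrable_velocity_if_bounded_variation(2)[OF ac assms bv that])
qed

text \<open>Pointwise convergence under a common energy bound. The limit inherits the estimate of
  finite sums of increments, and its absolute continuity and the integrability of its velocity are
  derived from that.\<close>

locale converging_curves =
  fixes \<theta> K :: real and g :: "nat \<Rightarrow> real \<Rightarrow> 'a::euclidean_space" and \<gamma> :: "real \<Rightarrow> 'a"
  assumes fe: "\<And>n. finite_energy_curve \<theta> K (g n)"
    and lim: "\<And>t. 0 \<le> t \<Longrightarrow> (\<lambda>n. g n t) \<longlonglongrightarrow> \<gamma> t"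
begin

lemma \<theta>: "\<theta> > 1" and K: "K \<ge> 0"
  using fe[of 0] unfolding finite_energy_curve_def by auto

lemma limit_sum_increments_le:
  assumes "0 \<le> T" "D division_of S" "S \<subseteq> {0..T}" "c > 0"
  shows "(\<Sum>k\<in>D. norm (\<gamma> (Sup k) - \<gamma> (Inf k))) \<le> c * (\<Sum>k\<in>D. Sup k - Inf k) + c powr (1 - \<theta>) * K"
proof (rule LIMSEQ_le_const2)
  show "(\<lambda>n. \<Sum>k\<in>D. norm (g n (Sup k) - g n (Inf k))) \<longlonglongrightarrow> (\<Sum>k\<in>D. norm (\<gamma> (Sup k) - \<gamma> (Inf k)))"
  proof (intro tendsto_sum tendsto_norm tendsto_diff lim)
    fix k assume k: "k \<in> D"
    obtain u v where "k = cbox u v" "k \<noteq> {}" "k \<subseteq> {0..T}"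
      using division_ofD(2,3,4)[OF assms(2) k] assms(3) by blast
    then show "0 \<le> Sup k" "0 \<le> Inf k" by (auto simp: cbox_interval)
  qed
  show "\<exists>N. \<forall>n\<ge>N. (\<Sum>k\<in>D. norm (g n (Sup k) - g n (Inf k))) \<le> c * (\<Sum>k\<in>D. Sup k - Inf k) + c powr (1 - \<theta>) * K"
    using finite_energy_curve.sum_increments_le[OF fe assms] by blast
qed

lemma limit_increment_le:
  assumes "0 \<le> s" "s \<le> t" "c > 0"
  shows "norm (\<gamma> t - \<gamma> s) \<le> c * (t - s) + c powr (1 - \<theta>) * K"
proof -
  have "{{s..t}} division_of {s..t}"
    using division_of_self[of s t] assms by (simp add: cbox_interval)
  from limit_sum_increments_le[OF _ this _ assms(3), of t] assms show ?thesis by simp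
qed

lemma limit_ac: "loc_abs_continuous \<gamma>"
  unfolding loc_abs_continuous_def abs_continuous_on_def
proof (intro allI impI)
  fix T e :: real assume T: "0 \<le> T" and e: "0 < e"
  obtain c where c: "c > 0" "c powr (1 - \<theta>) * K < e / 2"
    using small_powr_coefficient[OF \<theta>, of "e / 2" K] e K by auto
  show "\<exists>\<delta>>0. \<forall>D S. D division_of S \<and> S \<subseteq> {0..T} \<and> (\<Sum>k\<in>D. Sup k - Inf k) < \<delta> \<longrightarrow>
      (\<Sum>k\<in>D. norm (\<gamma> (Sup k) - \<gamma> (Inf k))) < e"
  proof (intro exI[of _ "e / (2 * c)"] conjI allI impI; (elim conjE)?)
    show "0 < e / (2 * c)" using e c by simp
    fix D S assume D: "D division_of S" "S \<subseteq> {0..T}" "(\<Sum>k\<in>D. Sup k - Inf k) < e / (2 * c)"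
    have "c * (\<Sum>k\<in>D. Sup k - Inf k) < e / 2" using mult_strict_left_mono[OF D(3) c(1)] c(1) by simp
    then show "(\<Sum>k\<in>D. norm (\<gamma> (Sup k) - \<gamma> (Inf k))) < e"
      using limit_sum_increments_le[OF T D(1,2) c(1)] c(2) by linarith
  qed
qed

lemma limit_velocity_integrable:
  assumes "0 \<le> T"
  shows "integrable (lebesgue_on {0..T}) (velocity \<gamma>)"
    and "\<And>s t. 0 \<le> s \<Longrightarrow> s \<le> t \<Longrightarrow> t \<le> T \<Longrightarrow> (LINT u:{s..t}|lebesgue_on {0..T}. velocity \<gamma> u) = \<gamma> t - \<gamma> s"
proof -
  have bv: "(\<Sum>k\<in>D. norm (\<gamma> (Sup k) - \<gamma> (Inf k))) \<le> T + K" if "D division_of {0..T}" for D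
    using limit_sum_increments_le[OF assms that order_refl zero_less_one] sum_lengths_division(2)[OF that] assms
      by simp
  show "integrable (lebesgue_on {0..T}) (velocity \<gamma>)"
    by (rule ac_integrable_velocity_if_bounded_variation(1)[OF limit_ac assms bv])
  show "(LINT u:{s..t}|lebesgue_on {0..T}. velocity \<gamma> u) = \<gamma> t - \<gamma> s" if "0 \<le> s" "s \<le> t" "t \<le> T" for s t
    by (rule ac_integrable_velocity_if_bounded_variation(2)[OF limit_ac assms bv that])
qed

lemma velocity_weak_convergence:
  assumes T: "0 \<le> T" and D: "D \<in> sets (lebesgue_on {0..T})"
  shows "(\<lambda>n. LINT t:D|lebesgue_on {0..T}. velocity (g n) t) \<longlonglongrightarrow> (LINT t:D|lebesgue_on {0..T}. velocity \<gamma> t)"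
proof (rule set_integral_tendsto_lebesgue_on[OF _ _ \<theta> _ K _ T D])
  show "integrable (lebesgue_on {0..T}) (velocity (g n))" for n
    by (rule finite_energy_curve.velocity_integrable(1)[OF fe T])
  show "integrable (lebesgue_on {0..T}) (velocity \<gamma>)" by (rule limit_velocity_integrable(1)[OF T])
  show "(\<integral>\<^sup>+ t. ennreal (norm (velocity (g n) t) powr \<theta>) \<partial>lebesgue_on {0..T}) \<le> ennreal K" for n
    by (rule finite_energy_curve.nn_integral_powr_le[OF fe T])
  show "(\<lambda>n. LINT t:{0..s}|lebesgue_on {0..T}. velocity (g n) t) \<longlonglongrightarrow> (LINT t:{0..s}|lebesgue_on {0..T}.
    velocity \<gamma> t)"
    if "s \<in> {0..T}" for s
    using that by (simp add: finite_energy_curve.velocity_integrable(2)[OF fe T] limit_velocity_integrable(2)[OF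
      T])
      (intro tendsto_diff lim; simp)
qed

text \<open>Convergence at the finitely many points of a grid, together with the increment estimate
  for the curves and for the limit. Each increment is below \<open>e / 3\<close>: one sixth from the
  energy term and one sixth from the mesh, as \<open>c * \<delta> = e / 6\<close>.\<close>

lemma uniform_on_compacts:
  assumes "e > 0"
  shows "eventually (\<lambda>n. \<forall>t\<in>{0..T}. dist (\<gamma> t) (g n t) < e) sequentially"
proof -
  obtain c where c: "c > 0" "c powr (1 - \<theta>) * K < e / 6"
    using small_powr_coefficient[OF \<theta>, of "e / 6" K] assms K by auto
  define \<delta> where "\<delta> = e / (6 * c)"
  have \<delta>: "\<delta> > 0" "c * \<delta> = e / 6" using assms c by (auto simp: \<delta>_def)
  obtain m :: nat where m: "T / \<delta> \<le> real m" using real_arch_simple by blast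
  have "eventually (\<lambda>n. \<forall>i\<in>{..m}. dist (\<gamma> (real i * \<delta>)) (g n (real i * \<delta>)) < e / 3) sequentially"
  proof (rule eventually_ball_finite)
    show "\<forall>i\<in>{..m}. eventually (\<lambda>n. dist (\<gamma> (real i * \<delta>)) (g n (real i * \<delta>)) < e / 3) sequentially"
    proof
      fix i
      have "(\<lambda>n. g n (real i * \<delta>)) \<longlonglongrightarrow> \<gamma> (real i * \<delta>)" using \<delta> by (intro lim) auto
      then have "eventually (\<lambda>n. dist (g n (real i * \<delta>)) (\<gamma> (real i * \<delta>)) < e / 3) sequentially"
        using assms by (intro tendstoD) auto
      then show "eventually (\<lambda>n. dist (\<gamma> (real i * \<delta>)) (g n (real i * \<delta>)) < e / 3) sequentially"
        by (simp add: dist_commute)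
    qed
  qed simp
  then show ?thesis
  proof eventually_elim
    case (elim n)
    show ?case
    proof
      fix t assume t: "t \<in> {0..T}"
      define i where "i = nat \<lfloor>t / \<delta>\<rfloor>"
      have t0: "0 \<le> t / \<delta>" using t \<delta> by simp
      have i: "real i \<le> t / \<delta>" "t / \<delta> < real i + 1" using t0 unfolding i_def by linarith+
      have "t / \<delta> \<le> T / \<delta>" using t \<delta> by (intro divide_right_mono) auto
      then have im: "i \<in> {..m}" using i(1) m by simp
      have s: "real i * \<delta> \<le> t" "t - real i * \<delta> \<le> \<delta>" using i \<delta>(1) by (simp_all add: field_simps)
      have s0: "0 \<le> real i * \<delta>" using \<delta> by simp
      have "c * (t - real i * \<delta>) \<le> e / 6" using mult_left_mono[OF s(2), of c] c \<delta>(2) by simp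
      then have "norm (\<gamma> t - \<gamma> (real i * \<delta>)) < e / 3" "norm (g n t - g n (real i * \<delta>)) < e / 3"
        using limit_increment_le[OF s0 s(1) c(1)] finite_energy_curve.increment_le[OF fe s0 s(1) c(1), of n]
          c(2) by linarith+
      moreover have "dist (\<gamma> (real i * \<delta>)) (g n (real i * \<delta>)) < e / 3" using elim im by blast
      moreover have "dist (\<gamma> t) (g n t) \<le> dist (\<gamma> t) (\<gamma> (real i * \<delta>)) +
        (dist (\<gamma> (real i * \<delta>)) (g n (real i * \<delta>)) + dist (g n (real i * \<delta>)) (g n t))"
        by (rule order_trans[OF dist_triangle add_left_mono[OF dist_triangle]])
      ultimately show "dist (\<gamma> t) (g n t) < e" by (simp add: dist_norm norm_minus_commute)
    qed
  qed
qed

end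

text \<open>\<open>g\<close> is approximated by functions with countably many values:
  \<open>k n x\<close> is the first index of a dense sequence of \<open>Y\<close> whose point is
  within 1/(n+1) of \<open>g x\<close>. Composition with each approximation is measurable, and
  continuity gives the limit.\<close>

lemma caratheodory_measurable:
  fixes f :: "'m \<Rightarrow> 'y::{second_countable_topology, metric_space} \<Rightarrow> 'z::metric_space"
  assumes cont: "\<And>x. x \<in> space M \<Longrightarrow> continuous_on Y (f x)"
    and meas: "\<And>y. y \<in> Y \<Longrightarrow> (\<lambda>x. f x y) \<in> borel_measurable M"
    and g [measurable]: "g \<in> borel_measurable M" and gY: "\<And>x. x \<in> space M \<Longrightarrow> g x \<in> Y"
  shows "(\<lambda>x. f x (g x)) \<in> borel_measurable M"
proof (cases "Y = {}")
  case True
  then have "space M = {}" using gY by auto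
  then show ?thesis by (simp add: measurable_def)
next
  case False
  obtain D where D: "countable D" "D \<subseteq> Y" "Y \<subseteq> closure D" by (rule separable)
  have Dne: "D \<noteq> {}" using D(3) False by auto
  define d where "d = from_nat_into D"
  have dY: "d i \<in> Y" for i unfolding d_def using from_nat_into[OF Dne] D(2) by blast
  define k where "k n x = (LEAST i. dist (d i) (g x) < 1 / real (Suc n))" for n x
  have k: "dist (d (k n x)) (g x) < 1 / real (Suc n)" if "x \<in> space M" for n x
  proof -
    have "g x \<in> closure D" using gY[OF that] D(3) by blast
    then obtain y where "y \<in> D" "dist y (g x) < 1 / real (Suc n)"
      using closure_approachable[of "g x" D]
        by (metis divide_pos_pos of_nat_0_less_iff zero_less_Suc zero_less_one)
    moreover then obtain i where "d i = y" using from_nat_into_surj[OF D(1)] by (auto simp: d_def)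
    ultimately have "dist (d i) (g x) < 1 / real (Suc n)" by simp
    then show ?thesis unfolding k_def by (rule LeastI)
  qed
  have [measurable]: "k n \<in> measurable M (count_space UNIV)" for n
    unfolding k_def by measurable
  show ?thesis
  proof (rule borel_measurable_LIMSEQ_metric)
    show "(\<lambda>x. f x (d (k n x))) \<in> borel_measurable M" for n
      by (rule measurable_compose_countable[of "\<lambda>i x. f x (d i)" M borel "k n"]) (use meas dY in auto)
    fix x assume x: "x \<in> space M"
    have "(\<lambda>n. dist (d (k n x)) (g x)) \<longlonglongrightarrow> 0"
    proof (rule tendsto_sandwich[OF _ _ tendsto_const])
      show "(\<lambda>n. 1 / real (Suc n)) \<longlonglongrightarrow> 0" by (rule LIMSEQ_Suc[OF lim_1_over_n])
      show "eventually (\<lambda>n. dist (d (k n x)) (g x) \<le> 1 / real (Suc n)) sequentially"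
        using k[OF x] by (intro always_eventually allI less_imp_le)
    qed auto
    then have "(\<lambda>n. d (k n x)) \<longlonglongrightarrow> g x" using tendsto_dist_iff by blast
    then show "(\<lambda>n. f x (d (k n x))) \<longlonglongrightarrow> f x (g x)"
      by (rule continuous_on_tendsto_compose[OF cont[OF x]]) (use gY[OF x] dY in auto)
  qed
qed

text \<open>Completeness of Lebesgue measure: all subsets of the exceptional null set are
  measurable.\<close>

lemma borel_measurable_lebesgue_on_AE:
  fixes f g :: "'n::euclidean_space \<Rightarrow> real"
  assumes S: "S \<in> sets lebesgue" and f: "f \<in> borel_measurable (lebesgue_on S)"
    and ae: "AE x in lebesgue_on S. f x = g x"
  shows "g \<in> borel_measurable (lebesgue_on S)"
proof -
  have sp: "space (lebesgue_on S) = S" by simp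
  have "AE x in lebesgue. x \<in> S \<longrightarrow> f x = g x" using ae S by (subst (asm) AE_restrict_space_iff) auto
  then obtain N where N: "{x. \<not> (x \<in> S \<longrightarrow> f x = g x)} \<subseteq> N" "N \<in> null_sets lebesgue"
    by (auto simp: eventually_ae_filter)
  have neg: "negligible N" using N(2) by (simp add: negligible_iff_null_sets)
  show ?thesis
  proof (rule borel_measurableI_le)
    fix c :: real
    have "{x \<in> space (lebesgue_on S). f x \<le> c} \<in> sets (lebesgue_on S)" using f by measurable
    then have "{x \<in> S. f x \<le> c} \<in> sets lebesgue" using S by (simp add: sets_restrict_space_iff)
    moreover have "N \<inter> S \<inter> {x. g x \<le> c} \<in> sets lebesgue"
      by (rule negligible_imp_sets[OF negligible_subset[OF neg]]) auto
    moreover have "N \<in> sets lebesgue" using N(2) by auto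
    moreover have "{x \<in> S. g x \<le> c} = ({x \<in> S. f x \<le> c} - N) \<union> (N \<inter> S \<inter> {x. g x \<le> c})" using N(1) by auto
    ultimately have "{x \<in> S. g x \<le> c} \<in> sets lebesgue" by auto
    then show "{x \<in> space (lebesgue_on S). g x \<le> c} \<in> sets (lebesgue_on S)"
      using S by (simp add: sets_restrict_space_iff)
  qed
qed

lemma caratheodory_lebesgue_on:
  fixes f :: "'n::euclidean_space \<Rightarrow> 'y::{second_countable_topology, metric_space} \<Rightarrow> real"
  assumes S: "S \<in> sets lebesgue" and cont: "AE x in lebesgue_on S. continuous_on Y (f x)"
    and meas: "\<And>y. y \<in> Y \<Longrightarrow> (\<lambda>x. f x y) \<in> borel_measurable (lebesgue_on S)"
    and g: "g \<in> borel_measurable (lebesgue_on S)" and gY: "\<And>x. x \<in> S \<Longrightarrow> g x \<in> Y"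
  shows "(\<lambda>x. f x (g x)) \<in> borel_measurable (lebesgue_on S)"
proof -
  obtain N where N: "{x \<in> space (lebesgue_on S). \<not> continuous_on Y (f x)} \<subseteq> N" "N \<in> null_sets (lebesgue_on S)"
    using cont by (auto simp: eventually_ae_filter)
  define f' where "f' x y = (if x \<in> N then 0 else f x y)" for x y
  have [measurable]: "N \<in> sets (lebesgue_on S)" using N by auto
  have "(\<lambda>x. f' x (g x)) \<in> borel_measurable (lebesgue_on S)"
  proof (rule caratheodory_measurable[OF _ _ g, where Y = Y])
    show "continuous_on Y (f' x)" if "x \<in> space (lebesgue_on S)" for x
      using N(1) that by (cases "x \<in> N") (auto simp: f'_def[abs_def])
    show "(\<lambda>x. f' x y) \<in> borel_measurable (lebesgue_on S)" if "y \<in> Y" for y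
      unfolding f'_def using meas[OF that] by measurable
  qed (use gY in auto)
  moreover have "AE x in lebesgue_on S. f' x (g x) = f x (g x)"
    using AE_not_in[OF N(2)] by eventually_elim (simp add: f'_def)
  ultimately show ?thesis by (rule borel_measurable_lebesgue_on_AE[OF S])
qed

section \<open>Lower semicontinuity of the running, exit and interaction costs\<close>

section \<open>Costs of the mean field game\<close>

lemma AE_lebesgue_on_subset:
  assumes "AE t in lebesgue_on S. P t" "S \<in> sets lebesgue" "T \<in> sets lebesgue" "T \<subseteq> S"
  shows "AE t in lebesgue_on T. P t"
  using assms by (auto simp: AE_restrict_space_iff elim!: eventually_mono)

text \<open>If \<open>liminf f < x\<close>, some finite \<open>A < x\<close> bounds \<open>f\<close>
  along a subsequence. A proof of lower semicontinuity may therefore start from a uniform bound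
  \<open>A\<close> and only has to show that the limit obeys it.\<close>

lemma liminf_ge_if_subsequences:
  fixes f :: "nat \<Rightarrow> ennreal"
  assumes "\<And>(r :: nat \<Rightarrow> nat) A. strict_mono r \<Longrightarrow> A \<ge> 0 \<Longrightarrow> (\<And>n. f (r n) \<le> ennreal A) \<Longrightarrow> x \<le> ennreal A"
  shows "x \<le> liminf f"
proof (rule ccontr)
  assume "\<not> ?thesis"
  then have "liminf f < x" by simp
  then obtain y where y: "liminf f < y" "y < x" using dense by blast
  then have "y \<noteq> \<infinity>" by auto
  then obtain A where A: "y = ennreal A" "A \<ge> 0" by (cases y) auto
  have "infinite {n. f n \<le> y}"
  proof
    assume "finite {n. f n \<le> y}"
    then have "eventually (\<lambda>n. n \<notin> {n. f n \<le> y}) sequentially"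
      using finite_nat_set_iff_bounded eventually_sequentially by (metis leD)
    then have "eventually (\<lambda>n. y \<le> f n) sequentially" by (rule eventually_mono) auto
    then have "y \<le> liminf f" by (rule Liminf_bounded)
    then show False using y by simp
  qed
  then obtain r :: "nat \<Rightarrow> nat" where "strict_mono r" "\<And>n. r n \<in> {n. f n \<le> y}"
    using infinite_enumerate by blast
  with assms[of r A] A have "x \<le> y" by auto
  then show False using y by simp
qed

lemma curvesD:
  assumes "\<gamma> \<in> curves X"
  shows "continuous_on {0..} \<gamma>" "\<And>t. 0 \<le> t \<Longrightarrow> \<gamma> t \<in> X"
  using assms by (auto simp: curves_def)

text \<open>Derives from the Caratheodory conditions the measurability that the lower semicontinuity
  theorem asks for on a bounded interval.\<close>

lemma caratheodory_functional_lsc: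
  fixes f :: "real \<Rightarrow> 'y::euclidean_space \<Rightarrow> 'b::euclidean_space \<Rightarrow> real"
  assumes cont: "AE t in lebesgue_on {0..}. continuous_on (Y \<times> UNIV) (\<lambda>(y, q). f t y q)"
    and conv: "AE t in lebesgue_on {0..}. \<forall>y\<in>Y. convex_on UNIV (f t y)"
    and nonneg: "\<And>t y q. 0 \<le> t \<Longrightarrow> y \<in> Y \<Longrightarrow> 0 \<le> f t y q"
    and meas: "\<And>y q. y \<in> Y \<Longrightarrow> (\<lambda>t. f t y q) \<in> borel_measurable (lebesgue_on {0..})"
    and y: "\<And>n. continuous_on {0..} (y n)" "\<And>n t. 0 \<le> t \<Longrightarrow> y n t \<in> Y"
      "continuous_on {0..} y0" "\<And>t. 0 \<le> t \<Longrightarrow> y0 t \<in> Y" "\<And>t. 0 \<le> t \<Longrightarrow> (\<lambda>n. y n t) \<longlonglongrightarrow> y0 t"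
    and p: "\<And>n. integrable (lebesgue_on {0..T}) (p n)" "integrable (lebesgue_on {0..T}) p0"
    and \<theta>: "\<theta> > 1" and K: "\<And>n. (\<integral>\<^sup>+ t. ennreal (norm (p n t) powr \<theta>) \<partial>lebesgue_on {0..T}) \<le> ennreal K" "K \<ge> 0"
    and weak: "\<And>D. D \<in> sets (lebesgue_on {0..T}) \<Longrightarrow>
      (\<lambda>n. LINT t:D|lebesgue_on {0..T}. p n t) \<longlonglongrightarrow> (LINT t:D|lebesgue_on {0..T}. p0 t)"
    and le: "\<And>n. (\<integral>\<^sup>+ t. ennreal (f t (y n t) (p n t)) \<partial>lebesgue_on {0..T}) \<le> ennreal A" "A \<ge> 0"
  shows "(\<integral>\<^sup>+ t. ennreal (f t (y0 t) (p0 t)) \<partial>lebesgue_on {0..T}) \<le> ennreal A"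
proof -
  interpret finite_measure "lebesgue_on {0..T}" by (rule finite_measure_lebesgue_on) auto
  have cont': "AE t in lebesgue_on {0..T}. continuous_on (Y \<times> UNIV) (\<lambda>(y, q). f t y q)"
    by (rule AE_lebesgue_on_subset[OF cont]) auto
  have conv': "AE t in lebesgue_on {0..T}. \<forall>y\<in>Y. convex_on UNIV (f t y)"
    by (rule AE_lebesgue_on_subset[OF conv]) auto
  have comp: "(\<lambda>t. f t (z t) (q t)) \<in> borel_measurable (lebesgue_on {0..T})"
    if z: "continuous_on {0..} z" "\<And>t. 0 \<le> t \<Longrightarrow> z t \<in> Y" and q: "q \<in> borel_measurable (lebesgue_on {0..T})"
      for z q
  proof -
    have "z \<in> borel_measurable (lebesgue_on {0..T})"
      using continuous_on_subset[OF z(1), of "{0..T}"]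
        by (intro continuous_imp_measurable_on_sets_lebesgue) auto
    then have zq: "(\<lambda>t. (z t, q t)) \<in> borel_measurable (lebesgue_on {0..T})" using q
      by (rule borel_measurable_Pair)
    have "(\<lambda>t. (\<lambda>(y, q). f t y q) (z t, q t)) \<in> borel_measurable (lebesgue_on {0..T})"
    proof (rule caratheodory_lebesgue_on[OF _ cont' _ zq])
      show "(\<lambda>t. case yq of (y, q) \<Rightarrow> f t y q) \<in> borel_measurable (lebesgue_on {0..T})" if yq: "yq \<in> Y \<times> UNIV"
        for yq
      proof -
        obtain y' q' where "yq = (y', q')" "y' \<in> Y" using yq by auto
        then show ?thesis using measurable_restrict_mono[OF meas, of y' "{0..T}"] by auto
      qed
    qed (use z(2) in auto)
    then show ?thesis by simp
  qed
  show ?thesis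
  proof (rule nn_integral_convex_lsc[OF cont' _ _ _ _ _ _ _ _ p \<theta> K weak le])
    show "AE t in lebesgue_on {0..T}. convex_on UNIV (f t (y0 t))"
      using conv' AE_space by eventually_elim (use y(4) in auto)
    show "(\<lambda>t. f t (y n t) q) \<in> borel_measurable (lebesgue_on {0..T})" for n q
      by (rule comp[OF y(1,2)]) auto
    show "(\<lambda>t. f t (y n t) (p n t)) \<in> borel_measurable (lebesgue_on {0..T})" for n
      by (rule comp[OF y(1,2) borel_measurable_integrable[OF p(1)]])
    show "(\<lambda>t. f t (y0 t) (p0 t)) \<in> borel_measurable (lebesgue_on {0..T})"
      by (rule comp[OF y(3,4) borel_measurable_integrable[OF p(2)]])
  qed (use y nonneg in auto)
qed

text \<open>Monotone convergence along \<open>{0..T n}\<close>. Covering almost every time is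
  enough, so \<open>T n\<close> may increase to \<open>m\<close> without reaching it.\<close>

lemma nn_integral_exhaust:
  fixes f :: "real \<Rightarrow> ennreal"
  assumes f: "f \<in> borel_measurable (lebesgue_on {0..})" and mono: "incseq T"
    and cover: "AE t in lebesgue. 0 \<le> t \<longrightarrow> ereal t \<le> m \<longrightarrow> (\<exists>n. t \<le> T n)" and Tm: "\<And>n. ereal (T n) \<le> m"
    and le: "\<And>n. (\<integral>\<^sup>+ t. f t \<partial>lebesgue_on {0..T n}) \<le> c"
  shows "(\<integral>\<^sup>+ t\<in>{t. 0 \<le> t \<and> ereal t \<le> m}. f t \<partial>lebesgue) \<le> c"
proof -
  have fm: "(\<lambda>t. f t * indicator {0..T n} t) \<in> borel_measurable lebesgue" for n
  proof -
    have "f \<in> borel_measurable (lebesgue_on {0..T n})" by (rule measurable_restrict_mono[OF f]) auto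
    then show ?thesis by (subst (asm) borel_measurable_restrict_space_iff_ennreal) auto
  qed
  have "(\<integral>\<^sup>+ t\<in>{t. 0 \<le> t \<and> ereal t \<le> m}. f t \<partial>lebesgue) = (\<integral>\<^sup>+ t. (SUP n.
    f t * indicator {0..T n} t) \<partial>lebesgue)"
  proof (rule nn_integral_cong_AE)
    show "AE t in lebesgue. f t * indicator {t. 0 \<le> t \<and> ereal t \<le> m} t = (SUP n. f t * indicator {0..T n} t)"
      using cover
    proof eventually_elim
      case (elim t)
      show ?case
      proof (cases "0 \<le> t \<and> ereal t \<le> m")
        case True
        then obtain n where n: "t \<le> T n" using elim by blast
        show ?thesis
        proof (rule antisym)
          show "f t * indicator {t. 0 \<le> t \<and> ereal t \<le> m} t \<le> (SUP n. f t * indicator {0..T n} t)"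
            using True n by (intro SUP_upper2[of n]) auto
          show "(SUP n. f t * indicator {0..T n} t) \<le> f t * indicator {t. 0 \<le> t \<and> ereal t \<le> m} t"
            using True by (intro SUP_least) (auto simp: indicator_def)
        qed
      next
        case False
        have "t \<notin> {0..T n}" for n
        proof
          assume "t \<in> {0..T n}"
          then have "ereal t \<le> ereal (T n)" "0 \<le> t" by auto
          then show False using False order_trans[OF _ Tm[of n], of "ereal t"] by simp
        qed
        then show ?thesis using False by simp
      qed
    qed
  qed
  also have "\<dots> = (SUP n. \<integral>\<^sup>+ t. f t * indicator {0..T n} t \<partial>lebesgue)"
  proof (rule nn_integral_monotone_convergence_SUP[OF _ fm])
    show "incseq (\<lambda>n t. f t * indicator {0..T n} t)"
      using mono by (auto simp: incseq_def le_fun_def indicator_def intro: order_trans)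
  qed
  also have "\<dots> = (SUP n. \<integral>\<^sup>+ t. f t \<partial>lebesgue_on {0..T n})"
    by (intro SUP_cong refl nn_integral_restrict_space[symmetric]) auto
  also have "\<dots> \<le> c" by (rule SUP_least) (rule le)
  finally show ?thesis .
qed

section \<open>Exit times and exit costs under locally uniform convergence\<close>

lemma exit_time_not_hit: "0 \<le> t \<Longrightarrow> ereal t < exit_time \<Xi> \<gamma> \<Longrightarrow> \<gamma> t \<notin> \<Xi>"
  unfolding exit_time_def using Inf_lower[of "ereal t" "{ereal t |t. 0 \<le> t \<and> \<gamma> t \<in> \<Xi>}"] by auto

lemma exit_time_ge:
  assumes "\<And>t. 0 \<le> t \<Longrightarrow> t \<le> T \<Longrightarrow> \<gamma> t \<notin> \<Xi>"
  shows "ereal T \<le> exit_time \<Xi> \<gamma>"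
  unfolding exit_time_def
proof (rule Inf_greatest)
  fix x assume "x \<in> {ereal t |t. 0 \<le> t \<and> \<gamma> t \<in> \<Xi>}"
  then show "ereal T \<le> x" using assms by force
qed

lemma exit_time_nonneg: "0 \<le> exit_time \<Xi> \<gamma>"
  unfolding exit_time_def by (rule Inf_greatest) auto

text \<open>Up to a time \<open>T'\<close> strictly between \<open>T\<close> and the exit time, the
  curve keeps a positive distance from the closed set, so a uniformly close curve cannot hit it by
  \<open>T'\<close>. This is lower semicontinuity of the exit time.\<close>

lemma exit_time_less_eventually:
  fixes \<gamma> :: "real \<Rightarrow> 'a::euclidean_space"
  assumes \<gamma>: "continuous_on {0..} \<gamma>" and \<Xi>: "closed \<Xi>"
    and unif: "\<And>T e. e > 0 \<Longrightarrow> eventually (\<lambda>n. \<forall>t\<in>{0..T}. dist (\<gamma> t) (u n t) < e) F"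
    and T: "0 \<le> T" "ereal T < exit_time \<Xi> \<gamma>"
  shows "eventually (\<lambda>n. ereal T < exit_time \<Xi> (u n)) F"
proof -
  obtain T' where T': "ereal T < ereal T'" "ereal T' < exit_time \<Xi> \<gamma>" using ereal_dense2[OF T(2)] by auto
  have "compact (\<gamma> ` {0..T'})"
    by (rule compact_continuous_image[OF continuous_on_subset[OF \<gamma>]]) auto
  moreover have "\<gamma> ` {0..T'} \<inter> \<Xi> = {}"
  proof -
    have "\<gamma> t \<notin> \<Xi>" if "t \<in> {0..T'}" for t
    proof (rule exit_time_not_hit)
      show "0 \<le> t" using that by simp
      have "ereal t \<le> ereal T'" using that by simp
      then show "ereal t < exit_time \<Xi> \<gamma>" using T'(2) by (rule le_less_trans)
    qed
    then show ?thesis by auto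
  qed
  ultimately obtain d where d: "d > 0" "\<forall>x\<in>\<gamma> ` {0..T'}. \<forall>y\<in>\<Xi>. d \<le> dist x y"
    using separate_compact_closed[OF _ \<Xi>] by blast
  show ?thesis
    using unif[OF d(1), of T']
  proof eventually_elim
    case (elim n)
    have "ereal T' \<le> exit_time \<Xi> (u n)"
    proof (rule exit_time_ge)
      fix t assume t: "0 \<le> t" "t \<le> T'"
      show "u n t \<notin> \<Xi>"
      proof
        assume "u n t \<in> \<Xi>"
        then have "d \<le> dist (\<gamma> t) (u n t)" using d(2) t by auto
        moreover have "dist (\<gamma> t) (u n t) < d" using elim t by simp
        ultimately show False by linarith
      qed
    qed
    then show ?case using T'(1) by (rule less_le_trans[rotated])
  qed
qed

text \<open>Linear growth keeps the limit exit time finite, monotonicity gives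
  \<open>\<Psi> T \<le> c\<close> at every \<open>T\<close> before it, and lower semicontinuity of
  \<open>\<Psi>\<close> extends the bound to the exit time itself.\<close>

lemma exit_cost_lsc:
  fixes s :: "nat \<Rightarrow> ereal"
  assumes nonneg: "\<And>t. t \<ge> 0 \<Longrightarrow> \<Psi> t \<ge> 0" and lsc: "lsc_on {0..} \<Psi>" and mono: "mono_on {0..} \<Psi>"
    and "a > 0" and growth: "\<And>t. t \<ge> 0 \<Longrightarrow> \<Psi> t \<ge> a * t - b"
    and s: "\<And>n. exit_cost \<Psi> (s n) \<le> ennreal c" "c \<ge> 0" "\<And>n. 0 \<le> s n" "0 \<le> s0"
    and ev: "\<And>T. 0 \<le> T \<Longrightarrow> ereal T < s0 \<Longrightarrow> \<exists>n. ereal T < s n"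
  shows "exit_cost \<Psi> s0 \<le> ennreal c"
proof -
  have sn: "\<exists>r. s n = ereal r \<and> 0 \<le> r \<and> \<Psi> r \<le> c" for n
  proof -
    have "s n \<noteq> \<infinity>" using s(1)[of n] by (auto simp: exit_cost_def top_unique)
    then obtain r where r: "s n = ereal r" "0 \<le> r" using s(3)[of n] by (cases "s n") auto
    then show ?thesis using s(1)[of n] s(2) by (auto simp: exit_cost_def)
  qed
  have below: "\<Psi> T \<le> c" if T: "0 \<le> T" "ereal T < s0" for T
  proof -
    obtain n where "ereal T < s n" using ev[OF T] by blast
    moreover obtain r where "s n = ereal r" "0 \<le> r" "\<Psi> r \<le> c" using sn by blast
    ultimately have "T \<le> r" "\<Psi> r \<le> c" "r \<in> {0..}" by auto
    then show ?thesis using mono_onD[OF mono, of T r] T by auto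
  qed
  have "s0 \<noteq> \<infinity>"
  proof
    assume "s0 = \<infinity>"
    \<comment> \<open>At this time the growth condition forces a value of at least
      \<open>c + 1\<close>.\<close>
    define T where "T = (c + \<bar>b\<bar> + 1) / a"
    have "T \<ge> 0" using \<open>a > 0\<close> s(2) by (simp add: T_def)
    then have "\<Psi> T \<le> c" using below[of T] \<open>s0 = \<infinity>\<close> by simp
    moreover have "a * T = c + \<bar>b\<bar> + 1" using \<open>a > 0\<close> by (simp add: T_def)
    ultimately show False using growth[OF \<open>T \<ge> 0\<close>] by linarith
  qed
  then obtain r where r: "s0 = ereal r" "0 \<le> r" using s(4) by (cases s0) auto
  have "\<Psi> r \<le> c"
  proof (rule ccontr)
    assume neg: "\<not> \<Psi> r \<le> c"
    show False
    \<comment> \<open>At 0 there are no earlier times to approach from; there monotonicity compares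
      directly with one of the \<open>s n\<close>.\<close>
    proof (cases "r = 0")
      case True
      obtain r' where "s 0 = ereal r'" "0 \<le> r'" "\<Psi> r' \<le> c" using sn by blast
      then show False using mono_onD[OF mono, of 0 r'] True neg by auto
    next
      case False
      have "eventually (\<lambda>z. c < \<Psi> z) (at r within {0..})"
        using lsc r(2) neg unfolding lsc_on_def by auto
      then obtain d where d: "d > 0" "\<And>z. z \<in> {0..} \<Longrightarrow> z \<noteq> r \<Longrightarrow> dist z r < d \<Longrightarrow> c < \<Psi> z"
        unfolding eventually_at by blast
      define z where "z = max (r / 2) (r - d / 2)"
      have z: "0 \<le> z" "z < r" "dist z r < d" using False r(2) d(1) by (auto simp: z_def dist_real_def max_def)
      then have "c < \<Psi> z" by (intro d(2)) auto
      then show False using below[of z] z r(1) by auto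
    qed
  qed
  then show ?thesis using r by (simp add: exit_cost_def ennreal_leI)
qed

locale mean_field_game =
  fixes X \<Xi> :: "'a::euclidean_space set"
    and l :: "real \<Rightarrow> 'a \<Rightarrow> 'a \<Rightarrow> real"
    and h :: "real \<Rightarrow> 'a \<Rightarrow> 'a \<Rightarrow> 'a \<Rightarrow> 'a \<Rightarrow> real"
    and \<Psi> :: "real \<Rightarrow> real" and \<alpha> \<theta> C \<beta> a b :: real
  assumes X: "compact X" and \<Xi>: "closed \<Xi>"
    and l_nonneg: "\<And>t x p. t \<ge> 0 \<Longrightarrow> x \<in> X \<Longrightarrow> l t x p \<ge> 0"
    and l_measurable: "\<And>x p. x \<in> X \<Longrightarrow> (\<lambda>t. l t x p) \<in> borel_measurable (lebesgue_on {0..})"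
    and l_continuous: "AE t in lebesgue_on {0..}. continuous_on (X \<times> UNIV) (\<lambda>(x, p). l t x p)"
    and l_convex: "AE t in lebesgue_on {0..}. \<forall>x\<in>X. convex_on UNIV (\<lambda>p. l t x p)"
    and \<alpha>: "\<alpha> > 0" and \<theta>: "\<theta> > 1"
    and l_coercive: "\<And>t x p. t \<ge> 0 \<Longrightarrow> x \<in> X \<Longrightarrow> l t x p \<ge> \<alpha> * norm p powr \<theta>"
    and h_nonneg: "\<And>t x x' p p'. t \<ge> 0 \<Longrightarrow> x \<in> X \<Longrightarrow> x' \<in> X \<Longrightarrow> h t x x' p p' \<ge> 0"
    and h_measurable: "\<And>x x' p p'. x \<in> X \<Longrightarrow> x' \<in> X \<Longrightarrow>
          (\<lambda>t. h t x x' p p') \<in> borel_measurable (lebesgue_on {0..})"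
    and h_continuous: "AE t in lebesgue_on {0..}.
          continuous_on (X \<times> X \<times> UNIV \<times> UNIV) (\<lambda>(x, x', p, p'). h t x x' p p')"
    and h_convex: "AE t in lebesgue_on {0..}. \<forall>x\<in>X. \<forall>x'\<in>X.
          convex_on UNIV (\<lambda>(p, p'). h t x x' p p')"
    and h_symmetric: "\<And>t x x' p p'. t \<ge> 0 \<Longrightarrow> x \<in> X \<Longrightarrow> x' \<in> X \<Longrightarrow> h t x x' p p' = h t x' x p' p"
    and C: "C > 0" and \<beta>: "0 < \<beta>" "\<beta> \<le> \<theta>"
    and h_growth: "\<And>t x x' p p'. t \<ge> 0 \<Longrightarrow> x \<in> X \<Longrightarrow> x' \<in> X \<Longrightarrow>
          h t x x' p p' \<le> C * (norm p powr \<beta> + norm p' powr \<beta>)"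
    and Psi_nonneg: "\<And>t. t \<ge> 0 \<Longrightarrow> \<Psi> t \<ge> 0"
    and Psi_lsc: "lsc_on {0..} \<Psi>" and Psi_mono: "mono_on {0..} \<Psi>"
    and a: "a > 0" and b: "b > 0" and Psi_growth: "\<And>t. t \<ge> 0 \<Longrightarrow> \<Psi> t \<ge> a * t - b"
begin

text \<open>The part of \<open>total_cost\<close> that depends on the curve alone, with the same
  convention for curves that are not absolutely continuous.\<close>

definition own_cost :: "(real \<Rightarrow> 'a) \<Rightarrow> ennreal" where
  "own_cost \<gamma> = (if loc_abs_continuous \<gamma> then running_cost l \<gamma> + exit_cost \<Psi> (exit_time \<Xi> \<gamma>) else \<infinity>)"

abbreviation "interaction \<equiv> interaction_cost \<Xi> h"

lemma energy_le_running_cost: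
  assumes "\<gamma> \<in> curves X" and ac: "loc_abs_continuous \<gamma>"
  shows "ennreal \<alpha> * energy \<theta> \<gamma> \<le> running_cost l \<gamma>"
proof -
  have m: "(\<lambda>t. ennreal (norm (velocity \<gamma> t) powr \<theta>) * indicator {0..} t) \<in> borel_measurable lebesgue"
  proof -
    have "(\<lambda>t. ennreal (norm (velocity \<gamma> t) powr \<theta>)) \<in> borel_measurable (lebesgue_on {0..})"
      using velocity_measurable_atLeast[OF ac] by measurable
    then show ?thesis by (subst (asm) borel_measurable_restrict_space_iff_ennreal) auto
  qed
  have "ennreal \<alpha> * energy \<theta> \<gamma> = (\<integral>\<^sup>+ t\<in>{0..}. ennreal \<alpha> * ennreal (norm (velocity \<gamma> t) powr \<theta>) \<partial>lebesgue)"
    unfolding energy_def by (subst nn_integral_cmult[OF m, symmetric]) (simp add: mult.assoc)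
  also have "\<dots> \<le> running_cost l \<gamma>"
    unfolding running_cost_def
  proof (rule nn_integral_mono)
    fix t :: real
    show "ennreal \<alpha> * ennreal (norm (velocity \<gamma> t) powr \<theta>) * indicator {0..} t
      \<le> ennreal (l t (\<gamma> t) (velocity \<gamma> t)) * indicator {0..} t"
    proof (cases "0 \<le> t")
      case True
      have "\<alpha> * norm (velocity \<gamma> t) powr \<theta> \<le> l t (\<gamma> t) (velocity \<gamma> t)"
        using l_coercive[OF True curvesD(2)[OF assms(1) True]] .
      then show ?thesis using \<alpha> True by (simp add: ennreal_mult[symmetric] ennreal_leI)
    qed simp
  qed
  finally show ?thesis .
qed

lemma own_cost_finite_energy:
  assumes "\<gamma> \<in> curves X" "own_cost \<gamma> \<le> ennreal c" "c \<ge> 0"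
  shows "finite_energy_curve \<theta> (c / \<alpha>) \<gamma>"
proof
  show ac: "loc_abs_continuous \<gamma>" using assms(2) by (auto simp: own_cost_def top_unique split: if_splits)
  have "ennreal \<alpha> * energy \<theta> \<gamma> \<le> running_cost l \<gamma>" by (rule energy_le_running_cost[OF assms(1) ac])
  also have "\<dots> \<le> own_cost \<gamma>" using ac by (simp add: own_cost_def)
  also have "\<dots> \<le> ennreal c" by (rule assms(2))
  finally have "ennreal (1 / \<alpha>) * (ennreal \<alpha> * energy \<theta> \<gamma>) \<le> ennreal (1 / \<alpha>) * ennreal c"
    by (rule mult_left_mono) simp
  then show "energy \<theta> \<gamma> \<le> ennreal (c / \<alpha>)"
    using \<alpha> assms(3) by (simp add: mult.assoc[symmetric] ennreal_mult[symmetric])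
qed (use \<theta> \<alpha> assms(3) in auto)

lemma own_cost_converging:
  assumes "\<And>n. u n \<in> curves X" "\<And>n. own_cost (u n) \<le> ennreal c" "c \<ge> 0"
    "\<And>t. 0 \<le> t \<Longrightarrow> (\<lambda>n. u n t) \<longlonglongrightarrow> \<gamma> t"
  shows "converging_curves \<theta> (c / \<alpha>) u \<gamma>"
  using own_cost_finite_energy assms by unfold_locales (auto simp: finite_energy_curve_def)

lemma running_cost_bounded_limit:
  assumes u: "\<And>n. u n \<in> curves X" "converging_curves \<theta> K u \<gamma>" and \<gamma>: "\<gamma> \<in> curves X"
    and le: "\<And>n. running_cost l (u n) \<le> ennreal A" "A \<ge> 0"
  shows "running_cost l \<gamma> \<le> ennreal A"
proof -
  interpret converging_curves \<theta> K u \<gamma> by fact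
  have lm: "(\<lambda>t. l t (\<gamma> t) (velocity \<gamma> t)) \<in> borel_measurable (lebesgue_on {0..})"
  proof -
    have "\<gamma> \<in> borel_measurable (lebesgue_on {0..})"
      using curvesD(1)[OF \<gamma>] by (intro continuous_imp_measurable_on_sets_lebesgue) auto
    then have "(\<lambda>t. (\<gamma> t, velocity \<gamma> t)) \<in> borel_measurable (lebesgue_on {0..})"
      using velocity_measurable_atLeast[OF limit_ac] by (rule borel_measurable_Pair)
    then have "(\<lambda>t. (\<lambda>(x, p). l t x p) (\<gamma> t, velocity \<gamma> t)) \<in> borel_measurable (lebesgue_on {0..})"
      by (rule caratheodory_lebesgue_on[OF _ l_continuous, rotated 2]) (use l_measurable curvesD(2)[OF \<gamma>] in
        auto)
    then show ?thesis by simp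
  qed
  have "(\<integral>\<^sup>+ t\<in>{t. 0 \<le> t \<and> ereal t \<le> \<infinity>}. ennreal (l t (\<gamma> t) (velocity \<gamma> t)) \<partial>lebesgue) \<le> ennreal A"
  proof (rule nn_integral_exhaust[where T = real])
    show "(\<lambda>t. ennreal (l t (\<gamma> t) (velocity \<gamma> t))) \<in> borel_measurable (lebesgue_on {0..})" using lm
      by measurable
    show "AE t in lebesgue. 0 \<le> t \<longrightarrow> ereal t \<le> \<infinity> \<longrightarrow> (\<exists>n. t \<le> real n)" using real_arch_simple by (intro AE_I2) auto
    fix n
    have T: "0 \<le> real n" by simp
    show "(\<integral>\<^sup>+ t. ennreal (l t (\<gamma> t) (velocity \<gamma> t)) \<partial>lebesgue_on {0..real n}) \<le> ennreal A"
    proof (rule caratheodory_functional_lsc[OF l_continuous l_convex l_nonneg l_measurable _ _ _ _ lim _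
      limit_velocity_integrable(1)[OF T] \<theta>
          finite_energy_curve.nn_integral_powr_le[OF fe T] K velocity_weak_convergence[OF T] _ le(2)])
      fix k
      have "(\<integral>\<^sup>+ t. ennreal (l t (u k t) (velocity (u k) t)) \<partial>lebesgue_on {0..real n}) =
        (\<integral>\<^sup>+ t\<in>{0..real n}. ennreal (l t (u k t) (velocity (u k) t)) \<partial>lebesgue)"
        by (rule nn_integral_restrict_space) auto
      also have "\<dots> \<le> running_cost l (u k)"
        unfolding running_cost_def by (intro nn_integral_mono) (auto simp: indicator_def)
      also have "\<dots> \<le> ennreal A" by (rule le)
      finally show "(\<integral>\<^sup>+ t. ennreal (l t (u k t) (velocity (u k) t)) \<partial>lebesgue_on {0..real n}) \<le> ennreal A" .
    qed (use curvesD[OF u(1)] curvesD[OF \<gamma>] finite_energy_curve.velocity_integrable(1)[OF fe T] in auto)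
  qed (auto simp: incseq_def)
  moreover have "{t. 0 \<le> t \<and> ereal t \<le> \<infinity>} = {0..}" by auto
  ultimately show ?thesis by (simp add: running_cost_def)
qed

text \<open>The bound \<open>c\<close> on the costs is a bound on the energies. It gives weak
  convergence of velocities for the running cost and locally uniform convergence for the exit
  time.\<close>

lemma own_cost_lsc:
  assumes u: "\<And>n. u n \<in> curves X" "\<And>n. own_cost (u n) \<le> ennreal c" "c \<ge> 0"
    and lim: "\<And>t. 0 \<le> t \<Longrightarrow> (\<lambda>n. u n t) \<longlonglongrightarrow> \<gamma> t" and \<gamma>: "\<gamma> \<in> curves X"
  shows "own_cost \<gamma> \<le> liminf (\<lambda>n. own_cost (u n))"
proof -
  interpret cc: converging_curves \<theta> "c / \<alpha>" u \<gamma> by (rule own_cost_converging[OF u lim])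
  have ac: "loc_abs_continuous (u n)" for n using u(2)[of n]
    by (auto simp: own_cost_def top_unique split: if_splits)
  have sub: "converging_curves \<theta> (c / \<alpha>) (u \<circ> r) \<gamma>" if "strict_mono r" for r :: "nat \<Rightarrow> nat"
    using u lim by (intro own_cost_converging) (auto intro: LIMSEQ_subseq_LIMSEQ[OF _ that, unfolded comp_def]
      u(3))
  have "running_cost l \<gamma> \<le> liminf (\<lambda>n. running_cost l (u n))"
  proof (rule liminf_ge_if_subsequences)
    fix r :: "nat \<Rightarrow> nat" and A assume "strict_mono r" "A \<ge> 0" "\<And>n. running_cost l (u (r n)) \<le> ennreal A"
    then show "running_cost l \<gamma> \<le> ennreal A"
      using running_cost_bounded_limit[OF _ sub \<gamma>, of r A] u(1) by simp
  qed
  moreover have "exit_cost \<Psi> (exit_time \<Xi> \<gamma>) \<le> liminf (\<lambda>n. exit_cost \<Psi> (exit_time \<Xi> (u n)))"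
  proof (rule liminf_ge_if_subsequences)
    fix r :: "nat \<Rightarrow> nat" and A assume r: "strict_mono r"
      and A: "A \<ge> 0" "\<And>n. exit_cost \<Psi> (exit_time \<Xi> (u (r n))) \<le> ennreal A"
    show "exit_cost \<Psi> (exit_time \<Xi> \<gamma>) \<le> ennreal A"
    proof (rule exit_cost_lsc[OF Psi_nonneg Psi_lsc Psi_mono a Psi_growth A(2,1) exit_time_nonneg
      exit_time_nonneg])
      fix T assume T: "0 \<le> T" "ereal T < exit_time \<Xi> \<gamma>"
      have "eventually (\<lambda>n. ereal T < exit_time \<Xi> ((u \<circ> r) n)) sequentially"
        by (rule exit_time_less_eventually[OF curvesD(1)[OF \<gamma>] \<Xi> converging_curves.uniform_on_compacts[OF sub[OF
          r]] T])
      then show "\<exists>n. ereal T < exit_time \<Xi> (u (r n))" by (auto simp: eventually_sequentially)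
    qed
  qed
  ultimately have "own_cost \<gamma> \<le> liminf (\<lambda>n. running_cost l (u n)) + liminf (\<lambda>n.
    exit_cost \<Psi> (exit_time \<Xi> (u n)))"
    using cc.limit_ac by (simp add: own_cost_def add_mono)
  also have "\<dots> \<le> liminf (\<lambda>n. own_cost (u n))"
    using ac by (simp add: own_cost_def liminf_add_ennreal)
  finally show ?thesis .
qed

lemma interaction_integrand_measurable:
  assumes \<gamma>: "\<gamma> \<in> curves X" "loc_abs_continuous \<gamma>" and \<gamma>': "\<gamma>' \<in> curves X" "loc_abs_continuous \<gamma>'"
  shows "(\<lambda>t. h t (\<gamma> t) (\<gamma>' t) (velocity \<gamma> t) (velocity \<gamma>' t)) \<in> borel_measurable (lebesgue_on {0..})"
proof -
  have "\<gamma> \<in> borel_measurable (lebesgue_on {0..})" "\<gamma>' \<in> borel_measurable (lebesgue_on {0..})"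
    using curvesD(1)[OF \<gamma>(1)] curvesD(1)[OF \<gamma>'(1)] by (auto intro!: continuous_imp_measurable_on_sets_lebesgue)
  then have "(\<lambda>t. (\<gamma> t, \<gamma>' t, velocity \<gamma> t, velocity \<gamma>' t)) \<in> borel_measurable (lebesgue_on {0..})"
    using velocity_measurable_atLeast[OF \<gamma>(2)] velocity_measurable_atLeast[OF \<gamma>'(2)]
    by (intro borel_measurable_Pair)
  then have "(\<lambda>t. (\<lambda>(x, x', p, p').
    h t x x' p p') (\<gamma> t, \<gamma>' t, velocity \<gamma> t, velocity \<gamma>' t)) \<in> borel_measurable (lebesgue_on {0..})"
    by (rule caratheodory_lebesgue_on[OF _ h_continuous, rotated 2])
      (use h_measurable curvesD(2)[OF \<gamma>(1)] curvesD(2)[OF \<gamma>'(1)] in auto)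
  then show ?thesis by simp
qed

text \<open>A pair of curves is one curve in the product space, and the joint convexity of
  \<open>h\<close> in the two velocities is convexity in the velocity of that curve.\<close>

lemma interaction_on_interval_limit:
  assumes u: "\<And>n. u n \<in> curves X" "converging_curves \<theta> K u \<gamma>" and \<gamma>: "\<gamma> \<in> curves X"
    and w: "\<And>n. w n \<in> curves X" "converging_curves \<theta> K w \<gamma>'" and \<gamma>': "\<gamma>' \<in> curves X"
    and T: "0 \<le> T" and A: "A \<ge> 0"
    and le: "\<And>n. (\<integral>\<^sup>+ t. ennreal (h t (u n t) (w n t) (velocity (u n) t) (velocity (w n) t)) \<partial>lebesgue_on
      {0..T}) \<le> ennreal A"
  shows "(\<integral>\<^sup>+ t. ennreal (h t (\<gamma> t) (\<gamma>' t) (velocity \<gamma> t) (velocity \<gamma>' t)) \<partial>lebesgue_on {0..T}) \<le> ennreal A"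
proof -
  interpret u: converging_curves \<theta> K u \<gamma> by fact
  interpret w: converging_curves \<theta> K w \<gamma>' by fact
  let ?M = "lebesgue_on {0..T}"
  define f where "f t y q = h t (fst y) (snd y) (fst q) (snd q)" for t and y q :: "'a \<times> 'a"
  note fu = u.fe and fw = w.fe
  have pairint: "integrable ?M (\<lambda>t. (v t, v' t))" and
    pairval: "\<And>D. D \<in> sets ?M \<Longrightarrow> (LINT t:D|?M. (v t, v' t)) = (LINT t:D|?M. v t, LINT t:D|?M. v' t)"
    if v: "integrable ?M v" "integrable ?M v'" for v v' :: "real \<Rightarrow> 'a"
  proof -
    have l1: "bounded_linear (\<lambda>x::'a. (x, 0::'a))" and l2: "bounded_linear (\<lambda>x::'a. (0::'a, x))"
      by (auto intro!: bounded_linear_Pair bounded_linear_ident bounded_linear_zero)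
    have eq: "(\<lambda>t. (v t, v' t)) = (\<lambda>t. (v t, 0) + (0, v' t))" by auto
    show int: "integrable ?M (\<lambda>t. (v t, v' t))"
      unfolding eq using integrable_bounded_linear[OF l1 v(1)] integrable_bounded_linear[OF l2 v(2)]
      by (rule Bochner_Integration.integrable_add)
    fix D assume D: "D \<in> sets ?M"
    note ii = integrable_mult_indicator[OF D int]
    have "fst (LINT t:D|?M. (v t, v' t)) = (LINT t:D|?M. v t)"
      unfolding set_lebesgue_integral_def using integral_bounded_linear[OF bounded_linear_fst ii] by simp
    moreover have "snd (LINT t:D|?M. (v t, v' t)) = (LINT t:D|?M. v' t)"
      unfolding set_lebesgue_integral_def using integral_bounded_linear[OF bounded_linear_snd ii] by simp
    ultimately show "(LINT t:D|?M. (v t, v' t)) = (LINT t:D|?M. v t, LINT t:D|?M. v' t)"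
      by (intro prod_eqI) auto
  qed
  \<comment> \<open>Bounds the energy of the pair by those of its components; the factor is crude,
    but only finiteness matters.\<close>
  have powr_pair: "norm (p, q) powr \<theta> \<le> 2 powr \<theta> * (norm p powr \<theta> + norm q powr \<theta>)" for p q :: 'a
  proof -
    have "norm (p, q) \<le> norm p + norm q" by (rule norm_Pair_le)
    also have "\<dots> \<le> 2 * max (norm p) (norm q)" by simp
    finally have "norm (p, q) powr \<theta> \<le> (2 * max (norm p) (norm q)) powr \<theta>"
      using \<theta> by (intro powr_mono2) auto
    also have "\<dots> = 2 powr \<theta> * max (norm p) (norm q) powr \<theta>" by (simp add: powr_mult)
    also have "max (norm p) (norm q) powr \<theta> \<le> norm p powr \<theta> + norm q powr \<theta>"
      by (cases "norm p \<le> norm q") (auto simp: max_def)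
    then have "2 powr \<theta> * max (norm p) (norm q) powr \<theta> \<le> 2 powr \<theta> * (norm p powr \<theta> + norm q powr \<theta>)"
      by (rule mult_left_mono) simp
    finally show ?thesis .
  qed
  have "(\<integral>\<^sup>+ t. ennreal (f t (\<gamma> t, \<gamma>' t) (velocity \<gamma> t, velocity \<gamma>' t)) \<partial>?M) \<le> ennreal A"
  proof (rule caratheodory_functional_lsc[where Y = "X \<times> X" and T = T and f = f and y = "\<lambda>n t. (u n t, w n t)"
    and
        p = "\<lambda>n t. (velocity (u n) t, velocity (w n) t)", OF _ _ _ _ _ _ _ _ _ _ _ \<theta> _ _ _ _ A])
    show "AE t in lebesgue_on {0..}. continuous_on ((X \<times> X) \<times> UNIV) (\<lambda>(y, q). f t y q)"
      using h_continuous
    proof eventually_elim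
      case (elim t)
      have "continuous_on ((X \<times> X) \<times> UNIV) (\<lambda>z :: ('a \<times> 'a) \<times> ('a \<times> 'a).
        (fst (fst z), snd (fst z), fst (snd z), snd (snd z)))"
        by (intro continuous_intros)
      then have "continuous_on ((X \<times> X) \<times> UNIV) (\<lambda>z :: ('a \<times> 'a) \<times> ('a \<times> 'a). (\<lambda>(x, x', p, p').
        h t x x' p p') (fst (fst z), snd (fst z), fst (snd z), snd (snd z)))"
        by (rule continuous_on_compose2[OF elim]) auto
      then show ?case by (simp add: f_def case_prod_beta)
    qed
    show "AE t in lebesgue_on {0..}. \<forall>y\<in>X \<times> X. convex_on UNIV (f t y)"
      using h_convex by eventually_elim (auto simp: f_def[abs_def] case_prod_unfold)
    show "0 \<le> f t y q" if "0 \<le> t" "y \<in> X \<times> X" for t y q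
      using h_nonneg that by (auto simp: f_def)
    show "(\<lambda>t. f t y q) \<in> borel_measurable (lebesgue_on {0..})" if "y \<in> X \<times> X" for y q
      using h_measurable that by (auto simp: f_def)
    show "continuous_on {0..} (\<lambda>t. (u n t, w n t))" for n
      using curvesD(1)[OF u(1)] curvesD(1)[OF w(1)] by (intro continuous_on_Pair)
    show "continuous_on {0..} (\<lambda>t. (\<gamma> t, \<gamma>' t))"
      using curvesD(1)[OF \<gamma>] curvesD(1)[OF \<gamma>'] by (intro continuous_on_Pair)
    show "(u n t, w n t) \<in> X \<times> X" "(\<gamma> t, \<gamma>' t) \<in> X \<times> X" if "0 \<le> t" for n t
      using curvesD(2) u(1) w(1) \<gamma> \<gamma>' that by auto
    show "(\<lambda>n. (u n t, w n t)) \<longlonglongrightarrow> (\<gamma> t, \<gamma>' t)" if "0 \<le> t" for t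
      by (intro tendsto_Pair u.lim w.lim that)
    show "integrable ?M (\<lambda>t. (velocity (u n) t, velocity (w n) t))" for n
      by (intro pairint finite_energy_curve.velocity_integrable(1)[OF fu T]
        finite_energy_curve.velocity_integrable(1)[OF fw T])
    show "integrable ?M (\<lambda>t. (velocity \<gamma> t, velocity \<gamma>' t))"
      by (intro pairint u.limit_velocity_integrable(1)[OF T] w.limit_velocity_integrable(1)[OF T])
    show "(\<integral>\<^sup>+ t. ennreal (norm (velocity (u n) t, velocity (w n) t) powr \<theta>) \<partial>?M) \<le> ennreal (2 powr \<theta> * (K +
      K))" for n
    proof -
      have m: "velocity (u n) \<in> borel_measurable ?M" "velocity (w n) \<in> borel_measurable ?M"
        using velocity_measurable T finite_energy_curve.ac[OF fu] finite_energy_curve.ac[OF fw] by blast+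
      note [measurable] = m
      have "(\<integral>\<^sup>+ t. ennreal (norm (velocity (u n) t, velocity (w n) t) powr \<theta>) \<partial>?M) \<le>
        (\<integral>\<^sup>+ t. ennreal (2 powr \<theta>) * (ennreal (norm (velocity (u n) t) powr \<theta>) + ennreal (norm (velocity
          (w n) t) powr \<theta>)) \<partial>?M)"
        using powr_pair by (intro nn_integral_mono) (simp add: ennreal_mult[symmetric] ennreal_plus[symmetric]
          ennreal_leI del: ennreal_plus)
      also have "\<dots> = ennreal (2 powr \<theta>) * ((\<integral>\<^sup>+ t. ennreal (norm (velocity (u n) t) powr \<theta>) \<partial>?M) + (\<integral>\<^sup>+ t.
        ennreal (norm (velocity (w n) t) powr \<theta>) \<partial>?M))"
        by (simp add: nn_integral_add nn_integral_cmult)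
      also have "\<dots> \<le> ennreal (2 powr \<theta>) * (ennreal K + ennreal K)"
        by (intro mult_left_mono add_mono finite_energy_curve.nn_integral_powr_le[OF fu T]
          finite_energy_curve.nn_integral_powr_le[OF fw T]) simp
      also have "\<dots> = ennreal (2 powr \<theta> * (K + K))"
        using u.K by (simp add: ennreal_mult[symmetric] ennreal_plus[symmetric] del: ennreal_plus)
      finally show ?thesis .
    qed
    show "0 \<le> 2 powr \<theta> * (K + K)" using u.K by simp
    show "(\<lambda>n. LINT t:D|?M. (velocity (u n) t, velocity (w n) t)) \<longlonglongrightarrow> (LINT t:D|?M.
      (velocity \<gamma> t, velocity \<gamma>' t))"
      if D: "D \<in> sets ?M" for D
    proof -
      have "(\<lambda>n. (LINT t:D|?M. velocity (u n) t, LINT t:D|?M. velocity (w n) t)) \<longlonglongrightarrow> (LINT t:D|?M.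
        velocity \<gamma> t, LINT t:D|?M. velocity \<gamma>' t)"
        by (intro tendsto_Pair u.velocity_weak_convergence w.velocity_weak_convergence T D)
      then show ?thesis
        by (simp only: pairval[OF u.limit_velocity_integrable(1)[OF T] w.limit_velocity_integrable(1)[OF T] D]
          pairval[OF finite_energy_curve.velocity_integrable(1)[OF fu T]
            finite_energy_curve.velocity_integrable(1)[OF fw T] D])
    qed
    show "(\<integral>\<^sup>+ t. ennreal (f t (u n t, w n t) (velocity (u n) t, velocity (w n) t)) \<partial>?M) \<le> ennreal A" for n
      using le by (simp add: f_def)
  qed
  then show ?thesis by (simp add: f_def)
qed

text \<open>The interval of interaction varies with the curves. Up to a time strictly before both
  limit exits, the approximating curves have eventually not exited either, so the bound
  \<open>A\<close> applies on this fixed interval. Letting the time increase to the first limit exit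
  misses only a null set.\<close>

lemma interaction_lsc:
  assumes u: "\<And>n. u n \<in> curves X" "\<And>n. own_cost (u n) \<le> ennreal c" and \<gamma>: "\<gamma> \<in> curves X"
    and limu: "\<And>t. 0 \<le> t \<Longrightarrow> (\<lambda>n. u n t) \<longlonglongrightarrow> \<gamma> t"
    and w: "\<And>n. w n \<in> curves X" "\<And>n. own_cost (w n) \<le> ennreal c" and \<gamma>': "\<gamma>' \<in> curves X"
    and limw: "\<And>t. 0 \<le> t \<Longrightarrow> (\<lambda>n. w n t) \<longlonglongrightarrow> \<gamma>' t"
    and c: "c \<ge> 0"
  shows "interaction \<gamma> \<gamma>' \<le> liminf (\<lambda>n. interaction (u n) (w n))"
proof (rule liminf_ge_if_subsequences)
  fix r :: "nat \<Rightarrow> nat" and A assume r: "strict_mono r"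
    and A: "A \<ge> 0" "\<And>n. interaction (u (r n)) (w (r n)) \<le> ennreal A"
  have conv: "converging_curves \<theta> (c / \<alpha>) (\<lambda>n. u (s n)) \<gamma>" "converging_curves \<theta> (c / \<alpha>) (\<lambda>n. w (s n)) \<gamma>'"
    if "strict_mono s" for s :: "nat \<Rightarrow> nat"
    using u w limu limw
      by (auto intro!: own_cost_converging c LIMSEQ_subseq_LIMSEQ[OF _ that, unfolded comp_def])
  interpret cu: converging_curves \<theta> "c / \<alpha>" "\<lambda>n. u (r n)" \<gamma> by (rule conv[OF r])
  interpret cw: converging_curves \<theta> "c / \<alpha>" "\<lambda>n. w (r n)" \<gamma>' by (rule conv[OF r])
  define m where "m = min (exit_time \<Xi> \<gamma>) (exit_time \<Xi> \<gamma>')"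
  have m0: "0 \<le> m" by (simp add: m_def exit_time_nonneg)
  let ?f = "\<lambda>t. h t (\<gamma> t) (\<gamma>' t) (velocity \<gamma> t) (velocity \<gamma>' t)"
  have fm: "(\<lambda>t. ennreal (?f t)) \<in> borel_measurable (lebesgue_on {0..})"
    using interaction_integrand_measurable[OF \<gamma> cu.limit_ac \<gamma>' cw.limit_ac] by measurable
  have step: "(\<integral>\<^sup>+ t. ennreal (?f t) \<partial>lebesgue_on {0..T}) \<le> ennreal A" if T: "0 \<le> T" "ereal T < m" for T
  proof -
    have "eventually (\<lambda>n. ereal T < exit_time \<Xi> (u (r n))) sequentially"
      by (rule exit_time_less_eventually[OF curvesD(1)[OF \<gamma>] \<Xi> cu.uniform_on_compacts T(1)])
        (use T(2) in \<open>auto simp: m_def\<close>)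
    moreover have "eventually (\<lambda>n. ereal T < exit_time \<Xi> (w (r n))) sequentially"
      by (rule exit_time_less_eventually[OF curvesD(1)[OF \<gamma>'] \<Xi> cw.uniform_on_compacts T(1)])
        (use T(2) in \<open>auto simp: m_def\<close>)
    ultimately have "eventually (\<lambda>n.
      ereal T < min (exit_time \<Xi> (u (r n))) (exit_time \<Xi> (w (r n)))) sequentially"
      by eventually_elim simp
    then obtain N where N: "\<And>n. n \<ge> N \<Longrightarrow> ereal T < min (exit_time \<Xi> (u (r n))) (exit_time \<Xi> (w (r n)))"
      by (auto simp: eventually_sequentially)
    \<comment> \<open>Dropping the first \<open>N\<close> terms makes all remaining pairs interact
      at least up to \<open>T\<close>.\<close>
    define s where "s n = r (n + N)" for n
    have s: "strict_mono s" using r by (auto simp: s_def strict_mono_def)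
    show ?thesis
    proof (rule interaction_on_interval_limit[OF _ conv(1)[OF s] \<gamma> _ conv(2)[OF s] \<gamma>' T(1) A(1)])
      fix n
      let ?g = "\<lambda>t. ennreal (h t (u (s n) t) (w (s n) t) (velocity (u (s n)) t) (velocity (w (s n)) t))"
      have "(\<integral>\<^sup>+ t. ?g t \<partial>lebesgue_on {0..T}) = (\<integral>\<^sup>+ t\<in>{0..T}. ?g t \<partial>lebesgue)"
        by (rule nn_integral_restrict_space) auto
      also have "\<dots> \<le> interaction (u (s n)) (w (s n))"
        unfolding interaction_cost_def
      proof (rule nn_integral_mono)
        fix t
        have "{0..T} \<subseteq> {t. 0 \<le> t \<and> ereal t \<le> min (exit_time \<Xi> (u (s n))) (exit_time \<Xi> (w (s n)))}"
        proof
          fix t assume t: "t \<in> {0..T}"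
          then have "ereal t \<le> ereal T" by simp
          also have "\<dots> \<le> min (exit_time \<Xi> (u (s n))) (exit_time \<Xi> (w (s n)))"
            using less_imp_le[OF N[of "n + N"]] unfolding s_def by simp
          finally show "t \<in> {t. 0 \<le> t \<and> ereal t \<le> min (exit_time \<Xi> (u (s n))) (exit_time \<Xi> (w (s n)))}" using t
            by simp
        qed
        then show "?g t * indicator {0..T} t \<le> ?g t * indicator {t. 0 \<le> t \<and>
          ereal t \<le> min (exit_time \<Xi> (u (s n))) (exit_time \<Xi> (w (s n)))} t"
          by (intro mult_left_mono) (auto simp: indicator_def)
      qed
      also have "\<dots> \<le> ennreal A" using A(2)[of "n + N"] by (simp add: s_def)
      finally show "(\<integral>\<^sup>+ t. ?g t \<partial>lebesgue_on {0..T}) \<le> ennreal A" .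
    qed (use u w in auto)
  qed
  have "(\<integral>\<^sup>+ t\<in>{t. 0 \<le> t \<and> ereal t \<le> m}. ennreal (?f t) \<partial>lebesgue) \<le> ennreal A"
  proof (cases m)
    case PInf
    show ?thesis
    proof (rule nn_integral_exhaust[OF fm, where T = real])
      show "AE t in lebesgue. 0 \<le> t \<longrightarrow> ereal t \<le> m \<longrightarrow> (\<exists>n. t \<le> real n)" using real_arch_simple
        by (intro AE_I2) auto
    qed (use PInf step in \<open>auto simp: incseq_def\<close>)
  next
    case MInf
    then show ?thesis using m0 by simp
  next
    case (real q)
    show ?thesis
    \<comment> \<open>For \<open>q = 0\<close> the domain of integration is one point. Otherwise it
      is exhausted by times strictly below \<open>q\<close>, because \<open>step\<close> requires a
      strict inequality.\<close>
    proof (cases "q = 0")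
      case True
      have ae: "AE t in lebesgue. t \<notin> {0::real}"
        by (rule AE_not_in) (auto simp: negligible_iff_null_sets[symmetric])
      have "(\<integral>\<^sup>+ t\<in>{t. 0 \<le> t \<and> ereal t \<le> m}. ennreal (?f t) \<partial>lebesgue) = (\<integral>\<^sup>+ (t::real). 0 \<partial>lebesgue)"
      proof (rule nn_integral_cong_AE)
        show "AE t in lebesgue. ennreal (?f t) * indicator {t. 0 \<le> t \<and> ereal t \<le> m} t = 0"
          using ae by eventually_elim (auto simp: indicator_def real True)
      qed
      then show ?thesis by simp
    next
      case False
      then have q: "q > 0" using m0 real by simp
      define T where "T n = q - q / real (Suc n)" for n
      have T: "0 \<le> T n" "T n < q" for n using q by (auto simp: T_def field_simps)
      show ?thesis
      proof (rule nn_integral_exhaust[OF fm, where T = T])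
        show "incseq T" unfolding T_def using q by (intro incseq_SucI diff_left_mono divide_left_mono) auto
        show "ereal (T n) \<le> m" for n using T(2)[of n] real by (simp add: less_imp_le)
        show "(\<integral>\<^sup>+ t. ennreal (?f t) \<partial>lebesgue_on {0..T n}) \<le> ennreal A" for n
          using T real by (intro step) auto
        have "AE t in lebesgue. t \<notin> {q}" by (rule AE_not_in) (auto simp: negligible_iff_null_sets[symmetric])
        then show "AE t in lebesgue. 0 \<le> t \<longrightarrow> ereal t \<le> m \<longrightarrow> (\<exists>n. t \<le> T n)"
        proof eventually_elim
          case (elim t)
          show ?case
          proof (intro impI)
            assume "ereal t \<le> m"
            then have "t < q" using elim real by auto
            then have "(q - t) / q > 0" using q by simp
            then obtain n where "1 / real (Suc n) < (q - t) / q" using nat_approx_posE by blast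
            then have "q / real (Suc n) < q - t" using q by (simp add: field_simps)
            then show "\<exists>n. t \<le> T n" by (intro exI[of _ n]) (simp add: T_def)
          qed
        qed
      qed
    qed
  qed
  then show "interaction \<gamma> \<gamma>' \<le> ennreal A" by (simp add: interaction_cost_def m_def)
qed

lemma interaction_commute:
  assumes "\<gamma> \<in> curves X" "\<gamma>' \<in> curves X"
  shows "interaction \<gamma> \<gamma>' = interaction \<gamma>' \<gamma>"
  unfolding interaction_cost_def
proof (intro nn_integral_cong)
  fix t
  show "ennreal (h t (\<gamma> t) (\<gamma>' t) (velocity \<gamma> t) (velocity \<gamma>' t)) * indicator {t. 0 \<le> t \<and>
    ereal t \<le> min (exit_time \<Xi> \<gamma>) (exit_time \<Xi> \<gamma>')} t =
    ennreal (h t (\<gamma>' t) (\<gamma> t) (velocity \<gamma>' t) (velocity \<gamma> t)) * indicator {t. 0 \<le> t \<and> ereal t \<le> min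
      (exit_time \<Xi> \<gamma>') (exit_time \<Xi> \<gamma>)} t"
  proof (cases "0 \<le> t")
    case True
    show ?thesis
      unfolding h_symmetric[OF True curvesD(2)[OF assms(1) True] curvesD(2)[OF assms(2) True]] min.commute[of
        "exit_time \<Xi> \<gamma>'"] ..
  qed simp
qed

text \<open>Origin of both constants: since \<beta> \<le> \<theta>, the integrand is at most
  \<open>C\<close> times 2 plus the two \<theta>-powers; the duration is at most
  \<open>b / a\<close> plus the exit cost divided by \<open>a\<close>; and an energy is at most the
  own cost divided by \<open>\<alpha>\<close>.\<close>

definition interaction_const :: real where "interaction_const = 2 * C * b / a"
definition interaction_slope :: real where "interaction_slope = 2 * C / a + C / \<alpha>"

lemma exit_time_le:
  assumes "exit_cost \<Psi> s \<noteq> \<infinity>" "0 \<le> s"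
  obtains r where "s = ereal r" "0 \<le> r" "ennreal r \<le> ennreal (b / a) + ennreal (1 / a) * exit_cost \<Psi> s"
proof -
  have "s \<noteq> \<infinity>" using assms(1) by (auto simp: exit_cost_def)
  then obtain r where r: "s = ereal r" "0 \<le> r" using assms(2) by (cases s) auto
  have "a * r \<le> \<Psi> r + b" using Psi_growth[OF r(2)] by simp
  then have "r \<le> b / a + 1 / a * \<Psi> r" using a by (simp add: field_simps)
  then have "ennreal r \<le> ennreal (b / a + 1 / a * \<Psi> r)" by (rule ennreal_leI)
  also have "\<dots> = ennreal (b / a) + ennreal (1 / a) * ennreal (\<Psi> r)"
    using a b Psi_nonneg[OF r(2)]
      by (simp add: ennreal_mult[symmetric] ennreal_plus[symmetric] del: ennreal_plus)
  finally show ?thesis using that[OF r] r by (simp add: exit_cost_def)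
qed

text \<open>If an own cost is infinite, so is the right-hand side, the slope being positive.
  Otherwise the exit time of \<open>\<gamma>\<close> bounds the duration of the interaction, and
  each energy is charged to its own curve.\<close>

lemma interaction_le_own_costs:
  assumes \<gamma>: "\<gamma> \<in> curves X" and \<gamma>': "\<gamma>' \<in> curves X"
  shows "interaction \<gamma> \<gamma>' \<le> ennreal interaction_const + ennreal interaction_slope * (own_cost \<gamma> + own_cost \<gamma>')"
proof (cases "own_cost \<gamma> = \<infinity> \<or> own_cost \<gamma>' = \<infinity>")
  case True
  have "interaction_slope > 0" using C a \<alpha> by (simp add: interaction_slope_def add_pos_pos)
  then have "ennreal interaction_slope * (own_cost \<gamma> + own_cost \<gamma>') = \<infinity>"
    using True by (auto simp: ennreal_mult_top)
  then show ?thesis by simp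
next
  case False
  then have ac: "loc_abs_continuous \<gamma>" "loc_abs_continuous \<gamma>'"
    and L: "own_cost \<gamma> = running_cost l \<gamma> + exit_cost \<Psi> (exit_time \<Xi> \<gamma>)"
      "own_cost \<gamma>' = running_cost l \<gamma>' + exit_cost \<Psi> (exit_time \<Xi> \<gamma>')"
    by (auto simp: own_cost_def split: if_splits)
  define D where "D = {t. 0 \<le> t \<and> ereal t \<le> min (exit_time \<Xi> \<gamma>) (exit_time \<Xi> \<gamma>')}"
  have "exit_cost \<Psi> (exit_time \<Xi> \<gamma>) \<noteq> \<infinity>" using False L by auto
  then obtain r where r: "exit_time \<Xi> \<gamma> = ereal r" "0 \<le> r"
    "ennreal r \<le> ennreal (b / a) + ennreal (1 / a) * exit_cost \<Psi> (exit_time \<Xi> \<gamma>)"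
    using exit_time_nonneg by (rule exit_time_le)
  have "D \<subseteq> {0..r}" by (auto simp: D_def r)
  have velm: "(\<lambda>t. ennreal (norm (velocity g t) powr \<theta>) * indicator {0..} t) \<in> borel_measurable lebesgue"
    if "loc_abs_continuous g" for g :: "real \<Rightarrow> 'a"
  proof -
    have "(\<lambda>t. ennreal (norm (velocity g t) powr \<theta>)) \<in> borel_measurable (lebesgue_on {0..})"
      using velocity_measurable_atLeast[OF that] by measurable
    then show ?thesis by (subst (asm) borel_measurable_restrict_space_iff_ennreal) auto
  qed
  define e1 where "e1 = (\<lambda>t. ennreal (norm (velocity \<gamma> t) powr \<theta>) * indicator {0..} t)"
  define e2 where "e2 = (\<lambda>t. ennreal (norm (velocity \<gamma>' t) powr \<theta>) * indicator {0..} t)"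
  have me: "e1 \<in> borel_measurable lebesgue" "e2 \<in> borel_measurable lebesgue"
    unfolding e1_def e2_def by (rule velm[OF ac(1)], rule velm[OF ac(2)])
  have powr_le: "x powr \<beta> \<le> 1 + x powr \<theta>" if "x \<ge> 0" for x :: real
  proof (cases "x \<le> 1")
    case True
    then have "x powr \<beta> \<le> 1" using that \<beta> by (intro powr_le1) auto
    then show ?thesis using that powr_ge_zero[of x \<theta>] by linarith
  next
    case False
    then have "x powr \<beta> \<le> x powr \<theta>" using \<beta> by (intro powr_mono) auto
    then show ?thesis by simp
  qed
  have "interaction \<gamma> \<gamma>' \<le> (\<integral>\<^sup>+ t. ennreal (2 * C) * indicator {0..r} t + ennreal C * e1 t +
    ennreal C * e2 t \<partial>lebesgue)"
    unfolding e1_def e2_def interaction_cost_def D_def[symmetric]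
  proof (rule nn_integral_mono)
    fix t
    show "ennreal (h t (\<gamma> t) (\<gamma>' t) (velocity \<gamma> t) (velocity \<gamma>' t)) * indicator D t \<le>
      ennreal (2 * C) * indicator {0..r} t + ennreal C * (ennreal (norm (velocity \<gamma> t) powr \<theta>) * indicator {0..}
        t)
      + ennreal C * (ennreal (norm (velocity \<gamma>' t) powr \<theta>) * indicator {0..} t)"
    proof (cases "t \<in> D")
      case True
      then have t: "0 \<le> t" "t \<in> {0..r}" using \<open>D \<subseteq> {0..r}\<close> by auto
      have "h t (\<gamma> t) (\<gamma>' t) (velocity \<gamma> t) (velocity \<gamma>' t) \<le> C * (norm (velocity \<gamma> t) powr \<beta> +
        norm (velocity \<gamma>' t) powr \<beta>)"
        by (intro h_growth t curvesD(2)[OF \<gamma>] curvesD(2)[OF \<gamma>'])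
      also have "\<dots> \<le> C * ((1 + norm (velocity \<gamma> t) powr \<theta>) + (1 + norm (velocity \<gamma>' t) powr \<theta>))"
        using C by (intro mult_left_mono add_mono powr_le) auto
      also have "\<dots> = 2 * C + C * norm (velocity \<gamma> t) powr \<theta> + C * norm (velocity \<gamma>' t) powr \<theta>"
        by (simp add: algebra_simps)
      finally have "ennreal (h t (\<gamma> t) (\<gamma>' t) (velocity \<gamma> t) (velocity \<gamma>' t)) \<le> ennreal (2 * C +
        C * norm (velocity \<gamma> t) powr \<theta> + C * norm (velocity \<gamma>' t) powr \<theta>)"
        by (rule ennreal_leI)
      then show ?thesis using True t C
        by (simp add: ennreal_mult ennreal_plus)
    qed simp
  qed
  also have "\<dots> = ennreal (2 * C) * ennreal r + ennreal C * energy \<theta> \<gamma> + ennreal C * energy \<theta> \<gamma>'"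
  proof -
    have m: "(\<lambda>t. ennreal (2 * C) * indicator {0..r} t) \<in> borel_measurable lebesgue"
      "(\<lambda>t. ennreal C * e1 t) \<in> borel_measurable lebesgue" "(\<lambda>t. ennreal C * e2 t) \<in> borel_measurable lebesgue"
      by (intro borel_measurable_times_ennreal borel_measurable_const borel_measurable_indicator me; simp)+
    have "(\<integral>\<^sup>+ t. ennreal (2 * C) * indicator {0..r} t \<partial>lebesgue) = ennreal (2 * C) * ennreal r"
      using r(2) by (subst nn_integral_cmult_indicator) auto
    moreover have "energy \<theta> \<gamma> = (\<integral>\<^sup>+ t. e1 t \<partial>lebesgue)" "energy \<theta> \<gamma>' = (\<integral>\<^sup>+ t. e2 t \<partial>lebesgue)"
      unfolding energy_def e1_def e2_def by simp_all
    moreover have "(\<integral>\<^sup>+ t. ennreal (2 * C) * indicator {0..r} t + ennreal C * e1 t + ennreal C * e2 t \<partial>lebesgue)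
      = (\<integral>\<^sup>+ t. ennreal (2 * C) * indicator {0..r} t + ennreal C * e1 t \<partial>lebesgue) +
        (\<integral>\<^sup>+ t. ennreal C * e2 t \<partial>lebesgue)"
      by (rule nn_integral_add[OF borel_measurable_add[OF m(1,2)] m(3)])
    moreover have "(\<integral>\<^sup>+ t. ennreal (2 * C) * indicator {0..r} t + ennreal C * e1 t \<partial>lebesgue)
      = (\<integral>\<^sup>+ t. ennreal (2 * C) * indicator {0..r} t \<partial>lebesgue) + (\<integral>\<^sup>+ t. ennreal C * e1 t \<partial>lebesgue)"
      by (rule nn_integral_add[OF m(1,2)])
    moreover have "(\<integral>\<^sup>+ t. ennreal C * e1 t \<partial>lebesgue) = ennreal C * (\<integral>\<^sup>+ t. e1 t \<partial>lebesgue)"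
      "(\<integral>\<^sup>+ t. ennreal C * e2 t \<partial>lebesgue) = ennreal C * (\<integral>\<^sup>+ t. e2 t \<partial>lebesgue)"
      by (rule nn_integral_cmult[OF me(1)], rule nn_integral_cmult[OF me(2)])
    ultimately show ?thesis by simp
  qed
  also have "\<dots> \<le> ennreal (2 * C) * (ennreal (b / a) + ennreal (1 / a) * own_cost \<gamma>) +
    ennreal (C / \<alpha>) * own_cost \<gamma> + ennreal (C / \<alpha>) * own_cost \<gamma>'"
  proof (intro add_mono mult_left_mono)
    show "ennreal r \<le> ennreal (b / a) + ennreal (1 / a) * own_cost \<gamma>"
      using r(3) by (rule order_trans) (intro add_left_mono mult_left_mono, auto simp: L)
    have en: "ennreal C * energy \<theta> g \<le> ennreal (C / \<alpha>) * own_cost g" if "g \<in> curves X" "loc_abs_continuous g"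
      for g
    proof -
      have "ennreal (C / \<alpha>) * (ennreal \<alpha> * energy \<theta> g) \<le> ennreal (C / \<alpha>) * own_cost g"
        using energy_le_running_cost[OF that] that(2)
          by (intro mult_left_mono) (auto simp: own_cost_def intro: add_increasing2)
      then show ?thesis using C \<alpha> by (simp add: mult.assoc[symmetric] ennreal_mult[symmetric])
    qed
    show "ennreal C * energy \<theta> \<gamma> \<le> ennreal (C / \<alpha>) * own_cost \<gamma>" by (rule en[OF \<gamma> ac(1)])
    show "ennreal C * energy \<theta> \<gamma>' \<le> ennreal (C / \<alpha>) * own_cost \<gamma>'" by (rule en[OF \<gamma>' ac(2)])
  qed simp
  also have "\<dots> \<le> ennreal interaction_const + ennreal interaction_slope * (own_cost \<gamma> + own_cost \<gamma>')"
  proof -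
    have e1: "ennreal (2 * C) * ennreal (b / a) = ennreal interaction_const"
      using C a b by (simp add: interaction_const_def ennreal_mult[symmetric])
    have e2: "ennreal interaction_slope = ennreal (2 * C) * ennreal (1 / a) + ennreal (C / \<alpha>)"
      using C a \<alpha> by (simp add: interaction_slope_def ennreal_mult[symmetric] ennreal_plus[symmetric] del:
        ennreal_plus)
    have "ennreal (2 * C) * (ennreal (b / a) + ennreal (1 / a) * own_cost \<gamma>) + ennreal (C / \<alpha>) * own_cost \<gamma> +
      ennreal (C / \<alpha>) * own_cost \<gamma>'
      = ennreal interaction_const + (ennreal interaction_slope * own_cost \<gamma> + ennreal (C / \<alpha>) * own_cost \<gamma>')"
      unfolding e1[symmetric] e2 by (simp add: distrib_left distrib_right add.assoc mult.assoc)
    also have "\<dots> \<le> ennreal interaction_const + (ennreal interaction_slope * own_cost \<gamma> +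
      ennreal interaction_slope * own_cost \<gamma>')"
      unfolding e2 by (intro add_left_mono mult_right_mono) auto
    finally show ?thesis by (simp add: distrib_left)
  qed
  finally show ?thesis .
qed

end

section \<open>Continuous extension to a closure, and base-4 coding of curves\<close>

section \<open>Encoding curves by real numbers\<close>

lemma LIMSEQ_close:
  fixes a b :: "nat \<Rightarrow> 'a::metric_space"
  assumes "a \<longlonglongrightarrow> l" "\<And>n. dist (a n) (b n) < 1 / real (Suc n)"
  shows "b \<longlonglongrightarrow> l"
proof -
  have "(\<lambda>n. dist (b n) l) \<longlonglongrightarrow> 0"
  proof (rule tendsto_sandwich[OF _ _ tendsto_const])
    have "(\<lambda>n. dist (a n) l) \<longlonglongrightarrow> 0" using assms(1) tendsto_dist_iff by blast
    from tendsto_add[OF LIMSEQ_Suc[OF lim_1_over_n] this]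
    show "(\<lambda>n. 1 / real (Suc n) + dist (a n) l) \<longlonglongrightarrow> 0" by simp
    show "eventually (\<lambda>n. dist (b n) l \<le> 1 / real (Suc n) + dist (a n) l) sequentially"
    proof (intro always_eventually allI)
      fix n
      have "dist (b n) l \<le> dist (a n) (b n) + dist (a n) l" using dist_triangle3[of "b n" l "a n"] by simp
      then show "dist (b n) l \<le> 1 / real (Suc n) + dist (a n) l" using assms(2)[of n] by linarith
    qed
  qed auto
  then show ?thesis using tendsto_dist_iff by blast
qed

text \<open>Interleaving two sequences with the same limit shows that the limit of \<open>f\<close>
  does not depend on the sequence. For continuity on the closure, each \<open>u n\<close> is
  replaced by a point of \<open>S\<close> so near that argument and value both move by less than
  1/(n+1).\<close>

lemma continuous_extension_to_closure:
  fixes f :: "'a::metric_space \<Rightarrow> 'b::metric_space"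
  assumes conv: "\<And>u z. (\<And>n. u n \<in> S) \<Longrightarrow> u \<longlonglongrightarrow> z \<Longrightarrow> convergent (\<lambda>n. f (u n))"
  obtains F where "\<And>z. z \<in> S \<Longrightarrow> F z = f z"
    "\<And>u z. (\<And>n. u n \<in> closure S) \<Longrightarrow> u \<longlonglongrightarrow> z \<Longrightarrow> (\<lambda>n. F (u n)) \<longlonglongrightarrow> F z"
proof -
  define F where "F z = lim (\<lambda>n. f ((SOME u. (\<forall>n. u n \<in> S) \<and> u \<longlonglongrightarrow> z) n))" for z
  have Flim: "(\<lambda>n. f (u n)) \<longlonglongrightarrow> F z" if u: "\<And>n. u n \<in> S" "u \<longlonglongrightarrow> z" for u z
  proof -
    define v where "v = (SOME u. (\<forall>n. u n \<in> S) \<and> u \<longlonglongrightarrow> z)"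
    have v: "\<And>n. v n \<in> S" "v \<longlonglongrightarrow> z"
      using someI[of "\<lambda>u. (\<forall>n. u n \<in> S) \<and> u \<longlonglongrightarrow> z" u] u unfolding v_def by blast+
    have fv: "(\<lambda>n. f (v n)) \<longlonglongrightarrow> F z"
      using conv[OF v] unfolding F_def v_def[symmetric] by (simp add: convergent_LIMSEQ_iff)
    define w where "w n = (if even n then u (n div 2) else v (n div 2))" for n
    have wz: "w \<longlonglongrightarrow> z"
    proof (rule metric_LIMSEQ_I)
      fix e :: real assume "e > 0"
      obtain N1 where N1: "\<And>n. n \<ge> N1 \<Longrightarrow> dist (u n) z < e" using metric_LIMSEQ_D[OF u(2) \<open>e > 0\<close>] by blast
      obtain N2 where N2: "\<And>n. n \<ge> N2 \<Longrightarrow> dist (v n) z < e" using metric_LIMSEQ_D[OF v(2) \<open>e > 0\<close>] by blast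
      show "\<exists>no. \<forall>n\<ge>no. dist (w n) z < e"
      proof (intro exI[of _ "2 * max N1 N2"] allI impI)
        fix n assume "2 * max N1 N2 \<le> n"
        then have "N1 \<le> n div 2" "N2 \<le> n div 2" by auto
        then show "dist (w n) z < e" using N1 N2 by (simp add: w_def)
      qed
    qed
    have wS: "w n \<in> S" for n using u(1) v(1) by (simp add: w_def)
    have "convergent (\<lambda>n. f (w n))" by (rule conv[OF wS wz])
    then obtain l where l: "(\<lambda>n. f (w n)) \<longlonglongrightarrow> l" by (auto simp: convergent_def)
    have "strict_mono (\<lambda>n::nat. 2 * n)" "strict_mono (\<lambda>n::nat. 2 * n + 1)" by (auto simp: strict_mono_def)
    from LIMSEQ_subseq_LIMSEQ[OF l this(1)] LIMSEQ_subseq_LIMSEQ[OF l this(2)]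
    have "(\<lambda>n. f (u n)) \<longlonglongrightarrow> l" "(\<lambda>n. f (v n)) \<longlonglongrightarrow> l" by (simp_all add: comp_def w_def)
    then show ?thesis using fv LIMSEQ_unique by blast
  qed
  show ?thesis
  proof (rule that)
    show "F z = f z" if "z \<in> S" for z
      using Flim[of "\<lambda>_. z" z] that LIMSEQ_unique[OF tendsto_const, of "f z" "F z"] by auto
    fix u z assume u: "\<And>n. u n \<in> closure S" "u \<longlonglongrightarrow> z"
    have "\<exists>s\<in>S. dist s (u n) < 1 / real (Suc n) \<and> dist (f s) (F (u n)) < 1 / real (Suc n)" for n
    proof -
      obtain v where v: "\<And>k. v k \<in> S" "v \<longlonglongrightarrow> u n" using u(1)[of n] closure_sequential by blast
      have p: "0 < 1 / real (Suc n)" by simp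
      obtain N1 where N1: "\<And>k. k \<ge> N1 \<Longrightarrow> dist (v k) (u n) < 1 / real (Suc n)" using metric_LIMSEQ_D[OF v(2) p]
        by blast
      obtain N2 where N2: "\<And>k. k \<ge> N2 \<Longrightarrow> dist (f (v k)) (F (u n)) < 1 / real (Suc n)"
        using metric_LIMSEQ_D[OF Flim[OF v] p] by blast
      show ?thesis using v(1) N1[of "max N1 N2"] N2[of "max N1 N2"] by (intro bexI[of _ "v (max N1 N2)"]) auto
    qed
    then obtain s where s: "\<And>n. s n \<in> S" "\<And>n. dist (s n) (u n) < 1 / real (Suc n)"
      "\<And>n. dist (f (s n)) (F (u n)) < 1 / real (Suc n)"
      by metis
    have "dist (u n) (s n) < 1 / real (Suc n)" for n using s(2)[of n] by (simp only: dist_commute)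
    from LIMSEQ_close[OF u(2) this] have "s \<longlonglongrightarrow> z" .
    then have "(\<lambda>n. f (s n)) \<longlonglongrightarrow> F z" by (rule Flim[OF s(1)])
    from LIMSEQ_close[OF this s(3)] show "(\<lambda>n. F (u n)) \<longlonglongrightarrow> F z" .
  qed
qed

text \<open>A point of a Cantor-like set. All values lie in [0, 1/3], which leaves room for adding
  an integer part that can be recovered.\<close>

definition binary_code :: "(nat \<Rightarrow> bool) \<Rightarrow> real" where
  "binary_code b = (\<Sum>n. of_bool (b n) * (1 / 4) ^ Suc n)"

lemma summable_quarter: "summable (\<lambda>n. (c n :: real) * (1 / 4) ^ (n + k))" if "\<And>n. \<bar>c n\<bar> \<le> 1" for c
proof (rule summable_comparison_test)
  show "summable (\<lambda>n. (1 / 4 :: real) ^ (n + k))"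
    unfolding summable_iff_shift by (rule summable_geometric) simp
  show "\<exists>N. \<forall>n\<ge>N. norm (c n * (1 / 4) ^ (n + k)) \<le> (1 / 4) ^ (n + k)"
    using that by (auto simp: abs_mult intro!: mult_left_le_one_le)
qed

lemma suminf_quarter_bound: "\<bar>\<Sum>n. (c n :: real) * (1 / 4) ^ (n + k)\<bar> \<le> 4 / 3 * (1 / 4) ^ k" if "\<And>n. \<bar>c n\<bar> \<le> 1"
  for c
proof -
  have sg: "summable (\<lambda>n. (1 / 4 :: real) ^ (n + k))"
    unfolding summable_iff_shift by (rule summable_geometric) simp
  have "norm (\<Sum>n. c n * (1 / 4) ^ (n + k)) \<le> (\<Sum>n. (1 / 4) ^ (n + k))"
    using that by (intro norm_suminf_le sg) (auto simp: abs_mult intro!: mult_left_le_one_le)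
  also have "\<dots> = (\<Sum>n. (1 / 4) ^ n * (1 / 4) ^ k)" by (simp add: power_add)
  also have "\<dots> = 4 / 3 * (1 / 4) ^ k"
    by (subst suminf_mult2[symmetric]) (auto simp: suminf_geometric)
  finally show ?thesis by simp
qed

lemma binary_code_range: "0 \<le> binary_code b" "binary_code b \<le> 1 / 3"
proof -
  have s: "summable (\<lambda>n. of_bool (b n) * (1 / 4 :: real) ^ (n + 1))" by (rule summable_quarter) auto
  show "0 \<le> binary_code b" unfolding binary_code_def using s by (intro suminf_nonneg) auto
  show "binary_code b \<le> 1 / 3"
    using suminf_quarter_bound[of "\<lambda>n. of_bool (b n)" 1] by (auto simp: binary_code_def)
qed

text \<open>The first differing digit, at \<open>k\<close>, contributes 4^(-(k+1)), and the later
  digits can cancel at most a third of it; the remaining two thirds exceed the half permitted by the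
  assumption.\<close>

lemma binary_code_close:
  assumes "\<bar>binary_code b - binary_code b'\<bar> < 1 / 2 * (1 / 4) ^ Suc n" and "i \<le> n"
  shows "b i = b' i"
proof (rule ccontr)
  assume "b i \<noteq> b' i"
  define k where "k = (LEAST i. b i \<noteq> b' i)"
  have k: "b k \<noteq> b' k" unfolding k_def using \<open>b i \<noteq> b' i\<close> by (rule LeastI)
  have kn: "k \<le> n" using Least_le[of "\<lambda>i. b i \<noteq> b' i", OF \<open>b i \<noteq> b' i\<close>] assms(2) by (simp add: k_def)
  have less: "b j = b' j" if "j < k" for j using not_less_Least[of j "\<lambda>i. b i \<noteq> b' i"] that
    by (auto simp: k_def)
  define c where "c j = (of_bool (b j) - of_bool (b' j) :: real)" for j
  have c1: "\<bar>c j\<bar> \<le> 1" for j by (simp add: c_def)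
  have s: "summable (\<lambda>j. c j * (1 / 4) ^ (j + 1))" by (rule summable_quarter[OF c1])
  have "binary_code b - binary_code b' = (\<Sum>j. of_bool (b j) * (1 / 4) ^ (j +
    1) - of_bool (b' j) * (1 / 4) ^ (j + 1))"
    unfolding binary_code_def
      using summable_quarter[of "\<lambda>j. of_bool (b j)" 1] summable_quarter[of "\<lambda>j. of_bool (b' j)" 1]
    by (subst suminf_diff) auto
  also have "\<dots> = (\<Sum>j. c j * (1 / 4) ^ (j + 1))" by (simp only: c_def left_diff_distrib)
  also have "\<dots> = (\<Sum>j. c (j + Suc k) * (1 / 4) ^ (j + Suc k + 1)) + (\<Sum>j<Suc k. c j * (1 / 4) ^ (j + 1))"
    by (rule suminf_split_initial_segment[OF s])
  also have "(\<Sum>j<Suc k. c j * (1 / 4) ^ (j + 1)) = c k * (1 / 4) ^ (k + 1)"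
    using less by (simp add: c_def)
  finally have eq: "binary_code b - binary_code b' = (\<Sum>j. c (j + Suc k) * (1 / 4) ^ (j + (k + 2))) +
    c k * (1 / 4) ^ (k + 1)"
    by (simp add: add.assoc)
  have "\<bar>c k * (1 / 4) ^ (k + 1)\<bar> = (1 / 4) ^ (k + 1)" using k by (auto simp: c_def abs_mult)
  moreover have "\<bar>\<Sum>j. c (j + Suc k) * (1 / 4) ^ (j + (k + 2))\<bar> \<le> 4 / 3 * (1 / 4) ^ (k + 2)"
    by (rule suminf_quarter_bound[OF c1])
  moreover have "(4 / 3 * (1 / 4) ^ (k + 2) :: real) = 1 / 3 * (1 / 4) ^ (k + 1)" by simp
  ultimately have "\<bar>binary_code b - binary_code b'\<bar> \<ge> 2 / 3 * (1 / 4) ^ (k + 1)" unfolding eq by linarith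
  moreover have "(1 / 4 :: real) ^ (n + 1) \<le> (1 / 4) ^ (k + 1)" using kn by (intro power_decreasing) auto
  moreover have "(0::real) < (1 / 4) ^ (n + 1)" by simp
  ultimately show False using assms(1) unfolding Suc_eq_plus1 by linarith
qed

text \<open>An enumeration, with repetitions, of the nonnegative rationals.\<close>

definition time_node :: "nat \<Rightarrow> real" where
  "time_node i = real (fst (prod_decode i)) / real (Suc (snd (prod_decode i)))"

lemma time_node_nonneg: "0 \<le> time_node i"
  by (simp add: time_node_def)

lemma time_node_dense:
  assumes "0 \<le> t" "0 < e"
  obtains i where "time_node i \<le> t" "t - time_node i < e"
proof -
  obtain k where k: "1 / real (Suc k) < e" using nat_approx_posE[OF assms(2)] by blast
  define j where "j = nat \<lfloor>t * real (Suc k)\<rfloor>"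
  have "0 \<le> t * real (Suc k)" using assms by simp
  then have j: "real j \<le> t * real (Suc k)" "t * real (Suc k) < real j + 1" unfolding j_def by linarith+
  have "time_node (prod_encode (j, k)) = real j / real (Suc k)" by (simp add: time_node_def)
  moreover have "real j / real (Suc k) \<le> t" using j(1) by (simp add: divide_le_eq)
  moreover have "t - real j / real (Suc k) < 1 / real (Suc k)"
  proof -
    have "t < (real j + 1) / real (Suc k)" using j(2) by (simp add: less_divide_eq)
    then show ?thesis by (simp add: add_divide_distrib)
  qed
  ultimately show ?thesis using that[of "prod_encode (j, k)"] k by auto
qed

context mean_field_game
begin

lemma finite_own_cost_level:
  assumes "own_cost \<gamma> < \<infinity>"
  obtains n where "own_cost \<gamma> \<le> ennreal (real n)" "ennreal (real n - 1) \<le> own_cost \<gamma>"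
proof -
  obtain r where r: "own_cost \<gamma> = ennreal r" "0 \<le> r" using assms by (cases "own_cost \<gamma>") auto
  define n where "n = nat \<lceil>r\<rceil>"
  have "r \<le> real n" "real n - 1 \<le> r" using r(2) unfolding n_def by linarith+
  then show ?thesis using r by (intro that[of n]) (auto intro: ennreal_leI)
qed

text \<open>The level is recorded in the integer part of the code: codes near a given one belong to curves
  whose costs have a common bound.\<close>

definition level :: "real \<Rightarrow> nat" where "level z = nat \<lfloor>z / 2\<rfloor>"

text \<open>\<open>s\<close> encodes, \<open>\<phi>\<close> decodes, and \<open>Z\<close> is the
  closure of the set of codes. When codes converge, the level and each answer become constant. At a
  node, constant answers and compactness of \<open>X\<close> force convergence of the values, and
  the common energy bound carries it to all times. Decoding therefore extends continuously to
  \<open>Z\<close>, and lower semicontinuity keeps the costs of the added curves below their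
  level.\<close>

lemma exists_encoding:
  obtains Z \<phi> s where "closed Z" "\<And>z. z \<in> Z \<Longrightarrow> \<phi> z \<in> curves X"
    "\<And>z. z \<in> Z \<Longrightarrow> own_cost (\<phi> z) \<le> ennreal (real (level z))"
    "\<And>z. z \<in> Z \<Longrightarrow> 0 \<le> z \<and> z \<le> 2 * real (level z) + 1"
    "\<And>u z t. (\<And>n. u n \<in> Z) \<Longrightarrow> u \<longlonglongrightarrow> z \<Longrightarrow> 0 \<le> t \<Longrightarrow> (\<lambda>n. \<phi> (u n) t) \<longlonglongrightarrow> \<phi> z t"
    "\<And>u z. (\<And>n. u n \<in> Z) \<Longrightarrow> u \<longlonglongrightarrow> z \<Longrightarrow> eventually (\<lambda>n. level (u n) = level z) sequentially"
    "\<And>\<gamma>. \<gamma> \<in> curves X \<Longrightarrow> own_cost \<gamma> < \<infinity> \<Longrightarrow> s \<gamma> \<in> Z \<and> \<phi> (s \<gamma>) = \<gamma> \<and> ennreal (real (level (s \<gamma>)) - 1) \<le> own_cost \<gamma>"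
proof -
  define \<Gamma> where "\<Gamma> = {\<gamma> \<in> curves X. own_cost \<gamma> < \<infinity>}"
  obtain BB :: "'a set set" where BB: "countable BB" "topological_basis BB" using ex_countable_basis by blast
  have BBne: "BB \<noteq> {}" using topological_basisE[OF BB(2) open_UNIV UNIV_I] by blast
  define bit where "bit \<gamma> n = (\<gamma> (time_node (fst (prod_decode n))) \<in> from_nat_into BB (snd (prod_decode n)))"
    for \<gamma> n
  have "\<forall>\<gamma>\<in>\<Gamma>. \<exists>n. own_cost \<gamma> \<le> ennreal (real n) \<and> ennreal (real n - 1) \<le> own_cost \<gamma>"
    using finite_own_cost_level unfolding \<Gamma>_def by blast
  then obtain N where N: "\<And>\<gamma>. \<gamma> \<in> \<Gamma> \<Longrightarrow> own_cost \<gamma> \<le> ennreal (real (N \<gamma>))"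
    "\<And>\<gamma>. \<gamma> \<in> \<Gamma> \<Longrightarrow> ennreal (real (N \<gamma>) - 1) \<le> own_cost \<gamma>"
    by metis
  \<comment> \<open>The level is doubled so that codes of different levels are more than 1 apart,
    those of one level filling at most a third.\<close>
  define s where "s \<gamma> = 2 * real (N \<gamma>) + binary_code (bit \<gamma>)" for \<gamma>
  have sr: "2 * real (N \<gamma>) \<le> s \<gamma>" "s \<gamma> \<le> 2 * real (N \<gamma>) + 1 / 3" for \<gamma>
    using binary_code_range[of "bit \<gamma>"] by (auto simp: s_def)
  have levels: "level (s \<gamma>) = N \<gamma>" for \<gamma>
  proof -
    have "\<lfloor>s \<gamma> / 2\<rfloor> = int (N \<gamma>)" using sr[of \<gamma>] by (intro floor_unique) auto
    then show ?thesis by (simp add: level_def)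
  qed
  have same_N: "N \<gamma> = N \<gamma>'" if "\<bar>s \<gamma> - s \<gamma>'\<bar> < 1" for \<gamma> \<gamma>'
  proof -
    have "\<bar>2 * real (N \<gamma>) - 2 * real (N \<gamma>')\<bar> < 2" using sr[of \<gamma>] sr[of \<gamma>'] that by linarith
    then show ?thesis by linarith
  qed
  have key: "\<exists>M. (\<forall>n\<ge>M. N (g n) = N (g M)) \<and> (\<forall>t\<ge>0. convergent (\<lambda>n. g n t))"
    if g: "\<And>n. g n \<in> \<Gamma>" and sg: "(\<lambda>n. s (g n)) \<longlonglongrightarrow> z" for g z
  proof -
    have cau: "\<exists>M. \<forall>n\<ge>M. \<forall>k\<ge>M. \<bar>s (g n) - s (g k)\<bar> < e" if "e > 0" for e
      using metric_CauchyD[OF LIMSEQ_imp_Cauchy[OF sg] that] by (auto simp: dist_real_def)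
    obtain M where M: "\<And>n k. n \<ge> M \<Longrightarrow> k \<ge> M \<Longrightarrow> \<bar>s (g n) - s (g k)\<bar> < 1" using cau[of 1] by auto
    have NM: "N (g n) = N (g M)" if "n \<ge> M" for n using same_N[OF M[OF that order_refl]] .
    \<comment> \<open>Once the levels agree, nearness of the codes is nearness of their base-4
      parts, which fixes the digits.\<close>
    have bits: "\<exists>K\<ge>M. \<forall>n\<ge>K. bit (g n) i = bit (g K) i" for i
    proof -
      have "0 < 1 / 2 * (1 / 4 :: real) ^ Suc i" by simp
      from cau[OF this] obtain K where K: "\<And>n k. n \<ge> K \<Longrightarrow> k \<ge> K \<Longrightarrow> \<bar>s (g n) - s (g k)\<bar> < 1 / 2 * (1 / 4) ^ Suc i"
        by blast
      show ?thesis
      proof (intro exI[of _ "max M K"] conjI allI impI)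
        fix n assume n: "max M K \<le> n"
        have "\<bar>binary_code (bit (g n)) - binary_code (bit (g (max M K)))\<bar> < 1 / 2 * (1 / 4) ^ Suc i"
          using K[of n "max M K"] NM[of n] NM[of "max M K"] n by (simp add: s_def)
        then show "bit (g n) i = bit (g (max M K)) i" by (rule binary_code_close) simp
      qed simp
    qed
    \<comment> \<open>Some subsequence converges, to \<open>y\<close> say. Each basic neighbourhood
      of \<open>y\<close> then contains infinitely many of the values, and the answer to whether it
      contains them being eventually constant, it contains all late ones.\<close>
    have node: "convergent (\<lambda>n. g n (time_node i))" for i
    proof -
      have inX: "g n (time_node i) \<in> X" for n
        using g[of n] curvesD(2) time_node_nonneg by (auto simp: \<Gamma>_def)
      have "seq_compact X" using X by (simp add: compact_imp_seq_compact)
      then obtain y r where y: "y \<in> X" "strict_mono r" "((\<lambda>n. g n (time_node i)) \<circ> r) \<longlonglongrightarrow> y"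
        using inX unfolding seq_compact_def by (metis (no_types, lifting))
      have "(\<lambda>n. g n (time_node i)) \<longlonglongrightarrow> y"
      proof (rule topological_tendstoI)
        fix S assume S: "open S" "y \<in> S"
        obtain B where B: "B \<in> BB" "y \<in> B" "B \<subseteq> S" by (rule topological_basisE[OF BB(2) S])
        obtain k where k: "from_nat_into BB k = B" using from_nat_into_surj[OF BB(1) B(1)] by blast
        obtain K where K: "\<And>n. n \<ge> K \<Longrightarrow> bit (g n) (prod_encode (i, k)) = bit (g K) (prod_encode (i, k))"
          using bits[of "prod_encode (i, k)"] by blast
        have bitB: "bit (g n) (prod_encode (i, k)) \<longleftrightarrow> g n (time_node i) \<in> B" for n by (simp add: bit_def k)
        have "open B" using BB(2) B(1) topological_basis_open by blast
        then have "eventually (\<lambda>n. ((\<lambda>n. g n (time_node i)) \<circ> r) n \<in> B) sequentially"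
          using y(3) B(2) topological_tendstoD by blast
        then obtain n0 where n0: "\<And>n. n \<ge> n0 \<Longrightarrow> g (r n) (time_node i) \<in> B"
          by (auto simp: eventually_sequentially)
        define n1 where "n1 = r (max n0 K)"
        have "n1 \<ge> K" using seq_suble[OF y(2), of "max n0 K"] by (simp add: n1_def)
        moreover have "g n1 (time_node i) \<in> B" using n0 by (simp add: n1_def)
        ultimately have "bit (g K) (prod_encode (i, k))" using K[of n1] bitB by blast
        then have "g n (time_node i) \<in> B" if "n \<ge> K" for n using K[OF that] bitB by blast
        then show "eventually (\<lambda>n. g n (time_node i) \<in> S) sequentially"
          using B(3) by (auto simp: eventually_sequentially)
      qed
      then show ?thesis by (auto simp: convergent_def)
    qed
    define c where "c = real (N (g M))"
    have fe: "finite_energy_curve \<theta> (c / \<alpha>) (g n)" if "n \<ge> M" for n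
      using g[of n] N(1)[OF g[of n]] NM[OF that] by (intro own_cost_finite_energy) (auto simp: \<Gamma>_def c_def)
    have "convergent (\<lambda>n. g n t)" if t: "t \<ge> 0" for t
    proof -
      have "Cauchy (\<lambda>n. g n t)"
      proof (rule metric_CauchyI)
        fix e :: real assume e: "e > 0"
        have cK: "c / \<alpha> \<ge> 0" using \<alpha> by (simp add: c_def)
        obtain d where d: "d > 0" "d powr (1 - \<theta>) * (c / \<alpha>) < e / 6"
          using small_powr_coefficient[OF \<theta>, of "e / 6" "c / \<alpha>"] e cK by auto
        obtain i where i: "time_node i \<le> t" "t - time_node i < e / (6 * d)"
          using time_node_dense[OF t, of "e / (6 * d)"] e d by auto
        have inc: "norm (g n t - g n (time_node i)) < e / 3" if "n \<ge> M" for n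
        proof -
          have "d * (t - time_node i) \<le> e / 6"
            using mult_left_mono[OF less_imp_le[OF i(2)], of d] d(1) by simp
          then show ?thesis
            using finite_energy_curve.increment_le[OF fe[OF that] time_node_nonneg i(1) d(1)] d(2) by linarith
        qed
        obtain K where K: "\<And>n k. n \<ge> K \<Longrightarrow> k \<ge> K \<Longrightarrow> dist (g n (time_node i)) (g k (time_node i)) < e / 3"
          using metric_CauchyD[OF convergent_Cauchy[OF node[of i]], of "e / 3"] e by auto
        show "\<exists>K. \<forall>m\<ge>K. \<forall>n\<ge>K. dist (g m t) (g n t) < e"
        proof (intro exI[of _ "max K M"] allI impI)
          fix m n assume mn: "max K M \<le> m" "max K M \<le> n"
          have "dist (g m t) (g n t) \<le> dist (g m t) (g m (time_node i)) +
            (dist (g m (time_node i)) (g n (time_node i)) + dist (g n (time_node i)) (g n t))"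
            by (rule order_trans[OF dist_triangle add_left_mono[OF dist_triangle]])
          moreover have "dist (g m (time_node i)) (g n (time_node i)) < e / 3" using mn by (intro K) auto
          moreover have "dist (g m t) (g m (time_node i)) < e / 3" using inc[of m] mn by (simp add: dist_norm)
          moreover have "dist (g n (time_node i)) (g n t) < e / 3" using inc[of n] mn
            by (simp add: dist_norm norm_minus_commute)
          ultimately show "dist (g m t) (g n t) < e" by linarith
        qed
      qed
      then show ?thesis by (rule Cauchy_convergent)
    qed
    then show ?thesis using NM by blast
  qed
  \<comment> \<open>Two curves with the same code, taken alternately, form a sequence of constant
    code; its values converge, so the curves coincide.\<close>
  have inj: "\<gamma> = \<gamma>'" if "\<gamma> \<in> \<Gamma>" "\<gamma>' \<in> \<Gamma>" "s \<gamma> = s \<gamma>'" for \<gamma> \<gamma>'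
  proof -
    define g where "g n = (if even n then \<gamma> else \<gamma>')" for n :: nat
    have "(\<lambda>n. s (g n)) = (\<lambda>n. s \<gamma>)" using that(3) by (auto simp: g_def)
    then have lims: "(\<lambda>n. s (g n)) \<longlonglongrightarrow> s \<gamma>" by simp
    have eq: "\<gamma> t = \<gamma>' t" if "t \<ge> 0" for t
    proof -
      have gG: "g n \<in> \<Gamma>" for n using \<open>\<gamma> \<in> \<Gamma>\<close> \<open>\<gamma>' \<in> \<Gamma>\<close> by (simp add: g_def)
      from key[OF gG lims] that have "convergent (\<lambda>n. g n t)" by blast
      then obtain y where y: "(\<lambda>n. g n t) \<longlonglongrightarrow> y" by (auto simp: convergent_def)
      have "strict_mono (\<lambda>n::nat. 2 * n)" "strict_mono (\<lambda>n::nat. 2 * n + 1)" by (auto simp: strict_mono_def)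
      from LIMSEQ_subseq_LIMSEQ[OF y this(1)] LIMSEQ_subseq_LIMSEQ[OF y this(2)]
      have "(\<lambda>n. \<gamma> t) \<longlonglongrightarrow> y" "(\<lambda>n. \<gamma>' t) \<longlonglongrightarrow> y" by (simp_all add: comp_def g_def)
      then show ?thesis by (simp add: LIMSEQ_const_iff)
    qed
    show ?thesis
    proof
      fix t show "\<gamma> t = \<gamma>' t"
        using eq that(1,2) by (cases "t \<ge> 0") (auto simp: \<Gamma>_def curves_def PiE_def extensional_def)
    qed
  qed
  define S where "S = s ` \<Gamma>"
  define dec where "dec z = inv_into \<Gamma> s z" for z
  have dec: "dec z \<in> \<Gamma>" "s (dec z) = z" if "z \<in> S" for z
    using that by (auto simp: S_def dec_def inv_into_into f_inv_into_f)
  have decs: "dec (s \<gamma>) = \<gamma>" if "\<gamma> \<in> \<Gamma>" for \<gamma>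
    using that dec[of "s \<gamma>"] by (intro inj) (auto simp: S_def)
  have keyS: "\<exists>M. (\<forall>n\<ge>M. N (dec (u n)) = N (dec (u M))) \<and> (\<forall>t\<ge>0. convergent (\<lambda>n. dec (u n) t))"
    if "\<And>n. u n \<in> S" "u \<longlonglongrightarrow> z" for u z
  proof (rule key)
    show "dec (u n) \<in> \<Gamma>" for n by (rule dec[OF that(1)])
    show "(\<lambda>n. s (dec (u n))) \<longlonglongrightarrow> z" using that dec by simp
  qed
  have "\<exists>F. (\<forall>z\<in>S. F z = dec z t) \<and> (\<forall>u z. (\<forall>n. u n \<in> closure S) \<longrightarrow> u \<longlonglongrightarrow> z \<longrightarrow> (\<lambda>n. F (u n)) \<longlonglongrightarrow> F z)" if "t \<ge> 0"
    for t
  proof -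
    have conv: "convergent (\<lambda>n. dec (u n) t)" if "\<And>n. u n \<in> S" "u \<longlonglongrightarrow> z" for u z
      using keyS[OF that] \<open>t \<ge> 0\<close> by blast
    show ?thesis
    proof (rule continuous_extension_to_closure[of S "\<lambda>z. dec z t"])
      show "convergent (\<lambda>n. dec (u n) t)" if "\<And>n. u n \<in> S" "u \<longlonglongrightarrow> z" for u z by (rule conv[OF that])
      fix F assume F: "\<And>z. z \<in> S \<Longrightarrow> F z = dec z t"
        "\<And>u z. (\<And>n. u n \<in> closure S) \<Longrightarrow> u \<longlonglongrightarrow> z \<Longrightarrow> (\<lambda>n. F (u n)) \<longlonglongrightarrow> F z"
      show ?thesis
      proof (intro exI[of _ F] conjI ballI allI impI)
        show "F z = dec z t" if "z \<in> S" for z by (rule F(1)[OF that])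
        show "(\<lambda>n. F (u n)) \<longlonglongrightarrow> F z" if "\<forall>n. u n \<in> closure S" "u \<longlonglongrightarrow> z" for u z
          by (rule F(2)[OF _ that(2)]) (use that(1) in simp)
      qed
    qed
  qed
  then have "\<forall>t\<in>{0..}. \<exists>F. (\<forall>z\<in>S. F z = dec z t) \<and> (\<forall>u z. (\<forall>n. u n \<in> closure S) \<longrightarrow> u \<longlonglongrightarrow> z \<longrightarrow> (\<lambda>n. F (u n)) \<longlonglongrightarrow> F z)"
    by simp
  from bchoice[OF this] obtain F where F:
    "\<forall>t\<in>{0..}. (\<forall>z\<in>S. F t z = dec z t) \<and> (\<forall>u z. (\<forall>n. u n \<in> closure S) \<longrightarrow> u \<longlonglongrightarrow> z \<longrightarrow> (\<lambda>n. F t (u n)) \<longlonglongrightarrow> F t z)" ..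
  have F1: "F t z = dec z t" if "t \<ge> 0" "z \<in> S" for t z using F that by simp
  have F2: "(\<lambda>n. F t (u n)) \<longlonglongrightarrow> F t z" if "t \<ge> 0" "\<And>n. u n \<in> closure S" "u \<longlonglongrightarrow> z" for t u z using F that by simp
  \<comment> \<open>The value \<open>undefined\<close> at negative times is what membership in
    \<open>curves X\<close> prescribes.\<close>
  define \<phi> where "\<phi> z = (\<lambda>t. if 0 \<le> t then F t z else undefined)" for z
  have \<phi>S: "\<phi> z = dec z" if "z \<in> S" for z
  proof
    fix t show "\<phi> z t = dec z t"
      using F1[OF _ that] dec(1)[OF that]
        by (cases "t \<ge> 0") (auto simp: \<phi>_def \<Gamma>_def curves_def PiE_def extensional_def)
  qed
  have approx: "\<exists>g m. (\<forall>n. g n \<in> \<Gamma> \<and> N (g n) = m) \<and> (\<lambda>n. s (g n)) \<longlonglongrightarrow> z \<and> (\<forall>t\<ge>0. (\<lambda>n. g n t) \<longlonglongrightarrow> \<phi> z t)"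
    if "z \<in> closure S" for z
  proof -
    from iffD1[OF closure_sequential that] obtain u where "(\<forall>n. u n \<in> S) \<and> u \<longlonglongrightarrow> z" ..
    then have u: "\<And>n. u n \<in> S" "u \<longlonglongrightarrow> z" by simp_all
    from keyS[OF u] obtain M where "(\<forall>n\<ge>M. N (dec (u n)) = N (dec (u M))) \<and>
      (\<forall>t\<ge>0. convergent (\<lambda>n. dec (u n) t))" ..
    then have M: "\<And>n. n \<ge> M \<Longrightarrow> N (dec (u n)) = N (dec (u M))" by blast
    define g where "g n = dec (u (n + M))" for n
    have lim: "(\<lambda>n. g n t) \<longlonglongrightarrow> \<phi> z t" if "t \<ge> 0" for t
    proof -
      have "(\<lambda>n. F t (u n)) \<longlonglongrightarrow> F t z"
        by (rule F2[OF that _ u(2)]) (rule subsetD[OF closure_subset u(1)])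
      then have "(\<lambda>n. F t (u (n + M))) \<longlonglongrightarrow> F t z" by (rule LIMSEQ_ignore_initial_segment)
      then show ?thesis using that F1[OF that u(1)] by (simp add: g_def \<phi>_def)
    qed
    have "(\<lambda>n. s (g n)) \<longlonglongrightarrow> z"
      using LIMSEQ_ignore_initial_segment[OF u(2), of M] dec(2)[OF u(1)] by (simp add: g_def)
    moreover have "g n \<in> \<Gamma> \<and> N (g n) = N (dec (u M))" for n using M[of "n + M"] dec(1)[OF u(1)]
      by (simp add: g_def)
    ultimately show ?thesis using lim by (intro exI[of _ g] exI[of _ "N (dec (u M))"]) simp
  qed
  \<comment> \<open>A limit of codes of level \<open>m\<close> remains between \<open>2 * m\<close>
    and \<open>2 * m + 1 / 3\<close>, so \<open>level\<close> still reads off \<open>m\<close>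
    there.\<close>
  have main: "\<phi> z \<in> curves X \<and> own_cost (\<phi> z) \<le> ennreal (real (level z)) \<and> 2 * real (level z) \<le> z \<and>
    z \<le> 2 * real (level z) + 1 / 3"
    if z: "z \<in> closure S" for z
  proof -
    from approx[OF z] obtain g m where gm: "(\<forall>n. g n \<in> \<Gamma> \<and> N (g n) = m) \<and> (\<lambda>n. s (g n)) \<longlonglongrightarrow> z \<and>
      (\<forall>t\<ge>0. (\<lambda>n. g n t) \<longlonglongrightarrow> \<phi> z t)"
      by (elim exE)
    have g: "g n \<in> \<Gamma>" "N (g n) = m" "(\<lambda>n. s (g n)) \<longlonglongrightarrow> z" for n using gm by simp_all
    have g4: "(\<lambda>n. g n t) \<longlonglongrightarrow> \<phi> z t" if "t \<ge> 0" for t using gm that by simp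
    have zr: "2 * real m \<le> z" "z \<le> 2 * real m + 1 / 3"
    proof -
      show "2 * real m \<le> z" by (rule LIMSEQ_le_const[OF g(3)]) (use sr(1)[of "g _"] g(2) in auto)
      show "z \<le> 2 * real m + 1 / 3" by (rule LIMSEQ_le_const2[OF g(3)]) (use sr(2)[of "g _"] g(2) in auto)
    qed
    have "\<lfloor>z / 2\<rfloor> = int m" using zr by (intro floor_unique) auto
    then have lev: "level z = m" by (simp add: level_def)
    have gc: "g n \<in> curves X" "own_cost (g n) \<le> ennreal (real m)" for n
      using g(1)[of n] N(1)[OF g(1)[of n]] g(2)[of n] by (auto simp: \<Gamma>_def)
    interpret converging_curves \<theta> "real m / \<alpha>" g "\<phi> z" by (rule own_cost_converging[OF gc]) (use g4 in auto)
    have cont: "continuous_on {0..} (\<phi> z)"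
      unfolding continuous_on_eq_continuous_within
    proof
      fix t :: real assume "t \<in> {0..}"
      then have t: "0 \<le> t" by simp
      have "abs_continuous_on {0..t + 1} (\<phi> z)" by (rule loc_abs_continuousD[OF limit_ac order_refl])
      then have "continuous_on {0..t + 1} (\<phi> z)" by (rule abs_continuous_on_imp_continuous_on)
      then have "continuous (at t within {0..t + 1}) (\<phi> z)" using t
        by (simp add: continuous_on_eq_continuous_within)
      moreover have "at t within {0..t + 1} = at t within {0..}"
        by (rule at_within_nhd[of t "{..<t + 1}"]) (use t in auto)
      ultimately show "continuous (at t within {0..}) (\<phi> z)" by simp
    qed
    have "\<phi> z t \<in> X" if "t \<ge> 0" for t
      by (rule closed_sequentially[OF compact_imp_closed[OF X] _ g4[OF that]]) (rule curvesD(2)[OF gc(1) that])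
    then have cur: "\<phi> z \<in> curves X" using cont by (auto simp: curves_def \<phi>_def PiE_def extensional_def)
    have "own_cost (\<phi> z) \<le> liminf (\<lambda>n. own_cost (g n))"
      by (rule own_cost_lsc[OF gc _ g4 cur]) auto
    also have "\<dots> \<le> ennreal (real m)" by (rule liminf_le_const[OF gc(2)])
    finally show ?thesis using cur lev zr by simp
  qed
  show ?thesis
  proof (rule that[of "closure S" \<phi> s])
    show "closed (closure S)" by simp
    show "\<phi> z \<in> curves X" "own_cost (\<phi> z) \<le> ennreal (real (level z))" "0 \<le> z \<and> z \<le> 2 * real (level z) + 1"
      if "z \<in> closure S" for z
      using main[OF that] by auto
    show "(\<lambda>n. \<phi> (u n) t) \<longlonglongrightarrow> \<phi> z t" if "\<And>n. u n \<in> closure S" "u \<longlonglongrightarrow> z" "0 \<le> t" for u z t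
      using F2[OF that(3,1,2)] that(3) by (simp add: \<phi>_def)
    show "eventually (\<lambda>n. level (u n) = level z) sequentially" if u: "\<And>n. u n \<in> closure S" "u \<longlonglongrightarrow> z" for u z
    proof -
      have z: "z \<in> closure S" by (rule closed_sequentially[OF closed_closure u])
      have "eventually (\<lambda>n. dist (u n) z < 1) sequentially" by (rule tendstoD[OF u(2)]) simp
      then show ?thesis
      proof eventually_elim
        case (elim n)
        have "2 * real (level (u n)) \<le> u n" "u n \<le> 2 * real (level (u n)) + 1 / 3" "2 * real (level z) \<le> z"
          "z \<le> 2 * real (level z) + 1 / 3"
          using main[OF u(1)[of n]] main[OF z] by simp_all
        then have "\<bar>2 * real (level (u n)) - 2 * real (level z)\<bar> < 2" using elim unfolding dist_real_def
          by linarith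
        then show ?case by linarith
      qed
    qed
    show "s \<gamma> \<in> closure S \<and> \<phi> (s \<gamma>) = \<gamma> \<and> ennreal (real (level (s \<gamma>)) - 1) \<le> own_cost \<gamma>"
      if "\<gamma> \<in> curves X" "own_cost \<gamma> < \<infinity>" for \<gamma>
    proof -
      have \<gamma>: "\<gamma> \<in> \<Gamma>" using that by (simp add: \<Gamma>_def)
      then have "s \<gamma> \<in> S" unfolding S_def by (rule imageI)
      have "\<phi> (s \<gamma>) = \<gamma>" using \<phi>S[OF \<open>s \<gamma> \<in> S\<close>] decs[OF \<gamma>] by simp
      moreover have "s \<gamma> \<in> closure S" by (rule subsetD[OF closure_subset \<open>s \<gamma> \<in> S\<close>])
      ultimately show ?thesis using N(2)[OF \<gamma>] levels[of \<gamma>] by simp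
    qed
  qed
qed

end

section \<open>Borel structure on curves: joint measurability of position and velocity, exit
  times\<close>

section \<open>Measurability on the space of curves\<close>

text \<open>Openness may be tested by sequences because the neighbourhoods with horizon n and width
  1/(n+1) form a countable base at each curve.\<close>

lemma openin_curve_topologyI:
  assumes U: "U \<subseteq> curves X"
    and seq: "\<And>\<gamma> u. \<gamma> \<in> U \<Longrightarrow> (\<And>n. u n \<in> curves X) \<Longrightarrow>
      (\<And>T e. e > 0 \<Longrightarrow> eventually (\<lambda>n. \<forall>t\<in>{0..T}. dist (\<gamma> t) (u n t) < e) sequentially) \<Longrightarrow> \<exists>n. u n \<in> U"
  shows "openin (curve_topology X) U"
  unfolding openin_curve_topology
proof (intro conjI ballI U)
  fix \<gamma> assume \<gamma>: "\<gamma> \<in> U"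
  show "\<exists>T\<ge>0. \<exists>e>0. compact_nbhd X T e \<gamma> \<subseteq> U"
  proof (rule ccontr)
    assume neg: "\<not> ?thesis"
    have "\<exists>\<omega>. \<omega> \<in> compact_nbhd X (real n) (1 / real (Suc n)) \<gamma> \<and> \<omega> \<notin> U" for n
    proof (rule ccontr)
      assume "\<nexists>\<omega>. \<omega> \<in> compact_nbhd X (real n) (1 / real (Suc n)) \<gamma> \<and> \<omega> \<notin> U"
      then have "0 \<le> real n \<and> 0 < 1 / real (Suc n) \<and> compact_nbhd X (real n) (1 / real (Suc n)) \<gamma> \<subseteq> U" by auto
      then show False using neg by blast
    qed
    then have "\<forall>n. \<exists>\<omega>. \<omega> \<in> compact_nbhd X (real n) (1 / real (Suc n)) \<gamma> \<and> \<omega> \<notin> U" by blast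
    from choice[OF this] obtain u where u: "\<forall>n. u n \<in> compact_nbhd X (real n) (1 / real (Suc n)) \<gamma> \<and> u n \<notin> U" ..
    have "\<exists>n. u n \<in> U"
    proof (rule seq[OF \<gamma>])
      show "u n \<in> curves X" for n using u by (simp add: compact_nbhd_def)
      fix T e :: real assume "e > 0"
      then obtain k where k: "1 / real (Suc k) < e" using nat_approx_posE by blast
      show "eventually (\<lambda>n. \<forall>t\<in>{0..T}. dist (\<gamma> t) (u n t) < e) sequentially"
        using eventually_ge_at_top[of "max k (nat \<lceil>T\<rceil>)"]
      proof eventually_elim
        case (elim n)
        have "1 / real (Suc n) \<le> 1 / real (Suc k)" using elim by (intro divide_left_mono) auto
        moreover have "T \<le> real n" using elim by linarith
        moreover have "\<forall>t\<in>{0..real n}. dist (\<gamma> t) (u n t) < 1 / real (Suc n)" using u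
          by (simp add: compact_nbhd_def)
        ultimately show ?case using k
          by (meson atLeastAtMost_iff less_le_trans less_trans order_trans not_le le_less_trans)
      qed
    qed
    then show False using u by blast
  qed
qed

abbreviation curve_borel :: "'a::metric_space set \<Rightarrow> (real \<Rightarrow> 'a) measure" where
  "curve_borel X \<equiv> borel_of_topology (curve_topology X)"

lemma space_curve_borel: "space (curve_borel X) = curves X"
  by (simp add: borel_of_topology_def space_measure_of_conv)

lemma openin_borel_of_topology: "openin Y U \<Longrightarrow> U \<in> sets (borel_of_topology Y)"
  unfolding borel_of_topology_def by (subst sets_measure_of) (auto dest: openin_subset)

lemma evaluation_measurable:
  assumes t: "0 \<le> t"
  shows "(\<lambda>\<gamma>. \<gamma> t) \<in> borel_measurable (curve_borel X)"
proof (rule borel_measurableI)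
  fix S :: "'a set" assume S: "open S"
  have "openin (curve_topology X) ((\<lambda>\<gamma>. \<gamma> t) -` S \<inter> curves X)"
    unfolding openin_curve_topology
  proof (intro conjI ballI)
    fix \<gamma> assume "\<gamma> \<in> (\<lambda>\<gamma>. \<gamma> t) -` S \<inter> curves X"
    then obtain e where e: "e > 0" "ball (\<gamma> t) e \<subseteq> S" using S open_contains_ball by blast
    have "compact_nbhd X t e \<gamma> \<subseteq> (\<lambda>\<gamma>. \<gamma> t) -` S \<inter> curves X"
    proof
      fix \<omega> assume "\<omega> \<in> compact_nbhd X t e \<gamma>"
      then have "\<omega> \<in> curves X" "\<omega> t \<in> ball (\<gamma> t) e" using t by (auto simp: compact_nbhd_def)
      then show "\<omega> \<in> (\<lambda>\<gamma>. \<gamma> t) -` S \<inter> curves X" using e(2) by blast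
    qed
    then show "\<exists>T\<ge>0. \<exists>e>0. compact_nbhd X T e \<gamma> \<subseteq> (\<lambda>\<gamma>. \<gamma> t) -` S \<inter> curves X" using t e(1) by blast
  qed simp
  then show "(\<lambda>\<gamma>. \<gamma> t) -` S \<inter> space (curve_borel X) \<in> sets (curve_borel X)"
    unfolding space_curve_borel by (rule openin_borel_of_topology)
qed

text \<open>Curve and time vary together. The time is approximated from below by multiples of
  1/(n+1), at each of which evaluation is measurable; \<open>max 0\<close> keeps the time in the
  domain where curves are continuous.\<close>

lemma evaluation_measurable_joint:
  fixes X :: "'a::euclidean_space set"
  assumes f: "f \<in> measurable M (curve_borel X)" and g [measurable]: "g \<in> borel_measurable M"
  shows "(\<lambda>x. f x (max 0 (g x))) \<in> borel_measurable M"
proof (rule borel_measurable_LIMSEQ_metric)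
  define k where "k n x = nat \<lfloor>real (Suc n) * max 0 (g x)\<rfloor>" for n x
  have k [measurable]: "k n \<in> measurable M (count_space UNIV)" for n unfolding k_def by measurable
  show "(\<lambda>x. f x (real (k n x) / real (Suc n))) \<in> borel_measurable M" for n
  proof (rule measurable_compose_countable[of "\<lambda>i x. f x (real i / real (Suc n))" M borel "k n"])
    show "(\<lambda>x. f x (real i / real (Suc n))) \<in> borel_measurable M" for i
      by (rule measurable_compose[OF f evaluation_measurable]) simp
  qed (rule k)
  fix x assume x: "x \<in> space M"
  have "f x \<in> curves X" using measurable_space[OF f x] by (simp add: space_curve_borel)
  then have cont: "continuous_on {0..} (f x)" by (rule curvesD)
  have "(\<lambda>n. real (k n x) / real (Suc n)) \<longlonglongrightarrow> max 0 (g x)"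
  proof (rule LIMSEQ_close[OF tendsto_const])
    fix n
    have "real (k n x) = of_int \<lfloor>real (Suc n) * max 0 (g x)\<rfloor>" unfolding k_def by simp
    then have "real (k n x) \<le> real (Suc n) * max 0 (g x)" "real (Suc n) * max 0 (g x) < real (k n x) + 1"
      by linarith+
    then have "real (k n x) / real (Suc n) \<le> max 0 (g x)" "max 0 (g x) < (real (k n x) + 1) / real (Suc n)"
      by (simp_all only: pos_divide_le_eq pos_less_divide_eq of_nat_0_less_iff zero_less_Suc mult.commute)
    then show "dist (max 0 (g x)) (real (k n x) / real (Suc n)) < 1 / real (Suc n)"
      unfolding dist_real_def add_divide_distrib by linarith
  qed
  then show "(\<lambda>n. f x (real (k n x) / real (Suc n))) \<longlonglongrightarrow> f x (max 0 (g x))"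
    by (rule continuous_on_tendsto_compose[OF cont]) auto
qed

text \<open>Existence of a limit becomes a Cauchy condition over countably many increments, so that
  differentiability will define a measurable set. Continuity away from 0 passes from rational to
  real increments.\<close>

lemma limit_at_zero_iff_rational_Cauchy:
  fixes g :: "real \<Rightarrow> 'a::complete_space"
  assumes cont: "\<And>r. 0 < \<bar>r\<bar> \<Longrightarrow> \<bar>r\<bar> < d \<Longrightarrow> isCont g r" and d: "d > 0"
  shows "(\<exists>v. (g \<longlongrightarrow> v) (at 0)) \<longleftrightarrow>
    (\<forall>k::nat. \<exists>m::nat. \<forall>r r'::rat. 0 < \<bar>real_of_rat r\<bar> \<and> \<bar>real_of_rat r\<bar> < 1 / real (Suc m) \<and>
       0 < \<bar>real_of_rat r'\<bar> \<and> \<bar>real_of_rat r'\<bar> < 1 / real (Suc m) \<longrightarrow>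
       dist (g (real_of_rat r)) (g (real_of_rat r')) \<le> 1 / real (Suc k))" (is "?L \<longleftrightarrow> (\<forall>k. \<exists>m. ?C k m)")
proof
  assume ?L
  then obtain v where v: "(g \<longlongrightarrow> v) (at 0)" ..
  show "\<forall>k. \<exists>m. ?C k m"
  proof
    fix k :: nat
    have "eventually (\<lambda>r. dist (g r) v < 1 / real (Suc k) / 2) (at 0)" by (rule tendstoD[OF v]) simp
    then obtain e where e: "e > 0" "\<And>r. r \<noteq> 0 \<Longrightarrow> dist r 0 < e \<Longrightarrow> dist (g r) v < 1 / real (Suc k) / 2"
      unfolding eventually_at by blast
    obtain m where m: "1 / real (Suc m) < e" using nat_approx_posE[OF e(1)] by blast
    have "?C k m"
    proof (intro allI impI)
      fix r r' :: rat
      assume r: "0 < \<bar>real_of_rat r\<bar> \<and> \<bar>real_of_rat r\<bar> < 1 / real (Suc m) \<and>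
        0 < \<bar>real_of_rat r'\<bar> \<and> \<bar>real_of_rat r'\<bar> < 1 / real (Suc m)"
      have "dist (g (real_of_rat r)) v < 1 / real (Suc k) / 2" by (rule e(2)) (use r m in auto)
      moreover have "dist (g (real_of_rat r')) v < 1 / real (Suc k) / 2" by (rule e(2)) (use r m in auto)
      ultimately show "dist (g (real_of_rat r)) (g (real_of_rat r')) \<le> 1 / real (Suc k)"
        using dist_triangle2[of "g (real_of_rat r)" "g (real_of_rat r')" v] by linarith
    qed
    then show "\<exists>m. ?C k m" ..
  qed
next
  assume C: "\<forall>k. \<exists>m. ?C k m"
  define q where "q n = (1 / of_nat (Suc n) :: rat)" for n
  have q: "real_of_rat (q n) = 1 / real (Suc n)" for n unfolding q_def by (simp add: of_rat_divide of_rat_add)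
  have "Cauchy (\<lambda>n. g (real_of_rat (q n)))"
  proof (rule metric_CauchyI)
    fix e :: real assume "e > 0"
    then obtain k where k: "1 / real (Suc k) < e" using nat_approx_posE by blast
    obtain m where m: "?C k m" using C by blast
    show "\<exists>M. \<forall>i\<ge>M. \<forall>j\<ge>M. dist (g (real_of_rat (q i))) (g (real_of_rat (q j))) < e"
    proof (intro exI[of _ "Suc m"] allI impI)
      fix i j assume "Suc m \<le> i" "Suc m \<le> j"
      then have "1 / real (Suc i) < 1 / real (Suc m)" "1 / real (Suc j) < 1 / real (Suc m)"
        by (auto intro!: divide_strict_left_mono)
      then have "dist (g (real_of_rat (q i))) (g (real_of_rat (q j))) \<le> 1 / real (Suc k)"
        by (intro m[rule_format]) (simp add: q)
      then show "dist (g (real_of_rat (q i))) (g (real_of_rat (q j))) < e" using k by linarith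
    qed
  qed
  then obtain v where v: "(\<lambda>n. g (real_of_rat (q n))) \<longlonglongrightarrow> v" using Cauchy_convergent convergent_def by blast
  have "(g \<longlongrightarrow> v) (at 0)"
  proof (rule tendstoI)
    fix e :: real assume "e > 0"
    then obtain k where k: "1 / real (Suc k) < e" using nat_approx_posE by blast
    obtain m where m: "?C k m" using C by blast
    define d' where "d' = min d (1 / real (Suc m))"
    have d': "d' > 0" using d by (simp add: d'_def)
    have "dist (g r) v < e" if r: "r \<noteq> 0" "\<bar>r\<bar> < d'" for r
    proof -
      have rat: "dist (g (real_of_rat s)) v \<le> 1 / real (Suc k)"
        if s: "0 < \<bar>real_of_rat s\<bar>" "\<bar>real_of_rat s\<bar> < 1 / real (Suc m)" for s
      proof (rule LIMSEQ_le_const2)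
        show "(\<lambda>n. dist (g (real_of_rat s)) (g (real_of_rat (q n)))) \<longlonglongrightarrow> dist (g (real_of_rat s)) v"
          by (intro tendsto_intros v)
        show "\<exists>N. \<forall>n\<ge>N. dist (g (real_of_rat s)) (g (real_of_rat (q n))) \<le> 1 / real (Suc k)"
        proof (intro exI[of _ "Suc m"] allI impI)
          fix n assume "Suc m \<le> n"
          then have "1 / real (Suc n) < 1 / real (Suc m)" by (auto intro!: divide_strict_left_mono)
          then have "0 < \<bar>real_of_rat (q n)\<bar>" "\<bar>real_of_rat (q n)\<bar> < 1 / real (Suc m)" by (simp_all add: q)
          then show "dist (g (real_of_rat s)) (g (real_of_rat (q n))) \<le> 1 / real (Suc k)"
            by (intro m[rule_format] conjI s)
        qed
      qed
      have "\<exists>s. r < real_of_rat s \<and> real_of_rat s < r + 1 / real (Suc n)" for n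
        by (rule of_rat_dense) simp
      then obtain s where s: "\<And>n. r < real_of_rat (s n)" "\<And>n. real_of_rat (s n) < r + 1 / real (Suc n)" by metis
      have sr: "(\<lambda>n. real_of_rat (s n)) \<longlonglongrightarrow> r"
      proof (rule LIMSEQ_close[OF tendsto_const])
        fix n show "dist r (real_of_rat (s n)) < 1 / real (Suc n)"
          using s(1)[of n] s(2)[of n] unfolding dist_real_def by linarith
      qed
      have "isCont g r" by (rule cont) (use r in \<open>auto simp: d'_def\<close>)
      then have gs: "(\<lambda>n. g (real_of_rat (s n))) \<longlonglongrightarrow> g r" using sr by (rule isCont_tendsto_compose)
      have "open {x. 0 < \<bar>x\<bar> \<and> \<bar>x\<bar> < 1 / real (Suc m)}"
        by (intro open_Collect_conj open_Collect_less continuous_intros)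
      moreover have "r \<in> {x. 0 < \<bar>x\<bar> \<and> \<bar>x\<bar> < 1 / real (Suc m)}" using r by (auto simp: d'_def)
      ultimately have "eventually (\<lambda>n. real_of_rat (s n) \<in> {x. 0 < \<bar>x\<bar> \<and> \<bar>x\<bar> < 1 / real (Suc m)}) sequentially"
        by (rule topological_tendstoD[OF sr])
      then have "eventually (\<lambda>n. dist (g (real_of_rat (s n))) v \<le> 1 / real (Suc k)) sequentially"
        by eventually_elim (use rat in simp)
      then have "dist (g r) v \<le> 1 / real (Suc k)"
        by (rule tendsto_upperbound[OF tendsto_dist[OF gs tendsto_const]]) simp
      then show ?thesis using k by linarith
    qed
    then show "eventually (\<lambda>r. dist (g r) v < e) (at 0)"
      unfolding eventually_at using d' by (intro exI[of _ d']) auto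
  qed
  then show ?L by blast
qed

lemma has_vector_derivative_iff_tendsto:
  "(f has_vector_derivative v) (at x) \<longleftrightarrow> ((\<lambda>r. (f (x + r) - f x) /\<^sub>R r) \<longlongrightarrow> v) (at 0)"
proof -
  have "(f has_vector_derivative v) (at x) \<longleftrightarrow> ((\<lambda>r. norm (f (x + r) - f x - r *\<^sub>R v) / norm r) \<longlongrightarrow> 0) (at 0)"
    by (simp add: has_vector_derivative_def has_derivative_at bounded_linear_scaleR_left)
  also have "\<dots> \<longleftrightarrow> ((\<lambda>r. norm ((f (x + r) - f x) /\<^sub>R r - v)) \<longlongrightarrow> 0) (at 0)"
  proof (rule tendsto_cong)
    have "norm (f (x + r) - f x - r *\<^sub>R v) / norm r = norm ((f (x + r) - f x) /\<^sub>R r - v)" if "r \<noteq> 0" for r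
    proof -
      have "f (x + r) - f x - r *\<^sub>R v = r *\<^sub>R ((f (x + r) - f x) /\<^sub>R r - v)"
        using that by (simp add: scaleR_right_diff_distrib)
      then show ?thesis using that
        by (metis norm_scaleR nonzero_mult_div_cancel_left norm_eq_zero real_norm_def)
    qed
    then show "eventually (\<lambda>r. norm (f (x + r) - f x - r *\<^sub>R v) / norm r = norm ((f (x +
      r) - f x) /\<^sub>R r - v)) (at 0)"
      unfolding eventually_at by (intro exI[of _ 1]) auto
  qed
  also have "\<dots> \<longleftrightarrow> ((\<lambda>r. (f (x + r) - f x) /\<^sub>R r) \<longlongrightarrow> v) (at 0)"
    by (simp add: tendsto_norm_zero_iff LIM_zero_iff)
  finally show ?thesis .
qed

text \<open>The difference quotients are measurable in curve and time, hence so are the set where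
  they converge and their limit. Where they diverge, \<open>velocity\<close> unfolds to the fixed
  vector \<open>SOME v. False\<close>, so the formula is exact at every positive time and not just
  almost everywhere.\<close>

lemma velocity_measurable_joint:
  fixes X :: "'a::euclidean_space set"
  assumes f: "f \<in> measurable M (curve_borel X)" and g [measurable]: "g \<in> borel_measurable M"
  shows "(\<lambda>x. if 0 < g x then velocity (f x) (g x) else 0) \<in> borel_measurable M"
proof -
  define D where "D r x = (f x (max 0 (g x + r)) - f x (max 0 (g x))) /\<^sub>R r" for r :: real and x
  have [measurable]: "D r \<in> borel_measurable M" for r
  proof -
    have "(\<lambda>x. f x (max 0 (g x + r))) \<in> borel_measurable M" "(\<lambda>x. f x (max 0 (g x))) \<in> borel_measurable M"
      by (rule evaluation_measurable_joint[OF f]; measurable)+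
    then show ?thesis unfolding D_def by measurable
  qed
  define P where "P x \<longleftrightarrow> (\<forall>k::nat. \<exists>m::nat. \<forall>r r'::rat. 0 < \<bar>real_of_rat r\<bar> \<and>
    \<bar>real_of_rat r\<bar> < 1 / real (Suc m) \<and>
       0 < \<bar>real_of_rat r'\<bar> \<and> \<bar>real_of_rat r'\<bar> < 1 / real (Suc m) \<longrightarrow>
       dist (D (real_of_rat r) x) (D (real_of_rat r') x) \<le> 1 / real (Suc k))" for x
  have [measurable]: "Measurable.pred M P" unfolding P_def by measurable
  have vel: "(if 0 < g x then velocity (f x) (g x) else 0) =
    (if 0 < g x then (if P x then lim (\<lambda>n. D (1 / real (Suc n)) x) else (SOME v. False)) else 0)"
    if x: "x \<in> space M" for x
  proof (cases "0 < g x")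
    case True
    have "f x \<in> curves X" using measurable_space[OF f x] by (simp add: space_curve_borel)
    then have cont: "continuous_on {0..} (f x)" by (rule curvesD)
    have "isCont (\<lambda>r. D r x) r" if "0 < \<bar>r\<bar>" "\<bar>r\<bar> < g x" for r
    proof -
      have pos: "0 < g x + r" using that(2) by linarith
      have "isCont (f x) (g x + r)"
        by (rule continuous_on_interior[OF cont]) (use pos in simp)
      then have "isCont (\<lambda>r. f x (g x + r)) r"
        by (rule isCont_o2[where f = "\<lambda>r. g x + r", rotated]) (intro continuous_intros)
      moreover have "eventually (\<lambda>r. f x (max 0 (g x + r)) = f x (g x + r)) (nhds r)"
      proof -
        have "eventually (\<lambda>r. r \<in> {- g x<..}) (nhds r)" using pos by (intro eventually_nhds_in_open) auto
        then show ?thesis by eventually_elim (auto simp: max_def)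
      qed
      ultimately have "isCont (\<lambda>r. f x (max 0 (g x + r))) r" by (subst isCont_cong)
      then show ?thesis unfolding D_def using that(1) by (intro continuous_intros) auto
    qed
    from limit_at_zero_iff_rational_Cauchy[OF this True]
    have P: "P x \<longleftrightarrow> (\<exists>v. ((\<lambda>r. D r x) \<longlongrightarrow> v) (at 0))" unfolding P_def ..
    have deriv: "(f x has_vector_derivative v) (at (g x)) \<longleftrightarrow> ((\<lambda>r. D r x) \<longlongrightarrow> v) (at 0)" for v
    proof -
      have "(f x has_vector_derivative v) (at (g x)) \<longleftrightarrow> ((\<lambda>r. (f x (g x + r) - f x (g x)) /\<^sub>R r) \<longlongrightarrow> v) (at 0)"
        by (rule has_vector_derivative_iff_tendsto)
      also have "\<dots> \<longleftrightarrow> ((\<lambda>r. D r x) \<longlongrightarrow> v) (at 0)"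
      proof (rule tendsto_cong)
        have "eventually (\<lambda>r. r \<in> {- g x<..}) (nhds 0)" using True by (intro eventually_nhds_in_open) auto
        then have "eventually (\<lambda>r. r \<in> {- g x<..}) (at 0)" by (rule filter_leD[OF at_within_le_nhds])
        then show "eventually (\<lambda>r. (f x (g x + r) - f x (g x)) /\<^sub>R r = D r x) (at 0)"
          by eventually_elim (use True in \<open>auto simp: D_def max_def\<close>)
      qed
      finally show ?thesis .
    qed
    show ?thesis
    proof (cases "P x")
      case True
      then obtain v where v: "((\<lambda>r. D r x) \<longlongrightarrow> v) (at 0)" using P by blast
      then have "velocity (f x) (g x) = v" using deriv by (intro vector_derivative_at) blast
      moreover have "lim (\<lambda>n. D (1 / real (Suc n)) x) = v"
      proof (rule limI, rule filterlim_compose[OF v])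
        show "filterlim (\<lambda>n. 1 / real (Suc n)) (at 0) sequentially"
          using LIMSEQ_Suc[OF lim_1_over_n] by (auto simp: filterlim_at)
      qed
      ultimately show ?thesis using True by simp
    next
      case False
      then have "(\<lambda>v. (f x has_vector_derivative v) (at (g x))) = (\<lambda>v. False)" using P deriv by blast
      then show ?thesis using False by (simp add: vector_derivative_def)
    qed
  qed simp
  have "(\<lambda>x. if 0 < g x then (if P x then lim (\<lambda>n. D (1 / real (Suc n)) x) else (SOME v.
    False)) else 0) \<in> borel_measurable M"
    by measurable
  then show ?thesis using vel by (subst measurable_cong) auto
qed

text \<open>Lower semicontinuity of the exit time makes its strict superlevel sets open.\<close>

lemma exit_time_measurable:
  fixes X :: "'a::euclidean_space set"
  assumes \<Xi>: "closed \<Xi>"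
  shows "exit_time \<Xi> \<in> borel_measurable (curve_borel X)"
proof (rule borel_measurableI_greater)
  fix y :: ereal
  have "{\<gamma> \<in> curves X. y < exit_time \<Xi> \<gamma>} \<in> sets (curve_borel X)"
  proof (cases "y < 0")
    case True
    then have "{\<gamma> \<in> curves X. y < exit_time \<Xi> \<gamma>} = space (curve_borel X)"
      using less_le_trans[OF True exit_time_nonneg] by (auto simp: space_curve_borel)
    then show ?thesis by simp
  next
    case False
    show ?thesis
    proof (cases y)
      case (real T)
      show ?thesis
      proof (intro openin_borel_of_topology openin_curve_topologyI)
        fix \<gamma> u assume \<gamma>: "\<gamma> \<in> {\<gamma> \<in> curves X. y < exit_time \<Xi> \<gamma>}" and u: "\<And>n. u n \<in> curves X"
          and unif: "\<And>T e. e > 0 \<Longrightarrow> eventually (\<lambda>n. \<forall>t\<in>{0..T}. dist (\<gamma> t) (u n t) < e) sequentially"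
        have "continuous_on {0..} \<gamma>" using \<gamma> curvesD(1) by blast
        moreover have "0 \<le> T" "ereal T < exit_time \<Xi> \<gamma>" using False real \<gamma> by auto
        ultimately have "eventually (\<lambda>n. ereal T < exit_time \<Xi> (u n)) sequentially"
          by (intro exit_time_less_eventually[OF _ \<Xi> unif])
        then obtain n where "ereal T < exit_time \<Xi> (u n)"
          using eventually_happens'[OF sequentially_bot] by blast
        then show "\<exists>n. u n \<in> {\<gamma> \<in> curves X. y < exit_time \<Xi> \<gamma>}" using u real by blast
      qed blast
    qed (use False in auto)
  qed
  then show "{x \<in> space (curve_borel X). y < exit_time \<Xi> x} \<in> sets (curve_borel X)"
    by (simp only: space_curve_borel)
qed

lemma sigma_finite_lebesgue: "sigma_finite_measure (lebesgue :: real measure)"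
proof
  show "\<exists>A :: real set set. countable A \<and> A \<subseteq> sets lebesgue \<and> \<Union>A = space lebesgue \<and>
    (\<forall>a\<in>A. emeasure lebesgue a \<noteq> (\<infinity>::ennreal))"
  proof (intro exI[of _ "range (\<lambda>n. {- real n..real n})"] conjI)
    have "\<exists>n. x \<in> {- real n..real n}" for x :: real
    proof -
      obtain n where "\<bar>x\<bar> \<le> real n" using real_arch_simple by blast
      then show ?thesis by (intro exI[of _ n]) auto
    qed
    then show "\<Union> (range (\<lambda>n. {- real n..real n})) = space lebesgue" by auto
  qed auto
qed

context mean_field_game
begin

text \<open>Measurability of an integral with a parameter needs the integrand to be measurable in
  curve and time together. The integrand is set to 0 off a set \<open>S\<close> of times at which
  \<open>h\<close> is continuous; this makes the Caratheodory composition available without changing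
  the integral.\<close>

lemma interaction_measurable:
  assumes \<gamma>: "\<gamma> \<in> curves X"
  shows "interaction \<gamma> \<in> borel_measurable (curve_borel X)"
proof -
  let ?M = "curve_borel X \<Otimes>\<^sub>M (lebesgue :: real measure)"
  have "AE t in lebesgue. t \<in> {0..} \<longrightarrow> continuous_on (X \<times> X \<times> UNIV \<times> UNIV) (\<lambda>(x, x', p, p'). h t x x' p p')"
    using h_continuous by (subst (asm) AE_restrict_space_iff) auto
  then obtain N where N: "{t \<in> space lebesgue. \<not> (t \<in> {0..} \<longrightarrow>
    continuous_on (X \<times> X \<times> UNIV \<times> UNIV) (\<lambda>(x, x', p, p'). h t x x' p p'))} \<subseteq> N"
    "N \<in> null_sets lebesgue" by (auto simp: eventually_ae_filter)
  \<comment> \<open>Time 0 is removed together with the null set, because the jointly measurable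
    velocity is cut off at nonpositive times.\<close>
  define S where "S = {0<..} - N"
  have S: "S \<in> sets lebesgue" using N(2) unfolding S_def by (intro sets.Diff) auto
  have cont: "continuous_on (X \<times> X \<times> UNIV \<times> UNIV) (\<lambda>(x, x', p, p'). h t x x' p p')" if "t \<in> S" for t
  proof (rule ccontr)
    assume "\<not> ?thesis"
    then have "t \<in> N" using that by (intro subsetD[OF N(1)]) (simp add: S_def del: UNIV_Times_UNIV)
    then show False using that by (simp add: S_def)
  qed
  define f where "f \<omega> = (\<lambda>(x, x', p, p'). if snd \<omega> \<in> S then h (snd \<omega>) x x' p p' else 0)"
    for \<omega> :: "(real \<Rightarrow> 'a) \<times> real"
  have snd_m: "snd \<in> borel_measurable ?M"
    by (rule measurable_compose[OF measurable_snd]) (rule measurable_completion, simp)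
  have fst_m: "fst \<in> measurable ?M (curve_borel X)" by (rule measurable_fst)
  have const_m: "(\<lambda>_. \<gamma>) \<in> measurable ?M (curve_borel X)" using \<gamma> by (simp add: space_curve_borel)
  define v where "v \<omega> = (if 0 < snd \<omega> then velocity \<gamma> (snd \<omega>) else 0)" for \<omega> :: "(real \<Rightarrow> 'a) \<times> real"
  define v' where "v' \<omega> = (if 0 < snd \<omega> then velocity (fst \<omega>) (snd \<omega>) else 0)" for \<omega> :: "(real \<Rightarrow> 'a) \<times> real"
  have "(\<lambda>\<omega>. f \<omega> (\<gamma> (max 0 (snd \<omega>)), fst \<omega> (max 0 (snd \<omega>)), v \<omega>, v' \<omega>)) \<in> borel_measurable ?M"
  proof (rule caratheodory_measurable[where Y = "X \<times> X \<times> UNIV \<times> UNIV"])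
    show "continuous_on (X \<times> X \<times> UNIV \<times> UNIV) (f \<omega>)" for \<omega>
    proof (cases "snd \<omega> \<in> S")
      case True
      then have "f \<omega> = (\<lambda>(x, x', p, p'). h (snd \<omega>) x x' p p')" by (simp add: f_def)
      then show ?thesis using cont[OF True] by (simp only:)
    next
      case False
      then have "f \<omega> = (\<lambda>_. 0)" by (auto simp: f_def)
      then show ?thesis by simp
    qed
    show "(\<lambda>\<omega>. f \<omega> y) \<in> borel_measurable ?M" if y: "y \<in> X \<times> X \<times> UNIV \<times> UNIV" for y
    proof -
      obtain x x' p p' where yy: "y = (x, x', p, p')" "x \<in> X" "x' \<in> X" using y by auto
      have "(\<lambda>t. h t x x' p p') \<in> borel_measurable (lebesgue_on S)"
        by (rule measurable_restrict_mono[OF h_measurable[OF yy(2,3)]]) (auto simp: S_def)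
      then have "(\<lambda>t. if t \<in> S then h t x x' p p' else 0) \<in> borel_measurable lebesgue"
        by (rule borel_measurable_if_I) (rule S)
      then have "(\<lambda>\<omega>. if snd \<omega> \<in> S then h (snd \<omega>) x x' p p' else 0) \<in> borel_measurable ?M"
        by (rule measurable_compose[OF measurable_snd])
      then show ?thesis by (simp add: f_def yy)
    qed
    have "v \<in> borel_measurable ?M" "v' \<in> borel_measurable ?M"
      unfolding v_def[abs_def] v'_def[abs_def]
      by (rule velocity_measurable_joint[OF const_m snd_m], rule velocity_measurable_joint[OF fst_m snd_m])
    then show "(\<lambda>\<omega>. (\<gamma> (max 0 (snd \<omega>)), fst \<omega> (max 0 (snd \<omega>)), v \<omega>, v' \<omega>)) \<in> borel_measurable ?M"
      by (intro borel_measurable_Pair evaluation_measurable_joint[OF const_m snd_m]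
        evaluation_measurable_joint[OF fst_m snd_m])
    show "(\<gamma> (max 0 (snd \<omega>)), fst \<omega> (max 0 (snd \<omega>)), v \<omega>, v' \<omega>) \<in> X \<times> X \<times> UNIV \<times> UNIV"
      if "\<omega> \<in> space ?M" for \<omega>
      using that curvesD(2)[OF \<gamma>] curvesD(2)[of "fst \<omega>" X] by (auto simp: space_pair_measure space_curve_borel)
  qed
  then have m1: "(\<lambda>\<omega>. ennreal (f \<omega> (\<gamma> (max 0 (snd \<omega>)), fst \<omega> (max 0 (snd \<omega>)), v \<omega>,
    v' \<omega>))) \<in> borel_measurable ?M" by measurable
  have m2: "Measurable.pred ?M (\<lambda>\<omega>. ereal (snd \<omega>) \<le> min (exit_time \<Xi> \<gamma>) (exit_time \<Xi> (fst \<omega>)))"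
  proof -
    have [measurable]: "(\<lambda>\<omega>. exit_time \<Xi> (fst \<omega>)) \<in> borel_measurable ?M"
      by (rule measurable_compose[OF fst_m exit_time_measurable[OF \<Xi>]])
    note snd_m [measurable]
    show ?thesis by measurable
  qed
  define G where "G \<gamma>' t = (if ereal t \<le> min (exit_time \<Xi> \<gamma>) (exit_time \<Xi> \<gamma>')
    then ennreal (f (\<gamma>', t) (\<gamma> (max 0 t), \<gamma>' (max 0 t), v (\<gamma>', t), v' (\<gamma>', t))) else 0)" for \<gamma>' t
  have "case_prod G \<in> borel_measurable ?M"
  proof -
    have "(\<lambda>\<omega>. if ereal (snd \<omega>) \<le> min (exit_time \<Xi> \<gamma>) (exit_time \<Xi> (fst \<omega>)) then
      ennreal (f \<omega> (\<gamma> (max 0 (snd \<omega>)), fst \<omega> (max 0 (snd \<omega>)), v \<omega>, v' \<omega>)) else 0) \<in> borel_measurable ?M"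
      using m1 m2 by measurable
    moreover have "case_prod G = (\<lambda>\<omega>. if ereal (snd \<omega>) \<le> min (exit_time \<Xi> \<gamma>) (exit_time \<Xi> (fst \<omega>)) then
      ennreal (f \<omega> (\<gamma> (max 0 (snd \<omega>)), fst \<omega> (max 0 (snd \<omega>)), v \<omega>, v' \<omega>)) else 0)"
      by (rule ext) (simp add: G_def split: prod.split)
    ultimately show ?thesis by (simp only:)
  qed
  then have "(\<lambda>\<gamma>'. \<integral>\<^sup>+ t. G \<gamma>' t \<partial>lebesgue) \<in> borel_measurable (curve_borel X)"
    by (rule sigma_finite_measure.borel_measurable_nn_integral[OF sigma_finite_lebesgue])
  moreover have "(\<integral>\<^sup>+ t. G \<gamma>' t \<partial>lebesgue) = interaction \<gamma> \<gamma>'" for \<gamma>'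
    unfolding interaction_cost_def
  proof (rule nn_integral_cong_AE)
    have "AE t in lebesgue. t \<notin> {0::real}" by (rule AE_not_in) (auto simp: negligible_iff_null_sets[symmetric])
    with AE_not_in[OF N(2)]
    show "AE t in lebesgue. G \<gamma>' t = ennreal (h t (\<gamma> t) (\<gamma>' t) (velocity \<gamma> t) (velocity \<gamma>' t)) *
      indicator {t. 0 \<le> t \<and> ereal t \<le> min (exit_time \<Xi> \<gamma>) (exit_time \<Xi> \<gamma>')} t"
    proof eventually_elim
      case (elim t)
      show ?case
      proof (cases "0 < t")
        case True
        then show ?thesis using elim by (auto simp: G_def f_def S_def v_def v'_def max_def indicator_def)
      next
        case False
        then have "\<not> 0 \<le> t" using elim by auto
        then show ?thesis by (auto simp: G_def f_def S_def indicator_def)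
      qed
    qed
  qed
  ultimately show ?thesis by simp
qed

end

section \<open>Transport of the equilibrium from codes to curves\<close>

section \<open>The encoded game\<close>

text \<open>No measurability of \<open>f\<close> is assumed, hence only an inequality: the integral
  is a supremum over simple functions below \<open>f\<close>, and each of them can be transported
  exactly. It serves to bound the integral of the total cost.\<close>

lemma nn_integral_distr_le:
  assumes T: "T \<in> measurable M N"
  shows "(\<integral>\<^sup>+ x. f x \<partial>distr M N T) \<le> (\<integral>\<^sup>+ x. f (T x) \<partial>M)"
  unfolding nn_integral_def[of "distr M N T" f]
proof (rule SUP_least)
  fix g assume "g \<in> {g. simple_function (distr M N T) g \<and> g \<le> f}"
  then have g: "simple_function (distr M N T) g" "g \<le> f" by auto
  have gm: "g \<in> borel_measurable (distr M N T)" by (rule borel_measurable_simple_function[OF g(1)])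
  have "integral\<^sup>S (distr M N T) g = (\<integral>\<^sup>+ x. g x \<partial>distr M N T)"
    by (rule nn_integral_eq_simple_integral[OF g(1), symmetric])
  also have "\<dots> = (\<integral>\<^sup>+ x. g (T x) \<partial>M)" by (rule nn_integral_distr[OF T gm])
  also have "\<dots> \<le> (\<integral>\<^sup>+ x. f (T x) \<partial>M)" using g(2) by (intro nn_integral_mono) (simp add: le_fun_def)
  finally show "integral\<^sup>S (distr M N T) g \<le> (\<integral>\<^sup>+ x. f (T x) \<partial>M)" .
qed

lemma curves_eqI:
  assumes "\<gamma> \<in> curves X" "\<gamma>' \<in> curves X" "\<And>t. 0 \<le> t \<Longrightarrow> \<gamma> t = \<gamma>' t"
  shows "\<gamma> = \<gamma>'"
proof
  fix t show "\<gamma> t = \<gamma>' t"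
    using assms by (cases "0 \<le> t") (auto simp: curves_def PiE_def extensional_def)
qed

lemma sets_borel_of_topology: "sets (borel_of_topology Y) = sigma_sets (topspace Y) {U. openin Y U}"
  unfolding borel_of_topology_def by (rule sets_measure_of) (blast dest: openin_subset)

lemma sets_borel_of_top_of_set:
  assumes X: "closed X" and A: "A \<in> sets (borel_of_topology (top_of_set X))"
  shows "A \<in> sets borel" "A \<subseteq> X"
proof -
  have A': "A \<in> sigma_sets X {U. openin (top_of_set X) U}"
    using A by (simp add: sets_borel_of_topology)
  have "sigma_sets X {U. openin (top_of_set X) U} \<subseteq> sets borel"
    using X by (intro sets.sigma_sets_subset') (auto simp: openin_open)
  then show "A \<in> sets borel" using A' by blast
  show "A \<subseteq> X" using sets.sets_into_space[OF A] by (simp add: borel_of_topology_def space_measure_of_conv)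
qed

text \<open>Fixes an encoding with the properties obtained before, and a curve
  \<open>\<gamma>0\<close> to be used as the value of decoding outside \<open>Z\<close>.\<close>

locale encoded_game = mean_field_game +
  fixes Z :: "real set" and \<phi> :: "real \<Rightarrow> real \<Rightarrow> 'a" and s :: "(real \<Rightarrow> 'a) \<Rightarrow> real" and \<gamma>0 :: "real \<Rightarrow> 'a"
  assumes closed_Z: "closed Z" and code_curve: "\<And>z. z \<in> Z \<Longrightarrow> \<phi> z \<in> curves X"
    and code_cost: "\<And>z. z \<in> Z \<Longrightarrow> own_cost (\<phi> z) \<le> ennreal (real (level z))"
    and code_level: "\<And>z. z \<in> Z \<Longrightarrow> 0 \<le> z \<and> z \<le> 2 * real (level z) + 1"
    and code_lim: "\<And>u z t. (\<And>n. u n \<in> Z) \<Longrightarrow> u \<longlonglongrightarrow> z \<Longrightarrow> 0 \<le> t \<Longrightarrow> (\<lambda>n. \<phi> (u n) t) \<longlonglongrightarrow> \<phi> z t"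
    and level_lim: "\<And>u z. (\<And>n. u n \<in> Z) \<Longrightarrow> u \<longlonglongrightarrow> z \<Longrightarrow> eventually (\<lambda>n. level (u n) = level z) sequentially"
    and decode: "\<And>\<gamma>. \<gamma> \<in> curves X \<Longrightarrow> own_cost \<gamma> < \<infinity> \<Longrightarrow>
      s \<gamma> \<in> Z \<and> \<phi> (s \<gamma>) = \<gamma> \<and> ennreal (real (level (s \<gamma>)) - 1) \<le> own_cost \<gamma>"
    and \<gamma>0: "\<gamma>0 \<in> curves X"
begin

text \<open>The second entry of the maximum controls \<open>z\<close> at limits of codes whose curve
  is cheap. On a code \<open>s \<gamma>\<close> the first entry is the larger one by the choice of
  the level.\<close>

definition code_own :: "real \<Rightarrow> ennreal" where
  "code_own z = (if z \<in> Z then max (own_cost (\<phi> z)) (ennreal (real (level z) - 1)) else \<infinity>)"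

definition code_interaction :: "real \<times> real \<Rightarrow> ennreal" where
  "code_interaction p = (if fst p \<in> Z \<and> snd p \<in> Z then interaction (\<phi> (fst p)) (\<phi> (snd p)) else \<infinity>)"

definition curve :: "real \<Rightarrow> real \<Rightarrow> 'a" where
  "curve z = (if z \<in> Z then \<phi> z else \<gamma>0)"

lemma curve_in_curves: "curve z \<in> curves X"
  using code_curve \<gamma>0 by (simp add: curve_def)

lemma own_cost_le_code: "z \<in> Z \<Longrightarrow> own_cost (\<phi> z) \<le> code_own z"
  by (simp add: code_own_def)

lemma code_own_finite: "z \<in> Z \<Longrightarrow> code_own z < \<infinity>"
  using le_less_trans[OF code_cost[of z] ennreal_less_top] by (simp add: code_own_def)

lemma code_own_s:
  assumes "\<gamma> \<in> curves X" "own_cost \<gamma> < \<infinity>"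
  shows "s \<gamma> \<in> Z" "\<phi> (s \<gamma>) = \<gamma>" "code_own (s \<gamma>) = own_cost \<gamma>"
  using decode[OF assms] by (auto simp: code_own_def max_def)

lemma code_converging:
  assumes u: "\<And>n. u n \<in> Z" "u \<longlonglongrightarrow> z"
  shows "z \<in> Z" "\<exists>M. \<forall>n. level (u (n + M)) = level z \<and> own_cost (\<phi> (u (n + M))) \<le> ennreal (real (level z))"
proof -
  show "z \<in> Z" by (rule closed_sequentially[OF closed_Z u])
  obtain M where M: "\<And>n. n \<ge> M \<Longrightarrow> level (u n) = level z"
    using level_lim[OF u] unfolding eventually_sequentially by blast
  have "level (u (n + M)) = level z \<and> own_cost (\<phi> (u (n + M))) \<le> ennreal (real (level z))" for n
    using M[of "n + M"] code_cost[OF u(1), of "n + M"] by simp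
  then show "\<exists>M. \<forall>n. level (u (n + M)) = level z \<and> own_cost (\<phi> (u (n + M))) \<le> ennreal (real (level z))" by blast
qed

text \<open>Past some index all levels equal that of the limit, hence the energies are bounded, and
  pointwise convergence of the decoded curves becomes locally uniform.\<close>

lemma code_uniform:
  assumes u: "\<And>n. u n \<in> Z" "u \<longlonglongrightarrow> z" and e: "e > 0"
  shows "eventually (\<lambda>n. \<forall>t\<in>{0..T}. dist (\<phi> z t) (\<phi> (u n) t) < e) sequentially"
proof -
  from code_converging(2)[OF u] obtain M where M': "\<forall>n. level (u (n + M)) = level z \<and>
    own_cost (\<phi> (u (n + M))) \<le> ennreal (real (level z))" ..
  have M: "z \<in> Z" "level (u (n + M)) = level z" "own_cost (\<phi> (u (n + M))) \<le> ennreal (real (level z))"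
    "0 \<le> t \<Longrightarrow> (\<lambda>n. \<phi> (u (n + M)) t) \<longlonglongrightarrow> \<phi> z t" for n t
    using M' code_converging(1)[OF u] LIMSEQ_ignore_initial_segment[OF code_lim[OF u(1) u(2), of t], of M]
      by simp_all
  have "converging_curves \<theta> (real (level z) / \<alpha>) (\<lambda>n. \<phi> (u (n + M))) (\<phi> z)"
    by (rule own_cost_converging[OF code_curve[OF u(1)] M(3) _ M(4)]) auto
  from converging_curves.uniform_on_compacts[OF this e]
  have "eventually (\<lambda>n. \<forall>t\<in>{0..T}. dist (\<phi> z t) (\<phi> (u (n + M)) t) < e) sequentially" .
  then show ?thesis by (rule eventually_sequentially_seg[THEN iffD1])
qed

text \<open>A sequence of bounded cost lies in \<open>Z\<close>. Its level is eventually that of the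
  limit, so the level entry is constant and only the cost of the curve requires lower
  semicontinuity.\<close>

lemma lsc_code_own: "lsc code_own"
proof (rule lscI, rule liminf_ge_if_subsequences)
  fix u z and r :: "nat \<Rightarrow> nat" and A
  assume u: "u \<longlonglongrightarrow> z" and r: "strict_mono r" and A: "A \<ge> 0" "\<And>n. code_own (u (r n)) \<le> ennreal A"
  define v where "v n = u (r n)" for n
  have v: "v \<longlonglongrightarrow> z" using LIMSEQ_subseq_LIMSEQ[OF u r] by (simp add: v_def[abs_def] comp_def)
  have vZ: "v n \<in> Z" for n
  proof (rule ccontr)
    assume "v n \<notin> Z"
    then show False using A(2)[of n] by (simp add: code_own_def v_def top_unique)
  qed
  from code_converging(2)[OF vZ v] obtain M where M': "\<forall>n. level (v (n + M)) = level z \<and>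
    own_cost (\<phi> (v (n + M))) \<le> ennreal (real (level z))" ..
  have M: "z \<in> Z" "level (v (n + M)) = level z" "own_cost (\<phi> (v (n + M))) \<le> ennreal (real (level z))"
    "0 \<le> t \<Longrightarrow> (\<lambda>n. \<phi> (v (n + M)) t) \<longlonglongrightarrow> \<phi> z t" for n t
    using M' code_converging(1)[OF vZ v] LIMSEQ_ignore_initial_segment[OF code_lim[OF vZ v, of t], of M]
      by simp_all
  have "own_cost (\<phi> z) \<le> liminf (\<lambda>n. own_cost (\<phi> (v (n + M))))"
    by (rule own_cost_lsc[OF code_curve[OF vZ] M(3) _ M(4) code_curve[OF M(1)]]) auto
  also have "\<dots> \<le> ennreal A"
    by (rule liminf_le_const, rule order_trans[OF own_cost_le_code[OF vZ]]) (simp add: v_def A(2))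
  finally have "own_cost (\<phi> z) \<le> ennreal A" .
  moreover have "ennreal (real (level z) - 1) \<le> ennreal A"
    using A(2)[of M] M(2)[of 0] vZ[of M] by (simp add: code_own_def v_def)
  ultimately show "code_own z \<le> ennreal A" using M(1) by (simp add: code_own_def)
qed

lemma lsc_code_interaction: "lsc code_interaction"
proof (rule lscI, rule liminf_ge_if_subsequences)
  fix u z and r :: "nat \<Rightarrow> nat" and A
  assume u: "u \<longlonglongrightarrow> z" and r: "strict_mono r" and A: "A \<ge> 0" "\<And>n. code_interaction (u (r n)) \<le> ennreal A"
  define v where "v n = fst (u (r n))" for n
  define w where "w n = snd (u (r n))" for n
  have ur: "(\<lambda>n. u (r n)) \<longlonglongrightarrow> z" using LIMSEQ_subseq_LIMSEQ[OF u r] by (simp add: comp_def)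
  have v: "v \<longlonglongrightarrow> fst z" and w: "w \<longlonglongrightarrow> snd z"
    unfolding v_def[abs_def] w_def[abs_def] by (rule tendsto_fst[OF ur], rule tendsto_snd[OF ur])
  have "v n \<in> Z \<and> w n \<in> Z" for n
  proof (rule ccontr)
    assume "\<not> (v n \<in> Z \<and> w n \<in> Z)"
    then have "code_interaction (u (r n)) = \<infinity>" by (auto simp: code_interaction_def v_def w_def)
    then show False using A(2)[of n] by (simp add: top_unique)
  qed
  then have vZ: "v n \<in> Z" and wZ: "w n \<in> Z" for n by simp_all
  from code_converging(2)[OF vZ v] obtain M where M': "\<forall>n. level (v (n + M)) = level (fst z) \<and>
    own_cost (\<phi> (v (n + M))) \<le> ennreal (real (level (fst z)))" ..
  have M: "fst z \<in> Z" "level (v (n + M)) = level (fst z)"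
    "own_cost (\<phi> (v (n + M))) \<le> ennreal (real (level (fst z)))"
    "0 \<le> t \<Longrightarrow> (\<lambda>n. \<phi> (v (n + M)) t) \<longlonglongrightarrow> \<phi> (fst z) t" for n t
    using M' code_converging(1)[OF vZ v] LIMSEQ_ignore_initial_segment[OF code_lim[OF vZ v, of t], of M]
      by simp_all
  from code_converging(2)[OF wZ w] obtain K where K': "\<forall>n. level (w (n + K)) = level (snd z) \<and>
    own_cost (\<phi> (w (n + K))) \<le> ennreal (real (level (snd z)))" ..
  have K: "snd z \<in> Z" "level (w (n + K)) = level (snd z)"
    "own_cost (\<phi> (w (n + K))) \<le> ennreal (real (level (snd z)))"
    "0 \<le> t \<Longrightarrow> (\<lambda>n. \<phi> (w (n + K)) t) \<longlonglongrightarrow> \<phi> (snd z) t" for n t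
    using K' code_converging(1)[OF wZ w] LIMSEQ_ignore_initial_segment[OF code_lim[OF wZ w, of t], of K]
      by simp_all
  define c where "c = max (real (level (fst z))) (real (level (snd z)))"
  define N where "N = M + K"
  have "interaction (\<phi> (fst z)) (\<phi> (snd z)) \<le> liminf (\<lambda>n. interaction (\<phi> (v (n + N))) (\<phi> (w (n + N))))"
  proof (rule interaction_lsc[where c = c])
    show "\<phi> (v (n + N)) \<in> curves X" "\<phi> (w (n + N)) \<in> curves X" for n using code_curve vZ wZ by simp_all
    show "\<phi> (fst z) \<in> curves X" "\<phi> (snd z) \<in> curves X" using code_curve M(1) K(1) by simp_all
    have "ennreal (real (level (fst z))) \<le> ennreal c" "ennreal (real (level (snd z))) \<le> ennreal c"
      by (simp_all add: c_def ennreal_leI)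
    then show "own_cost (\<phi> (v (n + N))) \<le> ennreal c" "own_cost (\<phi> (w (n + N))) \<le> ennreal c" for n
      using order_trans[OF M(3)[of "n + K"]] order_trans[OF K(3)[of "n + M"]] by (simp_all add: N_def ac_simps)
    show "(\<lambda>n. \<phi> (v (n + N)) t) \<longlonglongrightarrow> \<phi> (fst z) t" if "0 \<le> t" for t
      by (rule LIMSEQ_ignore_initial_segment[OF code_lim[OF vZ v that]])
    show "(\<lambda>n. \<phi> (w (n + N)) t) \<longlonglongrightarrow> \<phi> (snd z) t" if "0 \<le> t" for t
      by (rule LIMSEQ_ignore_initial_segment[OF code_lim[OF wZ w that]])
    show "c \<ge> 0" by (simp add: c_def)
  qed
  also have "\<dots> \<le> ennreal A"
  proof (rule liminf_le_const)
    show "interaction (\<phi> (v (n + N))) (\<phi> (w (n + N))) \<le> ennreal A" for n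
      using A(2)[of "n + N"] vZ[of "n + N"] wZ[of "n + N"] by (simp add: code_interaction_def v_def w_def)
  qed
  finally show "code_interaction z \<le> ennreal A" using M(1) K(1) by (simp add: code_interaction_def)
qed

lemma code_interaction_le:
  "code_interaction (z, w) \<le> ennreal interaction_const + ennreal interaction_slope * (code_own z + code_own w)"
proof (cases "z \<in> Z \<and> w \<in> Z")
  case True
  then have "code_interaction (z, w) = interaction (\<phi> z) (\<phi> w)" by (simp add: code_interaction_def)
  also have "\<dots> \<le> ennreal interaction_const + ennreal interaction_slope * (own_cost (\<phi> z) + own_cost (\<phi> w))"
    using True by (intro interaction_le_own_costs code_curve) auto
  also have "\<dots> \<le> ennreal interaction_const + ennreal interaction_slope * (code_own z + code_own w)"
    using True by (intro add_left_mono mult_left_mono add_mono own_cost_le_code) auto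
  finally show ?thesis .
next
  case False
  have "interaction_slope > 0" using C a \<alpha> by (simp add: interaction_slope_def add_pos_pos)
  then have "ennreal interaction_slope * \<infinity> = \<infinity>" by (simp add: ennreal_mult_top)
  moreover have "code_own z + code_own w = \<infinity>" using False by (auto simp: code_own_def)
  ultimately have "ennreal interaction_const + ennreal interaction_slope * (code_own z + code_own w) = \<infinity>"
    by (simp only:) simp
  then show ?thesis by simp
qed

text \<open>On \<open>Z\<close> decoding is continuous for locally uniform convergence, so the
  points of \<open>Z\<close> decoded outside an open set form a closed set; off \<open>Z\<close> the
  map is constant.\<close>

lemma curve_measurable: "curve \<in> measurable borel (curve_borel X)"
  unfolding borel_of_topology_def
proof (rule measurable_measure_of)
  show "{U. openin (curve_topology X) U} \<subseteq> Pow (topspace (curve_topology X))" by (blast dest: openin_subset)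
  show "curve \<in> space borel \<rightarrow> topspace (curve_topology X)" using curve_in_curves by simp
  fix U assume "U \<in> {U. openin (curve_topology X) U}"
  then have U: "openin (curve_topology X) U" by simp
  have "closed {z \<in> Z. \<phi> z \<notin> U}"
    unfolding closed_sequential_limits
  proof (intro allI impI, elim conjE)
    fix u z assume u: "\<forall>n. u n \<in> {z \<in> Z. \<phi> z \<notin> U}" "u \<longlonglongrightarrow> z"
    have uZ: "u n \<in> Z" for n using u(1) by simp
    have "\<phi> z \<notin> U"
    proof
      assume "\<phi> z \<in> U"
      then obtain T e where e: "e > 0" "compact_nbhd X T e (\<phi> z) \<subseteq> U"
        using U unfolding openin_curve_topology by blast
      obtain n where "\<forall>t\<in>{0..T}. dist (\<phi> z t) (\<phi> (u n) t) < e"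
        using eventually_happens'[OF sequentially_bot code_uniform[OF uZ u(2) e(1)]] by blast
      then have "\<phi> (u n) \<in> compact_nbhd X T e (\<phi> z)" using code_curve[OF uZ] by (simp add: compact_nbhd_def)
      then show False using e(2) u(1) by blast
    qed
    then show "z \<in> {z \<in> Z. \<phi> z \<notin> U}" using closed_sequentially[OF closed_Z uZ u(2)] by simp
  qed
  then have "{z \<in> Z. \<phi> z \<notin> U} \<in> sets borel" "Z \<in> sets borel" using closed_Z by auto
  moreover have "curve -` U \<inter> space borel = (Z - {z \<in> Z. \<phi> z \<notin> U}) \<union> (if \<gamma>0 \<in> U then - Z else {})"
    by (auto simp: curve_def split: if_splits)
  ultimately show "curve -` U \<inter> space borel \<in> sets borel" by auto
qed

text \<open>The decoding is only continuous on \<^term>\<open>Z\<close> and its good set need not have a measurable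
  image, but by inner regularity the good set is exhausted by compact sets, whose images are closed.\<close>

lemma compact_image_closed:
  assumes K: "compact K" "K \<subseteq> Z"
  shows "\<phi> ` K \<in> sets (curve_borel X)"
proof -
  have "openin (curve_topology X) (curves X - \<phi> ` K)"
  proof (rule openin_curve_topologyI)
    fix \<gamma> u assume \<gamma>: "\<gamma> \<in> curves X - \<phi> ` K" and u: "\<And>n. u n \<in> curves X"
      and unif: "\<And>T e. e > 0 \<Longrightarrow> eventually (\<lambda>n. \<forall>t\<in>{0..T}. dist (\<gamma> t) (u n t) < e) sequentially"
    show "\<exists>n. u n \<in> curves X - \<phi> ` K"
    proof (rule ccontr)
      assume "\<nexists>n. u n \<in> curves X - \<phi> ` K"
      \<comment> \<open>If every approximating curve were decoded from \<open>K\<close>, a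
        subsequence of the codes would converge in \<open>K\<close> and its limit would decode to
        \<open>\<gamma>\<close>.\<close>
      then have "\<forall>n. \<exists>z. z \<in> K \<and> u n = \<phi> z" using u by blast
      from choice[OF this] obtain z where z: "\<forall>n. z n \<in> K \<and> u n = \<phi> (z n)" ..
      have "seq_compact K" using K(1) by (rule compact_imp_seq_compact)
      then have "\<exists>y\<in>K. \<exists>r::nat \<Rightarrow> nat. strict_mono r \<and> (z \<circ> r) \<longlonglongrightarrow> y"
        unfolding seq_compact_def using z by blast
      then obtain y and r :: "nat \<Rightarrow> nat" where y: "y \<in> K" "strict_mono r" "(z \<circ> r) \<longlonglongrightarrow> y" by blast
      have "\<gamma> = \<phi> y"
      proof (rule curves_eqI)
        show "\<gamma> \<in> curves X" using \<gamma> by simp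
        show "\<phi> y \<in> curves X" using code_curve y(1) K(2) by blast
        fix t :: real assume t: "0 \<le> t"
        have "(\<lambda>n. u n t) \<longlonglongrightarrow> \<gamma> t"
        proof (rule tendstoI)
          fix e :: real assume "e > 0"
          from unif[OF this, of t] show "eventually (\<lambda>n. dist (u n t) (\<gamma> t) < e) sequentially"
            by eventually_elim (use t in \<open>simp add: dist_commute\<close>)
        qed
        then have "(\<lambda>n. u (r n) t) \<longlonglongrightarrow> \<gamma> t" using LIMSEQ_subseq_LIMSEQ[OF _ y(2)] by (simp add: comp_def)
        moreover have "(\<lambda>n. \<phi> ((z \<circ> r) n) t) \<longlonglongrightarrow> \<phi> y t"
          by (rule code_lim[OF _ y(3) t]) (use z K(2) in auto)
        ultimately show "\<gamma> t = \<phi> y t" using z LIMSEQ_unique by (simp add: comp_def)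
      qed
      then show False using \<gamma> y(1) by blast
    qed
  qed blast
  then have "space (curve_borel X) - (curves X - \<phi> ` K) \<in> sets (curve_borel X)"
    by (intro sets.compl_sets openin_borel_of_topology)
  moreover have "\<phi> ` K \<subseteq> curves X" using code_curve K(2) by blast
  then have "space (curve_borel X) - (curves X - \<phi> ` K) = \<phi> ` K" by (auto simp: space_curve_borel)
  ultimately show ?thesis by simp
qed

text \<open>\<open>P\<close> is an arbitrary predicate, such as optimality of a curve, so a
  measurable set of full measure on which it holds has to be exhibited. The decoded images of
  countably many compact sets of good codes form one.\<close>

lemma AE_distr_curve:
  assumes \<mu>: "prob_space \<mu>" "sets \<mu> = sets borel" and ae: "AE z in \<mu>. z \<in> Z \<and> P (\<phi> z)"
  shows "AE \<gamma> in distr \<mu> (curve_borel X) curve. P \<gamma>"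
proof -
  interpret \<mu>: prob_space \<mu> by fact
  have sp: "space \<mu> = UNIV" using sets_eq_imp_space_eq[OF \<mu>(2)] by simp
  have cm: "curve \<in> measurable \<mu> (curve_borel X)"
    using curve_measurable measurable_cong_sets[OF \<mu>(2) refl] by blast
  interpret Q: prob_space "distr \<mu> (curve_borel X) curve" by (rule \<mu>.prob_space_distr[OF cm])
  obtain N where N: "{z \<in> space \<mu>. \<not> (z \<in> Z \<and> P (\<phi> z))} \<subseteq> N" "emeasure \<mu> N = 0" "N \<in> sets \<mu>"
    by (rule AE_E[OF ae])
  define G where "G = - N"
  have G: "G \<in> sets borel" "G \<subseteq> Z" "\<And>z. z \<in> G \<Longrightarrow> P (\<phi> z)" using N(1,3) \<mu>(2) sp by (auto simp: G_def)
  have "N \<in> null_sets \<mu>" using N(2,3) by auto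
  have G1: "emeasure \<mu> G = 1"
  proof -
    have "emeasure \<mu> (space \<mu> - N) = emeasure \<mu> (space \<mu>)"
      by (rule emeasure_Diff_null_set[OF \<open>N \<in> null_sets \<mu>\<close>]) simp
    then show ?thesis by (simp add: sp G_def Compl_eq_Diff_UNIV \<mu>.emeasure_space_1[unfolded sp])
  qed
  have reg: "emeasure \<mu> G = (SUP K\<in>{K. K \<subseteq> G \<and> compact K}. emeasure \<mu> K)"
    by (rule inner_regular[OF \<mu>(2) _ G(1)]) (simp add: \<mu>.emeasure_space_1)
  have "\<exists>K. (K \<subseteq> G \<and> compact K) \<and> ennreal (1 - 1 / real (Suc n)) < emeasure \<mu> K" for n
  proof -
    have "ennreal (1 - 1 / real (Suc n)) < ennreal 1" by (rule ennreal_lessI) auto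
    then have "ennreal (1 - 1 / real (Suc n)) < (SUP K\<in>{K. K \<subseteq> G \<and> compact K}. emeasure \<mu> K)"
      using G1 reg by simp
    then show ?thesis unfolding less_SUP_iff by blast
  qed
  then have "\<forall>n. \<exists>K. (K \<subseteq> G \<and> compact K) \<and> ennreal (1 - 1 / real (Suc n)) < emeasure \<mu> K" by blast
  from choice[OF this] obtain K where K: "\<forall>n. (K n \<subseteq> G \<and> compact (K n)) \<and>
    ennreal (1 - 1 / real (Suc n)) < emeasure \<mu> (K n)" ..
  have KG: "K n \<subseteq> G" "compact (K n)" "ennreal (1 - 1 / real (Suc n)) < emeasure \<mu> (K n)" for n using K
    by simp_all
  have CS: "\<phi> ` K n \<in> sets (curve_borel X)" for n
    by (rule compact_image_closed[OF KG(2)]) (rule order_trans[OF KG(1) G(2)])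
  define W where "W = (\<Union>n. \<phi> ` K n)"
  have W: "W \<in> sets (curve_borel X)" unfolding W_def using CS by blast
  have "1 - 1 / real (Suc n) \<le> Q.prob W" for n
  proof -
    have "ennreal (1 - 1 / real (Suc n)) \<le> emeasure \<mu> (K n)" using KG(3) by (rule less_imp_le)
    also have "\<dots> \<le> emeasure \<mu> (curve -` W \<inter> space \<mu>)"
    proof (rule emeasure_mono)
      show "K n \<subseteq> curve -` W \<inter> space \<mu>"
      proof
        fix x assume x: "x \<in> K n"
        then have "x \<in> Z" using KG(1) G(2) by blast
        moreover have "\<phi> x \<in> W" using x unfolding W_def by blast
        ultimately show "x \<in> curve -` W \<inter> space \<mu>" by (simp add: curve_def sp)
      qed
      show "curve -` W \<inter> space \<mu> \<in> sets \<mu>" by (rule measurable_sets[OF cm W])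
    qed
    also have "\<dots> = emeasure (distr \<mu> (curve_borel X) curve) W" by (rule emeasure_distr[OF cm W, symmetric])
    also have "\<dots> = ennreal (Q.prob W)" by (rule Q.emeasure_eq_measure)
    finally show ?thesis by (simp add: measure_nonneg)
  qed
  moreover have "(\<lambda>n. 1 - 1 / real (Suc n)) \<longlonglongrightarrow> 1 - 0"
    by (intro tendsto_diff tendsto_const LIMSEQ_Suc[OF lim_1_over_n])
  ultimately have "1 \<le> Q.prob W" by (intro LIMSEQ_le_const2[of "\<lambda>n. 1 - 1 / real (Suc n)" 1]) auto
  then have "Q.prob W = 1" using Q.prob_le_1[of W] by linarith
  then have "AE \<gamma> in distr \<mu> (curve_borel X) curve. \<gamma> \<in> W" by (rule Q.AE_prob_1)
  then show ?thesis
  proof eventually_elim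
    case (elim \<gamma>)
    then show ?case using KG(1) G(3) unfolding W_def by blast
  qed
qed

text \<open>The constants come from 2 n + 1 = 3 + 2 (n - 1) for the level n; conversion to
  \<open>ennreal\<close> cuts n - 1 off at 0, which only helps.\<close>

lemma code_coercive:
  assumes "z \<in> Z"
  shows "ennreal \<bar>z\<bar> \<le> ennreal 3 + ennreal 2 * code_own z"
proof -
  have "2 * (real (level z) - 1) \<le> 2 * max 0 (real (level z) - 1)" by (intro mult_left_mono) auto
  then have "2 * real (level z) + 1 \<le> 3 + 2 * max 0 (real (level z) - 1)" unfolding right_diff_distrib by simp
  moreover have "\<bar>z\<bar> \<le> 2 * real (level z) + 1" using code_level[OF assms] by simp
  ultimately have "\<bar>z\<bar> \<le> 3 + 2 * max 0 (real (level z) - 1)" by (rule order_trans[rotated])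
  then have "ennreal \<bar>z\<bar> \<le> ennreal (3 + 2 * max 0 (real (level z) - 1))" by (rule ennreal_leI)
  also have "\<dots> = ennreal 3 + ennreal 2 * ennreal (real (level z) - 1)"
  proof -
    have "ennreal (3 + 2 * max 0 (real (level z) - 1)) = ennreal 3 + ennreal (2 * max 0 (real (level z) - 1))"
      by (rule ennreal_plus) auto
    also have "ennreal (2 * max 0 (real (level z) - 1)) = ennreal 2 * ennreal (max 0 (real (level z) - 1))"
      by (rule ennreal_mult) auto
    also have "ennreal (max 0 (real (level z) - 1)) = ennreal (real (level z) - 1)"
      by (cases "0 \<le> real (level z) - 1") (auto simp: ennreal_neg max_def)
    finally show ?thesis .
  qed
  also have "\<dots> \<le> ennreal 3 + ennreal 2 * code_own z"
    using assms by (intro add_left_mono mult_left_mono) (auto simp: code_own_def)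
  finally show ?thesis .
qed

lemma start_continuous: "continuous_on Z (\<lambda>z. curve z 0)"
  unfolding continuous_on_sequentially
proof (intro allI ballI impI, elim conjE)
  fix u z assume u: "z \<in> Z" "\<forall>n. u n \<in> Z" "u \<longlonglongrightarrow> z"
  have "(\<lambda>n. \<phi> (u n) 0) \<longlonglongrightarrow> \<phi> z 0" by (rule code_lim[OF _ u(3)]) (use u(2) in auto)
  then show "((\<lambda>z. curve z 0) \<circ> u) \<longlonglongrightarrow> curve z 0" using u by (simp add: comp_def curve_def)
qed

lemma start_measurable: "(\<lambda>z. curve z 0) \<in> borel_measurable borel"
  by (rule measurable_compose[OF curve_measurable evaluation_measurable]) simp

text \<open>A competitor \<open>\<omega>\<close> of finite own cost is compared through its code
  \<open>s \<omega>\<close>, where the encoded cost equals that of the curve. At the optimal point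
  the encoded cost merely dominates that of the decoded curve, which is the favourable direction.
  Competitors of infinite own cost have infinite total cost.\<close>

theorem exists_equilibrium_measure:
  assumes adm: "\<And>x0. x0 \<in> X \<Longrightarrow> \<exists>\<gamma>\<in>curves X. \<gamma> 0 = x0 \<and> own_cost \<gamma> \<le> ennreal \<kappa>"
    and m0: "m0 \<in> borel_prob_measures (top_of_set X)"
  obtains Q where "Q \<in> borel_prob_measures (curve_topology X)"
    "distr Q (borel_of_topology (top_of_set X)) (\<lambda>\<gamma>. \<gamma> 0) = m0"
    "(\<integral>\<^sup>+ \<gamma>. total_cost \<Xi> l h \<Psi> \<gamma> Q \<partial>Q) < \<infinity>"
    "AE \<gamma> in Q. total_cost \<Xi> l h \<Psi> \<gamma> Q = Inf {total_cost \<Xi> l h \<Psi> \<omega> Q | \<omega>. \<omega> \<in> curves X \<and> \<omega> 0 = \<gamma> 0}"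
proof -
  let ?BX = "borel_of_topology (top_of_set X)"
  have m0p: "prob_space m0" and m0s: "sets m0 = sets ?BX" using m0 by (auto simp: borel_prob_measures_def)
  have m0sp: "space m0 = X" using sets_eq_imp_space_eq[OF m0s]
    by (simp add: borel_of_topology_def space_measure_of_conv)
  have Xc: "closed X" by (rule compact_imp_closed[OF X])
  have idm: "(\<lambda>x. x) \<in> borel_measurable m0"
  proof (rule borel_measurableI)
    fix S :: "'a set" assume "open S"
    then have "openin (top_of_set X) (S \<inter> X)" by (auto simp: openin_open)
    then show "(\<lambda>x. x) -` S \<inter> space m0 \<in> sets m0" by (simp add: m0sp m0s openin_borel_of_topology)
  qed
  \<comment> \<open>\<open>m0\<close> is a measure on the Borel sets of \<open>X\<close>, whereas
    the potential game is played over a whole space; \<open>n0\<close> is its image under the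
    inclusion.\<close>
  define n0 where "n0 = distr m0 borel (\<lambda>x. x)"
  have n0p: "prob_space n0" unfolding n0_def by (rule prob_space.prob_space_distr[OF m0p idm])
  have n0X: "AE x in n0. x \<in> X"
  proof -
    have "AE x in m0. x \<in> X" using AE_space[of m0] by (simp add: m0sp)
    then show ?thesis unfolding n0_def using Xc by (subst AE_distr_iff[OF idm]) auto
  qed
  interpret n0: prob_space n0 by (rule n0p)
  interpret pg: potential_game Z "\<lambda>z. curve z 0"
    code_own code_interaction n0 3 2 interaction_const interaction_slope \<kappa>
  proof
    show "code_own z = \<infinity>" if "z \<notin> Z" for z using that by (simp add: code_own_def)
    show "code_interaction (z, w) = code_interaction (w, z)" for z w
      using interaction_commute[OF code_curve code_curve, of z w] by (auto simp: code_interaction_def)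
    show "sets n0 = sets borel" by (simp add: n0_def)
    show "AE x in n0. \<exists>z\<in>Z. curve z 0 = x \<and> code_own z \<le> ennreal \<kappa>"
      using n0X
    proof eventually_elim
      case (elim x)
      obtain \<gamma> where \<gamma>: "\<gamma> \<in> curves X" "\<gamma> 0 = x" "own_cost \<gamma> \<le> ennreal \<kappa>" using adm[OF elim] by blast
      have "own_cost \<gamma> < \<infinity>" using \<gamma>(3) by (rule le_less_trans) simp
      from code_own_s[OF \<gamma>(1) this] \<gamma>(2,3) show ?case by (intro bexI[of _ "s \<gamma>"]) (auto simp: curve_def)
    qed
  qed (fact closed_Z start_continuous start_measurable lsc_code_own code_coercive lsc_code_interaction
    code_interaction_le)+
  obtain \<mu> where \<mu>: "pg.feasible \<mu>" "(\<integral>\<^sup>+ z. code_own z \<partial>\<mu>) < \<infinity>"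
    and opt: "AE z in \<mu>. \<forall>w\<in>Z. curve w 0 = curve z 0 \<longrightarrow>
      code_own z + (\<integral>\<^sup>+ v. code_interaction (z, v) \<partial>\<mu>) \<le> code_own w + (\<integral>\<^sup>+ v. code_interaction (w, v) \<partial>\<mu>)"
    by (rule pg.exists_equilibrium)
  interpret \<mu>: prob_space \<mu> using \<mu>(1) by (rule pg.feasibleD)
  have \<mu>s: "sets \<mu> = sets borel" and start: "distr \<mu> borel (\<lambda>z. curve z 0) = n0" using \<mu>(1)
    by (auto simp: pg.feasible_def)
  have borel_\<mu>: "f \<in> measurable \<mu> N" if "f \<in> measurable borel N" for f and N :: "'n measure"
    using that measurable_cong_sets[OF \<mu>s refl] by blast
  define I where "I z = (\<integral>\<^sup>+ v. code_interaction (z, v) \<partial>\<mu>)" for z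
  have AE_Z: "AE z in \<mu>. z \<in> Z"
  proof -
    have "AE z in \<mu>. code_own z \<noteq> \<infinity>"
      by (rule nn_integral_PInf_AE[OF borel_\<mu>[OF pg.L_meas]]) (use \<mu>(2) in auto)
    then show ?thesis by eventually_elim (auto simp: code_own_def split: if_splits)
  qed
  have I_le: "I z \<le> ennreal interaction_const + ennreal interaction_slope * (code_own z + (\<integral>\<^sup>+ v.
    code_own v \<partial>\<mu>))" for z
    unfolding I_def using pg.interaction_le[OF \<mu>(1)] .
  define Q where "Q = distr \<mu> (curve_borel X) curve"
  have cm: "curve \<in> measurable \<mu> (curve_borel X)" by (rule borel_\<mu>[OF curve_measurable])
  have Qp: "prob_space Q" unfolding Q_def by (rule \<mu>.prob_space_distr[OF cm])
  have Qs: "sets Q = sets (curve_borel X)" by (simp add: Q_def)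
  have transfer: "AE \<gamma> in Q. P \<gamma>" if "AE z in \<mu>. z \<in> Z \<and> P (\<phi> z)" for P
    unfolding Q_def by (rule AE_distr_curve[OF \<mu>.prob_space_axioms \<mu>s that])
  have ac: "loc_abs_continuous (\<phi> z)" if "z \<in> Z" for z
    using code_cost[OF that] by (auto simp: own_cost_def top_unique split: if_splits)
  have AE_ac: "AE \<gamma> in Q. loc_abs_continuous \<gamma>"
    by (rule transfer, use AE_Z in eventually_elim) (use ac in auto)
  have intQ: "(\<integral>\<^sup>+ \<gamma>'. interaction (\<phi> z) \<gamma>' \<partial>Q) = I z" if z: "z \<in> Z" for z
  proof -
    have "(\<integral>\<^sup>+ \<gamma>'. interaction (\<phi> z) \<gamma>' \<partial>Q) = (\<integral>\<^sup>+ v. interaction (\<phi> z) (curve v) \<partial>\<mu>)"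
      unfolding Q_def by (rule nn_integral_distr[OF cm]) (simp add: interaction_measurable[OF code_curve[OF z]])
    also have "\<dots> = I z"
      unfolding I_def
      by (rule nn_integral_cong_AE, use AE_Z in eventually_elim)
        (use z in \<open>simp add: code_interaction_def curve_def\<close>)
    finally show ?thesis .
  qed
  have total: "total_cost \<Xi> l h \<Psi> (\<phi> z) Q = own_cost (\<phi> z) + I z" if z: "z \<in> Z" for z
  proof -
    have "I z < \<infinity>"
      by (rule le_less_trans[OF I_le]) (use code_own_finite[OF z] \<mu>(2) in \<open>simp add: ennreal_mult_less_top\<close>)
    then have "nn_integrable Q (interaction (\<phi> z))"
      unfolding nn_integrable_def using interaction_measurable[OF code_curve[OF z]] intQ[OF z]
      by (simp add: Q_def)
    then show ?thesis using AE_ac ac[OF z] intQ[OF z] by (simp add: total_cost_def own_cost_def)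
  qed
  have total_inf: "total_cost \<Xi> l h \<Psi> \<omega> Q = \<infinity>" if "own_cost \<omega> = \<infinity>" for \<omega>
    using that by (auto simp: total_cost_def own_cost_def split: if_splits)
  show ?thesis
  proof (rule that[of Q])
    show "Q \<in> borel_prob_measures (curve_topology X)" using Qp Qs by (simp add: borel_prob_measures_def)
    have ev0: "(\<lambda>\<gamma>. \<gamma> 0) \<in> measurable (curve_borel X) ?BX"
      unfolding borel_of_topology_def[of "top_of_set X"]
    proof (rule measurable_measure_of)
      show "{U. openin (top_of_set X) U} \<subseteq> Pow (topspace (top_of_set X))" by (blast dest: openin_subset)
      show "(\<lambda>\<gamma>. \<gamma> 0) \<in> space (curve_borel X) \<rightarrow> topspace (top_of_set X)"
        using curvesD(2) by (auto simp: space_curve_borel)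
      fix U assume "U \<in> {U. openin (top_of_set X) U}"
      then obtain S where S: "open S" "U = X \<inter> S" by (auto simp: openin_open)
      have "(\<lambda>\<gamma>. \<gamma> 0) -` S \<inter> space (curve_borel X) \<in> sets (curve_borel X)"
        by (rule measurable_sets[OF evaluation_measurable]) (use S in auto)
      moreover have "(\<lambda>\<gamma>. \<gamma> 0) -` S \<inter> space (curve_borel X) = (\<lambda>\<gamma>. \<gamma> 0) -` U \<inter> space (curve_borel X)"
        using S(2) curvesD(2)[of _ X 0] by (auto simp: space_curve_borel)
      ultimately show "(\<lambda>\<gamma>. \<gamma> 0) -` U \<inter> space (curve_borel X) \<in> sets (curve_borel X)" by simp
    qed
    have D: "distr Q ?BX (\<lambda>\<gamma>. \<gamma> 0) = distr \<mu> ?BX (\<lambda>z. curve z 0)"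
      unfolding Q_def by (subst distr_distr[OF ev0 cm]) (simp add: comp_def)
    have sm: "(\<lambda>z. curve z 0) \<in> measurable \<mu> ?BX" by (rule measurable_compose[OF cm ev0])
    show "distr Q ?BX (\<lambda>\<gamma>. \<gamma> 0) = m0"
      unfolding D
    proof (rule measure_eqI)
      show "sets (distr \<mu> ?BX (\<lambda>z. curve z 0)) = sets m0" by (simp add: m0s)
      fix A assume "A \<in> sets (distr \<mu> ?BX (\<lambda>z. curve z 0))"
      then have A: "A \<in> sets ?BX" by simp
      have A': "A \<in> sets borel" "A \<subseteq> X" using sets_borel_of_top_of_set[OF Xc A] .
      have "emeasure (distr \<mu> ?BX (\<lambda>z. curve z 0)) A = emeasure \<mu> ((\<lambda>z. curve z 0) -` A \<inter> space \<mu>)"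
        by (rule emeasure_distr[OF sm A])
      also have "\<dots> = emeasure n0 A"
        unfolding start[symmetric] by (rule emeasure_distr[OF borel_\<mu>[OF start_measurable] A'(1), symmetric])
      also have "\<dots> = emeasure m0 ((\<lambda>x. x) -` A \<inter> space m0)" unfolding n0_def
        by (rule emeasure_distr[OF idm A'(1)])
      also have "(\<lambda>x. x) -` A \<inter> space m0 = A" using A'(2) m0sp by auto
      finally show "emeasure (distr \<mu> ?BX (\<lambda>z. curve z 0)) A = emeasure m0 A" .
    qed
    have "(\<integral>\<^sup>+ \<gamma>. total_cost \<Xi> l h \<Psi> \<gamma> Q \<partial>Q) \<le> (\<integral>\<^sup>+ z. total_cost \<Xi> l h \<Psi> (curve z) Q \<partial>\<mu>)"
      unfolding Q_def by (rule nn_integral_distr_le[OF cm])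
    also have "\<dots> \<le> (\<integral>\<^sup>+ z. code_own z + (ennreal interaction_const + ennreal interaction_slope * (code_own z +
      (\<integral>\<^sup>+ v. code_own v \<partial>\<mu>))) \<partial>\<mu>)"
    proof (rule nn_integral_mono_AE, use AE_Z in eventually_elim)
      case (elim z)
      have "total_cost \<Xi> l h \<Psi> (curve z) Q = own_cost (\<phi> z) + I z" using total[OF elim] elim
        by (simp add: curve_def)
      also have "\<dots> \<le> code_own z + (ennreal interaction_const + ennreal interaction_slope * (code_own z + (\<integral>\<^sup>+ v.
        code_own v \<partial>\<mu>)))"
        by (intro add_mono own_cost_le_code elim I_le)
      finally show ?case .
    qed
    also have "\<dots> < \<infinity>"
    proof -
      have [measurable]: "code_own \<in> borel_measurable \<mu>" by (rule borel_\<mu>[OF pg.L_meas])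
      have "(\<integral>\<^sup>+ z. code_own z + (ennreal interaction_const + ennreal interaction_slope * (code_own z + (\<integral>\<^sup>+ v.
        code_own v \<partial>\<mu>))) \<partial>\<mu>)
        = (\<integral>\<^sup>+ z. code_own z \<partial>\<mu>) + (ennreal interaction_const + ennreal interaction_slope *
          ((\<integral>\<^sup>+ z. code_own z \<partial>\<mu>) + (\<integral>\<^sup>+ v. code_own v \<partial>\<mu>)))"
        by (simp add: nn_integral_add nn_integral_cmult \<mu>.emeasure_space_1)
      then show ?thesis using \<mu>(2) by (simp add: ennreal_mult_less_top)
    qed
    finally show "(\<integral>\<^sup>+ \<gamma>. total_cost \<Xi> l h \<Psi> \<gamma> Q \<partial>Q) < \<infinity>" .
    show "AE \<gamma> in Q. total_cost \<Xi> l h \<Psi> \<gamma> Q = Inf {total_cost \<Xi> l h \<Psi> \<omega> Q | \<omega>. \<omega> \<in> curves X \<and> \<omega> 0 = \<gamma> 0}"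
    proof (rule transfer, use AE_Z opt in eventually_elim)
      case (elim z)
      have "total_cost \<Xi> l h \<Psi> (\<phi> z) Q \<le> total_cost \<Xi> l h \<Psi> \<omega> Q" if \<omega>: "\<omega> \<in> curves X" "\<omega> 0 = \<phi> z 0" for \<omega>
      proof (cases "own_cost \<omega> = \<infinity>")
        case True
        then show ?thesis using total_inf by simp
      next
        case False
        then have fin: "own_cost \<omega> < \<infinity>" by (simp add: top.not_eq_extremum)
        note s = code_own_s[OF \<omega>(1) fin]
        have "total_cost \<Xi> l h \<Psi> (\<phi> z) Q \<le> code_own z + I z"
          unfolding total[OF elim(1)] by (intro add_right_mono own_cost_le_code elim(1))
        also have "\<dots> \<le> code_own (s \<omega>) + I (s \<omega>)"
          using elim s(1,2) \<omega>(2) unfolding I_def curve_def by simp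
        also have "\<dots> = total_cost \<Xi> l h \<Psi> \<omega> Q" using total[OF s(1)] s(2,3) by simp
        finally show ?thesis .
      qed
      then have "total_cost \<Xi> l h \<Psi> (\<phi> z) Q \<le> Inf {total_cost \<Xi> l h \<Psi> \<omega> Q | \<omega>. \<omega> \<in> curves X \<and> \<omega> 0 = \<phi> z 0}"
        by (intro Inf_greatest) blast
      moreover have "Inf {total_cost \<Xi> l h \<Psi> \<omega> Q | \<omega>. \<omega> \<in> curves X \<and> \<omega> 0 = \<phi> z 0} \<le> total_cost \<Xi> l h \<Psi> (\<phi> z) Q"
        using code_curve[OF elim(1)] by (intro Inf_lower) blast
      ultimately show ?case using elim(1) by (simp add: antisym)
    qed
  qed
qed

end

theorem theorem4p9:
  fixes \<Omega> \<Xi> :: "(real ^ 'd) set"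
    and l :: "real \<Rightarrow> real ^ 'd \<Rightarrow> real ^ 'd \<Rightarrow> real"
    and h :: "real \<Rightarrow> real ^ 'd \<Rightarrow> real ^ 'd \<Rightarrow> real ^ 'd \<Rightarrow> real ^ 'd \<Rightarrow> real"
    and \<Psi> :: "real \<Rightarrow> real"
    and \<alpha> \<theta> C \<beta> a b \<kappa> :: real
    and m0 :: "(real ^ 'd) measure"
  assumes "\<Omega> \<noteq> {}" and "open \<Omega>" and "bounded \<Omega>"
    and "\<Xi> \<subseteq> closure \<Omega>" and "\<Xi> \<noteq> {}" and "closed \<Xi>"
    and l_nonneg: "\<And>t x p. t \<ge> 0 \<Longrightarrow> x \<in> closure \<Omega> \<Longrightarrow> l t x p \<ge> 0"
    and l_measurable: "\<And>x p. x \<in> closure \<Omega> \<Longrightarrow>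
          (\<lambda>t. l t x p) \<in> borel_measurable (lebesgue_on {0..})"
    and l_continuous: "AE t in lebesgue_on {0..}.
          continuous_on (closure \<Omega> \<times> UNIV) (\<lambda>(x, p). l t x p)"
    and l_convex: "AE t in lebesgue_on {0..}. \<forall>x\<in>closure \<Omega>. convex_on UNIV (\<lambda>p. l t x p)"
    and "\<alpha> > 0" and "\<theta> > 1"
    and l_coercive: "\<And>t x p. t \<ge> 0 \<Longrightarrow> x \<in> closure \<Omega> \<Longrightarrow> l t x p \<ge> \<alpha> * norm p powr \<theta>"
    and h_nonneg: "\<And>t x x' p p'. t \<ge> 0 \<Longrightarrow> x \<in> closure \<Omega> \<Longrightarrow> x' \<in> closure \<Omega> \<Longrightarrow>
          h t x x' p p' \<ge> 0"
    and h_measurable: "\<And>x x' p p'. x \<in> closure \<Omega> \<Longrightarrow> x' \<in> closure \<Omega> \<Longrightarrow>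
          (\<lambda>t. h t x x' p p') \<in> borel_measurable (lebesgue_on {0..})"
    and h_continuous: "AE t in lebesgue_on {0..}.
          continuous_on (closure \<Omega> \<times> closure \<Omega> \<times> UNIV \<times> UNIV) (\<lambda>(x, x', p, p'). h t x x' p p')"
    and h_convex: "AE t in lebesgue_on {0..}. \<forall>x\<in>closure \<Omega>. \<forall>x'\<in>closure \<Omega>.
          convex_on UNIV (\<lambda>(p, p'). h t x x' p p')"
    and h_symmetric: "\<And>t x x' p p'. t \<ge> 0 \<Longrightarrow> x \<in> closure \<Omega> \<Longrightarrow> x' \<in> closure \<Omega> \<Longrightarrow>
          h t x x' p p' = h t x' x p' p"
    and "C > 0" and "0 < \<beta>" and "\<beta> \<le> \<theta>"
    and h_growth: "\<And>t x x' p p'. t \<ge> 0 \<Longrightarrow> x \<in> closure \<Omega> \<Longrightarrow> x' \<in> closure \<Omega> \<Longrightarrow>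
          h t x x' p p' \<le> C * (norm p powr \<beta> + norm p' powr \<beta>)"
    and Psi_nonneg: "\<And>t. t \<ge> 0 \<Longrightarrow> \<Psi> t \<ge> 0"
    and Psi_lsc: "lsc_on {0..} \<Psi>"
    and Psi_mono: "mono_on {0..} \<Psi>"
    and "a > 0" and "b > 0"
    and Psi_growth: "\<And>t. t \<ge> 0 \<Longrightarrow> \<Psi> t \<ge> a * t - b"
    and "\<kappa> > 0"
    and admissible: "\<And>x0. x0 \<in> closure \<Omega> \<Longrightarrow>
          \<exists>\<gamma>\<in>curves (closure \<Omega>). loc_abs_continuous \<gamma> \<and> \<gamma> 0 = x0 \<and>
            running_cost l \<gamma> + exit_cost \<Psi> (exit_time \<Xi> \<gamma>) \<le> ennreal \<kappa>"
    and m0: "m0 \<in> borel_prob_measures (top_of_set (closure \<Omega>))"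
  shows "\<exists>Q. equilibrium \<Omega> \<Xi> l h \<Psi> m0 Q"
proof -
  let ?X = "closure \<Omega>"
  interpret mean_field_game ?X \<Xi> l h \<Psi> \<alpha> \<theta> C \<beta> a b
  proof
    show "compact ?X" using \<open>bounded \<Omega>\<close> by (simp add: compact_closure)
  qed (fact assms)+
  obtain x0 where x0: "x0 \<in> ?X" using \<open>\<Omega> \<noteq> {}\<close> closure_subset by blast
  \<comment> \<open>Any curve will do as the value of decoding outside \<open>Z\<close>.\<close>
  obtain \<gamma>0 where \<gamma>0: "\<gamma>0 \<in> curves ?X" using admissible[OF x0] by blast
  have adm: "\<exists>\<gamma>\<in>curves ?X. \<gamma> 0 = x \<and> own_cost \<gamma> \<le> ennreal \<kappa>" if "x \<in> ?X" for x
    using admissible[OF that] by (auto simp: own_cost_def)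
  show ?thesis
  proof (rule exists_encoding)
    fix Z \<phi> s
    assume enc: "closed Z" "\<And>z. z \<in> Z \<Longrightarrow> \<phi> z \<in> curves ?X"
      "\<And>z. z \<in> Z \<Longrightarrow> own_cost (\<phi> z) \<le> ennreal (real (level z))"
      "\<And>z. z \<in> Z \<Longrightarrow> 0 \<le> z \<and> z \<le> 2 * real (level z) + 1"
      "\<And>u z t. (\<And>n. u n \<in> Z) \<Longrightarrow> u \<longlonglongrightarrow> z \<Longrightarrow> 0 \<le> t \<Longrightarrow> (\<lambda>n. \<phi> (u n) t) \<longlonglongrightarrow> \<phi> z t"
      "\<And>u z. (\<And>n. u n \<in> Z) \<Longrightarrow> u \<longlonglongrightarrow> z \<Longrightarrow> eventually (\<lambda>n. level (u n) = level z) sequentially"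
      "\<And>\<gamma>. \<gamma> \<in> curves ?X \<Longrightarrow> own_cost \<gamma> < \<infinity> \<Longrightarrow>
        s \<gamma> \<in> Z \<and> \<phi> (s \<gamma>) = \<gamma> \<and> ennreal (real (level (s \<gamma>)) - 1) \<le> own_cost \<gamma>"
    interpret encoded_game ?X \<Xi> l h \<Psi> \<alpha> \<theta> C \<beta> a b Z \<phi> s \<gamma>0
      by unfold_locales (fact enc \<gamma>0)+
    obtain Q where "Q \<in> borel_prob_measures (curve_topology ?X)"
      "distr Q (borel_of_topology (top_of_set ?X)) (\<lambda>\<gamma>. \<gamma> 0) = m0"
      "(\<integral>\<^sup>+ \<gamma>. total_cost \<Xi> l h \<Psi> \<gamma> Q \<partial>Q) < \<infinity>"
      "AE \<gamma> in Q. total_cost \<Xi> l h \<Psi> \<gamma> Q =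
        Inf {total_cost \<Xi> l h \<Psi> \<omega> Q | \<omega>. \<omega> \<in> curves ?X \<and> \<omega> 0 = \<gamma> 0}"
      using exists_equilibrium_measure[OF adm m0] by blast
    then show ?thesis unfolding equilibrium_def by blast
  qed
qed

end
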